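(* Let $n\ge2$, let $\Omega\subset\mathbb R^n$ be a bounded domain with sufficiently smooth boundary which is homeomorphic to a ball, let $T>0$ and $Q_T=\Omega\times(0,T)$. Assume $f:Q_T\to\mathbb R^n$ and $g:Q_T\to\mathbb R$ satisfy $$f\in L_2(Q_T),\qquad g\in W^{1,0}_2(Q_T),\qquad \partial_t g\in L_2(0,T;W^{-1}_2(\Omega)),$$ $$\int_\Omega g(x,t)\,dx=0\ \text{ for a.e. } t\in(0,T),\qquad g(\cdot,0)=0.$$ Call $(v,p)$ a weak solution if $$v\in C([0,T];L_2(\Omega))\cap W^{1,0}_2(Q_T),\qquad p\in L_2(Q_T),\qquad \partial_tv\in L_2(0,T;W^{-1}_2(\Omega)),$$ the equations $\partial_tv-\Delta v+\nabla p=f$ and $\operatorname{div}v=g$ hold in $Q_T$ in the sense of distributions, and $v|_{t=0}=0$, $v|_{\partial\Omega\times(0,T)}=0$ in the sense of traces. Then the weak solution, if it exists, is unique: if $(v_1,p_1)$ and $(v_2,p_2)$ are two weak solutions for the same $f,g$, then $v_1=v_2$ and $\nabla p_1=\nabla p_2$ in $Q_T$.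
   Context: "Sufficiently smooth boundary" means of class $C^k$ for some fixed sufficiently large $k$. $v$ is $\mathbb R^n$-valued, $p$ is scalar; $\nabla$, $\Delta$, $\operatorname{div}$ act in the spatial variable $x$, and $\nabla p$ is understood in the sense of distributions. $W^{1,0}_2(Q_T)=L_2(0,T;W^1_2(\Omega))=\{u\in L_2(Q_T):\nabla u\in L_2(Q_T)\}$. $\overset{\circ}{W}{}^1_2(\Omega)=\{u\in W^1_2(\Omega):u|_{\partial\Omega}=0\}$, and $W^{-1}_2(\Omega)$ is the dual space of $\overset{\circ}{W}{}^1_2(\Omega)$. *)

theory Defs
  imports "HOL-Analysis.Analysis"
begin

text \<open>
  Elements of Lebesgue and Sobolev spaces are represented by Borel functions; each almost-everywhere
  class has a Borel representative, and all notions below depend only on the class.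
  Space-time points are pairs \<open>(x, t)\<close>.
\<close>

definition cylinder :: "(real^'n) set \<Rightarrow> real \<Rightarrow> ((real^'n) \<times> real) set" where
  "cylinder \<Omega> T = \<Omega> \<times> {0<..<T}"


subsection \<open>Smooth functions and domains\<close>

definition dir_deriv :: "'a::real_normed_vector \<Rightarrow> ('a \<Rightarrow> real) \<Rightarrow> 'a \<Rightarrow> real" where
  "dir_deriv e f = (\<lambda>x. frechet_derivative f (at x) e)"

primrec Ck :: "nat \<Rightarrow> ('a::euclidean_space \<Rightarrow> real) \<Rightarrow> bool" where
  "Ck 0 f \<longleftrightarrow> continuous_on UNIV f"
| "Ck (Suc k) f \<longleftrightarrow> (\<forall>x. f differentiable (at x)) \<and> (\<forall>e. Ck k (dir_deriv e f))"

definition smooth_fun :: "('a::euclidean_space \<Rightarrow> real) \<Rightarrow> bool" where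
  "smooth_fun f \<longleftrightarrow> (\<forall>k. Ck k f)"

definition test_funs :: "'a::euclidean_space set \<Rightarrow> ('a \<Rightarrow> real) set" where
  "test_funs U = {\<phi>. smooth_fun \<phi> \<and> compact (closure {x. \<phi> x \<noteq> 0}) \<and> closure {x. \<phi> x \<noteq> 0} \<subseteq> U}"

text \<open>
  Near each boundary point, after relabelling and possibly reflecting the coordinate axes, the set
  is the region above the graph of a \<open>C\<^sup>k\<close> function of the other \<open>n - 1\<close> coordinates.
  That function is represented by some \<open>\<gamma>\<close> on the whole space which ignores the coordinate \<open>i\<close>.
\<close>

definition Ck_boundary :: "nat \<Rightarrow> (real^'n) set \<Rightarrow> bool" where
  "Ck_boundary k \<Omega> \<longleftrightarrow>
     (\<forall>x0\<in>frontier \<Omega>. \<exists>r>0. \<exists>i. \<exists>s\<in>{1, -1}. \<exists>\<gamma>.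
        Ck k \<gamma> \<and> (\<forall>x y. (\<forall>j. j \<noteq> i \<longrightarrow> x $ j = y $ j) \<longrightarrow> \<gamma> x = \<gamma> y) \<and>
        \<Omega> \<inter> ball x0 r = {x \<in> ball x0 r. s * x $ i > \<gamma> x})"


subsection \<open>Distributions\<close>

text \<open>Distributions on \<open>U\<close> are functionals on \<^term>\<open>test_funs U\<close>.\<close>

definition regular_distr ::
    "'a::euclidean_space set \<Rightarrow> ('a \<Rightarrow> real) \<Rightarrow> ('a \<Rightarrow> real) \<Rightarrow> real" where
  "regular_distr U u = (\<lambda>\<phi>. LINT x:U|lborel. u x * \<phi> x)"

definition distr_deriv ::
    "'a::euclidean_space \<Rightarrow> (('a \<Rightarrow> real) \<Rightarrow> real) \<Rightarrow> ('a \<Rightarrow> real) \<Rightarrow> real" where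
  "distr_deriv e D = (\<lambda>\<phi>. - D (dir_deriv e \<phi>))"

definition weak_deriv ::
    "'a::euclidean_space set \<Rightarrow> 'a \<Rightarrow> ('a \<Rightarrow> real) \<Rightarrow> ('a \<Rightarrow> real) \<Rightarrow> bool" where
  "weak_deriv U e u w \<longleftrightarrow>
     (\<forall>\<phi>\<in>test_funs U. distr_deriv e (regular_distr U u) \<phi> = regular_distr U w \<phi>)"

abbreviation space_dir :: "'n \<Rightarrow> (real^'n) \<times> real" where
  "space_dir i \<equiv> (axis i 1, 0)"

abbreviation time_dir :: "(real^'n) \<times> real" where
  "time_dir \<equiv> (0, 1)"


subsection \<open>Lebesgue and Sobolev spaces\<close>

definition L2 :: "'a measure \<Rightarrow> 'a set \<Rightarrow> ('a \<Rightarrow> 'b::euclidean_space) set" where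
  "L2 M A = {u. set_borel_measurable M A u \<and> set_integrable M A (\<lambda>x. (norm (u x))\<^sup>2)}"

definition L2_norm :: "'a::euclidean_space set \<Rightarrow> ('a \<Rightarrow> 'b::euclidean_space) \<Rightarrow> real" where
  "L2_norm A u = sqrt (LINT x:A|lborel. (norm (u x))\<^sup>2)"

definition is_weak_gradient ::
    "(real^'n) set \<Rightarrow> (real^'n \<Rightarrow> real) \<Rightarrow> (real^'n \<Rightarrow> real^'n) \<Rightarrow> bool" where
  "is_weak_gradient \<Omega> u G \<longleftrightarrow>
     G \<in> L2 lborel \<Omega> \<and> (\<forall>i. weak_deriv \<Omega> (axis i 1) u (\<lambda>x. G x $ i))"

definition W12 :: "(real^'n) set \<Rightarrow> (real^'n \<Rightarrow> real) set" where
  "W12 \<Omega> = {u \<in> L2 lborel \<Omega>. \<exists>G. is_weak_gradient \<Omega> u G}"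

definition W12_norm :: "(real^'n) set \<Rightarrow> (real^'n \<Rightarrow> real) \<Rightarrow> real" where
  "W12_norm \<Omega> u =
     sqrt ((L2_norm \<Omega> u)\<^sup>2 + (L2_norm \<Omega> (SOME G. is_weak_gradient \<Omega> u G))\<^sup>2)"

text \<open>The space \<open>W\<^sup>1\<^sup>,\<^sup>0\<^sub>2\<close> of the cylinder: only the spatial gradient is required to be in \<open>L\<^sub>2\<close>.\<close>

definition W102 :: "(real^'n) set \<Rightarrow> real \<Rightarrow> ((real^'n) \<times> real \<Rightarrow> real) set" where
  "W102 \<Omega> T = {u \<in> L2 lborel (cylinder \<Omega> T).
     \<exists>G :: (real^'n) \<times> real \<Rightarrow> real^'n. G \<in> L2 lborel (cylinder \<Omega> T) \<and>
       (\<forall>i. weak_deriv (cylinder \<Omega> T) (space_dir i) u (\<lambda>z. G z $ i))}"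


subsection \<open>Traces\<close>

text \<open>
  The diameter is only meaningful for bounded sets in the library, hence the boundedness condition.
\<close>

definition hausdorff_pre :: "real \<Rightarrow> real \<Rightarrow> 'a::euclidean_space set \<Rightarrow> ennreal" where
  "hausdorff_pre s \<delta> A =
     (INF C \<in> {C :: nat \<Rightarrow> 'a set. A \<subseteq> (\<Union>j. C j) \<and> (\<forall>j. bounded (C j) \<and> diameter (C j) \<le> \<delta>)}.
        \<Sum>j. ennreal (unit_ball_vol s * (diameter (C j) / 2) powr s))"

definition hausdorff_outer :: "real \<Rightarrow> 'a::euclidean_space set \<Rightarrow> ennreal" where
  "hausdorff_outer s A = (SUP \<delta>\<in>{0<..}. hausdorff_pre s \<delta> A)"

text \<open>
  The Hausdorff outer measure is countably additive on Borel sets, being a metric outer measure,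
  so \<^const>\<open>measure_of\<close> does not fall back to the zero measure here.
\<close>

definition surface_measure :: "(real^'n) measure" where
  "surface_measure = measure_of UNIV (sets borel) (hausdorff_outer (real (CARD('n) - 1)))"

text \<open>
  The graph of the trace operator from \<open>W\<^sup>1\<^sub>2(\<Omega>)\<close> to \<open>L\<^sub>2(\<partial>\<Omega>)\<close>: the extension by continuity of
  the restriction of smooth functions on the closure of \<open>\<Omega>\<close> to the boundary.
\<close>

definition has_trace :: "(real^'n) set \<Rightarrow> (real^'n \<Rightarrow> real) \<Rightarrow> (real^'n \<Rightarrow> real) \<Rightarrow> bool" where
  "has_trace \<Omega> u h \<longleftrightarrow> u \<in> W12 \<Omega> \<and> h \<in> L2 surface_measure (frontier \<Omega>) \<and>
     (\<exists>U :: nat \<Rightarrow> real^'n \<Rightarrow> real. (\<forall>m. smooth_fun (U m)) \<and>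
        (\<lambda>m. W12_norm \<Omega> (\<lambda>x. U m x - u x)) \<longlonglongrightarrow> 0 \<and>
        (\<lambda>m. \<integral>\<^sup>+x\<in>frontier \<Omega>. ennreal ((U m x - h x)\<^sup>2) \<partial>surface_measure) \<longlonglongrightarrow> 0)"

definition W12_zero_trace :: "(real^'n) set \<Rightarrow> (real^'n \<Rightarrow> real) set" where
  "W12_zero_trace \<Omega> = {u \<in> W12 \<Omega>. has_trace \<Omega> u (\<lambda>_. 0)}"


subsection \<open>The dual space \<open>W\<^sup>-\<^sup>1\<^sub>2(\<Omega>)\<close> and functions with values in it\<close>

definition dual_norm :: "(real^'n) set \<Rightarrow> ((real^'n \<Rightarrow> real) \<Rightarrow> real) \<Rightarrow> ennreal" where
  "dual_norm \<Omega> l = (SUP w\<in>{w \<in> W12_zero_trace \<Omega>. W12_norm \<Omega> w \<le> 1}. ennreal \<bar>l w\<bar>)"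

definition W_minus1 :: "(real^'n) set \<Rightarrow> ((real^'n \<Rightarrow> real) \<Rightarrow> real) set" where
  "W_minus1 \<Omega> = {l.
     (\<forall>u\<in>W12_zero_trace \<Omega>. \<forall>w\<in>W12_zero_trace \<Omega>. \<forall>a b.
        l (\<lambda>x. a * u x + b * w x) = a * l u + b * l w) \<and>
     dual_norm \<Omega> l < \<infinity>}"

text \<open>Since \<open>W\<^sup>-\<^sup>1\<^sub>2(\<Omega>)\<close> is separable and reflexive, measurability may be tested pointwise.\<close>

definition L2_W_minus1 :: "(real^'n) set \<Rightarrow> real \<Rightarrow> (real \<Rightarrow> (real^'n \<Rightarrow> real) \<Rightarrow> real) set" where
  "L2_W_minus1 \<Omega> T = {F.
     (\<forall>t\<in>{0<..<T}. F t \<in> W_minus1 \<Omega>) \<and>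
     (\<forall>w\<in>W12_zero_trace \<Omega>. set_borel_measurable lborel {0<..<T} (\<lambda>t. F t w)) \<and>
     (\<integral>\<^sup>+t\<in>{0<..<T}. (dual_norm \<Omega> (F t))\<^sup>2 \<partial>lborel) < \<infinity>}"

definition time_deriv_in_L2_W_minus1 ::
    "(real^'n) set \<Rightarrow> real \<Rightarrow> ((real^'n) \<times> real \<Rightarrow> real) \<Rightarrow> bool" where
  "time_deriv_in_L2_W_minus1 \<Omega> T u \<longleftrightarrow>
     (\<exists>F\<in>L2_W_minus1 \<Omega> T. \<forall>\<phi>\<in>test_funs (cylinder \<Omega> T).
        distr_deriv time_dir (regular_distr (cylinder \<Omega> T) u) \<phi>
          = (LINT t:{0<..<T}|lborel. F t (\<lambda>x. \<phi> (x, t))))"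

text \<open>
  If \<open>u\<close> lies in \<open>L\<^sub>2\<close> and its time derivative in \<open>L\<^sub>2(0,T;W\<^sup>-\<^sup>1\<^sub>2(\<Omega>))\<close>, then \<open>u\<close> coincides, for almost
  every time, with a unique continuous function from \<open>[0,T]\<close> to \<open>W\<^sup>-\<^sup>1\<^sub>2(\<Omega>)\<close>; the initial value of \<open>u\<close>
  is the value of that function at time 0.
\<close>

definition zero_initial_value ::
    "(real^'n) set \<Rightarrow> real \<Rightarrow> ((real^'n) \<times> real \<Rightarrow> real) \<Rightarrow> bool" where
  "zero_initial_value \<Omega> T u \<longleftrightarrow>
     (\<exists>H :: real \<Rightarrow> (real^'n \<Rightarrow> real) \<Rightarrow> real.
        (\<forall>t\<in>{0..T}. H t \<in> W_minus1 \<Omega>) \<and>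
        (\<forall>t\<in>{0..T}. ((\<lambda>s. dual_norm \<Omega> (\<lambda>w. H s w - H t w)) \<longlongrightarrow> 0) (at t within {0..T})) \<and>
        (AE t in lborel. t \<in> {0<..<T} \<longrightarrow>
           (\<forall>w\<in>W12_zero_trace \<Omega>. H t w = (LINT x:\<Omega>|lborel. u (x, t) * w x))) \<and>
        (\<forall>w\<in>W12_zero_trace \<Omega>. H 0 w = 0))"


subsection \<open>Weak solutions\<close>

text \<open>\<open>V\<close> is the representative of \<open>v\<close> belonging to \<open>C([0,T];L\<^sub>2(\<Omega>))\<close>.\<close>

definition L2_continuous_rep ::
    "(real^'n) set \<Rightarrow> real \<Rightarrow> ((real^'n) \<times> real \<Rightarrow> real^'n) \<Rightarrow> (real \<Rightarrow> real^'n \<Rightarrow> real^'n) \<Rightarrow> bool" where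
  "L2_continuous_rep \<Omega> T v V \<longleftrightarrow>
     (\<forall>t\<in>{0..T}. V t \<in> L2 lborel \<Omega>) \<and>
     (\<forall>t\<in>{0..T}. ((\<lambda>s. L2_norm \<Omega> (\<lambda>x. V s x - V t x)) \<longlongrightarrow> 0) (at t within {0..T})) \<and>
     (AE t in lborel. t \<in> {0<..<T} \<longrightarrow> (AE x in lborel. x \<in> \<Omega> \<longrightarrow> v (x, t) = V t x))"

definition admissible_data ::
    "(real^'n) set \<Rightarrow> real \<Rightarrow> ((real^'n) \<times> real \<Rightarrow> real^'n) \<Rightarrow> ((real^'n) \<times> real \<Rightarrow> real) \<Rightarrow> bool" where
  "admissible_data \<Omega> T f g \<longleftrightarrow>
     f \<in> L2 lborel (cylinder \<Omega> T) \<and>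
     g \<in> W102 \<Omega> T \<and>
     time_deriv_in_L2_W_minus1 \<Omega> T g \<and>
     (AE t in lborel. t \<in> {0<..<T} \<longrightarrow> (LINT x:\<Omega>|lborel. g (x, t)) = 0) \<and>
     zero_initial_value \<Omega> T g"

definition weak_solution ::
    "(real^'n) set \<Rightarrow> real \<Rightarrow> ((real^'n) \<times> real \<Rightarrow> real^'n) \<Rightarrow> ((real^'n) \<times> real \<Rightarrow> real) \<Rightarrow>
     ((real^'n) \<times> real \<Rightarrow> real^'n) \<Rightarrow> ((real^'n) \<times> real \<Rightarrow> real) \<Rightarrow> bool" where
  "weak_solution \<Omega> T f g v p \<longleftrightarrow>
     (let Q = cylinder \<Omega> T in
     (\<exists>V. L2_continuous_rep \<Omega> T v V \<and> (AE x in lborel. x \<in> \<Omega> \<longrightarrow> V 0 x = 0)) \<and>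
     (\<forall>i. (\<lambda>z. v z $ i) \<in> W102 \<Omega> T) \<and>
     p \<in> L2 lborel Q \<and>
     (\<forall>i. time_deriv_in_L2_W_minus1 \<Omega> T (\<lambda>z. v z $ i)) \<and>
     (\<forall>i. \<forall>\<phi>\<in>test_funs Q.
        distr_deriv time_dir (regular_distr Q (\<lambda>z. v z $ i)) \<phi>
        - (\<Sum>j\<in>UNIV. distr_deriv (space_dir j)
             (distr_deriv (space_dir j) (regular_distr Q (\<lambda>z. v z $ i))) \<phi>)
        + distr_deriv (space_dir i) (regular_distr Q p) \<phi>
        = regular_distr Q (\<lambda>z. f z $ i) \<phi>) \<and>
     (\<forall>\<phi>\<in>test_funs Q.
        (\<Sum>j\<in>UNIV. distr_deriv (space_dir j) (regular_distr Q (\<lambda>z. v z $ j)) \<phi>)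
        = regular_distr Q g \<phi>) \<and>
     (AE t in lborel. t \<in> {0<..<T} \<longrightarrow> (\<forall>i. has_trace \<Omega> (\<lambda>x. v (x, t) $ i) (\<lambda>_. 0))))"

end

theory Submission
  imports Defs
begin

text \<open>
  Let \<open>u\<close>, \<open>q\<close> and \<open>G\<close> be the differences of the two velocities, pressures and velocity gradients. They solve
  the homogeneous system, and formally one multiplies it by \<open>u\<close>. The time derivative of \<open>u\<close> is only a
  functional, however, and \<open>q\<close> is merely square integrable, so the equation is first integrated in time.
  With \<open>B(t)\<close> and \<open>P(t)\<close> the integrals of \<open>G\<close> and \<open>q\<close> over \<open>(0,t)\<close>, test functions \<open>\<theta>(t) w(x)\<close> with \<open>\<theta>\<close>
  approaching the indicator of \<open>(0,t)\<close>, together with \<open>u(0) = 0\<close> and the continuity of \<open>u\<close> in time, give at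
  every time \<open>t\<close> and for every test function \<open>w\<close> the identity
  \<open>\<integral> u\<^sub>i(t) w + \<Sum>\<^sub>j \<integral> B\<^sub>i\<^sub>j(t) \<partial>\<^sub>j w - \<integral> P(t) \<partial>\<^sub>i w = 0\<close>
  (lemma \<open>weak_time_derivative_integral\<close>). All coefficients are square integrable functions of \<open>x\<close>, so the
  identity extends to all \<open>w\<close> of zero trace (lemma \<open>weak_identity_extends_to_zero_trace\<close>), in particular to
  \<open>w = u\<^sub>i(s)\<close> for almost every \<open>s\<close>. Summation over \<open>i\<close> removes the pressure, because \<open>u(s)\<close> has divergence
  zero, and leaves \<open>(u(t), u(s)) = - (B(t), G(s))\<close>. Integration over \<open>s \<in> (0,t)\<close>, with \<open>Y(t)\<close> the integral of
  \<open>u\<close> over \<open>(0,t)\<close>, gives \<open>(u(t), Y(t)) = - |B(t)|^2 \<le> 0\<close>. Since \<open>u\<close> is the time derivative of \<open>Y\<close>, the left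
  hand side is the derivative of \<open>|Y|^2 / 2\<close>; as \<open>Y(0) = 0\<close>, a further integration yields \<open>Y = 0\<close>, hence
  \<open>u = 0\<close> (lemmas \<open>running_integral_pairing\<close> and \<open>stokes_abstract_uniqueness\<close>). The momentum equation
  expresses the pressure gradient by \<open>f\<close> and the velocity, so the pressure gradients agree as well.
  
  The extension to functions of zero trace is where the boundary enters. Such a function is the limit in
  \<open>W\<^sup>1\<^sub>2\<close> of smooth functions \<open>U\<close> whose boundary values tend to zero in \<open>L\<^sub>2(\<partial>\<Omega>)\<close>, but which need not vanish
  near the boundary. They are multiplied by a cutoff \<open>\<psi>\<close> that equals 1 in \<open>\<Omega>\<close> outside the strip of width \<open>\<delta>\<close>
  along the boundary and has a gradient of size \<open>1/\<delta>\<close> (lemma \<open>smooth_cutoff\<close>). The resulting error is harmless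
  because the integral of \<open>U^2\<close> over the strip is at most a constant times \<open>\<delta>\<close> times the boundary integral of
  \<open>U^2\<close> plus \<open>\<delta>^2\<close> times the integral of \<open>|\<nabla>U|^2\<close> (lemma \<open>boundary_strip_estimate\<close>): first \<open>U\<close> tends to
  its limit with \<open>\<delta>\<close> fixed, which removes the boundary integral, and then \<open>\<delta>\<close> tends to zero, which makes the
  coefficients small on the strip. The surface measure is the Hausdorff measure, so the strip estimate rests
  on a direct comparison of the volume of a strip with the Hausdorff measure of its foot
  (lemma \<open>strip_emeasure_le_hausdorff_outer\<close>).
\<close>

section \<open>Smooth functions and a smooth step\<close>

lemma dir_deriv_eqI:
  "(f has_derivative f') (at x) \<Longrightarrow> dir_deriv e f x = f' e"
  unfolding dir_deriv_def by (simp add: frechet_derivative_at[symmetric])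

lemma dir_deriv_has_derivative:
  "f differentiable (at x) \<Longrightarrow> (f has_derivative (\<lambda>e. dir_deriv e f x)) (at x)"
  unfolding dir_deriv_def by (simp add: frechet_derivative_works)

lemma Ck_differentiable: "Ck (Suc k) f \<Longrightarrow> f differentiable (at x)"
  by simp

lemma Ck_Suc_imp: "Ck (Suc k) f \<Longrightarrow> Ck k f"
proof (induction k arbitrary: f)
  case 0
  then show ?case
    by (auto simp: continuous_on_eq_continuous_at intro: differentiable_imp_continuous_within)
next
  case (Suc k)
  then show ?case by (metis Ck.simps(2))
qed

lemma Ck_mono: "Ck k f \<Longrightarrow> j \<le> k \<Longrightarrow> Ck j f"
  by (induction k) (auto simp: le_Suc_eq dest: Ck_Suc_imp simp del: Ck.simps(2))

lemma Ck_continuous: "Ck k f \<Longrightarrow> continuous_on UNIV f"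
  using Ck_mono[of k f 0] by simp

lemma dir_deriv_const: "dir_deriv e (\<lambda>x. c) = (\<lambda>x. 0)"
  by (rule ext) (rule dir_deriv_eqI, rule has_derivative_const)

lemma Ck_const: "Ck k (\<lambda>x. c)"
  by (induction k arbitrary: c) (auto simp: dir_deriv_const)

lemma dir_deriv_add:
  assumes "\<And>x. f differentiable (at x)" "\<And>x. g differentiable (at x)"
  shows "dir_deriv e (\<lambda>x. f x + g x) = (\<lambda>x. dir_deriv e f x + dir_deriv e g x)"
  by (rule ext) (rule dir_deriv_eqI, intro has_derivative_add dir_deriv_has_derivative assms)

lemma dir_deriv_mult:
  assumes "\<And>x. f differentiable (at x)" "\<And>x. g differentiable (at x)"
  shows "dir_deriv e (\<lambda>x. f x * g x) = (\<lambda>x. f x * dir_deriv e g x + dir_deriv e f x * g x)"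
  by (rule ext) (rule dir_deriv_eqI, intro has_derivative_mult dir_deriv_has_derivative assms)

lemma Ck_add: "Ck k f \<Longrightarrow> Ck k g \<Longrightarrow> Ck k (\<lambda>x. f x + g x)"
  by (induction k arbitrary: f g) (auto simp: dir_deriv_add intro: continuous_on_add)

lemma Ck_mult: "Ck k f \<Longrightarrow> Ck k g \<Longrightarrow> Ck k (\<lambda>x. f x * g x)"
proof (induction k arbitrary: f g)
  case 0
  then show ?case by (auto intro: continuous_on_mult)
next
  case (Suc k)
  then have "Ck k f" "Ck k g" by (blast intro: Ck_Suc_imp)+
  with Suc show ?case by (auto simp: dir_deriv_mult intro!: Ck_add)
qed

lemma Ck_inverse:
  assumes "Ck k f" "\<And>x. f x \<noteq> 0"
  shows "Ck k (\<lambda>x. inverse (f x))"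
  using assms(1)
proof (induction k)
  case 0
  then show ?case using assms(2) by (auto intro!: continuous_on_inverse)
next
  case (Suc k)
  then have k: "Ck k f" "Ck k (\<lambda>x. inverse (f x))" by (blast intro: Ck_Suc_imp)+
  have D: "((\<lambda>x. inverse (f x)) has_derivative
      (\<lambda>e. - (inverse (f x) * dir_deriv e f x * inverse (f x)))) (at x)" for x
    using Suc.prems assms(2) by (intro Deriv.has_derivative_inverse dir_deriv_has_derivative) auto
  then have "dir_deriv e (\<lambda>x. inverse (f x))
      = (\<lambda>x. (-1) * (inverse (f x) * dir_deriv e f x * inverse (f x)))" for e
    by (intro ext) (use dir_deriv_eqI[OF D] in simp)
  moreover have "Ck k (\<lambda>x. (-1) * (inverse (f x) * dir_deriv e f x * inverse (f x)))" for e
    using Suc.prems k by (intro Ck_mult Ck_const) auto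
  ultimately show ?case
    using D by (auto simp: differentiable_def simp del: mult_minus1)
qed

lemma Ck_sum: "(\<And>i. i \<in> I \<Longrightarrow> Ck k (f i)) \<Longrightarrow> Ck k (\<lambda>x. \<Sum>i\<in>I. f i x)"
  by (induction I rule: infinite_finite_induct) (auto intro: Ck_const Ck_add)

lemma Ck_prod: "(\<And>i. i \<in> I \<Longrightarrow> Ck k (f i)) \<Longrightarrow> Ck k (\<lambda>x. \<Prod>i\<in>I. f i x)"
  by (induction I rule: infinite_finite_induct) (auto intro: Ck_const Ck_mult)

lemma Ck_affine_arg:
  assumes "Ck k g"
  shows "Ck k (\<lambda>x. g (c + l \<bullet> x))"
  using assms
proof (induction k arbitrary: g)
  case 0
  then show ?case
    by simp (rule continuous_on_compose2[of UNIV g]; auto intro!: continuous_intros)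
next
  case (Suc k)
  have D: "((\<lambda>x. g (c + l \<bullet> x)) has_derivative (\<lambda>e. (l \<bullet> e) * dir_deriv 1 g (c + l \<bullet> x))) (at x)" for x
  proof -
    have g: "(g has_derivative (\<lambda>e. dir_deriv e g (c + l \<bullet> x))) (at (c + l \<bullet> x))"
      using Suc.prems by (intro dir_deriv_has_derivative) auto
    have lin: "dir_deriv (l \<bullet> e) g y = (l \<bullet> e) * dir_deriv 1 g y" if "y = c + l \<bullet> x" for e y
      using linear_cmul[OF has_derivative_linear[OF g], of "l \<bullet> e" 1] that by simp
    have "((\<lambda>x. c + l \<bullet> x) has_derivative (\<lambda>e. l \<bullet> e)) (at x)"
      by (auto intro!: derivative_eq_intros)
    from has_derivative_compose[OF this g] show ?thesis
      by (simp add: lin)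
  qed
  then have "dir_deriv e (\<lambda>x. g (c + l \<bullet> x)) = (\<lambda>x. (l \<bullet> e) * dir_deriv 1 g (c + l \<bullet> x))" for e
    by (intro ext) (rule dir_deriv_eqI[OF D])
  then show ?case
    using D Suc by (auto simp: differentiable_def intro!: Ck_mult Ck_const)
qed

lemma smooth_intros:
  "smooth_fun (\<lambda>x. c)"
  "smooth_fun f \<Longrightarrow> smooth_fun g \<Longrightarrow> smooth_fun (\<lambda>x. f x + g x)"
  "smooth_fun f \<Longrightarrow> smooth_fun g \<Longrightarrow> smooth_fun (\<lambda>x. f x * g x)"
  "smooth_fun h \<Longrightarrow> smooth_fun (\<lambda>x. h (c' + l \<bullet> x))"
  "(\<And>i. i \<in> I \<Longrightarrow> smooth_fun (F i)) \<Longrightarrow> smooth_fun (\<lambda>x. \<Sum>i\<in>I. F i x)"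
  "(\<And>i. i \<in> I \<Longrightarrow> smooth_fun (F i)) \<Longrightarrow> smooth_fun (\<lambda>x. \<Prod>i\<in>I. F i x)"
  unfolding smooth_fun_def by (auto intro: Ck_const Ck_add Ck_mult Ck_affine_arg Ck_sum Ck_prod)

lemma smooth_diff:
  "smooth_fun f \<Longrightarrow> smooth_fun g \<Longrightarrow> smooth_fun (\<lambda>x. f x - g x)"
  using smooth_intros(2)[of f "\<lambda>x. (-1) * g x"] smooth_intros(3)[of "\<lambda>x. -1" g] smooth_intros(1)
  by fastforce

lemma smooth_differentiable: "smooth_fun f \<Longrightarrow> f differentiable (at x)"
  unfolding smooth_fun_def using Ck_differentiable by blast

lemma smooth_dir_deriv: "smooth_fun f \<Longrightarrow> smooth_fun (dir_deriv e f)"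
  unfolding smooth_fun_def by (metis Ck.simps(2))

lemma smooth_continuous: "smooth_fun f \<Longrightarrow> continuous_on UNIV f"
  unfolding smooth_fun_def using Ck_continuous by blast

text \<open>
  The functions \<open>P(1/x) exp(-1/x)\<close> on the positive half line, extended by 0, are closed under
  differentiation, so all derivatives of \<open>exp(-1/x)\<close> are covered by one first-order statement.
\<close>

definition exp_poly_inverse :: "real poly \<Rightarrow> real \<Rightarrow> real" where
  "exp_poly_inverse P x = (if x > 0 then poly P (1 / x) * exp (- (1 / x)) else 0)"

lemma poly_times_exp_neg_tendsto_0:
  "((\<lambda>y::real. poly P y * exp (- y)) \<longlongrightarrow> 0) at_top"
proof -
  have *: "((\<lambda>y::real. y ^ k * exp (- y)) \<longlongrightarrow> 0) at_top" for k
    using tendsto_power_div_exp_0[of k] by (simp add: exp_minus divide_inverse)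
  have "((\<lambda>y::real. \<Sum>i\<le>degree P. coeff P i * (y ^ i * exp (- y))) \<longlongrightarrow> 0) at_top"
    by (intro tendsto_null_sum tendsto_mult_right_zero *)
  then show ?thesis
    by (simp add: poly_altdef sum_distrib_right mult.assoc)
qed

text \<open>
  For \<open>x > 0\<close> the chain rule with \<open>y = 1/x\<close> turns \<open>P(y) exp(-y)\<close> into \<open>y^2 (P(y) - P'(y)) exp(-y)\<close>; at 0 the
  difference quotient is again of the form polynomial in \<open>y\<close> times \<open>exp(-y)\<close>, which vanishes as \<open>y\<close> grows.
\<close>

lemma exp_poly_inverse_deriv:
  "(exp_poly_inverse P has_real_derivative exp_poly_inverse ([:0, 0, 1:] * (P - pderiv P)) x) (at x)"
proof -
  consider "x > 0" | "x < 0" | "x = 0" by linarith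
  then show ?thesis
  proof cases
    case 1
    have "((\<lambda>x. poly P (1 / x) * exp (- (1 / x))) has_real_derivative
        exp_poly_inverse ([:0, 0, 1:] * (P - pderiv P)) x) (at x)"
      using 1 unfolding exp_poly_inverse_def
      by (auto intro!: derivative_eq_intros DERIV_chain2[OF poly_DERIV]
          simp: field_simps power2_eq_square)
    then show ?thesis
      by (rule has_field_derivative_transform_within_open[of _ _ _ "{0<..}"])
        (use 1 in \<open>auto simp: exp_poly_inverse_def\<close>)
  next
    case 2
    have "((\<lambda>x. 0) has_real_derivative
        exp_poly_inverse ([:0, 0, 1:] * (P - pderiv P)) x) (at x)"
      using 2 by (auto simp: exp_poly_inverse_def)
    then show ?thesis
      by (rule has_field_derivative_transform_within_open[of _ _ _ "{..<0}"])
        (use 2 in \<open>auto simp: exp_poly_inverse_def\<close>)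
  next
    case 3
    \<comment> \<open>The difference quotient at 0 is \<open>(1/h) P(1/h) exp(-1/h)\<close>, and \<open>pCons 0 P\<close> is \<open>y P(y)\<close>.\<close>
    have "((\<lambda>h. poly (pCons 0 P) (inverse h) * exp (- inverse h)) \<longlongrightarrow> 0) (at_right 0)"
      by (rule filterlim_compose[OF poly_times_exp_neg_tendsto_0 filterlim_inverse_at_top_right])
    then have "((\<lambda>h. exp_poly_inverse P h / h) \<longlongrightarrow> 0) (at_right 0)"
      by (rule Lim_transform_eventually)
        (auto simp: eventually_at_right_field exp_poly_inverse_def field_simps intro: exI[of _ 1])
    moreover have "((\<lambda>h. exp_poly_inverse P h / h) \<longlongrightarrow> 0) (at_left 0)"
      by (rule Lim_transform_eventually[OF tendsto_const])
        (auto simp: eventually_at_left_field exp_poly_inverse_def intro!: exI[of _ "-1"])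
    ultimately have "((\<lambda>h. exp_poly_inverse P h / h) \<longlongrightarrow> 0) (at 0)"
      by (simp add: filterlim_split_at)
    then show ?thesis
      using 3 by (simp add: DERIV_def exp_poly_inverse_def)
  qed
qed

lemma smooth_exp_poly_inverse: "smooth_fun (exp_poly_inverse P)"
proof -
  have D: "(exp_poly_inverse P has_derivative
      (\<lambda>e. e * exp_poly_inverse ([:0, 0, 1:] * (P - pderiv P)) x)) (at x)" for P x
    using exp_poly_inverse_deriv[of P x] unfolding has_field_derivative_def by (subst mult.commute)
  have "Ck k (exp_poly_inverse P)" for k
  proof (induction k arbitrary: P)
    case 0
    show ?case using D by (auto simp: continuous_on_eq_continuous_at intro: has_derivative_continuous)
  next
    case (Suc k)
    have "dir_deriv e (exp_poly_inverse P)
        = (\<lambda>x. e * exp_poly_inverse ([:0, 0, 1:] * (P - pderiv P)) x)" for e P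
      by (intro ext) (rule dir_deriv_eqI[OF D])
    moreover have "exp_poly_inverse P differentiable (at x)" for x
      using D by (rule differentiableI)
    ultimately show ?case
      using Suc.IH by (auto intro!: Ck_mult Ck_const)
  qed
  then show ?thesis by (simp add: smooth_fun_def)
qed

definition smooth_step :: "real \<Rightarrow> real" where
  "smooth_step x = exp_poly_inverse 1 x / (exp_poly_inverse 1 x + exp_poly_inverse 1 (1 - x))"

lemma smooth_step_denom_pos: "exp_poly_inverse 1 x + exp_poly_inverse 1 (1 - x) > 0"
  by (auto simp: exp_poly_inverse_def intro: add_pos_nonneg add_nonneg_pos)

lemma smooth_step_smooth: "smooth_fun smooth_step"
proof -
  have "smooth_fun (\<lambda>x. exp_poly_inverse 1 x + exp_poly_inverse 1 (1 + (-1) \<bullet> x))"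
    by (intro smooth_intros smooth_exp_poly_inverse)
  then have s: "smooth_fun (\<lambda>x. exp_poly_inverse 1 x + exp_poly_inverse 1 (1 - x))"
    by simp
  have "smooth_fun (\<lambda>x. inverse (exp_poly_inverse 1 x + exp_poly_inverse 1 (1 - x)))"
    using s unfolding smooth_fun_def
    by (auto intro!: Ck_inverse) (use smooth_step_denom_pos in \<open>metis less_irrefl\<close>)
  from smooth_intros(3)[OF smooth_exp_poly_inverse[of 1] this]
  show ?thesis
    by (simp add: smooth_step_def[abs_def] divide_inverse)
qed

lemma smooth_step_0: "x \<le> 0 \<Longrightarrow> smooth_step x = 0"
  by (simp add: smooth_step_def exp_poly_inverse_def)

lemma smooth_step_1: "x \<ge> 1 \<Longrightarrow> smooth_step x = 1"
  by (simp add: smooth_step_def exp_poly_inverse_def)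

lemma smooth_step_bounds: "0 \<le> smooth_step x" "smooth_step x \<le> 1"
  using smooth_step_denom_pos[of x] by (auto simp: smooth_step_def exp_poly_inverse_def)

section \<open>Test functions and the fundamental lemma\<close>

lemma test_funsI:
  assumes "smooth_fun \<phi>" "compact K" "K \<subseteq> U" "\<And>x. x \<notin> K \<Longrightarrow> \<phi> x = 0"
  shows "\<phi> \<in> test_funs U"
proof -
  have "{x. \<phi> x \<noteq> 0} \<subseteq> K" using assms(4) by auto
  then have "closure {x. \<phi> x \<noteq> 0} \<subseteq> K"
    by (intro closure_minimal compact_imp_closed assms(2))
  moreover have "compact (closure {x. \<phi> x \<noteq> 0})"
    using calculation assms(2) by (metis bounded_subset closed_closure compact_eq_bounded_closed)
  ultimately show ?thesis using assms by (auto simp: test_funs_def)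
qed

lemma test_funsE:
  assumes "\<phi> \<in> test_funs U"
  obtains K where "smooth_fun \<phi>" "compact K" "K \<subseteq> U" "\<And>x. x \<notin> K \<Longrightarrow> \<phi> x = 0"
proof (rule that[of "closure {x. \<phi> x \<noteq> 0}"])
  show "\<phi> x = 0" if "x \<notin> closure {x. \<phi> x \<noteq> 0}" for x
    using that closure_subset[of "{x. \<phi> x \<noteq> 0}"] by blast
qed (use assms in \<open>auto simp: test_funs_def\<close>)

lemma test_funs_smooth: "\<phi> \<in> test_funs U \<Longrightarrow> smooth_fun \<phi>"
  by (simp add: test_funs_def)

lemma test_funs_mult:
  assumes "\<phi> \<in> test_funs U" "smooth_fun f"
  shows "(\<lambda>x. \<phi> x * f x) \<in> test_funs U"
  using assms by (elim test_funsE) (rule test_funsI, auto intro: smooth_intros)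

lemma dir_deriv_eq_0_outside:
  assumes "compact K" "\<And>x. x \<notin> K \<Longrightarrow> \<phi> x = 0" "x \<notin> K"
  shows "dir_deriv e \<phi> x = 0"
proof -
  have "((\<lambda>x. 0) has_derivative (\<lambda>_. 0)) (at x)" by simp
  then have "(\<phi> has_derivative (\<lambda>_. 0)) (at x)"
    by (rule has_derivative_transform_within_open[of _ _ _ _ "-K"])
      (use assms compact_imp_closed in auto)
  then show ?thesis by (rule dir_deriv_eqI)
qed

lemma test_funs_dir_deriv:
  assumes "\<phi> \<in> test_funs U"
  shows "dir_deriv e \<phi> \<in> test_funs U"
  using assms
  by (elim test_funsE) (rule test_funsI, auto intro: smooth_dir_deriv dir_deriv_eq_0_outside)

lemma test_funs_bounded:
  assumes "\<phi> \<in> test_funs U"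
  obtains B where "B > 0" "\<And>x. \<bar>\<phi> x\<bar> \<le> B"
proof -
  obtain K where K: "smooth_fun \<phi>" "compact K" "\<And>x. x \<notin> K \<Longrightarrow> \<phi> x = 0"
    using assms by (elim test_funsE) blast
  have "compact (\<phi> ` K)"
    using K(1,2) smooth_continuous by (blast intro: compact_continuous_image continuous_on_subset)
  then obtain B where "B > 0" "\<And>x. x \<in> K \<Longrightarrow> \<bar>\<phi> x\<bar> \<le> B"
    using bounded_pos[of "\<phi> ` K"] compact_imp_bounded by auto
  then show thesis using K(3) that[of B] by (metis abs_zero less_imp_le)
qed

lemma smooth_measurable: "smooth_fun f \<Longrightarrow> f \<in> borel_measurable borel"
  by (intro borel_measurable_continuous_onI smooth_continuous)

text \<open>
  Tensor products of steps that rise inside the box. They vanish outside the box for every \<open>m\<close> and tend to its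
  indicator, so testing against them gives integrals over boxes.
\<close>

definition box_cutoff :: "'a::euclidean_space \<Rightarrow> 'a \<Rightarrow> nat \<Rightarrow> 'a \<Rightarrow> real" where
  "box_cutoff a b m x =
     (\<Prod>i\<in>Basis. smooth_step (real m * ((x - a) \<bullet> i)) * smooth_step (real m * ((b - x) \<bullet> i)))"

lemma box_cutoff_smooth: "smooth_fun (box_cutoff a b m)"
proof -
  have "smooth_fun (\<lambda>x. \<Prod>i\<in>Basis. smooth_step (- real m * (a \<bullet> i) + (real m *\<^sub>R i) \<bullet> x)
      * smooth_step (real m * (b \<bullet> i) + (- real m *\<^sub>R i) \<bullet> x))"
    by (intro smooth_intros smooth_step_smooth)
  then show ?thesis
    by (simp add: box_cutoff_def[abs_def] algebra_simps inner_commute)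
qed

lemma box_cutoff_bounds: "0 \<le> box_cutoff a b m x" "box_cutoff a b m x \<le> 1"
  unfolding box_cutoff_def
  by (auto intro!: prod_nonneg prod_le_1 mult_le_one mult_nonneg_nonneg smooth_step_bounds)

lemma box_cutoff_outside:
  assumes "x \<notin> box a b"
  shows "box_cutoff a b m x = 0"
proof -
  obtain i where i: "i \<in> Basis" "(x - a) \<bullet> i \<le> 0 \<or> (b - x) \<bullet> i \<le> 0"
    using assms by (auto simp: mem_box inner_diff_left not_less)
  then have "smooth_step (real m * ((x - a) \<bullet> i)) * smooth_step (real m * ((b - x) \<bullet> i)) = 0"
    by (auto simp: mult_le_0_iff intro!: smooth_step_0)
  then show ?thesis
    unfolding box_cutoff_def using i by (intro prod_zero) auto
qed

lemma box_cutoff_tendsto: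
  "(\<lambda>m. box_cutoff a b m x) \<longlonglongrightarrow> indicator (box a b) x"
proof (cases "x \<in> box a b")
  case True
  have *: "(\<lambda>m. smooth_step (real m * r)) \<longlonglongrightarrow> 1" if "r > 0" for r
  proof (rule tendsto_eventually)
    obtain N where N: "1 / r \<le> real N" using real_arch_simple by blast
    show "\<forall>\<^sub>F m in sequentially. smooth_step (real m * r) = 1"
      using eventually_ge_at_top[of N]
    proof eventually_elim
      case (elim m)
      then have "1 / r \<le> real m" using N by linarith
      then show ?case using that by (intro smooth_step_1) (simp add: field_simps)
    qed
  qed
  have "(\<lambda>m. box_cutoff a b m x) \<longlonglongrightarrow> (\<Prod>i\<in>(Basis::'a set). 1 * 1)"
    unfolding box_cutoff_def
    using True by (intro tendsto_prod tendsto_mult *) (auto simp: mem_box inner_diff_left)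
  then show ?thesis using True by simp
qed (simp add: box_cutoff_outside)

lemma box_cutoff_test_fun:
  assumes "cbox a b \<subseteq> U"
  shows "box_cutoff a b m \<in> test_funs U"
  by (rule test_funsI[OF box_cutoff_smooth compact_cbox assms])
    (use box_cutoff_outside box_subset_cbox in blast)

definition rational_points :: "'a::euclidean_space set" where
  "rational_points = {x. \<forall>i\<in>Basis. x \<bullet> i \<in> \<rat>}"

lemma countable_rational_points: "countable (rational_points :: 'a::euclidean_space set)"
proof -
  have "rational_points \<subseteq> (\<lambda>f. \<Sum>i\<in>Basis. f i *\<^sub>R i) ` ((Basis :: 'a set) \<rightarrow>\<^sub>E \<rat>)"
  proof
    fix x :: 'a assume "x \<in> rational_points"
    then show "x \<in> (\<lambda>f. \<Sum>i\<in>Basis. f i *\<^sub>R i) ` ((Basis :: 'a set) \<rightarrow>\<^sub>E \<rat>)"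
      by (intro image_eqI[of _ _ "restrict (\<lambda>i. x \<bullet> i) Basis"])
        (auto simp: rational_points_def euclidean_representation)
  qed
  then show ?thesis
    by (rule countable_subset) (intro countable_image countable_PiE countable_rat finite_Basis)
qed

lemma rational_boxes_within:
  assumes "open (U :: 'a::euclidean_space set)" "x \<in> U"
  obtains a b where "a \<in> rational_points" "b \<in> rational_points" "x \<in> box a b" "cbox a b \<subseteq> U"
proof -
  obtain e where e: "e > 0" "ball x e \<subseteq> U" using assms openE by blast
  from rational_boxes[of "e / 2" x] e obtain a b where ab:
    "a \<in> rational_points" "b \<in> rational_points" "x \<in> box a b" "box a b \<subseteq> ball x (e / 2)"
    by (auto simp: rational_points_def)
  have "cbox a b = closure (box a b)" using ab by (intro closure_box[symmetric]) auto
  also have "\<dots> \<subseteq> cball x (e / 2)" using closure_mono[OF ab(4)] e by simp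
  also have "\<dots> \<subseteq> ball x e" using e by auto
  finally show thesis using ab e that by blast
qed

lemma borel_eq_rational_boxes:
  "sets (borel :: 'a::euclidean_space measure)
     = sigma_sets UNIV {box a b | a b. a \<in> rational_points \<and> b \<in> rational_points}"
    (is "_ = sigma_sets UNIV ?E")
proof -
  have cE: "countable ?E"
  proof -
    have "?E = (\<lambda>(a, b). box a b) ` (rational_points \<times> rational_points)" by auto
    then show ?thesis by (simp add: countable_rational_points)
  qed
  have eq: "(borel :: 'a measure) = sigma UNIV ?E"
  proof (rule borel_eq_sigmaI1[OF borel_def, where F="\<lambda>X. X" and A="?E", simplified image_ident])
    fix M :: "'a set" assume "M \<in> {S. open S}"
    then have o: "open M" by simp
    define F where "F = {X \<in> ?E. X \<subseteq> M}"
    have "M = \<Union>F"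
    proof (intro equalityI subsetI)
      fix x assume "x \<in> M"
      then obtain a b where "a \<in> rational_points" "b \<in> rational_points" "x \<in> box a b" "cbox a b \<subseteq> M"
        using rational_boxes_within[OF o] by metis
      then show "x \<in> \<Union>F" using box_subset_cbox[of a b] unfolding F_def by blast
    qed (auto simp: F_def)
    moreover have "countable F" using cE by (rule countable_subset[rotated]) (auto simp: F_def)
    ultimately show "M \<in> sets (sigma UNIV ?E)"
      by (metis (no_types, lifting) F_def mem_Collect_eq sets.countable_Union sets_measure_of
          sigma_sets.Basic subsetI top_greatest Pow_UNIV)
  qed auto
  have "sets (sigma UNIV ?E) = sigma_sets UNIV ?E" by (rule sets_measure_of) simp
  then show ?thesis by (rule trans[OF arg_cong[OF eq, of sets]])
qed

lemma enn2real_inject_finite: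
  fixes a b :: ennreal
  shows "a < \<infinity> \<Longrightarrow> b < \<infinity> \<Longrightarrow> enn2real a = enn2real b \<Longrightarrow> a = b"
  by (metis ennreal_enn2real infinity_ennreal_def)

text \<open>
  The positive and the negative part of \<open>g\<close> are densities of two finite measures that agree on the
  intersection-stable generator of all rational boxes, hence everywhere; the densities therefore coincide.
\<close>

lemma integral_rational_boxes_0_imp_AE_0:
  fixes g :: "'a::euclidean_space \<Rightarrow> real"
  assumes g: "integrable lborel g"
    and 0: "\<And>a b. a \<in> rational_points \<Longrightarrow> b \<in> rational_points \<Longrightarrow>
      (\<integral>x. indicator (box a b) x * g x \<partial>lborel) = 0"
  shows "AE x in lborel. g x = 0"
proof -
  let ?E = "{box a b | a b :: 'a. a \<in> rational_points \<and> b \<in> rational_points}"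
  have [measurable]: "g \<in> borel_measurable borel" using g by auto
  have fin: "(\<integral>\<^sup>+x. ennreal (h x) \<partial>lborel) < \<infinity>" if "integrable lborel h" for h :: "'a \<Rightarrow> real"
    using that by (simp add: real_integrable_def top.not_eq_extremum)
  have "density lborel (\<lambda>x. ennreal (g x)) = density lborel (\<lambda>x. ennreal (- g x))"
  proof (rule measure_eqI_generator_eq_countable[where \<Omega>=UNIV and E="?E" and A="?E"])
    show "Int_stable ?E"
    proof (rule Int_stableI)
      fix A B assume "A \<in> ?E" "B \<in> ?E"
      then obtain a b c d where AB: "A = box a b" "B = box c d"
        "a \<in> rational_points" "b \<in> rational_points" "c \<in> rational_points" "d \<in> rational_points"
        by blast
      then show "A \<inter> B \<in> ?E"
      proof -
        let ?p = "\<Sum>i\<in>Basis. max (a\<bullet>i) (c\<bullet>i) *\<^sub>R i" and ?q = "\<Sum>i\<in>Basis. min (b\<bullet>i) (d\<bullet>i) *\<^sub>R i"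
        have "A \<inter> B = box ?p ?q" unfolding AB by (rule box_Int_box)
        moreover have "?p \<in> rational_points" "?q \<in> rational_points"
          using AB by (auto simp: rational_points_def max_def min_def)
        ultimately show ?thesis by blast
      qed
    qed
    fix X assume "X \<in> ?E"
    then obtain a b where X: "X = box a b" "a \<in> rational_points" "b \<in> rational_points" by blast
    define h where "h = (\<lambda>x. indicator X x * g x)"
    have h: "integrable lborel h"
      using integrable_mult_indicator[OF _ g, of X] X by (simp add: h_def)
    have "integral\<^sup>L lborel h = 0" using 0[OF X(2,3)] by (simp add: h_def X)
    then have "enn2real (\<integral>\<^sup>+x. ennreal (h x) \<partial>lborel) = enn2real (\<integral>\<^sup>+x. ennreal (- h x) \<partial>lborel)"
      using real_lebesgue_integral_def[OF h] by linarith
    then have "(\<integral>\<^sup>+x. ennreal (h x) \<partial>lborel) = (\<integral>\<^sup>+x. ennreal (- h x) \<partial>lborel)"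
      by (rule enn2real_inject_finite[OF fin[OF h] fin[OF Bochner_Integration.integrable_minus[OF h]]])
    moreover have "(\<integral>\<^sup>+x. ennreal (h x) \<partial>lborel) = (\<integral>\<^sup>+x. ennreal (g x) * indicator X x \<partial>lborel)"
      "(\<integral>\<^sup>+x. ennreal (- h x) \<partial>lborel) = (\<integral>\<^sup>+x. ennreal (- g x) * indicator X x \<partial>lborel)"
      by (auto intro!: nn_integral_cong simp: h_def split: split_indicator)
    ultimately show "emeasure (density lborel (\<lambda>x. ennreal (g x))) X
        = emeasure (density lborel (\<lambda>x. ennreal (- g x))) X"
      by (simp add: emeasure_density X)
  next
    show "\<Union>?E = UNIV"
    proof (intro equalityI subsetI UNIV_I)
      fix x :: 'a
      obtain a b where "a \<in> rational_points" "b \<in> rational_points" "x \<in> box a b"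
        using rational_boxes_within[OF open_UNIV, of x] by auto
      then show "x \<in> \<Union>?E" by blast
    qed
    have "?E = (\<lambda>(a, b). box a b) ` (rational_points \<times> rational_points)" by auto
    then show "countable ?E" by (simp add: countable_rational_points)
    show "emeasure (density lborel (\<lambda>x. ennreal (g x))) a \<noteq> \<infinity>" if "a \<in> ?E" for a
    proof -
      have "emeasure (density lborel (\<lambda>x. ennreal (g x))) a
          \<le> emeasure (density lborel (\<lambda>x. ennreal (g x))) (space (density lborel (\<lambda>x. ennreal (g x))))"
        by (rule emeasure_space)
      also have "\<dots> = (\<integral>\<^sup>+x. ennreal (g x) \<partial>lborel)"
        by (simp add: emeasure_density)
      also have "\<dots> < \<infinity>" by (rule fin[OF g])
      finally show ?thesis by simp
    qed
  qed (auto simp: borel_eq_rational_boxes)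
  then have "AE x in lborel. ennreal (g x) = ennreal (- g x)"
    by (subst (asm) sigma_finite_measure.density_unique_iff[OF sigma_finite_lborel]) auto
  then show ?thesis
  proof eventually_elim
    case (elim x)
    then show ?case by (cases "g x \<ge> 0") (auto simp: ennreal_neg not_le ennreal_eq_0_iff)
  qed
qed

text \<open>
  The cutoffs of the rational boxes inside \<open>U\<close> suffice: in the limit they give the integral of \<open>f\<close> over each
  such box. Countability matters for functions of space and time, where each test function in \<open>x\<close> brings its own
  exceptional null set of times, and only countably many of these may be united.
\<close>

lemma countable_determining_test_funs:
  fixes U :: "'a::euclidean_space set"
  assumes U: "open U"
  shows "\<exists>C. countable C \<and> C \<subseteq> test_funs U \<and>
    (\<forall>f. set_integrable lborel U f \<longrightarrow> (\<forall>\<phi>\<in>C. (LINT x:U|lborel. f x * \<phi> x) = 0) \<longrightarrow>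
       (AE x in lborel. x \<in> U \<longrightarrow> f x = 0))"
proof -
  define I where "I = {(a, b :: 'a). a \<in> rational_points \<and> b \<in> rational_points \<and> cbox a b \<subseteq> U}"
  define C where "C = (\<lambda>((a, b), m). box_cutoff a b m) ` (I \<times> UNIV)"
  have cI: "countable I"
    by (rule countable_subset[of _ "rational_points \<times> rational_points"])
      (auto simp: I_def countable_rational_points)
  have 1: "countable C" unfolding C_def by (intro countable_image countable_SIGMA cI) auto
  have 2: "C \<subseteq> test_funs U"
    by (auto simp: C_def I_def intro: box_cutoff_test_fun)
  have 3: "AE x in lborel. x \<in> U \<longrightarrow> f x = 0"
    if f: "set_integrable lborel U f" and f0: "\<forall>\<phi>\<in>C. (LINT x:U|lborel. f x * \<phi> x) = 0" for f
  proof -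
    define g where "g = (\<lambda>x. indicator U x * f x)"
    have g: "integrable lborel g" using f by (simp add: set_integrable_def g_def)
    then have [measurable]: "g \<in> borel_measurable borel" by auto
    have box0: "(\<integral>x. indicator (box a b) x * g x \<partial>lborel) = 0" if "(a, b) \<in> I" for a b
    proof (rule LIMSEQ_unique)
      show "(\<lambda>m. \<integral>x. box_cutoff a b m x * g x \<partial>lborel) \<longlonglongrightarrow> (\<integral>x. indicator (box a b) x * g x \<partial>lborel)"
      proof (rule integral_dominated_convergence[where w="\<lambda>x. \<bar>g x\<bar>"])
        show "(\<lambda>x. box_cutoff a b i x * g x) \<in> borel_measurable lborel" for i
          using smooth_measurable[OF box_cutoff_smooth[of a b i]] by simp
        show "AE x in lborel. (\<lambda>i. box_cutoff a b i x * g x) \<longlonglongrightarrow> indicator (box a b) x * g x"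
          by (intro AE_I2 tendsto_mult box_cutoff_tendsto tendsto_const)
        show "AE x in lborel. norm (box_cutoff a b i x * g x) \<le> \<bar>g x\<bar>" for i
          by (intro AE_I2) (simp add: abs_mult box_cutoff_bounds mult_left_le_one_le)
      qed (use g in auto)
      have "(\<integral>x. box_cutoff a b m x * g x \<partial>lborel) = 0" for m
        using bspec[OF f0, of "box_cutoff a b m"] that
        by (force simp: C_def g_def set_lebesgue_integral_def mult_ac)
      then show "(\<lambda>m. \<integral>x. box_cutoff a b m x * g x \<partial>lborel) \<longlonglongrightarrow> 0" by simp
    qed
    have "AE x in lborel. x \<in> box a b \<longrightarrow> f x = 0" if ab: "(a, b) \<in> I" for a b
    proof -
      have "AE x in lborel. indicator (box a b) x * g x = 0"
      proof (rule integral_rational_boxes_0_imp_AE_0)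
        show "integrable lborel (\<lambda>x. indicator (box a b) x * g x)"
          using integrable_mult_indicator[OF _ g, of "box a b"] by simp
        fix c d :: 'a assume cd: "c \<in> rational_points" "d \<in> rational_points"
        define a' where "a' = (\<Sum>i\<in>Basis. max (c\<bullet>i) (a\<bullet>i) *\<^sub>R i)"
        define b' where "b' = (\<Sum>i\<in>Basis. min (d\<bullet>i) (b\<bullet>i) *\<^sub>R i)"
        have box: "box c d \<inter> box a b = box a' b'"
          unfolding a'_def b'_def by (rule box_Int_box)
        have "cbox a' b' \<subseteq> cbox a b"
          by (auto simp: a'_def b'_def mem_box)
        then have "(a', b') \<in> I"
          using ab cd by (auto simp: I_def a'_def b'_def rational_points_def max_def min_def)
        from box0[OF this] show "(\<integral>x. indicator (box c d) x * (indicator (box a b) x * g x) \<partial>lborel) = 0"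
          by (simp add: box[symmetric] indicator_inter_arith mult.assoc)
      qed
      then show ?thesis
      proof eventually_elim
        case (elim x)
        have "box a b \<subseteq> U" using ab box_subset_cbox[of a b] by (auto simp: I_def)
        then show ?case using elim by (auto simp: g_def split: split_indicator_asm)
      qed
    qed
    then have "AE x in lborel. \<forall>p\<in>I. x \<in> box (fst p) (snd p) \<longrightarrow> f x = 0"
      using cI by (subst AE_ball_countable) auto
    then show ?thesis
    proof eventually_elim
      case (elim x)
      show ?case
      proof
        assume "x \<in> U"
        then obtain a b where "(a, b) \<in> I" "x \<in> box a b"
          using rational_boxes_within[OF U] by (metis (mono_tags, lifting) I_def case_prodI mem_Collect_eq)
        then show "f x = 0" using elim by force
      qed
    qed
  qed
  show ?thesis by (intro exI[of _ C] conjI allI impI 1 2 3)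
qed

lemma fundamental_lemma:
  fixes U :: "'a::euclidean_space set"
  assumes "open U" "set_integrable lborel U f"
    "\<And>\<phi>. \<phi> \<in> test_funs U \<Longrightarrow> (LINT x:U|lborel. f x * \<phi> x) = 0"
  shows "AE x in lborel. x \<in> U \<longrightarrow> f x = 0"
proof -
  obtain C where C: "C \<subseteq> test_funs U"
    and det: "\<forall>f. set_integrable lborel U f \<longrightarrow> (\<forall>\<phi>\<in>C. (LINT x:U|lborel. f x * \<phi> x) = 0) \<longrightarrow>
       (AE x in lborel. x \<in> U \<longrightarrow> f x = 0)"
    using countable_determining_test_funs[OF assms(1)] by (elim exE conjE)
  show ?thesis
  proof (rule det[rule_format, OF assms(2)])
    fix \<phi> assume "\<phi> \<in> C"
    with C have "\<phi> \<in> test_funs U" by (rule subsetD)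
    then show "(LINT x:U|lborel. f x * \<phi> x) = 0" by (rule assms(3))
  qed
qed

section \<open>Hausdorff measure\<close>

definition delta_covers :: "real \<Rightarrow> 'a::euclidean_space set \<Rightarrow> (nat \<Rightarrow> 'a set) set" where
  "delta_covers \<delta> A = {C. A \<subseteq> (\<Union>j. C j) \<and> (\<forall>j. bounded (C j) \<and> diameter (C j) \<le> \<delta>)}"

definition diameter_weight :: "real \<Rightarrow> 'a::euclidean_space set \<Rightarrow> ennreal" where
  "diameter_weight s X = ennreal (unit_ball_vol s * (diameter X / 2) powr s)"

lemma hausdorff_pre_eq: "hausdorff_pre s \<delta> A = (INF C\<in>delta_covers \<delta> A. \<Sum>j. diameter_weight s (C j))"
  by (simp add: hausdorff_pre_def delta_covers_def diameter_weight_def)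

lemma diameter_weight_empty [simp]: "diameter_weight s {} = 0"
  by (simp add: diameter_weight_def)

lemma hausdorff_pre_le_cover: "C \<in> delta_covers \<delta> A \<Longrightarrow> hausdorff_pre s \<delta> A \<le> (\<Sum>j. diameter_weight s (C j))"
  unfolding hausdorff_pre_eq by (rule INF_lower)

lemma hausdorff_pre_empty: "\<delta> > 0 \<Longrightarrow> hausdorff_pre s \<delta> {} = 0"
  using hausdorff_pre_le_cover[of "\<lambda>_. {}" \<delta> "{}" s] by (simp add: delta_covers_def)

lemma hausdorff_pre_mono: "A \<subseteq> B \<Longrightarrow> hausdorff_pre s \<delta> A \<le> hausdorff_pre s \<delta> B"
  unfolding hausdorff_pre_eq by (rule INF_superset_mono) (auto simp: delta_covers_def)

lemma hausdorff_pre_antimono: "\<delta> \<le> \<delta>' \<Longrightarrow> hausdorff_pre s \<delta>' A \<le> hausdorff_pre s \<delta> A"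
  unfolding hausdorff_pre_eq by (rule INF_superset_mono) (auto simp: delta_covers_def intro: order_trans)

lemma hausdorff_pre_close:
  "hausdorff_pre s \<delta> A < e \<Longrightarrow> \<exists>C\<in>delta_covers \<delta> A. (\<Sum>j. diameter_weight s (C j)) < e"
  unfolding hausdorff_pre_eq INF_less_iff by auto

text \<open>
  Almost optimal covers of the sets \<open>A n\<close>, with errors summing to \<open>e\<close>, are merged into one cover of the union.
\<close>

lemma hausdorff_pre_countably_subadditive:
  "hausdorff_pre s \<delta> (\<Union>i. A i) \<le> (\<Sum>n::nat. hausdorff_pre s \<delta> (A n))"
proof (rule ennreal_le_epsilon)
  let ?O = "hausdorff_pre s \<delta>"
  fix e :: real assume "0 < e" "(\<Sum>n. ?O (A n)) < top"
  then have *: "\<And>n. ?O (A n) < ?O (A n) + e * (1/2)^Suc n"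
    by (auto simp add: less_top dest!: ennreal_suminf_lessD)
  have "\<forall>n. \<exists>C. C \<in> delta_covers \<delta> (A n) \<and> (\<Sum>j. diameter_weight s (C j)) < ?O (A n) + e * (1/2)^Suc n"
    using hausdorff_pre_close[OF *] by blast
  then obtain B where B: "\<And>n. B n \<in> delta_covers \<delta> (A n)"
    and Ble: "\<And>n. (\<Sum>i. diameter_weight s (B n i)) < ?O (A n) + e * (1/2)^(Suc n)"
    by metis
  define C where "C = case_prod B o prod_decode"
  have "C \<in> delta_covers \<delta> (\<Union>i. A i)"
  proof -
    have "(\<Union>i. A i) \<subseteq> (\<Union>i. C i)"
    proof
      fix x assume "x \<in> (\<Union>i. A i)"
      then obtain n i where "x \<in> B n i" using B by (fastforce simp: delta_covers_def)
      then have "x \<in> C (prod_encode (n, i))" by (simp add: C_def)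
      then show "x \<in> (\<Union>i. C i)" by blast
    qed
    then show ?thesis using B by (auto simp: delta_covers_def C_def split_def)
  qed
  then have "?O (\<Union>i. A i) \<le> (\<Sum>i. diameter_weight s (C i))"
    by (rule hausdorff_pre_le_cover)
  also have "\<dots> = (\<Sum>n. \<Sum>i. diameter_weight s (B n i))"
    unfolding C_def comp_def by (intro suminf_ennreal_2dimen) auto
  also have "\<dots> \<le> (\<Sum>n. ?O (A n) + e * (1/2) ^ Suc n)"
    using Ble by (intro suminf_le) (auto intro: less_imp_le)
  also have "\<dots> = (\<Sum>n. ?O (A n)) + (\<Sum>n. ennreal e * ennreal ((1/2) ^ Suc n))"
    using \<open>0 < e\<close> by (subst suminf_add[symmetric])
                     (auto simp del: ennreal_suminf_cmult simp add: ennreal_mult[symmetric])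
  also have "\<dots> = (\<Sum>n. ?O (A n)) + e"
    unfolding ennreal_suminf_cmult
    by (subst suminf_ennreal_eq[OF zero_le_power power_half_series]) auto
  finally show "?O (\<Union>i. A i) \<le> (\<Sum>n. ?O (A n)) + e" .
qed

lemma hausdorff_pre_le_outer: "\<delta> > 0 \<Longrightarrow> hausdorff_pre s \<delta> A \<le> hausdorff_outer s A"
  unfolding hausdorff_outer_def by (rule SUP_upper) simp

lemma hausdorff_outer_space:
  "outer_measure_space (Pow UNIV) (hausdorff_outer s :: 'a::euclidean_space set \<Rightarrow> ennreal)"
proof -
  have "hausdorff_outer s {} = (0 :: ennreal)" for s
    unfolding hausdorff_outer_def by (auto simp: hausdorff_pre_empty intro!: SUP_eq_const)
  moreover have "hausdorff_outer s A \<le> hausdorff_outer s B" if "A \<subseteq> B" for A B :: "'a set"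
    unfolding hausdorff_outer_def by (intro SUP_mono) (use hausdorff_pre_mono[OF that] in blast)
  moreover have "hausdorff_outer s (\<Union>i. A i) \<le> (\<Sum>n. hausdorff_outer s (A n))" for A :: "nat \<Rightarrow> 'a set"
    unfolding hausdorff_outer_def[of s "\<Union>i. A i"]
  proof (rule SUP_least)
    fix \<delta> :: real assume "\<delta> \<in> {0<..}"
    then show "hausdorff_pre s \<delta> (\<Union>i. A i) \<le> (\<Sum>n. hausdorff_outer s (A n))"
      by (intro order_trans[OF hausdorff_pre_countably_subadditive] suminf_le)
        (auto intro: hausdorff_pre_le_outer)
  qed
  ultimately show ?thesis
    by (auto simp: outer_measure_space_def positive_def increasing_def countably_subadditive_def)
qed

text \<open>
  A set of diameter less than \<open>d\<close> cannot meet both \<open>A\<close> and \<open>B\<close>, so a cover of \<open>A \<union> B\<close> by such sets splits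
  into a cover of \<open>A\<close> and a cover of \<open>B\<close>.
\<close>

lemma hausdorff_outer_separated:
  assumes d: "d > 0" and sep: "\<And>x y. x \<in> A \<Longrightarrow> y \<in> B \<Longrightarrow> d \<le> dist x y"
  shows "hausdorff_outer s A + hausdorff_outer s B \<le> hausdorff_outer s (A \<union> B)"
proof -
  have pre: "hausdorff_pre s \<delta> A + hausdorff_pre s \<delta> B \<le> hausdorff_pre s \<delta> (A \<union> B)"
    if \<delta>: "0 < \<delta>" "\<delta> < d" for \<delta>
    unfolding hausdorff_pre_eq[of s \<delta> "A \<union> B"]
  proof (rule INF_greatest)
    fix C assume C: "C \<in> delta_covers \<delta> (A \<union> B)"
    define CA where "CA j = (if C j \<inter> A = {} then {} else C j)" for j
    define CB where "CB j = (if C j \<inter> A = {} then C j else {})" for j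
    have "C j \<inter> B = {}" if CA: "C j \<inter> A \<noteq> {}" for j
    proof (rule ccontr)
      assume "C j \<inter> B \<noteq> {}"
      then obtain x y where "x \<in> C j" "x \<in> A" "y \<in> C j" "y \<in> B" using CA by blast
      moreover have "bounded (C j)" "diameter (C j) \<le> \<delta>" using C by (auto simp: delta_covers_def)
      ultimately show False using sep[of x y] diameter_bounded_bound[of "C j" x y] \<delta> by auto
    qed
    then have UB: "x \<in> CB j" if "x \<in> C j" "x \<in> B" for x j
      using that by (auto simp: CB_def)
    have UA: "x \<in> CA j" if "x \<in> C j" "x \<in> A" for x j
      using that by (auto simp: CA_def)
    have C': "bounded (C j)" "diameter (C j) \<le> \<delta>" "A \<union> B \<subseteq> (\<Union>j. C j)" for j
      using C by (auto simp: delta_covers_def)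
    then have "bounded (CA j) \<and> diameter (CA j) \<le> \<delta>" "bounded (CB j) \<and> diameter (CB j) \<le> \<delta>" for j
      using \<delta> by (auto simp: CA_def CB_def)
    moreover have "A \<subseteq> (\<Union>j. CA j)"
    proof
      fix x assume "x \<in> A"
      moreover from this obtain j where "x \<in> C j" using C'(3) by blast
      ultimately show "x \<in> (\<Union>j. CA j)" using UA by blast
    qed
    moreover have "B \<subseteq> (\<Union>j. CB j)"
    proof
      fix x assume "x \<in> B"
      moreover from this obtain j where "x \<in> C j" using C'(3) by blast
      ultimately show "x \<in> (\<Union>j. CB j)" using UB by blast
    qed
    ultimately have "CA \<in> delta_covers \<delta> A" "CB \<in> delta_covers \<delta> B"
      by (simp_all add: delta_covers_def)
    then have "hausdorff_pre s \<delta> A + hausdorff_pre s \<delta> B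
        \<le> (\<Sum>j. diameter_weight s (CA j)) + (\<Sum>j. diameter_weight s (CB j))"
      by (intro add_mono hausdorff_pre_le_cover)
    also have "\<dots> = (\<Sum>j. diameter_weight s (CA j) + diameter_weight s (CB j))"
      by (rule suminf_add) auto
    also have "\<dots> = (\<Sum>j. diameter_weight s (C j))"
      by (rule suminf_cong) (auto simp: CA_def CB_def)
    finally show "hausdorff_pre s \<delta> A + hausdorff_pre s \<delta> B \<le> (\<Sum>j. diameter_weight s (C j))" .
  qed
  have "hausdorff_pre s a A + hausdorff_pre s b B \<le> hausdorff_outer s (A \<union> B)"
    if "a > 0" "b > 0" for a b
  proof -
    define c where "c = min (min a b) (d / 2)"
    have c: "0 < c" "c < d" "c \<le> a" "c \<le> b" using that d by (auto simp: c_def)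
    have "hausdorff_pre s a A + hausdorff_pre s b B \<le> hausdorff_pre s c A + hausdorff_pre s c B"
      using c by (intro add_mono hausdorff_pre_antimono)
    also have "\<dots> \<le> hausdorff_pre s c (A \<union> B)" using c by (intro pre)
    also have "\<dots> \<le> hausdorff_outer s (A \<union> B)" using c by (intro hausdorff_pre_le_outer)
    finally show ?thesis .
  qed
  then have "(SUP b\<in>{0<..}. hausdorff_pre s a A + hausdorff_pre s b B) \<le> hausdorff_outer s (A \<union> B)"
    if "a > 0" for a using that by (intro SUP_least) auto
  then have "hausdorff_pre s a A + hausdorff_outer s B \<le> hausdorff_outer s (A \<union> B)"
    if "a > 0" for a
    using that unfolding hausdorff_outer_def[of s B] by (subst ennreal_SUP_add_right) auto
  then have "(SUP a\<in>{0<..}. hausdorff_pre s a A + hausdorff_outer s B) \<le> hausdorff_outer s (A \<union> B)"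
    by (intro SUP_least) auto
  then show ?thesis
    unfolding hausdorff_outer_def[of s A] by (subst ennreal_SUP_add_left[symmetric]) auto
qed

text \<open>
  The subadditivity in the definition of an outer measure concerns disjoint families; making \<open>A\<close> disjoint
  reduces the general case to it by monotonicity.
\<close>

lemma outer_measure_space_csubadditive:
  fixes A :: "nat \<Rightarrow> 'a set"
  assumes oms: "outer_measure_space (Pow UNIV) f"
  shows "f (\<Union>i. A i) \<le> (\<Sum>n. f (A n))"
proof -
  have "f (\<Union>i. A i) = f (\<Union>i. disjointed A i)" by (simp add: UN_disjointed_eq)
  also have "\<dots> \<le> (\<Sum>n. f (disjointed A n))"
    using oms disjoint_family_disjointed[of A]
    by (auto simp: outer_measure_space_def countably_subadditive_def)
  also have "\<dots> \<le> (\<Sum>n. f (A n))"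
    using oms by (intro suminf_le) (auto simp: outer_measure_space_def increasing_def disjointed_subset)
  finally show ?thesis .
qed

lemma outer_measure_space_subadditive:
  assumes oms: "outer_measure_space (Pow UNIV) f"
  shows "f (A \<union> B) \<le> f A + f B"
proof -
  have "f {} = 0" using oms by (auto simp: outer_measure_space_def positive_def)
  then show ?thesis
    using outer_measure_space_csubadditive[OF oms, of "binaryset A B"]
    by (simp add: UN_binaryset_eq suminf_binaryset_eq)
qed

text \<open>
  Caratheodory's criterion. The points \<open>A k\<close> of \<open>X\<close> at distance at least \<open>1/(k+1)\<close> from \<open>F\<close> are separated from
  \<open>F\<close>, so \<open>f (X \<inter> F) + f (A k) \<le> f X\<close>, and it remains to see that \<open>X - F\<close> exceeds \<open>A k\<close> by little. The shells
  \<open>D k\<close> between consecutive \<open>A k\<close> are separated as soon as their indices differ by two. This gives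
  \<open>f (A k) + f (D (k+1)) \<le> f (A (k+2))\<close>, so the sum of all \<open>f (D k)\<close> is bounded by \<open>2 f X\<close> and its tails
  tend to zero.
\<close>

lemma metric_outer_measure_closed:
  fixes f :: "'a::metric_space set \<Rightarrow> ennreal"
  assumes oms: "outer_measure_space (Pow UNIV) f"
    and metric: "\<And>A B d. d > 0 \<Longrightarrow> (\<And>x y. x \<in> A \<Longrightarrow> y \<in> B \<Longrightarrow> d \<le> dist x y) \<Longrightarrow> f A + f B \<le> f (A \<union> B)"
    and F: "closed F"
  shows "f (X \<inter> F) + f (X - F) \<le> f X"
proof (cases "F = {} \<or> f X = \<infinity>")
  case True
  then show ?thesis using oms by (auto simp: outer_measure_space_def positive_def)
next
  case False
  then have ne: "F \<noteq> {}" and fin: "f X < \<infinity>" by (auto simp: less_top)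
  have mono: "f A \<le> f B" if "A \<subseteq> B" for A B
    using oms that by (auto simp: outer_measure_space_def increasing_def)
  note csub = outer_measure_space_csubadditive[OF oms] and sub = outer_measure_space_subadditive[OF oms]
  define A where "A k = {x \<in> X - F. inverse (real (Suc k)) \<le> infdist x F}" for k
  define D where "D k = A (Suc k) - A k" for k
  have inv: "inverse (real (Suc (Suc k))) < inverse (real (Suc k))" for k by (simp add: field_simps)
  have A_mono: "A k \<subseteq> A (Suc k)" for k using less_imp_le[OF inv[of k]] unfolding A_def by (blast intro: order_trans)
  have pos: "infdist x F > 0" if "x \<notin> F" for x
    using that F ne in_closed_iff_infdist_zero[of F x] infdist_nonneg[of x F] by fastforce
  have UA: "X - F = (\<Union>k. A k)"
  proof (intro equalityI subsetI)
    fix x assume x: "x \<in> X - F"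
    then have "infdist x F > 0" using pos by auto
    then obtain n where "inverse (real (Suc n)) < infdist x F" using reals_Archimedean by blast
    then show "x \<in> (\<Union>k. A k)" using x by (auto simp: A_def intro!: exI[of _ n])
  qed (auto simp: A_def)
  have FA: "f (X \<inter> F) + f (A k) \<le> f X" for k
  proof -
    have "f (X \<inter> F) + f (A k) \<le> f (X \<inter> F \<union> A k)"
    proof (rule metric[of "inverse (real (Suc k))"])
      fix x y assume "x \<in> X \<inter> F" "y \<in> A k"
      then show "inverse (real (Suc k)) \<le> dist x y"
        using infdist_le[of x F y] by (auto simp: A_def dist_commute)
    qed simp
    also have "\<dots> \<le> f X" by (rule mono) (auto simp: A_def)
    finally show ?thesis .
  qed
  have AD: "f (A k) + f (D (Suc k)) \<le> f (A (Suc (Suc k)))" for k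
  proof -
    have "f (A k) + f (D (Suc k)) \<le> f (A k \<union> D (Suc k))"
    proof (rule metric[of "inverse (real (Suc k)) - inverse (real (Suc (Suc k)))"])
      fix x y assume "x \<in> A k" "y \<in> D (Suc k)"
      then have "inverse (real (Suc k)) \<le> infdist x F" "infdist y F < inverse (real (Suc (Suc k)))"
        by (auto simp: A_def D_def)
      then show "inverse (real (Suc k)) - inverse (real (Suc (Suc k))) \<le> dist x y"
        using infdist_triangle[of x F y] by linarith
    qed (use inv[of k] in simp)
    also have "\<dots> \<le> f (A (Suc (Suc k)))"
      using A_mono[of k] A_mono[of "Suc k"] by (intro mono) (auto simp: D_def)
    finally show ?thesis .
  qed
  have "(\<Sum>k<n. f (D (Suc k))) + (f (A 0) + f (A 1)) \<le> f (A n) + f (A (Suc n))" for n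
  proof (induction n)
    case (Suc n)
    have "(\<Sum>k<Suc n. f (D (Suc k))) + (f (A 0) + f (A 1))
        = ((\<Sum>k<n. f (D (Suc k))) + (f (A 0) + f (A 1))) + f (D (Suc n))" by (simp add: ac_simps)
    also have "\<dots> \<le> (f (A n) + f (A (Suc n))) + f (D (Suc n))" by (intro add_mono Suc order_refl)
    also have "\<dots> = f (A (Suc n)) + (f (A n) + f (D (Suc n)))" by (simp add: ac_simps)
    also have "\<dots> \<le> f (A (Suc n)) + f (A (Suc (Suc n)))" by (intro add_mono AD order_refl)
    finally show ?case .
  qed simp
  moreover have fA: "f (A n) \<le> f X" for n by (rule mono) (auto simp: A_def)
  ultimately have "(\<Sum>k<n. f (D (Suc k))) + 0 \<le> f X + f X" for n
    by (meson add_mono order_trans add_left_mono zero_le)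
  then have "(\<Sum>k. f (D (Suc k))) + 0 \<le> f X + f X" by (rule ennreal_suminf_bound_add)
  then have finD: "(\<Sum>k. f (D (Suc k))) < \<infinity>" using fin by (simp add: le_less_trans)
  define r where "r k = enn2real (f (D (Suc k)))" for k
  have r: "f (D (Suc k)) = ennreal (r k)" "0 \<le> r k" for k
    using ennreal_suminf_lessD[OF finD, of k] by (auto simp: r_def)
  have "summable r"
    using finD by (intro summable_suminf_not_top) (auto simp: r)
  then have tail: "(\<lambda>n. \<Sum>k. r (k + n)) \<longlonglongrightarrow> 0" by (rule suminf_exist_split2)
  have bound: "f (X \<inter> F) + f (X - F) \<le> f X + ennreal (\<Sum>k. r (k + n))" for n
  proof -
    have "X - F \<subseteq> A (Suc n) \<union> (\<Union>k. D (Suc (k + n)))"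
    proof
      fix x assume "x \<in> X - F"
      then obtain m where m: "x \<in> A m" using UA by blast
      show "x \<in> A (Suc n) \<union> (\<Union>k. D (Suc (k + n)))"
      proof (cases "x \<in> A (Suc n)")
        case x: False
        have "\<exists>k. x \<in> A (Suc (Suc n + k)) \<and> x \<notin> A (Suc n + k)"
        proof (rule ccontr)
          assume "\<not> ?thesis"
          then have "x \<notin> A (Suc n + k)" for k using x by (induction k) auto
          moreover have "x \<in> A (m + j)" for j using m A_mono by (induction j) auto
          ultimately show False by (metis add.commute)
        qed
        then obtain k where "x \<in> D (Suc n + k)" by (auto simp: D_def)
        then show ?thesis by (auto simp: ac_simps intro: exI[of _ k])
      qed simp
    qed
    then have "f (X - F) \<le> f (A (Suc n) \<union> (\<Union>k. D (Suc (k + n))))" by (rule mono)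
    also have "\<dots> \<le> f (A (Suc n)) + f (\<Union>k. D (Suc (k + n)))" by (rule sub)
    also have "\<dots> \<le> f (A (Suc n)) + (\<Sum>k. f (D (Suc (k + n))))" by (intro add_mono csub order_refl)
    also have "(\<Sum>k. f (D (Suc (k + n)))) = ennreal (\<Sum>k. r (k + n))"
      using \<open>summable r\<close> by (simp add: r suminf_ennreal2 summable_iff_shift)
    finally have "f (X \<inter> F) + f (X - F) \<le> (f (X \<inter> F) + f (A (Suc n))) + ennreal (\<Sum>k. r (k + n))"
      by (simp add: add.assoc add_left_mono)
    also have "\<dots> \<le> f X + ennreal (\<Sum>k. r (k + n))" by (intro add_mono FA order_refl)
    finally show ?thesis .
  qed
  have "(\<lambda>n. f X + ennreal (\<Sum>k. r (k + n))) \<longlonglongrightarrow> f X + ennreal 0"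
    by (intro tendsto_add tendsto_const tendsto_ennrealI tail)
  then show ?thesis
    by (intro LIMSEQ_le_const[of _ "f X"]) (use bound in auto)
qed

text \<open>
  Closed sets are measurable for the outer measure by the previous lemma, so the Borel sets lie in the
  sigma-algebra of Caratheodory measurable sets, on which an outer measure is countably additive.
\<close>

lemma hausdorff_outer_measure_space: "measure_space UNIV (sets borel) (hausdorff_outer s :: 'a::euclidean_space set \<Rightarrow> ennreal)"
proof -
  let ?f = "hausdorff_outer s :: 'a set \<Rightarrow> ennreal"
  let ?L = "lambda_system UNIV (Pow UNIV) ?f"
  interpret P: sigma_algebra "UNIV :: 'a set" "Pow UNIV" by (rule sigma_algebra_Pow)
  have ms: "measure_space UNIV ?L ?f"
    by (rule P.caratheodory_lemma[OF hausdorff_outer_space])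
  note sub = outer_measure_space_subadditive[OF hausdorff_outer_space[of s]]
  have "F \<in> ?L" if "closed F" for F
  proof -
    have "?f (X \<inter> F) + ?f (X - F) = ?f X" for X
    proof (rule antisym)
      show "?f (X \<inter> F) + ?f (X - F) \<le> ?f X"
        by (rule metric_outer_measure_closed[OF hausdorff_outer_space hausdorff_outer_separated that])
      show "?f X \<le> ?f (X \<inter> F) + ?f (X - F)"
        using sub[of "X \<inter> F" "X - F"] by (simp add: Int_Diff_Un)
    qed
    then show ?thesis using P.lambda_system_eq[of ?f] by blast
  qed
  moreover have "sigma_algebra UNIV ?L" using ms by (simp add: measure_space_def)
  ultimately have "sigma_sets UNIV {F. closed F} \<subseteq> ?L"
    by (intro sigma_algebra.sigma_sets_subset) auto
  then have "sets borel \<subseteq> ?L" by (simp add: borel_eq_closed)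
  then show ?thesis
    using ms sets.sigma_algebra_axioms[of "borel :: 'a measure"]
    by (auto simp: measure_space_def positive_def countably_additive_def)
qed

lemma sets_surface_measure [simp, measurable_cong]: "sets surface_measure = sets borel"
  using sets.sigma_sets_eq[of "borel :: (real^'n) measure"] by (simp add: surface_measure_def)

lemma space_surface_measure [simp]: "space surface_measure = UNIV"
  by (simp add: surface_measure_def)

text \<open>
  Without countable additivity \<open>measure_of\<close> would return the zero measure, so this equation carries the
  whole content of the preceding lemmas.
\<close>

lemma emeasure_surface_measure:
  fixes A :: "(real^'n) set"
  assumes "A \<in> sets borel"
  shows "emeasure surface_measure A = hausdorff_outer (real (CARD('n) - 1)) A"
proof (rule emeasure_measure_of[OF surface_measure_def])
  show "positive (sets surface_measure) (hausdorff_outer (real (CARD('n) - 1)) :: (real^'n) set \<Rightarrow> ennreal)"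
    "countably_additive (sets surface_measure) (hausdorff_outer (real (CARD('n) - 1)) :: (real^'n) set \<Rightarrow> ennreal)"
    using hausdorff_outer_measure_space[of "real (CARD('n) - 1)"] by (auto simp: measure_space_def)
qed (use assms in auto)

section \<open>Thin strips over a piece of the boundary\<close>

text \<open>
  Take a cover of \<open>A\<close> by sets of diameter \<open>d \<le> \<epsilon>\<close>. A set of the cover together with its translates by at most \<open>\<epsilon>\<close>
  in direction \<open>i\<close> fits into a box with side \<open>4\<epsilon>\<close> in that direction and sides \<open>2d\<close> in the others. Its volume
  \<open>4\<epsilon> (2d)^(n-1)\<close> is \<open>K \<epsilon>\<close> times the weight of the covering set in the Hausdorff measure.
\<close>

lemma strip_emeasure_le_hausdorff_outer:
  fixes A E :: "(real^'n) set"
  assumes n: "CARD('n) \<ge> 2" and \<epsilon>: "\<epsilon> > 0" and s: "\<bar>s\<bar> = 1"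
    and E: "\<And>x. x \<in> E \<Longrightarrow> \<exists>z\<in>A. \<exists>\<sigma>\<in>{0..\<epsilon>}. x = z + (\<sigma> * s) *\<^sub>R axis i 1"
  defines "K \<equiv> 4 ^ CARD('n) / unit_ball_vol (real (CARD('n) - 1))"
  shows "emeasure lborel E \<le> ennreal (K * \<epsilon>) * hausdorff_outer (real (CARD('n) - 1)) A"
proof -
  let ?n = "real (CARD('n) - 1)"
  have K: "K > 0" unfolding K_def by simp
  have "emeasure lborel E \<le> ennreal (K * \<epsilon>) * (\<Sum>j. diameter_weight ?n (C j))"
    if C: "C \<in> delta_covers \<epsilon> A" for C
  proof -
    have C': "bounded (C j)" "diameter (C j) \<le> \<epsilon>" "A \<subseteq> (\<Union>j. C j)" for j
      using C by (auto simp: delta_covers_def)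
    define d where "d j = diameter (C j)" for j
    have d: "0 \<le> d j" "d j \<le> \<epsilon>" for j using C' diameter_ge_0 by (auto simp: d_def)
    define c where "c j = (SOME c. c \<in> C j)" for j
    \<comment> \<open>Half sides: in direction \<open>i\<close> the shift by at most \<open>\<epsilon>\<close> adds to the diameter \<open>d j \<le> \<epsilon>\<close>.\<close>
    define w where "w j = (\<chi> k. if k = i then 2 * \<epsilon> else d j)" for j
    define B where "B j = (if C j = {} then {} else cbox (c j - w j) (c j + w j))" for j
    have emB: "emeasure lborel (B j) \<le> ennreal (K * \<epsilon>) * diameter_weight ?n (C j)" for j
    proof (cases "C j = {}")
      case False
      have "emeasure lborel (B j) = ennreal (\<Prod>b\<in>Basis. (2 *\<^sub>R w j) \<bullet> b)"
        using False d[of j] \<epsilon> by (auto simp: B_def emeasure_lborel_cbox_eq w_def Basis_vec_def inner_axis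
            inner_diff_left inner_add_left scaleR_2 intro!: arg_cong[of _ _ ennreal] prod.cong)
      also have "(\<Prod>b\<in>Basis. (2 *\<^sub>R w j) \<bullet> b) = (\<Prod>k\<in>UNIV. 2 * w j $ k)"
        by (simp add: Basis_vec_def cart_eq_inner_axis axis_eq_axis prod.UNION_disjoint)
      also have "\<dots> = 4 * \<epsilon> * (\<Prod>k\<in>UNIV - {i}. 2 * d j)"
        by (subst prod.remove[of _ i]) (auto simp: w_def intro!: prod.cong)
      also have "\<dots> = 4 * \<epsilon> * (2 * d j) ^ (CARD('n) - 1)" by (simp add: card_Diff_singleton)
      also have "\<dots> = 4 * \<epsilon> * 4 ^ (CARD('n) - 1) * (d j / 2) ^ (CARD('n) - 1)"
      proof -
        have "(2 * d j) ^ (CARD('n) - 1) = (4 * (d j / 2)) ^ (CARD('n) - 1)" by simp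
        then show ?thesis by (simp only: power_mult_distrib mult.assoc)
      qed
      also have "\<dots> = 4 ^ CARD('n) * \<epsilon> * (d j / 2) ^ (CARD('n) - 1)"
        using power_minus_mult[of "CARD('n)" "4::real"] by simp
      also have "(d j / 2) ^ (CARD('n) - 1) = (d j / 2) powr ?n"
      proof (cases "d j = 0")
        case True
        then show ?thesis using n by (simp add: power_0_left)
      next
        case False
        then show ?thesis using d[of j] by (subst powr_realpow) auto
      qed
      also have "4 ^ CARD('n) * \<epsilon> * \<dots> = (K * \<epsilon>) * (unit_ball_vol ?n * (d j / 2) powr ?n)"
      proof -
        have *: "P * \<epsilon> * q = (P / V * \<epsilon>) * (V * q)" if "V > 0" for P V q :: real
          using that by simp
        show ?thesis unfolding K_def by (rule *) simp
      qed
      also have "ennreal \<dots> = ennreal (K * \<epsilon>) * diameter_weight ?n (C j)"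
        using K \<epsilon> by (simp add: diameter_weight_def d_def ennreal_mult')
      finally show ?thesis by simp
    qed (simp add: B_def)
    have "E \<subseteq> (\<Union>j. B j)"
    proof
      fix x assume "x \<in> E"
      then obtain z \<sigma> where z: "z \<in> A" "\<sigma> \<in> {0..\<epsilon>}" "x = z + (\<sigma> * s) *\<^sub>R axis i 1" using E by blast
      then obtain j where j: "z \<in> C j" using C' by blast
      then have cj: "c j \<in> C j" unfolding c_def by (metis someI)
      have "dist (c j) z \<le> d j" unfolding d_def by (rule diameter_bounded_bound[OF C'(1) cj j])
      then have comp: "\<bar>(z - c j) $ k\<bar> \<le> d j" for k
        using component_le_norm_cart[of "z - c j" k] by (simp add: dist_norm norm_minus_commute)
      have "\<bar>\<sigma> * s\<bar> \<le> \<epsilon>" using z s by (simp add: abs_mult)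
      then have "\<bar>(x - c j) $ k\<bar> \<le> w j $ k" for k
        using comp[of k] d[of j] by (auto simp: z(3) w_def axis_def)
      then have "x \<in> B j"
        using cj by (auto simp: B_def mem_box_cart abs_le_iff algebra_simps)
      then show "x \<in> (\<Union>j. B j)" by blast
    qed
    then have "emeasure lborel E \<le> emeasure lborel (\<Union>j. B j)"
      by (rule emeasure_mono) (auto simp: B_def intro!: sets.countable_UN)
    also have "\<dots> \<le> (\<Sum>j. emeasure lborel (B j))"
      by (rule emeasure_subadditive_countably) (auto simp: B_def)
    also have "\<dots> \<le> (\<Sum>j. ennreal (K * \<epsilon>) * diameter_weight ?n (C j))"
      by (intro suminf_le emB) auto
    finally show ?thesis by simp
  qed
  then have le: "emeasure lborel E / ennreal (K * \<epsilon>) \<le> (\<Sum>j. diameter_weight ?n (C j))"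
    if "C \<in> delta_covers \<epsilon> A" for C
    using that K \<epsilon> by (intro divide_le_posI_ennreal) auto
  have "emeasure lborel E / ennreal (K * \<epsilon>) \<le> hausdorff_pre ?n \<epsilon> A"
    unfolding hausdorff_pre_eq by (rule INF_greatest) (rule le)
  also have "\<dots> \<le> hausdorff_outer ?n A" by (rule hausdorff_pre_le_outer[OF \<epsilon>])
  finally have "ennreal (K * \<epsilon>) * (emeasure lborel E / ennreal (K * \<epsilon>)) \<le> ennreal (K * \<epsilon>) * hausdorff_outer ?n A"
    by (rule mult_left_mono) simp
  moreover have "ennreal (K * \<epsilon>) * (emeasure lborel E / ennreal (K * \<epsilon>)) = emeasure lborel E"
    using K \<epsilon> mult_divide_eq_ennreal[of "ennreal (K * \<epsilon>)" "emeasure lborel E"]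
    by (simp add: ennreal_times_divide mult.commute)
  ultimately show ?thesis by simp
qed

text \<open>
  Write \<open>U x\<close> as its value at the foot point \<open>x - t e\<close> plus the integral of the derivative along the segment, and
  apply the Cauchy-Schwarz inequality to the integral.
\<close>

lemma square_le_boundary_plus_line_integral:
  fixes U :: "'a::euclidean_space \<Rightarrow> real"
  assumes U: "smooth_fun U" and t: "t > 0"
  shows "ennreal ((U x)\<^sup>2) \<le> 2 * ennreal ((U (x - t *\<^sub>R e))\<^sup>2)
      + 2 * ennreal t * (\<integral>\<^sup>+\<sigma>. indicator {0..t} \<sigma> * ennreal ((dir_deriv e U (x - \<sigma> *\<^sub>R e))\<^sup>2) \<partial>lborel)"
proof -
  define h where "h \<sigma> = U (x - \<sigma> *\<^sub>R e)" for \<sigma>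
  define g where "g \<sigma> = - dir_deriv e U (x - \<sigma> *\<^sub>R e)" for \<sigma>
  have h: "(h has_real_derivative g \<sigma>) (at \<sigma>)" for \<sigma>
  proof -
    have D: "(U has_derivative (\<lambda>v. dir_deriv v U (x - \<sigma> *\<^sub>R e))) (at (x - \<sigma> *\<^sub>R e))"
      by (intro dir_deriv_has_derivative smooth_differentiable U)
    have "((\<lambda>\<sigma>. x - \<sigma> *\<^sub>R e) has_derivative (\<lambda>r. - r *\<^sub>R e)) (at \<sigma>)"
      by (auto intro!: derivative_eq_intros)
    from has_derivative_compose[OF this D]
    have "(h has_derivative (\<lambda>r. dir_deriv ((- r) *\<^sub>R e) U (x - \<sigma> *\<^sub>R e))) (at \<sigma>)"
      by (simp add: h_def[abs_def])
    moreover have "dir_deriv ((- r) *\<^sub>R e) U (x - \<sigma> *\<^sub>R e) = g \<sigma> * r" for r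
      using linear_cmul[OF has_derivative_linear[OF D], of "- r" e] by (simp add: g_def)
    ultimately show ?thesis by (simp only: has_field_derivative_def)
  qed
  have cg: "isCont g \<sigma>" for \<sigma>
  proof -
    have c: "continuous_on UNIV (dir_deriv e U)" by (intro smooth_continuous smooth_dir_deriv U)
    have "continuous_on UNIV g" unfolding g_def
      by (intro continuous_on_minus continuous_on_compose2[OF c]) (auto intro!: continuous_intros)
    then show ?thesis by (simp add: continuous_on_eq_continuous_at)
  qed
  define D where "D = h t - h 0"
  \<comment> \<open>The mean of \<open>g\<close>; expanding the integral of \<open>(g - m)^2 \<ge> 0\<close> is the Cauchy-Schwarz inequality.\<close>
  define m where "m = D / t"
  have I1: "has_bochner_integral lborel (\<lambda>\<sigma>. g \<sigma> * indicator {0..t} \<sigma>) D"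
    unfolding D_def using t by (intro has_bochner_integral_FTC_Icc_real h cg) auto
  have i2: "integrable lborel (\<lambda>\<sigma>. indicator {0..t} \<sigma> *\<^sub>R (g \<sigma>)\<^sup>2)"
    by (rule borel_integrable_compact) (auto intro!: continuous_at_imp_continuous_on continuous_intros cg)
  have i3: "has_bochner_integral lborel (\<lambda>\<sigma>. m\<^sup>2 * indicator {0..t} \<sigma>) (m\<^sup>2 * t)"
    using has_bochner_integral_mult_right[OF has_bochner_integral_real_indicator[of "{0..t}" lborel], of "m\<^sup>2"] t
    by simp
  have "0 \<le> (\<integral>\<sigma>. indicator {0..t} \<sigma> *\<^sub>R (g \<sigma>)\<^sup>2 - 2 * m * (g \<sigma> * indicator {0..t} \<sigma>) + m\<^sup>2 * indicator {0..t} \<sigma> \<partial>lborel)"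
  proof (rule integral_nonneg_AE, rule AE_I2)
    fix \<sigma>
    have "indicator {0..t} \<sigma> *\<^sub>R (g \<sigma>)\<^sup>2 - 2 * m * (g \<sigma> * indicator {0..t} \<sigma>) + m\<^sup>2 * indicator {0..t} \<sigma>
        = indicator {0..t} \<sigma> * (g \<sigma> - m)\<^sup>2"
      by (simp add: power2_diff algebra_simps)
    then show "0 \<le> indicator {0..t} \<sigma> *\<^sub>R (g \<sigma>)\<^sup>2 - 2 * m * (g \<sigma> * indicator {0..t} \<sigma>) + m\<^sup>2 * indicator {0..t} \<sigma>"
      by simp
  qed
  also have "\<dots> = (\<integral>\<sigma>. indicator {0..t} \<sigma> *\<^sub>R (g \<sigma>)\<^sup>2 \<partial>lborel) - 2 * m * D + m\<^sup>2 * t"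
    using I1 i2 i3 by (simp add: has_bochner_integral_iff)
  finally have "D\<^sup>2 \<le> t * (\<integral>\<sigma>. indicator {0..t} \<sigma> *\<^sub>R (g \<sigma>)\<^sup>2 \<partial>lborel)"
    using t by (simp add: m_def power2_eq_square field_simps)
  then have "ennreal (D\<^sup>2) \<le> ennreal t * ennreal (\<integral>\<sigma>. indicator {0..t} \<sigma> *\<^sub>R (g \<sigma>)\<^sup>2 \<partial>lborel)"
    using t by (simp add: ennreal_mult'[symmetric] ennreal_leI)
  also have "ennreal (\<integral>\<sigma>. indicator {0..t} \<sigma> *\<^sub>R (g \<sigma>)\<^sup>2 \<partial>lborel)
      = (\<integral>\<^sup>+\<sigma>. ennreal (indicator {0..t} \<sigma> *\<^sub>R (g \<sigma>)\<^sup>2) \<partial>lborel)"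
    by (rule nn_integral_eq_integral[symmetric, OF i2]) simp
  also have "\<dots> = (\<integral>\<^sup>+\<sigma>. indicator {0..t} \<sigma> * ennreal ((dir_deriv e U (x - \<sigma> *\<^sub>R e))\<^sup>2) \<partial>lborel)"
    by (intro nn_integral_cong) (auto simp: g_def indicator_def)
  finally have DD: "ennreal (D\<^sup>2) \<le> ennreal t * \<dots>" .
  have "(U x)\<^sup>2 \<le> 2 * (U (x - t *\<^sub>R e))\<^sup>2 + 2 * D\<^sup>2"
    using sum_squares_bound[of "U (x - t *\<^sub>R e)" "- D"] by (simp add: D_def h_def power2_eq_square algebra_simps)
  then have "ennreal ((U x)\<^sup>2) \<le> 2 * ennreal ((U (x - t *\<^sub>R e))\<^sup>2) + 2 * ennreal (D\<^sup>2)"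
    by (simp add: ennreal_mult'[symmetric] ennreal_plus[symmetric] ennreal_leI flip: ennreal_numeral del: ennreal_plus)
  also have "\<dots> \<le> 2 * ennreal ((U (x - t *\<^sub>R e))\<^sup>2)
      + 2 * (ennreal t * (\<integral>\<^sup>+\<sigma>. indicator {0..t} \<sigma> * ennreal ((dir_deriv e U (x - \<sigma> *\<^sub>R e))\<^sup>2) \<partial>lborel))"
    by (intro add_mono mult_left_mono DD) auto
  finally show ?thesis by (simp add: mult.assoc)
qed

text \<open>
  \<open>\<tau>\<close> is the height above the boundary graph, measured along the axis \<open>i\<close> with orientation \<open>s\<close>: it increases
  at unit speed in that direction, is positive exactly inside \<open>\<Omega>\<close>, and is Lipschitz with constant \<open>M\<close>.
  Asking for \<open>M \<ge> 1\<close> lets \<open>M \<epsilon>\<close> also bound distances \<open>\<epsilon>\<close>.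
\<close>

definition graph_chart ::
    "(real^'n) set \<Rightarrow> real^'n \<Rightarrow> real \<Rightarrow> 'n \<Rightarrow> real \<Rightarrow> (real^'n \<Rightarrow> real) \<Rightarrow> real \<Rightarrow> bool" where
  "graph_chart \<Omega> p r i s \<tau> M \<longleftrightarrow>
     r > 0 \<and> \<bar>s\<bar> = 1 \<and> M \<ge> 1 \<and> continuous_on UNIV \<tau> \<and>
     (\<forall>x \<sigma>. \<tau> (x + (\<sigma> * s) *\<^sub>R axis i 1) = \<tau> x + \<sigma>) \<and>
     \<Omega> \<inter> ball p r = {x \<in> ball p r. \<tau> x > 0} \<and>
     (\<forall>x\<in>ball p r. \<forall>y\<in>ball p r. \<bar>\<tau> x - \<tau> y\<bar> \<le> M * dist x y)"

lemma C1_lipschitz_on_ball: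
  fixes \<gamma> :: "'a::euclidean_space \<Rightarrow> real"
  assumes "Ck (Suc 0) \<gamma>"
  shows "\<exists>L. \<forall>x\<in>ball p r. \<forall>y\<in>ball p r. \<bar>\<gamma> x - \<gamma> y\<bar> \<le> L * dist x y"
proof -
  have "\<exists>B. \<forall>x\<in>cball p r. \<bar>dir_deriv b \<gamma> x\<bar> \<le> B" for b
  proof -
    have "compact (dir_deriv b \<gamma> ` cball p r)"
      using assms by (intro compact_continuous_image) (auto intro: continuous_on_subset)
    then have "bounded (dir_deriv b \<gamma> ` cball p r)" by (rule compact_imp_bounded)
    then show ?thesis by (simp add: bounded_iff)
  qed
  then obtain B where B: "\<And>b x. x \<in> cball p r \<Longrightarrow> \<bar>dir_deriv b \<gamma> x\<bar> \<le> B b" by metis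
  show ?thesis
  proof (intro exI[of _ "\<Sum>b\<in>Basis. B b"] ballI)
    fix x y assume xy: "x \<in> ball p r" "y \<in> ball p r"
    have D: "(\<gamma> has_derivative (\<lambda>e. dir_deriv e \<gamma> z)) (at z)" for z
      using assms by (intro dir_deriv_has_derivative) auto
    have "norm (\<gamma> x - \<gamma> y) \<le> (\<Sum>b\<in>Basis. B b) * norm (x - y)"
    proof (rule differentiable_bound[OF convex_ball, where f'="\<lambda>z e. dir_deriv e \<gamma> z"])
      fix z assume z: "z \<in> ball p r"
      show "(\<gamma> has_derivative (\<lambda>e. dir_deriv e \<gamma> z)) (at z within ball p r)"
        using D by (rule has_derivative_at_withinI)
      show "onorm (\<lambda>e. dir_deriv e \<gamma> z) \<le> (\<Sum>b\<in>Basis. B b)"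
      proof (rule onorm_le)
        fix e :: 'a
        have lin: "linear (\<lambda>e. dir_deriv e \<gamma> z)" by (rule has_derivative_linear[OF D])
        have "dir_deriv e \<gamma> z = (\<Sum>b\<in>Basis. (e \<bullet> b) * dir_deriv b \<gamma> z)"
          using linear_sum[OF lin, of "\<lambda>b. (e \<bullet> b) *\<^sub>R b" Basis] linear_cmul[OF lin]
          by (simp add: euclidean_representation)
        also have "\<bar>\<dots>\<bar> \<le> (\<Sum>b\<in>Basis. \<bar>(e \<bullet> b) * dir_deriv b \<gamma> z\<bar>)" by (rule sum_abs)
        also have "\<dots> \<le> (\<Sum>b\<in>Basis. norm e * B b)"
          using z by (intro sum_mono) (auto simp: abs_mult intro!: mult_mono B Basis_le_norm)
        finally show "norm (dir_deriv e \<gamma> z) \<le> (\<Sum>b\<in>Basis. B b) * norm e"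
          by (simp add: sum_distrib_left mult.commute)
      qed
    qed (use xy in auto)
    then show "\<bar>\<gamma> x - \<gamma> y\<bar> \<le> (\<Sum>b\<in>Basis. B b) * dist x y" by (simp add: dist_norm)
  qed
qed

lemma Ck_boundary_graph_chart:
  assumes k: "k \<ge> 1" and "Ck_boundary k \<Omega>" and p: "p \<in> frontier \<Omega>"
  shows "\<exists>r i s \<tau> M. graph_chart \<Omega> p r i s \<tau> M"
proof -
  have "\<exists>r>0. \<exists>i. \<exists>s\<in>{1, -1}. \<exists>\<gamma>.
        Ck k \<gamma> \<and> (\<forall>x y. (\<forall>j. j \<noteq> i \<longrightarrow> x $ j = y $ j) \<longrightarrow> \<gamma> x = \<gamma> y) \<and>
        \<Omega> \<inter> ball p r = {x \<in> ball p r. s * x $ i > \<gamma> x}"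
    using assms(2) p unfolding Ck_boundary_def by (rule bspec)
  then obtain r i s \<gamma> where r: "r > 0" and s: "s \<in> {1, -1::real}" and \<gamma>: "Ck k \<gamma>"
    and inv': "\<forall>x y. (\<forall>j. j \<noteq> i \<longrightarrow> x $ j = y $ j) \<longrightarrow> \<gamma> x = \<gamma> y"
    and \<Omega>: "\<Omega> \<inter> ball p r = {x \<in> ball p r. s * x $ i > \<gamma> x}"
    by (elim exE bexE conjE)
  have inv: "\<gamma> x = \<gamma> y" if "\<And>j. j \<noteq> i \<Longrightarrow> x $ j = y $ j" for x y
    using inv' that by simp
  have "Ck (Suc 0) \<gamma>" by (rule Ck_mono[OF \<gamma>]) (use k in simp)
  then have "\<exists>L. \<forall>x\<in>ball p r. \<forall>y\<in>ball p r. \<bar>\<gamma> x - \<gamma> y\<bar> \<le> L * dist x y"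
    by (rule C1_lipschitz_on_ball)
  then obtain L where "\<forall>x\<in>ball p r. \<forall>y\<in>ball p r. \<bar>\<gamma> x - \<gamma> y\<bar> \<le> L * dist x y"
    by (elim exE)
  then have L: "\<bar>\<gamma> x - \<gamma> y\<bar> \<le> L * dist x y" if "x \<in> ball p r" "y \<in> ball p r" for x y
    using that by simp
  define \<tau> where "\<tau> x = s * x $ i - \<gamma> x" for x
  have "graph_chart \<Omega> p r i s \<tau> (max 1 (1 + L))"
    unfolding graph_chart_def
  proof (intro conjI allI ballI)
    show "continuous_on UNIV \<tau>"
      unfolding \<tau>_def by (intro continuous_intros Ck_continuous[OF \<gamma>])
    show "\<tau> (x + (\<sigma> * s) *\<^sub>R axis i 1) = \<tau> x + \<sigma>" for x \<sigma>
    proof -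
      have "\<gamma> (x + (\<sigma> * s) *\<^sub>R axis i 1) = \<gamma> x" by (rule inv) (auto simp: axis_def)
      moreover have "s * s = 1" using s by auto
      ultimately show ?thesis
        by (simp add: \<tau>_def algebra_simps)
    qed
    show "\<Omega> \<inter> ball p r = {x \<in> ball p r. \<tau> x > 0}" using \<Omega> by (auto simp: \<tau>_def)
    fix x y assume xy: "x \<in> ball p r" "y \<in> ball p r"
    have "\<bar>\<tau> x - \<tau> y\<bar> \<le> \<bar>s * (x $ i - y $ i)\<bar> + \<bar>\<gamma> x - \<gamma> y\<bar>"
      unfolding \<tau>_def by (simp add: algebra_simps)
    also have "\<bar>s * (x $ i - y $ i)\<bar> = \<bar>(x - y) $ i\<bar>" using s by auto
    also have "\<dots> \<le> dist x y" unfolding dist_norm by (rule component_le_norm_cart)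
    also have "\<bar>\<gamma> x - \<gamma> y\<bar> \<le> L * dist x y" by (rule L[OF xy])
    also have "dist x y + L * dist x y \<le> max 1 (1 + L) * dist x y"
    proof -
      have "dist x y + L * dist x y = (1 + L) * dist x y" by (simp add: algebra_simps)
      also have "\<dots> \<le> max 1 (1 + L) * dist x y" by (intro mult_right_mono) auto
      finally show ?thesis .
    qed
    finally show "\<bar>\<tau> x - \<tau> y\<bar> \<le> max 1 (1 + L) * dist x y" by simp
  qed (use r s in auto)
  then show ?thesis by blast
qed

text \<open>
  The inequality on segments is applied between \<open>x\<close> and its foot point \<open>\<pi> x = x - \<tau>(x) e\<close> on the boundary and
  integrated over the strip \<open>E\<close>. For the boundary term, the push-forward of Lebesgue measure on \<open>E\<close> under \<open>\<pi>\<close> is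
  at most \<open>K \<epsilon>\<close> times the surface measure, which is the volume comparison above. For the gradient term, the
  integrals over \<open>x\<close> and over the position \<open>\<sigma>\<close> on the segment are exchanged; by translation invariance each
  \<open>\<sigma>\<close> contributes at most the full integral over \<open>\<Omega>\<close>, and the lengths of the \<open>\<sigma>\<close>-interval and of the segment
  give one factor \<open>\<epsilon>\<close> each.
\<close>

lemma strip_in_chart_estimate:
  fixes \<Omega> :: "(real^'n) set"
  assumes n: "CARD('n) \<ge> 2" and \<Omega>: "open \<Omega>" and chart: "graph_chart \<Omega> p r i s \<tau> M"
    and \<epsilon>: "0 < \<epsilon>" "\<epsilon> < r / 2" and U: "smooth_fun U"
  defines "K \<equiv> 4 ^ CARD('n) / unit_ball_vol (real (CARD('n) - 1))"
  defines "E \<equiv> {x \<in> ball p (r / 2). 0 < \<tau> x \<and> \<tau> x \<le> \<epsilon>}"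
  shows "(\<integral>\<^sup>+x\<in>E. ennreal ((U x)\<^sup>2) \<partial>lborel)
    \<le> 2 * (ennreal (K * \<epsilon>) * (\<integral>\<^sup>+x\<in>frontier \<Omega>. ennreal ((U x)\<^sup>2) \<partial>surface_measure))
      + 2 * (ennreal (\<epsilon>\<^sup>2) * (\<integral>\<^sup>+x\<in>\<Omega>. ennreal ((dir_deriv (axis i 1) U x)\<^sup>2) \<partial>lborel))"
proof -
  define e :: "real^'n" where "e = s *\<^sub>R axis i 1"
  have s: "\<bar>s\<bar> = 1" "s * s = 1" and c\<tau>: "continuous_on UNIV \<tau>"
    and \<tau>: "\<And>x \<sigma>. \<tau> (x + \<sigma> *\<^sub>R e) = \<tau> x + \<sigma>"
    and dom: "\<Omega> \<inter> ball p r = {x \<in> ball p r. \<tau> x > 0}"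
    using chart by (auto simp: graph_chart_def e_def abs_if split: if_splits)
  have \<tau>m: "\<tau> (x - \<sigma> *\<^sub>R e) = \<tau> x - \<sigma>" for x \<sigma> using \<tau>[of x "- \<sigma>"] by simp
  have ne: "norm e = 1" using s by (simp add: e_def norm_axis_1)
  have [measurable]: "\<tau> \<in> borel_measurable borel" by (intro borel_measurable_continuous_onI c\<tau>)
  have [measurable]: "U \<in> borel_measurable borel" by (rule smooth_measurable[OF U])
  have [measurable]: "dir_deriv e U \<in> borel_measurable borel"
    by (intro smooth_measurable smooth_dir_deriv U)
  have [measurable]: "E \<in> sets borel" "\<Omega> \<in> sets borel" "frontier \<Omega> \<in> sets borel"
    using \<Omega> by (auto simp: E_def)
  define \<pi> where "\<pi> x = x - \<tau> x *\<^sub>R e" for x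
  have [measurable]: "\<pi> \<in> borel_measurable borel" unfolding \<pi>_def by measurable
  \<comment> \<open>The half radius in \<open>E\<close> and \<open>\<epsilon> < r / 2\<close> keep the whole segment inside the chart.\<close>
  have in\<Omega>: "x - \<sigma> *\<^sub>R e \<in> \<Omega>" if "x \<in> E" "0 \<le> \<sigma>" "\<sigma> < \<tau> x" for x \<sigma>
  proof -
    have "dist p (x - \<sigma> *\<^sub>R e) \<le> dist p x + norm (\<sigma> *\<^sub>R e)"
      using norm_triangle_ineq[of "p - x" "\<sigma> *\<^sub>R e"] by (simp add: dist_norm algebra_simps)
    also have "\<dots> < r" using that \<epsilon> ne by (auto simp: E_def)
    finally have "x - \<sigma> *\<^sub>R e \<in> {x \<in> ball p r. \<tau> x > 0}" using \<tau>m[of x \<sigma>] that by simp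
    then show ?thesis unfolding dom[symmetric] by blast
  qed
  have fr: "\<pi> x \<in> frontier \<Omega>" if x: "x \<in> E" for x
  proof -
    have "dist p (\<pi> x) \<le> dist p x + norm (\<tau> x *\<^sub>R e)"
      unfolding \<pi>_def using norm_triangle_ineq[of "p - x" "\<tau> x *\<^sub>R e"] by (simp add: dist_norm algebra_simps)
    also have "\<dots> < r" using x \<epsilon> ne by (auto simp: E_def)
    finally have "\<pi> x \<in> ball p r" by simp
    moreover have "\<pi> x \<notin> {x \<in> ball p r. \<tau> x > 0}" using \<tau>m[of x "\<tau> x"] by (simp add: \<pi>_def)
    ultimately have "\<pi> x \<notin> \<Omega>" unfolding dom[symmetric] by blast
    moreover have "\<pi> x \<in> closure \<Omega>"
      unfolding closure_approachable
    proof (intro allI impI)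
      fix d :: real assume "d > 0"
      have "\<tau> x > 0" using x by (simp add: E_def)
      define m where "m = min (\<tau> x) (d / 2)"
      have m: "0 < m" "m \<le> \<tau> x" "m < d" using \<open>d > 0\<close> \<open>\<tau> x > 0\<close> by (auto simp: m_def min_def)
      have "x - (\<tau> x - m) *\<^sub>R e \<in> \<Omega>" using m by (intro in\<Omega> x) auto
      moreover have "dist (x - (\<tau> x - m) *\<^sub>R e) (\<pi> x) = m"
        using m ne by (simp add: \<pi>_def dist_norm algebra_simps)
      ultimately show "\<exists>y\<in>\<Omega>. dist y (\<pi> x) < d" using m by metis
    qed
    ultimately show ?thesis using \<Omega> by (simp add: frontier_def interior_open)
  qed
  define F where "F y = ennreal ((U y)\<^sup>2)" for y
  have [measurable]: "F \<in> borel_measurable borel" unfolding F_def by measurable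
  have A: "(\<integral>\<^sup>+x\<in>E. F (\<pi> x) \<partial>lborel)
      \<le> ennreal (K * \<epsilon>) * (\<integral>\<^sup>+x\<in>frontier \<Omega>. F x \<partial>surface_measure)"
  proof -
    \<comment> \<open>The push-forward of volume on the strip, and the multiple of surface measure that dominates it.\<close>
    define N where "N = distr (density lborel (indicator E)) borel \<pi>"
    define N' where "N' = scale_measure (ennreal (K * \<epsilon>)) (density surface_measure (indicator (frontier \<Omega>)))"
    have sets: "sets N = sets N'" by (simp add: N_def N'_def)
    have "emeasure N A \<le> emeasure N' A" if A: "A \<in> sets N" for A
    proof -
      have [measurable]: "A \<in> sets borel" using A by (simp add: N_def)
      have [measurable]: "\<pi> -` A \<in> sets borel"
        using measurable_sets[of \<pi> borel borel A] by simp
      have "emeasure N A = emeasure lborel (E \<inter> \<pi> -` A)"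
        by (simp add: N_def emeasure_distr emeasure_density nn_integral_indicator
            indicator_inter_arith[symmetric])
      also have "\<dots> \<le> ennreal (K * \<epsilon>) * hausdorff_outer (real (CARD('n) - 1)) (frontier \<Omega> \<inter> A)"
        unfolding K_def
      proof (rule strip_emeasure_le_hausdorff_outer[OF n \<epsilon>(1) s(1)])
        fix x assume x: "x \<in> E \<inter> \<pi> -` A"
        then have "\<pi> x \<in> frontier \<Omega> \<inter> A" using fr by auto
        moreover have "\<tau> x \<in> {0..\<epsilon>}" using x by (auto simp: E_def)
        moreover have "x = \<pi> x + (\<tau> x * s) *\<^sub>R axis i 1" by (simp add: \<pi>_def e_def)
        ultimately show "\<exists>z\<in>frontier \<Omega> \<inter> A. \<exists>\<sigma>\<in>{0..\<epsilon>}. x = z + (\<sigma> * s) *\<^sub>R axis i 1" by blast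
      qed
      also have "\<dots> = emeasure N' A"
        by (simp add: N'_def emeasure_density indicator_inter_arith[symmetric] emeasure_surface_measure)
      finally show ?thesis .
    qed
    then have "N \<le> N'"
      using sets by (auto simp: le_measure_iff le_fun_def sets_eq_imp_space_eq[OF sets] emeasure_notin_sets)
        (metis emeasure_notin_sets order_refl sets)
    then have "(\<integral>\<^sup>+y. F y \<partial>N) \<le> (\<integral>\<^sup>+y. F y \<partial>N')" by (rule nn_integral_mono_measure[OF sets])
    then show ?thesis
      by (simp add: N_def N'_def nn_integral_distr nn_integral_density nn_integral_scale_measure mult.commute)
  qed
  define G where "G y = ennreal ((dir_deriv e U y)\<^sup>2)" for y
  have [measurable]: "G \<in> borel_measurable borel" unfolding G_def by measurable
  have B: "(\<integral>\<^sup>+x\<in>E. (\<integral>\<^sup>+\<sigma>. indicator {0..\<tau> x} \<sigma> * G (x - \<sigma> *\<^sub>R e) \<partial>lborel) \<partial>lborel)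
      \<le> ennreal \<epsilon> * (\<integral>\<^sup>+y\<in>\<Omega>. G y \<partial>lborel)"
  proof -
    have "(\<integral>\<^sup>+x\<in>E. (\<integral>\<^sup>+\<sigma>. indicator {0..\<tau> x} \<sigma> * G (x - \<sigma> *\<^sub>R e) \<partial>lborel) \<partial>lborel)
        \<le> (\<integral>\<^sup>+x. (\<integral>\<^sup>+\<sigma>. indicator {0..\<epsilon>} \<sigma> * (indicator \<Omega> (x - \<sigma> *\<^sub>R e) * G (x - \<sigma> *\<^sub>R e)) \<partial>lborel) \<partial>lborel)"
    proof (rule nn_integral_mono)
      fix x :: "real^'n"
      have "(\<integral>\<^sup>+\<sigma>. indicator {0..\<tau> x} \<sigma> * G (x - \<sigma> *\<^sub>R e) \<partial>lborel) * indicator E x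
          = (\<integral>\<^sup>+\<sigma>. indicator {0..\<tau> x} \<sigma> * G (x - \<sigma> *\<^sub>R e) * indicator E x \<partial>lborel)"
        by (rule nn_integral_multc[symmetric]) measurable
      also have "\<dots> \<le> (\<integral>\<^sup>+\<sigma>. indicator {0..\<epsilon>} \<sigma> * (indicator \<Omega> (x - \<sigma> *\<^sub>R e) * G (x - \<sigma> *\<^sub>R e)) \<partial>lborel)"
      proof (rule nn_integral_mono_AE)
        \<comment> \<open>The endpoint \<open>\<sigma> = \<tau> x\<close> is the foot point, which is not in \<open>\<Omega>\<close>.\<close>
        have "AE \<sigma> in lborel. \<sigma> \<noteq> \<tau> x" by (rule AE_lborel_singleton)
        then show "AE \<sigma> in lborel. indicator {0..\<tau> x} \<sigma> * G (x - \<sigma> *\<^sub>R e) * indicator E x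
            \<le> indicator {0..\<epsilon>} \<sigma> * (indicator \<Omega> (x - \<sigma> *\<^sub>R e) * G (x - \<sigma> *\<^sub>R e))"
        proof eventually_elim
          case (elim \<sigma>)
          show ?case
          proof (cases "x \<in> E \<and> \<sigma> \<in> {0..\<tau> x}")
            case True
            then have "x - \<sigma> *\<^sub>R e \<in> \<Omega>" "\<sigma> \<in> {0..\<epsilon>}" using elim by (auto intro!: in\<Omega> simp: E_def)
            then show ?thesis using True by simp
          qed (auto split: split_indicator)
        qed
      qed
      finally show "(\<integral>\<^sup>+\<sigma>. indicator {0..\<tau> x} \<sigma> * G (x - \<sigma> *\<^sub>R e) \<partial>lborel) * indicator E x
          \<le> (\<integral>\<^sup>+\<sigma>. indicator {0..\<epsilon>} \<sigma> * (indicator \<Omega> (x - \<sigma> *\<^sub>R e) * G (x - \<sigma> *\<^sub>R e)) \<partial>lborel)" .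
    qed
    also have "\<dots> = (\<integral>\<^sup>+\<sigma>. (\<integral>\<^sup>+x. indicator {0..\<epsilon>} \<sigma> * (indicator \<Omega> (x - \<sigma> *\<^sub>R e) * G (x - \<sigma> *\<^sub>R e)) \<partial>lborel) \<partial>lborel)"
      by (rule lborel_pair.Fubini'[symmetric]) measurable
    also have "\<dots> = (\<integral>\<^sup>+\<sigma>. indicator {0..\<epsilon>} \<sigma> * (\<integral>\<^sup>+y\<in>\<Omega>. G y \<partial>lborel) \<partial>lborel)"
    proof (rule nn_integral_cong)
      fix \<sigma> :: real
      have "(\<integral>\<^sup>+y\<in>\<Omega>. G y \<partial>lborel) = (\<integral>\<^sup>+y. G y * indicator \<Omega> y \<partial>distr lborel borel ((+) (- \<sigma> *\<^sub>R e)))"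
        by (simp only: lborel_distr_plus)
      also have "\<dots> = (\<integral>\<^sup>+x. indicator \<Omega> (x - \<sigma> *\<^sub>R e) * G (x - \<sigma> *\<^sub>R e) \<partial>lborel)"
        by (subst nn_integral_distr) (auto simp: mult.commute)
      finally show "(\<integral>\<^sup>+x. indicator {0..\<epsilon>} \<sigma> * (indicator \<Omega> (x - \<sigma> *\<^sub>R e) * G (x - \<sigma> *\<^sub>R e)) \<partial>lborel)
          = indicator {0..\<epsilon>} \<sigma> * (\<integral>\<^sup>+y\<in>\<Omega>. G y \<partial>lborel)"
        by (simp add: nn_integral_cmult)
    qed
    also have "\<dots> = ennreal \<epsilon> * (\<integral>\<^sup>+y\<in>\<Omega>. G y \<partial>lborel)"
      using \<epsilon> by (simp add: nn_integral_multc)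
    finally show ?thesis .
  qed
  have "(\<integral>\<^sup>+x\<in>E. F x \<partial>lborel) \<le> (\<integral>\<^sup>+x. 2 * (F (\<pi> x) * indicator E x)
      + 2 * ennreal \<epsilon> * ((\<integral>\<^sup>+\<sigma>. indicator {0..\<tau> x} \<sigma> * G (x - \<sigma> *\<^sub>R e) \<partial>lborel) * indicator E x) \<partial>lborel)"
  proof (rule nn_integral_mono)
    fix x
    show "F x * indicator E x \<le> 2 * (F (\<pi> x) * indicator E x)
      + 2 * ennreal \<epsilon> * ((\<integral>\<^sup>+\<sigma>. indicator {0..\<tau> x} \<sigma> * G (x - \<sigma> *\<^sub>R e) \<partial>lborel) * indicator E x)"
    proof (cases "x \<in> E")
      case True
      then have "0 < \<tau> x" "\<tau> x \<le> \<epsilon>" by (auto simp: E_def)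
      have "F x \<le> 2 * F (\<pi> x) + 2 * ennreal (\<tau> x) * (\<integral>\<^sup>+\<sigma>. indicator {0..\<tau> x} \<sigma> * G (x - \<sigma> *\<^sub>R e) \<partial>lborel)"
        unfolding F_def G_def \<pi>_def by (rule square_le_boundary_plus_line_integral[OF U \<open>0 < \<tau> x\<close>])
      also have "\<dots> \<le> 2 * F (\<pi> x) + 2 * ennreal \<epsilon> * (\<integral>\<^sup>+\<sigma>. indicator {0..\<tau> x} \<sigma> * G (x - \<sigma> *\<^sub>R e) \<partial>lborel)"
        using \<open>\<tau> x \<le> \<epsilon>\<close> by (intro add_mono mult_right_mono mult_left_mono ennreal_leI) auto
      finally show ?thesis using True by simp
    qed simp
  qed
  also have "\<dots> = 2 * (\<integral>\<^sup>+x\<in>E. F (\<pi> x) \<partial>lborel)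
      + 2 * ennreal \<epsilon> * (\<integral>\<^sup>+x\<in>E. (\<integral>\<^sup>+\<sigma>. indicator {0..\<tau> x} \<sigma> * G (x - \<sigma> *\<^sub>R e) \<partial>lborel) \<partial>lborel)"
  proof -
    define f1 where "f1 x = F (\<pi> x) * indicator E x" for x
    define f2 where "f2 x = (\<integral>\<^sup>+\<sigma>. indicator {0..\<tau> x} \<sigma> * G (x - \<sigma> *\<^sub>R e) \<partial>lborel) * indicator E x" for x
    have f2_eq: "f2 = (\<lambda>x. (\<integral>\<^sup>+\<sigma>. (if 0 \<le> \<sigma> \<and> \<sigma> \<le> \<tau> x then G (x - \<sigma> *\<^sub>R e) else 0) \<partial>lborel) * indicator E x)"
      unfolding f2_def by (intro ext arg_cong2[where f="(*)"] nn_integral_cong refl) (simp add: indicator_def)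
    have [measurable]: "f1 \<in> borel_measurable lborel" "f2 \<in> borel_measurable lborel"
      unfolding f1_def f2_eq by measurable
    have "(\<integral>\<^sup>+x. 2 * f1 x + 2 * ennreal \<epsilon> * f2 x \<partial>lborel)
        = 2 * (\<integral>\<^sup>+x. f1 x \<partial>lborel) + 2 * ennreal \<epsilon> * (\<integral>\<^sup>+x. f2 x \<partial>lborel)"
      by (simp add: nn_integral_add nn_integral_cmult)
    then show ?thesis by (simp only: f1_def f2_def)
  qed
  also have "\<dots> \<le> 2 * (ennreal (K * \<epsilon>) * (\<integral>\<^sup>+x\<in>frontier \<Omega>. F x \<partial>surface_measure))
      + 2 * ennreal \<epsilon> * (ennreal \<epsilon> * (\<integral>\<^sup>+y\<in>\<Omega>. G y \<partial>lborel))"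
    by (intro add_mono mult_left_mono A B) auto
  also have "2 * ennreal \<epsilon> * (ennreal \<epsilon> * (\<integral>\<^sup>+y\<in>\<Omega>. G y \<partial>lborel))
      = 2 * (ennreal (\<epsilon>\<^sup>2) * (\<integral>\<^sup>+y\<in>\<Omega>. G y \<partial>lborel))"
    using \<epsilon> by (simp add: power2_eq_square ennreal_mult mult.assoc)
  also have "G = (\<lambda>y. ennreal ((dir_deriv (axis i 1) U y)\<^sup>2))"
  proof
    fix y
    have "dir_deriv e U y = s * dir_deriv (axis i 1) U y"
      using linear_cmul[OF has_derivative_linear[OF dir_deriv_has_derivative[OF smooth_differentiable[OF U]]],
          of s "axis i 1" y] by (simp add: e_def)
    then show "G y = ennreal ((dir_deriv (axis i 1) U y)\<^sup>2)"
      using s by (simp add: G_def power_mult_distrib power2_eq_square)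
  qed
  finally show ?thesis unfolding F_def .
qed

section \<open>The boundary strip and cutoff functions\<close>

text \<open>
  Points of \<open>\<Omega>\<close> at distance less than \<open>\<epsilon>\<close> from the complement, written so that the strip is visibly open.
\<close>

definition boundary_strip :: "'a::metric_space set \<Rightarrow> real \<Rightarrow> 'a set" where
  "boundary_strip \<Omega> \<epsilon> = \<Omega> \<inter> (\<Union>y\<in>-\<Omega>. ball y \<epsilon>)"

lemma open_boundary_strip: "open \<Omega> \<Longrightarrow> open (boundary_strip \<Omega> \<epsilon>)"
  unfolding boundary_strip_def by auto

lemma boundary_strip_near_frontier:
  fixes \<Omega> :: "'a::euclidean_space set"
  assumes "x \<in> boundary_strip \<Omega> \<epsilon>"
  obtains z where "z \<in> frontier \<Omega>" "dist x z < \<epsilon>"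
proof -
  obtain y where y: "x \<in> \<Omega>" "y \<notin> \<Omega>" "dist x y < \<epsilon>"
    using assms by (auto simp: boundary_strip_def dist_commute)
  have "closed_segment x y \<inter> frontier \<Omega> \<noteq> {}"
    using y by (intro connected_Int_frontier connected_segment) (auto intro!: exI[of _ x] exI[of _ y])
  then obtain z where z: "z \<in> closed_segment x y" "z \<in> frontier \<Omega>" by blast
  have "dist x z \<le> dist x y"
    using dist_in_closed_segment[OF z(1)] by (simp add: dist_commute)
  then show thesis using that z y by auto
qed

text \<open>
  Finitely many charts cover the compact boundary. A point of the strip is within \<open>\<epsilon>\<close> of a boundary point, so by
  the Lipschitz bound its height in a suitable chart is at most \<open>M \<epsilon>\<close>, and the estimates in the charts add up.
\<close>

lemma boundary_strip_estimate:
  fixes \<Omega> :: "(real^'n) set"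
  assumes n: "CARD('n) \<ge> 2" and \<Omega>: "open \<Omega>" "bounded \<Omega>" and k: "k \<ge> 1" "Ck_boundary k \<Omega>"
  shows "\<exists>K \<epsilon>0. K \<ge> 0 \<and> \<epsilon>0 > 0 \<and> (\<forall>\<epsilon> U. 0 < \<epsilon> \<longrightarrow> \<epsilon> < \<epsilon>0 \<longrightarrow> smooth_fun U \<longrightarrow>
     (\<integral>\<^sup>+x\<in>boundary_strip \<Omega> \<epsilon>. ennreal ((U x)\<^sup>2) \<partial>lborel)
      \<le> ennreal (K * \<epsilon>) * (\<integral>\<^sup>+x\<in>frontier \<Omega>. ennreal ((U x)\<^sup>2) \<partial>surface_measure)
        + ennreal (K * \<epsilon>\<^sup>2) * (\<integral>\<^sup>+x\<in>\<Omega>. ennreal (\<Sum>j\<in>UNIV. (dir_deriv (axis j 1) U x)\<^sup>2) \<partial>lborel))"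
proof -
  have "\<forall>p\<in>frontier \<Omega>. \<exists>r i s \<tau> M. graph_chart \<Omega> p r i s \<tau> M"
    using Ck_boundary_graph_chart[OF k] by blast
  then obtain r i s \<tau> M where chart: "\<And>p. p \<in> frontier \<Omega> \<Longrightarrow> graph_chart \<Omega> p (r p) (i p) (s p) (\<tau> p) (M p)"
    by metis
  then have r: "r p > 0" and M: "M p \<ge> 1" and c\<tau>: "continuous_on UNIV (\<tau> p)"
    and dom: "\<Omega> \<inter> ball p (r p) = {x \<in> ball p (r p). \<tau> p x > 0}"
    and lip: "\<And>x y. x \<in> ball p (r p) \<Longrightarrow> y \<in> ball p (r p) \<Longrightarrow> \<bar>\<tau> p x - \<tau> p y\<bar> \<le> M p * dist x y"
    if "p \<in> frontier \<Omega>" for p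
    using that unfolding graph_chart_def by blast+
  have compact: "compact (frontier \<Omega>)" using \<Omega> by (simp add: compact_frontier_bounded)
  have "\<exists>P. P \<subseteq> frontier \<Omega> \<and> finite P \<and> frontier \<Omega> \<subseteq> (\<Union>p\<in>P. ball p (r p / 4))"
  proof (rule compactE_image[OF compact, of "frontier \<Omega>" "\<lambda>p. ball p (r p / 4)"])
    show "frontier \<Omega> \<subseteq> (\<Union>p\<in>frontier \<Omega>. ball p (r p / 4))" using r by auto
  qed (rule open_ball, blast)
  then obtain P where P: "P \<subseteq> frontier \<Omega>" "finite P" "frontier \<Omega> \<subseteq> (\<Union>p\<in>P. ball p (r p / 4))"
    by (elim exE conjE)
  \<comment> \<open>Below this threshold \<open>M p * \<epsilon> < r p / 4\<close>: a point \<open>\<epsilon>\<close>-close to a boundary point in the quarter ball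
     lies in the half ball, and its height \<open>M p * \<epsilon>\<close> is admissible for the chart. The 1 covers an empty \<open>P\<close>.\<close>
  define \<epsilon>0 where "\<epsilon>0 = Min (insert 1 ((\<lambda>p. r p / (4 * M p)) ` P))"
  have rM: "r p / (4 * M p) > 0" if "p \<in> P" for p using r[of p] M[of p] P that by fastforce
  then have "\<epsilon>0 > 0" using P by (simp add: \<epsilon>0_def)
  define c where "c = 4 ^ CARD('n) / unit_ball_vol (real (CARD('n) - 1))"
  have c: "c > 0" by (simp add: c_def)
  define K where "K = (\<Sum>p\<in>P. 2 * (c + 1) * (M p)\<^sup>2)"
  have "K \<ge> 0" using c by (auto simp: K_def intro!: sum_nonneg)
  have "(\<integral>\<^sup>+x\<in>boundary_strip \<Omega> \<epsilon>. ennreal ((U x)\<^sup>2) \<partial>lborel)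
      \<le> ennreal (K * \<epsilon>) * (\<integral>\<^sup>+x\<in>frontier \<Omega>. ennreal ((U x)\<^sup>2) \<partial>surface_measure)
        + ennreal (K * \<epsilon>\<^sup>2) * (\<integral>\<^sup>+x\<in>\<Omega>. ennreal (\<Sum>j\<in>UNIV. (dir_deriv (axis j 1) U x)\<^sup>2) \<partial>lborel)"
    (is "?L \<le> ennreal (K * \<epsilon>) * ?T + ennreal (K * \<epsilon>\<^sup>2) * ?D")
    if \<epsilon>: "0 < \<epsilon>" "\<epsilon> < \<epsilon>0" and U: "smooth_fun U" for \<epsilon> U
  proof -
    have \<epsilon>p: "M p * \<epsilon> < r p / 4" if p: "p \<in> P" for p
    proof -
      have "\<epsilon>0 \<le> r p / (4 * M p)" unfolding \<epsilon>0_def using P p by (intro Min_le) auto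
      then have "\<epsilon> < r p / (4 * M p)" using \<epsilon> by linarith
      then show ?thesis using M[of p] P p by (auto simp: field_simps)
    qed
    define E where "E p = {x \<in> ball p (r p / 2). 0 < \<tau> p x \<and> \<tau> p x \<le> M p * \<epsilon>}" for p
    have [measurable]: "E p \<in> sets borel" if "p \<in> P" for p
    proof -
      have [measurable]: "\<tau> p \<in> borel_measurable borel"
        using P that by (intro borel_measurable_continuous_onI c\<tau>) auto
      show ?thesis unfolding E_def by measurable
    qed
    have [measurable]: "U \<in> borel_measurable borel" by (rule smooth_measurable[OF U])
    have [measurable]: "dir_deriv e U \<in> borel_measurable borel" for e
      by (intro smooth_measurable smooth_dir_deriv U)
    have [measurable]: "\<Omega> \<in> sets borel" using \<Omega> by auto
    have cover: "\<exists>p\<in>P. x \<in> E p" if x: "x \<in> boundary_strip \<Omega> \<epsilon>" for x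
    proof -
      obtain z where z: "z \<in> frontier \<Omega>" "dist x z < \<epsilon>"
        using boundary_strip_near_frontier[OF x] by blast
      then obtain p where p: "p \<in> P" "dist p z < r p / 4" using P by auto
      then have pf: "p \<in> frontier \<Omega>" using P by auto
      have "\<epsilon> \<le> M p * \<epsilon>" using M[OF pf] \<epsilon> by simp
      then have "\<epsilon> < r p / 4" using \<epsilon>p[OF p(1)] by linarith
      then have d: "dist p x < r p / 2" using z p dist_triangle[of p x z] by (simp add: dist_commute)
      then have xb: "x \<in> ball p (r p)" and zb: "z \<in> ball p (r p)" using r[OF pf] p(2) by auto
      have "z \<notin> \<Omega>" using z(1) \<Omega> by (simp add: frontier_def interior_open)
      then have "\<tau> p z \<le> 0" using dom[OF pf] zb by (metis (no_types, lifting) IntE mem_Collect_eq not_le)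
      moreover have "x \<in> {x \<in> ball p (r p). \<tau> p x > 0}"
        using x xb unfolding dom[OF pf, symmetric] by (simp add: boundary_strip_def)
      moreover have "\<bar>\<tau> p x - \<tau> p z\<bar> \<le> M p * \<epsilon>"
        using lip[OF pf xb zb] mult_left_mono[of "dist x z" \<epsilon> "M p"] z M[OF pf] by linarith
      ultimately have "x \<in> E p" using d by (auto simp: E_def)
      then show ?thesis using p by blast
    qed
    have "?L \<le> (\<integral>\<^sup>+x. (\<Sum>p\<in>P. ennreal ((U x)\<^sup>2) * indicator (E p) x) \<partial>lborel)"
    proof (rule nn_integral_mono)
      fix x
      show "ennreal ((U x)\<^sup>2) * indicator (boundary_strip \<Omega> \<epsilon>) x \<le> (\<Sum>p\<in>P. ennreal ((U x)\<^sup>2) * indicator (E p) x)"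
      proof (cases "x \<in> boundary_strip \<Omega> \<epsilon>")
        case True
        then obtain p where p: "p \<in> P" "x \<in> E p" using cover by blast
        then have "ennreal ((U x)\<^sup>2) = ennreal ((U x)\<^sup>2) * indicator (E p) x" by simp
        also have "\<dots> \<le> (\<Sum>p\<in>P. ennreal ((U x)\<^sup>2) * indicator (E p) x)"
          using P p by (intro member_le_sum) auto
        finally show ?thesis using True by simp
      qed simp
    qed
    also have "\<dots> = (\<Sum>p\<in>P. \<integral>\<^sup>+x\<in>E p. ennreal ((U x)\<^sup>2) \<partial>lborel)"
      by (rule nn_integral_sum) measurable
    also have "\<dots> \<le> (\<Sum>p\<in>P. ennreal (2 * (c + 1) * (M p)\<^sup>2 * \<epsilon>) * ?T + ennreal (2 * (c + 1) * (M p)\<^sup>2 * \<epsilon>\<^sup>2) * ?D)"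
    proof (rule sum_mono)
      fix p assume p: "p \<in> P"
      then have pf: "p \<in> frontier \<Omega>" using P by auto
      have Mp: "M p \<ge> 1" "M p > 0" using M[OF pf] by auto
      have "(\<integral>\<^sup>+x\<in>E p. ennreal ((U x)\<^sup>2) \<partial>lborel) \<le> 2 * (ennreal (c * (M p * \<epsilon>)) * ?T)
          + 2 * (ennreal ((M p * \<epsilon>)\<^sup>2) * (\<integral>\<^sup>+x\<in>\<Omega>. ennreal ((dir_deriv (axis (i p) 1) U x)\<^sup>2) \<partial>lborel))"
        unfolding E_def c_def
      proof (rule strip_in_chart_estimate[OF n \<Omega>(1) chart[OF pf] _ _ U])
        show "0 < M p * \<epsilon>" using Mp \<epsilon> by simp
        show "M p * \<epsilon> < r p / 2" using \<epsilon>p[OF p] r[OF pf] by linarith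
      qed
      also have "\<dots> \<le> 2 * (ennreal (c * (M p * \<epsilon>)) * ?T) + 2 * (ennreal ((M p * \<epsilon>)\<^sup>2) * ?D)"
        by (intro add_mono mult_left_mono order_refl nn_integral_mono mult_right_mono ennreal_leI)
          (auto intro!: member_le_sum)
      also have "\<dots> = ennreal (2 * (c * (M p * \<epsilon>))) * ?T + ennreal (2 * (M p * \<epsilon>)\<^sup>2) * ?D"
        using c Mp \<epsilon> by (simp add: ennreal_mult mult.assoc)
      also have "\<dots> \<le> ennreal (2 * (c + 1) * (M p)\<^sup>2 * \<epsilon>) * ?T + ennreal (2 * (c + 1) * (M p)\<^sup>2 * \<epsilon>\<^sup>2) * ?D"
      proof (intro add_mono mult_right_mono ennreal_leI)
        have "c * M p \<le> (c + 1) * (M p * M p)"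
          using Mp c by (intro mult_mono) auto
        then have "c * M p * \<epsilon> \<le> (c + 1) * (M p * M p) * \<epsilon>" using \<epsilon> by (intro mult_right_mono) auto
        then show "2 * (c * (M p * \<epsilon>)) \<le> 2 * (c + 1) * (M p)\<^sup>2 * \<epsilon>"
          by (simp add: power2_eq_square algebra_simps)
        have "1 * ((M p)\<^sup>2 * \<epsilon>\<^sup>2) \<le> (c + 1) * ((M p)\<^sup>2 * \<epsilon>\<^sup>2)"
          using c by (intro mult_right_mono) auto
        then show "2 * (M p * \<epsilon>)\<^sup>2 \<le> 2 * (c + 1) * (M p)\<^sup>2 * \<epsilon>\<^sup>2"
          by (simp add: power_mult_distrib algebra_simps)
      qed auto
      finally show "(\<integral>\<^sup>+x\<in>E p. ennreal ((U x)\<^sup>2) \<partial>lborel)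
        \<le> ennreal (2 * (c + 1) * (M p)\<^sup>2 * \<epsilon>) * ?T + ennreal (2 * (c + 1) * (M p)\<^sup>2 * \<epsilon>\<^sup>2) * ?D" .
    qed
    also have "\<dots> = (\<Sum>p\<in>P. ennreal (2 * (c + 1) * (M p)\<^sup>2 * \<epsilon>)) * ?T
        + (\<Sum>p\<in>P. ennreal (2 * (c + 1) * (M p)\<^sup>2 * \<epsilon>\<^sup>2)) * ?D"
      by (simp add: sum.distrib sum_distrib_right)
    also have "(\<Sum>p\<in>P. ennreal (2 * (c + 1) * (M p)\<^sup>2 * \<epsilon>)) = ennreal (K * \<epsilon>)"
      unfolding K_def sum_distrib_right using c \<epsilon> by (intro sum_ennreal) auto
    also have "(\<Sum>p\<in>P. ennreal (2 * (c + 1) * (M p)\<^sup>2 * \<epsilon>\<^sup>2)) = ennreal (K * \<epsilon>\<^sup>2)"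
      unfolding K_def sum_distrib_right using c \<epsilon> by (intro sum_ennreal) auto
    finally show ?thesis .
  qed
  then show ?thesis using \<open>K \<ge> 0\<close> \<open>\<epsilon>0 > 0\<close> by blast
qed

lemma test_funs_zero: "(\<lambda>x. 0) \<in> test_funs U"
  by (rule test_funsI[of _ "{}"]) (auto intro: smooth_intros)

lemma test_funs_add:
  assumes "\<phi> \<in> test_funs U" "\<psi> \<in> test_funs U"
  shows "(\<lambda>x. \<phi> x + \<psi> x) \<in> test_funs U"
proof -
  obtain K where K: "smooth_fun \<phi>" "compact K" "K \<subseteq> U" "\<And>x. x \<notin> K \<Longrightarrow> \<phi> x = 0"
    using assms(1) by (elim test_funsE) blast
  obtain L where L: "smooth_fun \<psi>" "compact L" "L \<subseteq> U" "\<And>x. x \<notin> L \<Longrightarrow> \<psi> x = 0"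
    using assms(2) by (elim test_funsE) blast
  show ?thesis
    by (rule test_funsI[of _ "K \<union> L"]) (use K L in \<open>auto intro: smooth_intros\<close>)
qed

lemma test_funs_sum:
  assumes "\<And>i. i \<in> I \<Longrightarrow> \<phi> i \<in> test_funs U"
  shows "(\<lambda>x. \<Sum>i\<in>I. \<phi> i x) \<in> test_funs U"
  using assms by (induction I rule: infinite_finite_induct) (auto intro: test_funs_zero test_funs_add)

text \<open>
  A smooth bump supported in \<open>[-1,1]\<close> whose integer translates telescope to a partition of unity.
\<close>

definition hat :: "real \<Rightarrow> real" where
  "hat z = smooth_step (z + 1) - smooth_step z"

lemma hat_smooth: "smooth_fun hat"
  unfolding hat_def[abs_def]
  using smooth_diff[OF smooth_intros(4)[OF smooth_step_smooth, of 1 1] smooth_step_smooth]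
  by (simp add: add.commute)

lemma hat_bound: "\<bar>hat z\<bar> \<le> 1"
  using smooth_step_bounds[of z] smooth_step_bounds[of "z + 1"] unfolding hat_def by linarith

lemma hat_outside: "z \<notin> {-1..1} \<Longrightarrow> hat z = 0"
  unfolding hat_def using smooth_step_0[of z] smooth_step_0[of "z + 1"] smooth_step_1[of z] smooth_step_1[of "z + 1"]
  by force

lemma hat_test_fun: "hat \<in> test_funs UNIV"
  by (rule test_funsI[of _ "{-1..1}"]) (auto simp: hat_smooth hat_outside)

lemma sum_hat_shifts:
  assumes "real N \<ge> \<bar>z\<bar>"
  shows "(\<Sum>j\<le>2 * N. hat (z + real N - real j)) = 1"
proof -
  have "(\<Sum>j\<le>2 * N. hat (z + real N - real j))
      = (\<Sum>j\<le>2 * N. smooth_step (z + real N + 1 - real j) - smooth_step (z + real N + 1 - real (Suc j)))"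
    by (rule sum.cong) (simp_all add: hat_def algebra_simps)
  also have "\<dots> = smooth_step (z + real N + 1 - real 0) - smooth_step (z + real N + 1 - real (Suc (2 * N)))"
    by (rule sum_telescope)
  also have "\<dots> = 1"
    using assms by (simp add: smooth_step_1 smooth_step_0)
  finally show ?thesis .
qed

text \<open>
  At most three integers have distance at most 1 from \<open>z\<close>.
\<close>

lemma sum_shifts_bound:
  assumes g: "\<And>z. \<bar>g z\<bar> \<le> c" "\<And>z. z \<notin> {-1..1} \<Longrightarrow> g z = (0::real)" and J: "finite (J :: nat set)"
  shows "(\<Sum>j\<in>J. \<bar>g (z - real j)\<bar>) \<le> 3 * c"
proof -
  have c: "c \<ge> 0" using g(1)[of 0] by linarith
  define I where "I = {j \<in> J. \<bar>z - real j\<bar> \<le> 1}"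
  have fI: "finite I" using J by (simp add: I_def)
  have "(\<Sum>j\<in>J. \<bar>g (z - real j)\<bar>) = (\<Sum>j\<in>I. \<bar>g (z - real j)\<bar>)"
  proof (rule sum.mono_neutral_right[OF J], unfold I_def, blast, intro ballI)
    fix j assume "j \<in> J - {j \<in> J. \<bar>z - real j\<bar> \<le> 1}"
    then have "z - real j \<notin> {-1..1}" by (auto simp: abs_le_iff)
    then show "\<bar>g (z - real j)\<bar> = 0" by (simp add: g(2))
  qed
  also have "\<dots> \<le> real (card I) * c"
    using sum_bounded_above[of I "\<lambda>j. \<bar>g (z - real j)\<bar>" c] g(1) by simp
  also have "card I \<le> 3"
  proof (cases "I = {}")
    case False
    have "I \<subseteq> {Min I..Min I + 2}"
    proof
      fix j assume j: "j \<in> I"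
      have "Min I \<in> I" using fI False by simp
      then have "real j \<le> real (Min I) + 2" using j unfolding I_def by (simp add: abs_le_iff)
      then show "j \<in> {Min I..Min I + 2}" using fI j by simp
    qed
    then have "card I \<le> card {Min I..Min I + 2}" by (intro card_mono) auto
    then show ?thesis by simp
  qed simp
  then have "real (card I) * c \<le> 3 * c" using c by (intro mult_right_mono) auto
  finally show ?thesis .
qed

lemma norm_le_card_bound:
  fixes x :: "real^'n"
  assumes "\<And>i. \<bar>x $ i\<bar> \<le> r"
  shows "norm x \<le> real CARD('n) * r"
proof -
  have "norm x \<le> (\<Sum>i\<in>UNIV. \<bar>x $ i\<bar>)" by (rule norm_le_l1_cart)
  also have "\<dots> \<le> (\<Sum>i\<in>(UNIV::'n set). r)" by (rule sum_mono) (rule assms)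
  finally show ?thesis by simp
qed

text \<open>
  Tensor products of bumps on the lattice of mesh \<open>h = \<delta>/(8n)\<close> form a partition of unity. Keeping the bumps whose
  cell lies inside \<open>\<Omega>\<close> gives a test function on \<open>\<Omega>\<close>. Each point meets at most \<open>3^n\<close> bumps, so the
  bounds do not depend on the domain; a derivative costs a factor \<open>1/h\<close>, that is \<open>1/\<delta>\<close>. At a point at distance
  at least \<open>\<delta>/2\<close> from the complement every bump that is nonzero there is kept, because a cell has diameter at
  most \<open>n 2h = \<delta>/4\<close>.
\<close>

lemma smooth_cutoff:
  obtains C :: real where "C \<ge> 0"
    "\<And>(\<Omega> :: (real^'n) set) \<delta>. open \<Omega> \<Longrightarrow> bounded \<Omega> \<Longrightarrow> \<delta> > 0 \<Longrightarrow> \<exists>\<psi>\<in>test_funs \<Omega>.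
       (\<forall>x. \<bar>\<psi> x\<bar> \<le> C) \<and> (\<forall>x i. \<bar>dir_deriv (axis i 1) \<psi> x\<bar> \<le> C / \<delta>) \<and>
       (\<forall>x\<in>\<Omega> - boundary_strip \<Omega> \<delta>. \<psi> x = 1 \<and> (\<forall>i. dir_deriv (axis i 1) \<psi> x = 0))"
proof -
  obtain c0 where c0: "\<And>z. \<bar>dir_deriv 1 hat z\<bar> \<le> c0"
    using test_funs_bounded[OF test_funs_dir_deriv[OF hat_test_fun, of 1]] by metis
  define c where "c = max 1 c0"
  have c: "c \<ge> 1" "\<And>z. \<bar>dir_deriv 1 hat z\<bar> \<le> c" "\<And>z. \<bar>hat z\<bar> \<le> c"
    using c0 hat_bound by (auto simp: c_def le_max_iff_disj)
  have hat'0: "dir_deriv 1 hat z = 0" if "z \<notin> {-1..1}" for z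
    by (rule dir_deriv_eq_0_outside[of "{-1..1}"]) (use that hat_outside in auto)
  define n where "n = real CARD('n)"
  have n: "n > 0" by (simp add: n_def)
  \<comment> \<open>The first entry bounds \<open>\<psi>\<close>; the second is the bound of its derivatives, with \<open>1/h = 8n/\<delta>\<close>.\<close>
  define C where "C = max ((3 * c) ^ CARD('n)) (8 * n * (3 * c) ^ CARD('n))"
  have "C \<ge> 0" using c by (auto simp: C_def le_max_iff_disj)
  moreover have "\<exists>\<psi>\<in>test_funs \<Omega>.
       (\<forall>x. \<bar>\<psi> x\<bar> \<le> C) \<and> (\<forall>x i. \<bar>dir_deriv (axis i 1) \<psi> x\<bar> \<le> C / \<delta>) \<and>
       (\<forall>x\<in>\<Omega> - boundary_strip \<Omega> \<delta>. \<psi> x = 1 \<and> (\<forall>i. dir_deriv (axis i 1) \<psi> x = 0))"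
    if \<Omega>: "open \<Omega>" "bounded \<Omega>" and \<delta>: "\<delta> > 0" for \<Omega> :: "(real^'n) set" and \<delta>
  proof -
    define h where "h = \<delta> / (8 * n)"
    have h: "h > 0" using \<delta> n by (simp add: h_def)
    obtain R where R: "\<And>x. x \<in> \<Omega> \<Longrightarrow> norm x \<le> R" using \<Omega>(2) by (auto simp: bounded_iff)
    \<comment> \<open>Shifting by \<open>N\<close> makes the relevant lattice indices the natural numbers \<open>0, ..., 2N\<close>.\<close>
    obtain N where N: "R / h \<le> real N" using real_arch_simple by blast
    define z where "z k x i = x $ i / h + real N - real (k i)" for k :: "'n \<Rightarrow> nat" and x :: "real^'n" and i
    define \<beta> where "\<beta> k x = (\<Prod>i\<in>UNIV. hat (z k x i))" for k x
    define All where "All = (UNIV :: 'n set) \<rightarrow>\<^sub>E {..2 * N}"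
    have fAll: "finite All" by (auto simp: All_def intro: finite_PiE)
    define Cell where "Cell k = cbox (\<chi> i. h * (real (k i) - real N - 1)) (\<chi> i. h * (real (k i) - real N + 1))" for k :: "'n \<Rightarrow> nat"
    have z_Cell: "x \<in> Cell k \<longleftrightarrow> (\<forall>i. z k x i \<in> {-1..1})" for x k
      using h by (auto simp: Cell_def z_def mem_box_cart field_simps)
    have \<beta>0: "\<beta> k x = 0" if "x \<notin> Cell k" for x k
    proof -
      from that obtain i where "z k x i \<notin> {-1..1}" using z_Cell by blast
      then have "hat (z k x i) = 0" by (rule hat_outside)
      then show ?thesis unfolding \<beta>_def by (intro prod_zero) auto
    qed
    have z_affine: "z k x i = (real N - real (k i)) + ((1 / h) *\<^sub>R axis i 1) \<bullet> x" for k x i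
      by (simp add: z_def inner_axis' )
    have \<beta>_smooth: "smooth_fun (\<beta> k)" for k
      unfolding \<beta>_def[abs_def] z_affine by (intro smooth_intros hat_smooth)
    have \<beta>_deriv: "dir_deriv (axis j 1) (\<beta> k) x = (1 / h) * (\<Prod>i\<in>UNIV. (if i = j then dir_deriv 1 hat else hat) (z k x i))" for k j x
    proof -
      have D: "((\<lambda>x. hat (z k x i)) has_derivative (\<lambda>e. (e $ i / h) * dir_deriv 1 hat (z k x i))) (at x)" for i
      proof -
        have H: "(hat has_derivative (\<lambda>e. dir_deriv e hat (z k x i))) (at (z k x i))"
          by (intro dir_deriv_has_derivative smooth_differentiable hat_smooth)
        have lin: "dir_deriv r hat (z k x i) = r * dir_deriv 1 hat (z k x i)" for r
          using linear_cmul[OF has_derivative_linear[OF H], of r 1] by simp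
        have "((\<lambda>x. a + l \<bullet> x) has_derivative (\<lambda>e. l \<bullet> e)) (at x)" for a and l :: "real^'n"
          by (auto intro!: derivative_eq_intros)
        then have "((\<lambda>x. z k x i) has_derivative (\<lambda>e. ((1 / h) *\<^sub>R axis i 1) \<bullet> e)) (at x)"
          unfolding z_affine .
        from has_derivative_compose[OF this H]
        have "((\<lambda>x. hat (z k x i)) has_derivative (\<lambda>e. dir_deriv (((1 / h) *\<^sub>R axis i 1) \<bullet> e) hat (z k x i))) (at x)" .
        moreover have "dir_deriv (((1 / h) *\<^sub>R axis i 1) \<bullet> e) hat (z k x i) = (e $ i / h) * dir_deriv 1 hat (z k x i)" for e :: "real^'n"
          by (subst lin) (simp add: inner_axis')
        ultimately show ?thesis by (simp only:)
      qed
      have "dir_deriv (axis j 1) (\<beta> k) x = (\<Sum>i\<in>UNIV. ((axis j 1 :: real^'n) $ i / h) * dir_deriv 1 hat (z k x i)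
          * (\<Prod>l\<in>UNIV - {i}. hat (z k x l)))"
        unfolding \<beta>_def[abs_def] by (rule dir_deriv_eqI) (rule has_derivative_prod[OF D])
      also have "\<dots> = (\<Sum>i\<in>UNIV. if i = j then (1 / h) * dir_deriv 1 hat (z k x i) * (\<Prod>l\<in>UNIV - {i}. hat (z k x l)) else 0)"
        by (rule sum.cong) (auto simp: axis_def)
      also have "\<dots> = (1 / h) * (dir_deriv 1 hat (z k x j) * (\<Prod>l\<in>UNIV - {j}. hat (z k x l)))"
        by simp
      also have "dir_deriv 1 hat (z k x j) * (\<Prod>l\<in>UNIV - {j}. hat (z k x l))
          = (\<Prod>i\<in>UNIV. (if i = j then dir_deriv 1 hat else hat) (z k x i))"
        by (subst prod.remove[of _ j]) (auto intro!: prod.cong)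
      finally show ?thesis .
    qed
    have bound: "(\<Sum>k\<in>K. \<bar>\<Prod>i\<in>UNIV. G i (z k x i)\<bar>) \<le> (3 * c) ^ CARD('n)"
      if K: "K \<subseteq> All" and G: "\<And>i. G i = hat \<or> G i = dir_deriv 1 hat" for K G x
    proof -
      have "(\<Sum>k\<in>K. \<bar>\<Prod>i\<in>UNIV. G i (z k x i)\<bar>) \<le> (\<Sum>k\<in>All. \<bar>\<Prod>i\<in>UNIV. G i (z k x i)\<bar>)"
        using K fAll by (intro sum_mono2) auto
      also have "\<dots> = (\<Sum>k\<in>All. \<Prod>i\<in>UNIV. \<bar>G i (x $ i / h + real N - real (k i))\<bar>)"
        by (simp add: abs_prod z_def)
      also have "\<dots> = (\<Prod>i\<in>UNIV. \<Sum>j\<in>{..2 * N}. \<bar>G i (x $ i / h + real N - real j)\<bar>)"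
        unfolding All_def by (rule prod_sum_PiE[symmetric]) auto
      also have "\<dots> \<le> (\<Prod>i\<in>(UNIV::'n set). 3 * c)"
      proof (rule prod_mono, intro conjI)
        fix i
        show "(\<Sum>j\<in>{..2 * N}. \<bar>G i (x $ i / h + real N - real j)\<bar>) \<le> 3 * c"
        proof (rule sum_shifts_bound)
          show "\<bar>G i z\<bar> \<le> c" for z using G[of i] c by metis
          show "G i z = 0" if "z \<notin> {-1..1}" for z
            using G[of i] hat_outside[OF that] hat'0[OF that] by metis
        qed simp
      qed (auto intro: sum_nonneg)
      finally show ?thesis by simp
    qed
    define K where "K = {k \<in> All. Cell k \<subseteq> \<Omega>}"
    have K: "K \<subseteq> All" "finite K" using fAll by (auto simp: K_def)
    define \<psi> where "\<psi> x = (\<Sum>k\<in>K. \<beta> k x)" for x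
    have \<psi>_test: "\<psi> \<in> test_funs \<Omega>"
      unfolding \<psi>_def[abs_def]
    proof (rule test_funs_sum)
      fix k assume "k \<in> K"
      then show "\<beta> k \<in> test_funs \<Omega>"
        by (intro test_funsI[of _ "Cell k"] \<beta>_smooth) (auto simp: K_def Cell_def[abs_def] intro: \<beta>0[unfolded Cell_def])
    qed
    have \<psi>_bound: "\<bar>\<psi> x\<bar> \<le> C" for x
    proof -
      have "\<bar>\<psi> x\<bar> \<le> (\<Sum>k\<in>K. \<bar>\<beta> k x\<bar>)" unfolding \<psi>_def by (rule sum_abs)
      also have "\<dots> \<le> (3 * c) ^ CARD('n)" unfolding \<beta>_def by (rule bound[OF K(1)]) simp
      finally show ?thesis by (simp add: C_def)
    qed
    have \<psi>_deriv: "dir_deriv (axis j 1) \<psi> x = (\<Sum>k\<in>K. dir_deriv (axis j 1) (\<beta> k) x)" for j x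
      unfolding \<psi>_def[abs_def]
      by (rule dir_deriv_eqI) (intro has_derivative_sum dir_deriv_has_derivative smooth_differentiable \<beta>_smooth)
    have \<psi>'_bound: "\<bar>dir_deriv (axis j 1) \<psi> x\<bar> \<le> C / \<delta>" for j x
    proof -
      have "\<bar>dir_deriv (axis j 1) \<psi> x\<bar> \<le> (\<Sum>k\<in>K. \<bar>dir_deriv (axis j 1) (\<beta> k) x\<bar>)"
        unfolding \<psi>_deriv by (rule sum_abs)
      also have "\<dots> = (1 / h) * (\<Sum>k\<in>K. \<bar>\<Prod>i\<in>UNIV. (if i = j then dir_deriv 1 hat else hat) (z k x i)\<bar>)"
        unfolding \<beta>_deriv using h by (simp add: abs_mult sum_divide_distrib)
      also have "\<dots> \<le> (1 / h) * (3 * c) ^ CARD('n)"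
        using h by (intro mult_left_mono bound[OF K(1)]) auto
      also have "\<dots> = (8 * n * (3 * c) ^ CARD('n)) / \<delta>" using n \<delta> by (simp add: h_def)
      also have "\<dots> \<le> C / \<delta>" using \<delta> by (intro divide_right_mono) (auto simp: C_def)
      finally show ?thesis .
    qed
    \<comment> \<open>Stated at distance \<open>\<delta> / 2\<close>, so that around a point at distance \<open>\<delta>\<close> it holds on a ball and the derivatives vanish too.\<close>
    have one: "\<psi> y = 1" if y: "ball y (\<delta> / 2) \<subseteq> \<Omega>" for y
    proof -
      have "y \<in> \<Omega>" using y \<delta> by auto
      have "\<psi> y = (\<Sum>k\<in>All. \<beta> k y)"
        unfolding \<psi>_def
      proof (rule sum.mono_neutral_left[OF fAll K(1)], intro ballI)
        fix k assume k: "k \<in> All - K"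
        show "\<beta> k y = 0"
        proof (rule \<beta>0, rule notI)
          assume yc: "y \<in> Cell k"
          have "Cell k \<subseteq> \<Omega>"
          proof
            fix w assume w: "w \<in> Cell k"
            have "\<bar>(w - y) $ i\<bar> \<le> 2 * h" for i
            proof -
              have "h * (real (k i) - real N - 1) \<le> w $ i" "w $ i \<le> h * (real (k i) - real N + 1)"
                "h * (real (k i) - real N - 1) \<le> y $ i" "y $ i \<le> h * (real (k i) - real N + 1)"
                using w yc by (auto simp: Cell_def mem_box_cart)
              then show ?thesis by (simp add: algebra_simps abs_le_iff)
            qed
            then have "norm (w - y) \<le> real CARD('n) * (2 * h)" by (rule norm_le_card_bound)
            also have "\<dots> = \<delta> / 4" using n by (simp add: h_def n_def)
            finally have "w \<in> ball y (\<delta> / 2)" using \<delta> by (simp add: dist_norm norm_minus_commute)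
            then show "w \<in> \<Omega>" using y by blast
          qed
          then show False using k by (simp add: K_def)
        qed
      qed
      also have "\<dots> = (\<Prod>i\<in>UNIV. \<Sum>j\<in>{..2 * N}. hat (y $ i / h + real N - real j))"
        unfolding All_def \<beta>_def z_def by (rule prod_sum_PiE[symmetric]) auto
      also have "\<dots> = (\<Prod>i\<in>(UNIV::'n set). 1)"
      proof (rule prod.cong[OF refl], rule sum_hat_shifts)
        fix i
        have "\<bar>y $ i\<bar> \<le> R" using component_le_norm_cart[of y i] R[OF \<open>y \<in> \<Omega>\<close>] by linarith
        then have "\<bar>y $ i\<bar> / h \<le> R / h" using h by (intro divide_right_mono) auto
        then show "\<bar>y $ i / h\<bar> \<le> real N" using N h by (simp add: abs_divide)
      qed
      finally show ?thesis by simp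
    qed
    have inside: "ball x \<delta> \<subseteq> \<Omega>" if x: "x \<in> \<Omega> - boundary_strip \<Omega> \<delta>" for x
    proof
      fix y assume "y \<in> ball x \<delta>"
      then have "x \<in> ball y \<delta>" by (simp add: dist_commute)
      then show "y \<in> \<Omega>" using x unfolding boundary_strip_def by blast
    qed
    have "\<psi> x = 1 \<and> (\<forall>i. dir_deriv (axis i 1) \<psi> x = 0)" if x: "x \<in> \<Omega> - boundary_strip \<Omega> \<delta>" for x
    proof -
      have near: "\<psi> y = 1" if "y \<in> ball x (\<delta> / 2)" for y
      proof (rule one)
        have "ball y (\<delta> / 2) \<subseteq> ball x \<delta>"
        proof
          fix w assume "w \<in> ball y (\<delta> / 2)"
          then show "w \<in> ball x \<delta>" using that dist_triangle[of x w y] by (simp add: dist_commute)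
        qed
        then show "ball y (\<delta> / 2) \<subseteq> \<Omega>" using inside[OF x] by blast
      qed
      have "((\<lambda>y. 1) has_derivative (\<lambda>_. 0)) (at x)" by simp
      then have "(\<psi> has_derivative (\<lambda>_. 0)) (at x)"
        by (rule has_derivative_transform_within_open[of _ _ _ _ "ball x (\<delta> / 2)"]) (use near \<delta> in auto)
      then show ?thesis using near[of x] \<delta> by (auto intro: dir_deriv_eqI)
    qed
    then show ?thesis using \<psi>_test \<psi>_bound \<psi>'_bound by blast
  qed
  ultimately show thesis by (rule that)
qed

section \<open>Square integrable functions and weak derivatives\<close>

text \<open>
  Real functions on the whole measure space. A function on a domain is represented by its extension by zero,
  \<open>indicator \<Omega> x * u x\<close>, so that norms, pairings and Fubini's theorem need no reference to the domain.
\<close>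

definition sqint :: "'a measure \<Rightarrow> ('a \<Rightarrow> real) \<Rightarrow> bool" where
  "sqint M f \<longleftrightarrow> f \<in> borel_measurable M \<and> integrable M (\<lambda>x. (f x)\<^sup>2)"

definition l2n :: "'a measure \<Rightarrow> ('a \<Rightarrow> real) \<Rightarrow> real" where
  "l2n M f = sqrt (\<integral>x. (f x)\<^sup>2 \<partial>M)"

lemma sqint_measurable [measurable_dest]: "sqint M f \<Longrightarrow> f \<in> borel_measurable M"
  by (simp add: sqint_def)

lemma sqintI: "f \<in> borel_measurable M \<Longrightarrow> integrable M (\<lambda>x. (f x)\<^sup>2) \<Longrightarrow> sqint M f"
  by (simp add: sqint_def)

lemma l2n_nonneg [simp]: "0 \<le> l2n M f"
  by (simp add: l2n_def)

lemma l2n_sq: "(l2n M f)\<^sup>2 = (\<integral>x. (f x)\<^sup>2 \<partial>M)"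
  by (simp add: l2n_def)

lemma sqint_mult_integrable:
  assumes "sqint M f" "sqint M g"
  shows "integrable M (\<lambda>x. f x * g x)"
proof (rule Bochner_Integration.integrable_bound)
  show "integrable M (\<lambda>x. (f x)\<^sup>2 + (g x)\<^sup>2)" using assms by (simp add: sqint_def)
  show "(\<lambda>x. f x * g x) \<in> borel_measurable M"
    using assms by (intro borel_measurable_times sqint_measurable)
  show "AE x in M. norm (f x * g x) \<le> norm ((f x)\<^sup>2 + (g x)\<^sup>2)"
  proof (rule AE_I2)
    fix x
    have "2 * (\<bar>f x\<bar> * \<bar>g x\<bar>) \<le> (f x)\<^sup>2 + (g x)\<^sup>2" using sum_squares_bound[of "\<bar>f x\<bar>" "\<bar>g x\<bar>"] by (simp add: mult.assoc)
    moreover have "0 \<le> \<bar>f x\<bar> * \<bar>g x\<bar>" by simp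
    moreover have "norm (f x * g x) = \<bar>f x\<bar> * \<bar>g x\<bar>" "norm ((f x)\<^sup>2 + (g x)\<^sup>2) = (f x)\<^sup>2 + (g x)\<^sup>2"
      by (simp_all add: abs_mult)
    ultimately show "norm (f x * g x) \<le> norm ((f x)\<^sup>2 + (g x)\<^sup>2)" by linarith
  qed
qed

lemma sqint_add:
  assumes "sqint M f" "sqint M g"
  shows "sqint M (\<lambda>x. f x + g x)"
proof (rule sqintI)
  have "integrable M (\<lambda>x. (f x)\<^sup>2 + (2 * (f x * g x) + (g x)\<^sup>2))"
    using assms sqint_mult_integrable[OF assms] by (intro Bochner_Integration.integrable_add integrable_mult_right) (auto simp: sqint_def)
  then show "integrable M (\<lambda>x. (f x + g x)\<^sup>2)" by (simp add: power2_sum algebra_simps)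
qed (use assms in \<open>intro borel_measurable_add sqint_measurable\<close>)

lemma sqint_cmult: "sqint M f \<Longrightarrow> sqint M (\<lambda>x. c * f x)"
  by (auto simp: sqint_def power_mult_distrib intro: borel_measurable_times)

lemma sqint_diff: "sqint M f \<Longrightarrow> sqint M g \<Longrightarrow> sqint M (\<lambda>x. f x - g x)"
  using sqint_add[of M f "\<lambda>x. (-1) * g x"] sqint_cmult[of M g "-1"] by simp

lemma sqint_zero: "sqint M (\<lambda>x. 0)"
  by (simp add: sqint_def)

lemma sqint_sum: "(\<And>i. i \<in> I \<Longrightarrow> sqint M (f i)) \<Longrightarrow> sqint M (\<lambda>x. \<Sum>i\<in>I. f i x)"
  by (induction I rule: infinite_finite_induct) (auto intro: sqint_add sqint_zero)

lemma sqint_dominated: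
  assumes "sqint M g" "f \<in> borel_measurable M" "\<And>x. \<bar>f x\<bar> \<le> \<bar>g x\<bar>"
  shows "sqint M f" "l2n M f \<le> l2n M g"
proof -
  have le: "(f x)\<^sup>2 \<le> (g x)\<^sup>2" for x using assms(3)[of x] by (simp add: abs_le_square_iff)
  show "sqint M f"
  proof (rule sqintI[OF assms(2)])
    show "integrable M (\<lambda>x. (f x)\<^sup>2)"
      by (rule Bochner_Integration.integrable_bound[of M "\<lambda>x. (g x)\<^sup>2"])
        (use assms le in \<open>auto simp: sqint_def\<close>)
  qed
  then show "l2n M f \<le> l2n M g"
    using assms le unfolding l2n_def sqint_def by (intro real_sqrt_le_mono integral_mono) auto
qed

lemma l2n_cmult: "l2n M (\<lambda>x. c * f x) = \<bar>c\<bar> * l2n M f"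
  by (simp add: l2n_def power_mult_distrib real_sqrt_mult)

lemma sqint_bounded_mult:
  assumes "sqint M f" "m \<in> borel_measurable M" "\<And>x. \<bar>m x\<bar> \<le> C"
  shows "sqint M (\<lambda>x. m x * f x)" "l2n M (\<lambda>x. m x * f x) \<le> C * l2n M f"
proof -
  have C: "C \<ge> 0" using assms(3)[of undefined] by linarith
  have *: "\<bar>m x * f x\<bar> \<le> \<bar>C * f x\<bar>" for x
    using mult_right_mono[OF assms(3)[of x], of "\<bar>f x\<bar>"] C by (simp add: abs_mult)
  have m: "(\<lambda>x. m x * f x) \<in> borel_measurable M" using assms(1,2) by (intro borel_measurable_times) (auto dest: sqint_measurable)
  show "sqint M (\<lambda>x. m x * f x)" "l2n M (\<lambda>x. m x * f x) \<le> C * l2n M f"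
    using sqint_dominated[OF sqint_cmult[OF assms(1), of C] m *] C by (simp_all add: l2n_cmult)
qed

lemma Cauchy_Schwarz_integral:
  assumes f: "sqint M f" and g: "sqint M g"
  shows "\<bar>\<integral>x. f x * g x \<partial>M\<bar> \<le> l2n M f * l2n M g"
proof -
  define A where "A = (\<integral>x. (f x)\<^sup>2 \<partial>M)"
  define B where "B = (\<integral>x. (g x)\<^sup>2 \<partial>M)"
  define C where "C = (\<integral>x. f x * g x \<partial>M)"
  have fg: "integrable M (\<lambda>x. f x * g x)" by (rule sqint_mult_integrable[OF f g])
  have quad: "0 \<le> A + 2 * t * C + t\<^sup>2 * B" for t
  proof -
    have "0 \<le> (\<integral>x. (f x + t * g x)\<^sup>2 \<partial>M)" by (rule integral_nonneg_AE) simp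
    also have "(\<integral>x. (f x + t * g x)\<^sup>2 \<partial>M) = (\<integral>x. (f x)\<^sup>2 + (2 * t * (f x * g x) + t\<^sup>2 * (g x)\<^sup>2) \<partial>M)"
      by (simp add: power2_sum power_mult_distrib algebra_simps)
    also have "\<dots> = A + (2 * t * C + t\<^sup>2 * B)"
      unfolding A_def B_def C_def using f g fg by (simp add: sqint_def)
    finally show ?thesis by simp
  qed
  have B: "B \<ge> 0" unfolding B_def by (rule integral_nonneg_AE) simp
  have "C\<^sup>2 \<le> A * B"
  proof (cases "B = 0")
    case True
    have "C = 0"
    proof (rule ccontr)
      assume "C \<noteq> 0"
      \<comment> \<open>If \<open>B = 0\<close>, the quadratic in \<open>t\<close> is linear and would take the value \<open>-1\<close> at this \<open>t\<close>.\<close>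
      then have "A + 2 * (- (A + 1) / (2 * C)) * C = -1" by (simp add: field_simps)
      then show False using quad[of "- (A + 1) / (2 * C)"] True by simp
    qed
    then show ?thesis using True by simp
  next
    case False
    then have "B > 0" using B by simp
    \<comment> \<open>The minimum of the quadratic.\<close>
    have "0 \<le> A + 2 * (- C / B) * C + (- C / B)\<^sup>2 * B" by (rule quad)
    also have "\<dots> = A - C\<^sup>2 / B" using \<open>B > 0\<close> by (simp add: power2_eq_square field_simps)
    finally show ?thesis using \<open>B > 0\<close> by (simp add: field_simps)
  qed
  then have "sqrt (C\<^sup>2) \<le> sqrt (A * B)" by (rule real_sqrt_le_mono)
  then show ?thesis by (simp add: real_sqrt_mult A_def B_def C_def l2n_def)
qed

lemma l2n_triangle:
  assumes f: "sqint M f" and g: "sqint M g"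
  shows "l2n M (\<lambda>x. f x + g x) \<le> l2n M f + l2n M g"
proof -
  have "(l2n M (\<lambda>x. f x + g x))\<^sup>2 = (\<integral>x. (f x)\<^sup>2 + (2 * (f x * g x) + (g x)\<^sup>2) \<partial>M)"
    by (simp add: l2n_sq power2_sum algebra_simps)
  also have "\<dots> = (l2n M f)\<^sup>2 + (2 * (\<integral>x. f x * g x \<partial>M) + (l2n M g)\<^sup>2)"
    unfolding l2n_sq using f g sqint_mult_integrable[OF f g] by (simp add: sqint_def)
  also have "\<dots> \<le> (l2n M f + l2n M g)\<^sup>2"
    using Cauchy_Schwarz_integral[OF f g] by (simp add: power2_sum)
  finally show ?thesis by (rule power2_le_imp_le) simp
qed

lemma L2_iff_sqint:
  fixes u :: "'a \<Rightarrow> real"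
  shows "u \<in> L2 M A \<longleftrightarrow> sqint M (\<lambda>x. indicator A x * u x)"
proof -
  have "(\<lambda>x. (indicator A x * u x)\<^sup>2) = (\<lambda>x. indicator A x *\<^sub>R (u x)\<^sup>2)"
    by (auto simp: indicator_def)
  then show ?thesis
    by (simp add: L2_def sqint_def set_borel_measurable_def set_integrable_def)
qed

lemma L2_norm_eq_l2n:
  fixes u :: "'a::euclidean_space \<Rightarrow> real"
  shows "L2_norm A u = l2n lborel (\<lambda>x. indicator A x * u x)"
proof -
  have "(\<lambda>x. (indicator A x * u x)\<^sup>2) = (\<lambda>x. indicator A x *\<^sub>R (u x)\<^sup>2)"
    by (auto simp: indicator_def)
  then show ?thesis by (simp add: L2_norm_def l2n_def set_lebesgue_integral_def)
qed

lemma L2_component: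
  fixes G :: "'a \<Rightarrow> real^'n"
  assumes "G \<in> L2 M A"
  shows "sqint M (\<lambda>x. indicator A x * (G x $ i))"
proof (rule sqintI)
  have [measurable]: "(\<lambda>x. indicator A x *\<^sub>R G x) \<in> borel_measurable M"
    and int: "integrable M (\<lambda>x. indicator A x *\<^sub>R (norm (G x))\<^sup>2)"
    using assms by (auto simp: L2_def set_borel_measurable_def set_integrable_def)
  have "(\<lambda>x. (indicator A x *\<^sub>R G x) \<bullet> axis i 1) \<in> borel_measurable M" by measurable
  then have "(\<lambda>x. (indicator A x *\<^sub>R G x) $ i) \<in> borel_measurable M" by (simp add: inner_axis)
  then show m: "(\<lambda>x. indicator A x * (G x $ i)) \<in> borel_measurable M" by simp
  show "integrable M (\<lambda>x. (indicator A x * (G x $ i))\<^sup>2)"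
  proof (rule Bochner_Integration.integrable_bound[OF int])
    show "(\<lambda>x. (indicator A x * G x $ i)\<^sup>2) \<in> borel_measurable M" using m by simp
    show "AE x in M. norm ((indicator A x * G x $ i)\<^sup>2) \<le> norm (indicator A x *\<^sub>R (norm (G x))\<^sup>2)"
    proof (rule AE_I2)
      fix x
      have "(G x $ i)\<^sup>2 \<le> (norm (G x))\<^sup>2"
        using component_le_norm_cart[of "G x" i] by (metis abs_le_square_iff abs_norm_cancel)
      then show "norm ((indicator A x * G x $ i)\<^sup>2) \<le> norm (indicator A x *\<^sub>R (norm (G x))\<^sup>2)"
        by (simp add: indicator_def)
    qed
  qed
qed

lemma L2_component_norm_le:
  fixes G :: "'a::euclidean_space \<Rightarrow> real^'n"
  assumes "G \<in> L2 lborel A"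
  shows "l2n lborel (\<lambda>x. indicator A x * (G x $ i)) \<le> L2_norm A G"
  unfolding l2n_def L2_norm_def set_lebesgue_integral_def
proof (intro real_sqrt_le_mono integral_mono)
  show "integrable lborel (\<lambda>x. (indicator A x * G x $ i)\<^sup>2)"
    using L2_component[OF assms] by (simp add: sqint_def)
  show "integrable lborel (\<lambda>x. indicator A x *\<^sub>R (norm (G x))\<^sup>2)"
    using assms by (auto simp: L2_def set_integrable_def)
  fix x
  have "(G x $ i)\<^sup>2 \<le> (norm (G x))\<^sup>2"
    using component_le_norm_cart[of "G x" i] by (metis abs_le_square_iff abs_norm_cancel)
  then show "(indicator A x * G x $ i)\<^sup>2 \<le> indicator A x *\<^sub>R (norm (G x))\<^sup>2"
    by (simp add: indicator_def)
qed

lemma L2_vectorI: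
  fixes G :: "'a \<Rightarrow> real^'n"
  assumes "\<And>i. sqint M (\<lambda>x. indicator A x * (G x $ i))"
  shows "G \<in> L2 M A"
proof -
  have "(\<lambda>x. indicator A x *\<^sub>R G x) \<in> borel_measurable M"
    using assms by (subst borel_measurable_euclidean_space) (auto simp: Basis_vec_def inner_axis sqint_def)
  moreover have "(\<lambda>x. indicator A x *\<^sub>R (norm (G x))\<^sup>2) = (\<lambda>x. \<Sum>i\<in>UNIV. (indicator A x * (G x $ i))\<^sup>2)"
    by (auto simp: indicator_def norm_vec_def L2_set_def sum_nonneg)
  then have "integrable M (\<lambda>x. indicator A x *\<^sub>R (norm (G x))\<^sup>2)"
    using assms by (simp add: sqint_def)
  ultimately show ?thesis by (simp add: L2_def set_borel_measurable_def set_integrable_def)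
qed

lemma sqint_indicator_bounded:
  fixes \<Omega> :: "'a::euclidean_space set"
  assumes "bounded \<Omega>" "\<Omega> \<in> sets borel" and f: "f \<in> borel_measurable borel" "\<And>x. x \<in> \<Omega> \<Longrightarrow> \<bar>f x\<bar> \<le> B"
  shows "sqint lborel (\<lambda>x. indicator \<Omega> x * f x)"
proof (rule sqint_dominated(1)[where g="\<lambda>x. B * indicator \<Omega> x"])
  have "emeasure lborel \<Omega> < \<infinity>"
    using assms(1) by (metis emeasure_bounded_finite)
  then have "integrable lborel (indicator \<Omega> :: 'a \<Rightarrow> real)"
    using assms(2) by (simp add: integrable_indicator_iff)
  moreover have "(\<lambda>x. (indicator \<Omega> x)\<^sup>2) = (indicator \<Omega> :: 'a \<Rightarrow> real)" by (auto simp: indicator_def)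
  ultimately have "sqint lborel (indicator \<Omega>)"
    using assms(2) by (simp add: sqint_def)
  then show "sqint lborel (\<lambda>x. B * indicator \<Omega> x)" by (rule sqint_cmult)
  show "(\<lambda>x. indicator \<Omega> x * f x) \<in> borel_measurable lborel" using assms by simp
  show "\<bar>indicator \<Omega> x * f x\<bar> \<le> \<bar>B * indicator \<Omega> x\<bar>" for x
    using f(2)[of x] by (auto simp: indicator_def)
qed

lemma smooth_bounded_on_bounded:
  fixes f :: "'a::euclidean_space \<Rightarrow> real"
  assumes "smooth_fun f" "bounded S"
  obtains B where "\<And>x. x \<in> S \<Longrightarrow> \<bar>f x\<bar> \<le> B"
proof -
  have "compact (f ` closure S)"
    using assms smooth_continuous[OF assms(1)]
    by (intro compact_continuous_image) (auto intro: continuous_on_subset simp: compact_closure)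
  then have "bounded (f ` closure S)" by (rule compact_imp_bounded)
  then obtain B where "\<forall>y\<in>f ` closure S. \<bar>y\<bar> \<le> B" by (auto simp: bounded_iff)
  then show thesis using closure_subset by (intro that[of B]) blast
qed

lemma sqint_smooth_on_bounded:
  fixes f :: "'a::euclidean_space \<Rightarrow> real"
  assumes "smooth_fun f" "bounded \<Omega>" "open \<Omega>"
  shows "sqint lborel (\<lambda>x. indicator \<Omega> x * f x)"
proof -
  obtain B where "\<And>x. x \<in> \<Omega> \<Longrightarrow> \<bar>f x\<bar> \<le> B" using smooth_bounded_on_bounded[OF assms(1,2)] by metis
  then show ?thesis using assms by (intro sqint_indicator_bounded smooth_measurable) auto
qed

lemma sqint_on_bounded_integrable:
  fixes f :: "'a::euclidean_space \<Rightarrow> real"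
  assumes "bounded \<Omega>" "open \<Omega>" "sqint lborel (\<lambda>x. indicator \<Omega> x * f x)"
  shows "set_integrable lborel \<Omega> f"
proof -
  have "sqint lborel (\<lambda>x. indicator \<Omega> x * (1::real))"
    using assms by (intro sqint_indicator_bounded[where B=1]) auto
  from sqint_mult_integrable[OF this assms(3)]
  have "integrable lborel (\<lambda>x. indicator \<Omega> x * (indicator \<Omega> x * f x))" by simp
  moreover have "(\<lambda>x. indicator \<Omega> x * (indicator \<Omega> x * f x)) = (\<lambda>x. indicator \<Omega> x *\<^sub>R f x)"
    by (auto simp: indicator_def)
  ultimately show ?thesis by (simp add: set_integrable_def)
qed

lemma test_funs_integrable:
  fixes \<phi> :: "'a::euclidean_space \<Rightarrow> real"
  assumes "\<phi> \<in> test_funs U"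
  shows "integrable lborel \<phi>"
proof -
  obtain K where K: "smooth_fun \<phi>" "compact K" "\<And>x. x \<notin> K \<Longrightarrow> \<phi> x = 0"
    using assms by (elim test_funsE) blast
  have "integrable lborel (\<lambda>x. indicator K x *\<^sub>R \<phi> x)"
    using smooth_continuous[OF K(1)] K(2) by (intro borel_integrable_compact) (auto intro: continuous_on_subset)
  moreover have "(\<lambda>x. indicator K x *\<^sub>R \<phi> x) = \<phi>" by (rule ext, simp add: indicator_def) (use K(3) in blast)
  ultimately show ?thesis by simp
qed

text \<open>
  The integrals of the difference quotients vanish by translation invariance of Lebesgue measure. They converge
  boundedly, with a common bounded support, to the derivative.
\<close>

lemma integral_dir_deriv_test_fun:
  fixes \<zeta> :: "'a::euclidean_space \<Rightarrow> real"
  assumes "\<zeta> \<in> test_funs UNIV"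
  shows "(\<integral>x. dir_deriv e \<zeta> x \<partial>lborel) = 0"
proof -
  obtain K where K: "smooth_fun \<zeta>" "compact K" "\<And>x. x \<notin> K \<Longrightarrow> \<zeta> x = 0"
    using assms by (elim test_funsE) blast
  obtain B where B: "B > 0" "\<And>x. \<bar>dir_deriv e \<zeta> x\<bar> \<le> B"
    using test_funs_bounded[OF test_funs_dir_deriv[OF assms]] by metis
  obtain R where R: "\<And>x. x \<in> K \<Longrightarrow> norm x \<le> R"
    using compact_imp_bounded[OF K(2)] by (auto simp: bounded_iff)
  define t where "t m = 1 / real (Suc m)" for m
  have t: "0 < t m" "t m \<le> 1" for m by (auto simp: t_def)
  have t0: "t \<longlonglongrightarrow> 0" unfolding t_def by (rule LIMSEQ_Suc[OF lim_1_over_n])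
  define q where "q m x = (\<zeta> (x + t m *\<^sub>R e) - \<zeta> x) / t m" for m x
  have [measurable]: "\<zeta> \<in> borel_measurable borel" by (rule smooth_measurable[OF K(1)])
  have D: "(\<zeta> has_derivative (\<lambda>e. dir_deriv e \<zeta> x)) (at x)" for x
    by (intro dir_deriv_has_derivative smooth_differentiable K)
  have line: "((\<lambda>s. \<zeta> (x + s *\<^sub>R e)) has_real_derivative dir_deriv e \<zeta> (x + s *\<^sub>R e)) (at s)" for x s
  proof -
    have "((\<lambda>s. x + s *\<^sub>R e) has_derivative (\<lambda>r. r *\<^sub>R e)) (at s)"
      by (auto intro!: derivative_eq_intros)
    from has_derivative_compose[OF this D]
    have "((\<lambda>s. \<zeta> (x + s *\<^sub>R e)) has_derivative (\<lambda>r. dir_deriv (r *\<^sub>R e) \<zeta> (x + s *\<^sub>R e))) (at s)" .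
    moreover have "dir_deriv (r *\<^sub>R e) \<zeta> (x + s *\<^sub>R e) = dir_deriv e \<zeta> (x + s *\<^sub>R e) * r" for r
      using linear_cmul[OF has_derivative_linear[OF D], of r e] by simp
    ultimately show ?thesis by (simp only: has_field_derivative_def)
  qed
  have \<zeta>_int: "integrable lborel \<zeta>" by (rule test_funs_integrable[OF assms])
  have shift: "integrable lborel (\<lambda>x. \<zeta> (x + c))" "(\<integral>x. \<zeta> (x + c) \<partial>lborel) = (\<integral>x. \<zeta> x \<partial>lborel)" for c
  proof -
    have "integrable (distr lborel borel ((+) c)) \<zeta>" using \<zeta>_int by (simp only: lborel_distr_plus)
    then show "integrable lborel (\<lambda>x. \<zeta> (x + c))" by (subst (asm) integrable_distr_eq) (auto simp: add.commute)
    have "(\<integral>x. \<zeta> x \<partial>lborel) = (\<integral>x. \<zeta> x \<partial>distr lborel borel ((+) c))" by (simp only: lborel_distr_plus)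
    also have "\<dots> = (\<integral>x. \<zeta> (x + c) \<partial>lborel)" by (subst integral_distr) (auto simp: add.commute)
    finally show "(\<integral>x. \<zeta> (x + c) \<partial>lborel) = (\<integral>x. \<zeta> x \<partial>lborel)" by simp
  qed
  have q0: "(\<integral>x. q m x \<partial>lborel) = 0" for m
    unfolding q_def using shift \<zeta>_int by simp
  have "(\<lambda>m. \<integral>x. q m x \<partial>lborel) \<longlonglongrightarrow> (\<integral>x. dir_deriv e \<zeta> x \<partial>lborel)"
  proof (rule integral_dominated_convergence[where w="\<lambda>x. B * indicator (cball 0 (R + norm e)) x"])
    show "dir_deriv e \<zeta> \<in> borel_measurable lborel"
      using smooth_measurable[OF smooth_dir_deriv[OF K(1)]] by simp
    show "q i \<in> borel_measurable lborel" for i unfolding q_def by measurable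
    have "integrable lborel (indicator (cball 0 (R + norm e)) :: 'a \<Rightarrow> real)"
      using emeasure_bounded_finite[OF bounded_cball] by (simp add: integrable_indicator_iff)
    then show "integrable lborel (\<lambda>x. B * indicator (cball (0::'a) (R + norm e)) x)"
      by (intro integrable_mult_right) simp
    show "AE x in lborel. (\<lambda>i. q i x) \<longlonglongrightarrow> dir_deriv e \<zeta> x"
    proof (rule AE_I2)
      fix x
      have "((\<lambda>h. (\<zeta> (x + h *\<^sub>R e) - \<zeta> x) / h) \<longlongrightarrow> dir_deriv e \<zeta> x) (at 0)"
        using line[of x 0] by (simp add: DERIV_def)
      moreover have "filterlim t (at 0) sequentially"
        using t0 t by (auto simp: filterlim_at less_imp_neq[symmetric] intro!: always_eventually)
      ultimately show "(\<lambda>i. q i x) \<longlonglongrightarrow> dir_deriv e \<zeta> x"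
        unfolding q_def by (rule filterlim_compose)
    qed
    \<comment> \<open>The step lengths are at most 1, so all quotients vanish outside this ball.\<close>
    show "AE x in lborel. norm (q i x) \<le> B * indicator (cball 0 (R + norm e)) x" for i
    proof (rule AE_I2)
      fix x
      show "norm (q i x) \<le> B * indicator (cball 0 (R + norm e)) x"
      proof (cases "x \<in> cball 0 (R + norm e)")
        case True
        obtain s where "\<zeta> (x + t i *\<^sub>R e) - \<zeta> (x + 0 *\<^sub>R e) = (t i - 0) * dir_deriv e \<zeta> (x + s *\<^sub>R e)"
          using MVT2[of 0 "t i" "\<lambda>s. \<zeta> (x + s *\<^sub>R e)" "\<lambda>s. dir_deriv e \<zeta> (x + s *\<^sub>R e)"] line t by blast
        then have "q i x = dir_deriv e \<zeta> (x + s *\<^sub>R e)" using t[of i] by (simp add: q_def)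
        then show ?thesis using True B by simp
      next
        case False
        have "norm x > R + norm e" using False by simp
        moreover have "norm x \<le> norm (x + t i *\<^sub>R e) + t i * norm e"
          using norm_triangle_ineq4[of "x + t i *\<^sub>R e" "t i *\<^sub>R e"] t[of i] by simp
        moreover have "t i * norm e \<le> norm e" using t[of i] by (simp add: mult_left_le_one_le)
        ultimately have "x \<notin> K" "x + t i *\<^sub>R e \<notin> K" using R[of x] R[of "x + t i *\<^sub>R e"] norm_ge_zero[of e] by linarith+
        then show ?thesis using False K(3) by (simp add: q_def)
      qed
    qed
  qed
  then show ?thesis unfolding q0 by (simp add: LIMSEQ_const_iff)
qed

lemma set_lebesgue_integral_extend:
  fixes f :: "'a::euclidean_space \<Rightarrow> real"
  assumes "\<And>x. x \<notin> \<Omega> \<Longrightarrow> f x = 0"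
  shows "(LINT x:\<Omega>|lborel. f x) = (\<integral>x. f x \<partial>lborel)"
  unfolding set_lebesgue_integral_def by (rule Bochner_Integration.integral_cong) (use assms in \<open>auto simp: indicator_def\<close>)

lemma test_funs_outside: "\<phi> \<in> test_funs U \<Longrightarrow> x \<notin> U \<Longrightarrow> \<phi> x = 0"
  by (elim test_funsE) blast

lemma test_funs_UNIV: "\<phi> \<in> test_funs U \<Longrightarrow> \<phi> \<in> test_funs UNIV"
  by (simp add: test_funs_def)

text \<open>
  Integration by parts: the derivative of the test function \<open>\<phi> f\<close> has integral zero.
\<close>

lemma weak_deriv_smooth:
  fixes f :: "'a::euclidean_space \<Rightarrow> real"
  assumes f: "smooth_fun f"
  shows "weak_deriv \<Omega> e f (dir_deriv e f)"
  unfolding weak_deriv_def distr_deriv_def regular_distr_def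
proof
  fix \<phi> assume \<phi>: "\<phi> \<in> test_funs \<Omega>"
  have 1: "(LINT x:\<Omega>|lborel. f x * dir_deriv e \<phi> x) = (\<integral>x. dir_deriv e \<phi> x * f x \<partial>lborel)"
    by (subst set_lebesgue_integral_extend) (auto simp: mult.commute test_funs_outside[OF test_funs_dir_deriv[OF \<phi>]])
  have 2: "(LINT x:\<Omega>|lborel. dir_deriv e f x * \<phi> x) = (\<integral>x. \<phi> x * dir_deriv e f x \<partial>lborel)"
    by (subst set_lebesgue_integral_extend) (auto simp: mult.commute test_funs_outside[OF \<phi>])
  have "0 = (\<integral>x. dir_deriv e (\<lambda>x. \<phi> x * f x) x \<partial>lborel)"
    using integral_dir_deriv_test_fun[OF test_funs_UNIV[OF test_funs_mult[OF \<phi> f]]] by simp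
  also have "\<dots> = (\<integral>x. \<phi> x * dir_deriv e f x + dir_deriv e \<phi> x * f x \<partial>lborel)"
    using f test_funs_smooth[OF \<phi>] by (subst dir_deriv_mult) (auto intro: smooth_differentiable)
  also have "\<dots> = (\<integral>x. \<phi> x * dir_deriv e f x \<partial>lborel) + (\<integral>x. dir_deriv e \<phi> x * f x \<partial>lborel)"
    using test_funs_integrable[OF test_funs_mult[OF \<phi> smooth_dir_deriv[OF f]]]
      test_funs_integrable[OF test_funs_mult[OF test_funs_dir_deriv[OF \<phi>] f]]
    by (rule Bochner_Integration.integral_add)
  finally show "- (LINT x:\<Omega>|lborel. f x * dir_deriv e \<phi> x) = (LINT x:\<Omega>|lborel. dir_deriv e f x * \<phi> x)"
    unfolding 1 2 by simp
qed

section \<open>Weak identities and functions of zero trace\<close>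

lemma weak_deriv_diff:
  assumes "bounded \<Omega>" "open \<Omega>"
    and L2: "sqint lborel (\<lambda>x. indicator \<Omega> x * u x)" "sqint lborel (\<lambda>x. indicator \<Omega> x * v x)"
      "sqint lborel (\<lambda>x. indicator \<Omega> x * u' x)" "sqint lborel (\<lambda>x. indicator \<Omega> x * v' x)"
    and w: "weak_deriv \<Omega> e u u'" "weak_deriv \<Omega> e v v'"
  shows "weak_deriv \<Omega> e (\<lambda>x. u x - v x) (\<lambda>x. u' x - v' x)"
  unfolding weak_deriv_def distr_deriv_def regular_distr_def
proof
  fix \<phi> assume \<phi>: "\<phi> \<in> test_funs \<Omega>"
  have split: "(LINT x:\<Omega>|lborel. (f x - g x) * \<psi> x) = (LINT x:\<Omega>|lborel. f x * \<psi> x) - (LINT x:\<Omega>|lborel. g x * \<psi> x)"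
    if f: "sqint lborel (\<lambda>x. indicator \<Omega> x * f x)" and g: "sqint lborel (\<lambda>x. indicator \<Omega> x * g x)"
      and \<psi>: "\<psi> \<in> test_funs \<Omega>" for f g \<psi>
  proof -
    have p: "sqint lborel (\<lambda>x. indicator \<Omega> x * \<psi> x)"
      using test_funs_smooth[OF \<psi>] assms(1,2) by (rule sqint_smooth_on_bounded)
    have "integrable lborel (\<lambda>x. (indicator \<Omega> x * f x) * (indicator \<Omega> x * \<psi> x))"
      "integrable lborel (\<lambda>x. (indicator \<Omega> x * g x) * (indicator \<Omega> x * \<psi> x))"
      using f g p by (auto intro: sqint_mult_integrable)
    moreover have "(\<lambda>x. (indicator \<Omega> x * h x) * (indicator \<Omega> x * \<psi> x)) = (\<lambda>x. indicator \<Omega> x *\<^sub>R (h x * \<psi> x))" for h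
      by (auto simp: indicator_def)
    ultimately have "set_integrable lborel \<Omega> (\<lambda>x. f x * \<psi> x)" "set_integrable lborel \<Omega> (\<lambda>x. g x * \<psi> x)"
      by (simp_all only: set_integrable_def)
    then show ?thesis by (simp add: left_diff_distrib)
  qed
  have "- (LINT x:\<Omega>|lborel. u x * dir_deriv e \<phi> x) = (LINT x:\<Omega>|lborel. u' x * \<phi> x)"
    "- (LINT x:\<Omega>|lborel. v x * dir_deriv e \<phi> x) = (LINT x:\<Omega>|lborel. v' x * \<phi> x)"
    using w \<phi> by (auto simp: weak_deriv_def distr_deriv_def regular_distr_def)
  then show "- (LINT x:\<Omega>|lborel. (u x - v x) * dir_deriv e \<phi> x) = (LINT x:\<Omega>|lborel. (u' x - v' x) * \<phi> x)"
    by (simp only: split[OF L2(1,2) test_funs_dir_deriv[OF \<phi>]] split[OF L2(3,4) \<phi>])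
qed

lemma weak_deriv_unique:
  fixes \<Omega> :: "'a::euclidean_space set"
  assumes \<Omega>: "bounded \<Omega>" "open \<Omega>"
    and L2: "sqint lborel (\<lambda>x. indicator \<Omega> x * u' x)" "sqint lborel (\<lambda>x. indicator \<Omega> x * v' x)"
    and w: "weak_deriv \<Omega> e u u'" "weak_deriv \<Omega> e u v'"
  shows "AE x in lborel. x \<in> \<Omega> \<longrightarrow> u' x = v' x"
proof -
  have z: "sqint lborel (\<lambda>x. indicator \<Omega> x * (u' x - v' x))"
    using sqint_diff[OF L2] by (simp add: right_diff_distrib)
  have "AE x in lborel. x \<in> \<Omega> \<longrightarrow> u' x - v' x = 0"
  proof (rule fundamental_lemma[OF \<Omega>(2)])
    show "set_integrable lborel \<Omega> (\<lambda>x. u' x - v' x)" by (rule sqint_on_bounded_integrable[OF \<Omega> z])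
    fix \<phi> assume \<phi>: "\<phi> \<in> test_funs \<Omega>"
    have p: "sqint lborel (\<lambda>x. indicator \<Omega> x * \<phi> x)"
      using test_funs_smooth[OF \<phi>] \<Omega> by (rule sqint_smooth_on_bounded)
    have "integrable lborel (\<lambda>x. (indicator \<Omega> x * u' x) * (indicator \<Omega> x * \<phi> x))"
      "integrable lborel (\<lambda>x. (indicator \<Omega> x * v' x) * (indicator \<Omega> x * \<phi> x))"
      using L2 p by (auto intro: sqint_mult_integrable)
    moreover have "(\<lambda>x. (indicator \<Omega> x * h x) * (indicator \<Omega> x * \<phi> x)) = (\<lambda>x. indicator \<Omega> x *\<^sub>R (h x * \<phi> x))" for h
      by (auto simp: indicator_def)
    ultimately have "set_integrable lborel \<Omega> (\<lambda>x. u' x * \<phi> x)" "set_integrable lborel \<Omega> (\<lambda>x. v' x * \<phi> x)"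
      by (simp_all only: set_integrable_def)
    moreover have "(LINT x:\<Omega>|lborel. u' x * \<phi> x) = (LINT x:\<Omega>|lborel. v' x * \<phi> x)"
      using w \<phi> by (auto simp: weak_deriv_def distr_deriv_def regular_distr_def)
    ultimately show "(LINT x:\<Omega>|lborel. (u' x - v' x) * \<phi> x) = 0"
      by (simp add: left_diff_distrib)
  qed
  then show ?thesis by eventually_elim simp
qed

lemma l2n_cong_AE:
  assumes "sqint M f" "sqint M g" "AE x in M. f x = g x"
  shows "l2n M f = l2n M g"
  unfolding l2n_def
  by (rule arg_cong[of _ _ sqrt], rule integral_cong_AE) (use assms in \<open>auto simp: sqint_def\<close>)

text \<open>
  The norm of \<open>W\<^sup>1\<^sub>2\<close> refers to a chosen weak gradient. By uniqueness of weak derivatives the choice agrees almost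
  everywhere with the difference of the classical gradient of \<open>U m\<close> and the given \<open>G\<close>, so the classical partial
  derivatives converge to the components of \<open>G\<close>.
\<close>

lemma zero_trace_approximation:
  fixes \<Omega> :: "(real^'n) set"
  assumes \<Omega>: "bounded \<Omega>" "open \<Omega>" and tr: "has_trace \<Omega> h (\<lambda>_. 0)" and G: "is_weak_gradient \<Omega> h G"
  shows "\<exists>U :: nat \<Rightarrow> real^'n \<Rightarrow> real. (\<forall>m. smooth_fun (U m)) \<and>
    (\<lambda>m. l2n lborel (\<lambda>x. indicator \<Omega> x * (U m x - h x))) \<longlonglongrightarrow> 0 \<and>
    (\<forall>j. (\<lambda>m. l2n lborel (\<lambda>x. indicator \<Omega> x * (dir_deriv (axis j 1) (U m) x - G x $ j))) \<longlonglongrightarrow> 0) \<and>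
    (\<lambda>m. \<integral>\<^sup>+x\<in>frontier \<Omega>. ennreal ((U m x)\<^sup>2) \<partial>surface_measure) \<longlonglongrightarrow> 0"
proof -
  obtain U :: "nat \<Rightarrow> real^'n \<Rightarrow> real" where U: "\<And>m. smooth_fun (U m)"
    and W: "(\<lambda>m. W12_norm \<Omega> (\<lambda>x. U m x - h x)) \<longlonglongrightarrow> 0"
    and T: "(\<lambda>m. \<integral>\<^sup>+x\<in>frontier \<Omega>. ennreal ((U m x - 0)\<^sup>2) \<partial>surface_measure) \<longlonglongrightarrow> 0"
    using tr unfolding has_trace_def by blast
  have hL2: "sqint lborel (\<lambda>x. indicator \<Omega> x * h x)"
    using tr by (simp add: has_trace_def W12_def L2_iff_sqint)
  have GL2: "sqint lborel (\<lambda>x. indicator \<Omega> x * G x $ j)" for j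
    using G by (auto simp: is_weak_gradient_def intro: L2_component)
  have UL2: "sqint lborel (\<lambda>x. indicator \<Omega> x * U m x)"
    "sqint lborel (\<lambda>x. indicator \<Omega> x * dir_deriv e (U m) x)" for m e
    using U \<Omega> by (auto intro: sqint_smooth_on_bounded smooth_dir_deriv)
  define D where "D m x = (\<chi> j. dir_deriv (axis j 1) (U m) x - G x $ j)" for m x
  have DL2: "sqint lborel (\<lambda>x. indicator \<Omega> x * (D m x $ j))" for m j
    using sqint_diff[OF UL2(2)[where e="axis j 1"] GL2[of j], of m] by (simp add: D_def right_diff_distrib)
  have Dw: "weak_deriv \<Omega> (axis j 1) (\<lambda>x. U m x - h x) (\<lambda>x. D m x $ j)" for m j
  proof -
    have "weak_deriv \<Omega> (axis j 1) h (\<lambda>x. G x $ j)" using G by (auto simp: is_weak_gradient_def)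
    then show ?thesis
      unfolding D_def using weak_deriv_diff[OF \<Omega> UL2(1) hL2 UL2(2) GL2 weak_deriv_smooth[OF U]] by simp
  qed
  have Dg: "is_weak_gradient \<Omega> (\<lambda>x. U m x - h x) (D m)" for m
    unfolding is_weak_gradient_def using Dw DL2 by (auto intro: L2_vectorI)
  define S where "S m = (SOME G. is_weak_gradient \<Omega> (\<lambda>x. U m x - h x) G)" for m
  have Sg: "is_weak_gradient \<Omega> (\<lambda>x. U m x - h x) (S m)" for m
    unfolding S_def by (rule someI[of "is_weak_gradient \<Omega> (\<lambda>x. U m x - h x)", OF Dg])
  have SL2: "S m \<in> L2 lborel \<Omega>" for m using Sg by (simp add: is_weak_gradient_def)
  have W_eq: "W12_norm \<Omega> (\<lambda>x. U m x - h x)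
      = sqrt ((l2n lborel (\<lambda>x. indicator \<Omega> x * (U m x - h x)))\<^sup>2 + (L2_norm \<Omega> (S m))\<^sup>2)" for m
    by (simp add: W12_norm_def S_def L2_norm_eq_l2n)
  have 1: "l2n lborel (\<lambda>x. indicator \<Omega> x * (U m x - h x)) \<le> W12_norm \<Omega> (\<lambda>x. U m x - h x)" for m
    unfolding W_eq by simp
  have S_nonneg: "0 \<le> L2_norm \<Omega> (S m)" for m
    unfolding L2_norm_def set_lebesgue_integral_def by (auto intro!: integral_nonneg_AE)
  have 2: "l2n lborel (\<lambda>x. indicator \<Omega> x * (dir_deriv (axis j 1) (U m) x - G x $ j)) \<le> W12_norm \<Omega> (\<lambda>x. U m x - h x)" for m j
  proof -
    have "AE x in lborel. x \<in> \<Omega> \<longrightarrow> D m x $ j = S m x $ j"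
      using Sg by (intro weak_deriv_unique[OF \<Omega> DL2 L2_component[OF SL2] Dw]) (auto simp: is_weak_gradient_def)
    then have ae: "AE x in lborel. indicator \<Omega> x * (D m x $ j) = indicator \<Omega> x * (S m x $ j)"
      by eventually_elim (simp add: indicator_def)
    have "l2n lborel (\<lambda>x. indicator \<Omega> x * (D m x $ j)) = l2n lborel (\<lambda>x. indicator \<Omega> x * (S m x $ j))"
      by (rule l2n_cong_AE[OF DL2 L2_component[OF SL2] ae])
    also have "\<dots> \<le> L2_norm \<Omega> (S m)" by (rule L2_component_norm_le[OF SL2])
    also have "\<dots> \<le> W12_norm \<Omega> (\<lambda>x. U m x - h x)"
      unfolding W_eq using S_nonneg[of m] by simp
    finally show ?thesis by (simp add: D_def)
  qed
  show ?thesis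
  proof (intro exI[of _ U] conjI allI U)
    show "(\<lambda>m. l2n lborel (\<lambda>x. indicator \<Omega> x * (U m x - h x))) \<longlonglongrightarrow> 0"
      by (rule tendsto_sandwich[OF _ _ tendsto_const W]) (auto intro: always_eventually 1)
    show "(\<lambda>m. l2n lborel (\<lambda>x. indicator \<Omega> x * (dir_deriv (axis j 1) (U m) x - G x $ j))) \<longlonglongrightarrow> 0" for j
      by (rule tendsto_sandwich[OF _ _ tendsto_const W]) (auto intro: always_eventually 2)
    show "(\<lambda>m. \<integral>\<^sup>+x\<in>frontier \<Omega>. ennreal ((U m x)\<^sup>2) \<partial>surface_measure) \<longlonglongrightarrow> 0"
      using T by simp
  qed
qed

text \<open>
  Every point of the open set eventually leaves the shrinking strips, and \<open>f^2\<close> dominates.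
\<close>

lemma boundary_strip_l2n_tendsto_0:
  fixes \<Omega> :: "'a::euclidean_space set"
  assumes \<Omega>: "open \<Omega>" and f: "sqint lborel f" and \<delta>: "\<delta> \<longlonglongrightarrow> 0"
  shows "(\<lambda>l. l2n lborel (\<lambda>x. indicator (boundary_strip \<Omega> (\<delta> l)) x * f x)) \<longlonglongrightarrow> 0"
proof -
  have [measurable]: "boundary_strip \<Omega> \<epsilon> \<in> sets borel" for \<epsilon> using open_boundary_strip[OF \<Omega>] by auto
  have [measurable]: "f \<in> borel_measurable lborel" using f by (rule sqint_measurable)
  have "(\<lambda>l. \<integral>x. (indicator (boundary_strip \<Omega> (\<delta> l)) x * f x)\<^sup>2 \<partial>lborel) \<longlonglongrightarrow> (\<integral>x. 0 \<partial>(lborel :: 'a measure))"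
  proof (rule integral_dominated_convergence[where w="\<lambda>x. (f x)\<^sup>2"])
    show "integrable lborel (\<lambda>x. (f x)\<^sup>2)" using f by (simp add: sqint_def)
    show "AE x in lborel. norm ((indicator (boundary_strip \<Omega> (\<delta> l)) x * f x)\<^sup>2) \<le> (f x)\<^sup>2" for l
      by (rule AE_I2) (simp add: indicator_def)
    show "AE x in lborel. (\<lambda>l. (indicator (boundary_strip \<Omega> (\<delta> l)) x * f x)\<^sup>2) \<longlonglongrightarrow> 0"
    proof (rule AE_I2)
      fix x
      have "eventually (\<lambda>l. x \<notin> boundary_strip \<Omega> (\<delta> l)) sequentially"
      proof (cases "x \<in> \<Omega>")
        case True
        then obtain d where d: "d > 0" "ball x d \<subseteq> \<Omega>" using \<Omega> openE by blast
        have "eventually (\<lambda>l. \<delta> l < d) sequentially" using \<delta> d(1) by (rule order_tendstoD)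
        then show ?thesis
        proof eventually_elim
          case (elim l)
          show ?case
          proof
            assume "x \<in> boundary_strip \<Omega> (\<delta> l)"
            then obtain y where "y \<notin> \<Omega>" "dist y x < \<delta> l" by (auto simp: boundary_strip_def)
            then have "y \<in> ball x d" using elim by (simp add: dist_commute)
            then show False using d \<open>y \<notin> \<Omega>\<close> by blast
          qed
        qed
      qed (simp add: boundary_strip_def)
      then show "(\<lambda>l. (indicator (boundary_strip \<Omega> (\<delta> l)) x * f x)\<^sup>2) \<longlonglongrightarrow> 0"
        by (intro tendsto_eventually) (auto elim: eventually_mono)
    qed
  qed auto
  then have "(\<lambda>l. \<integral>x. (indicator (boundary_strip \<Omega> (\<delta> l)) x * f x)\<^sup>2 \<partial>lborel) \<longlonglongrightarrow> 0" by simp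
  from tendsto_real_sqrt[OF this] show ?thesis by (simp add: l2n_def)
qed

lemma sqrt_add_le: "0 \<le> x \<Longrightarrow> 0 \<le> y \<Longrightarrow> sqrt (x + y) \<le> sqrt x + sqrt y"
  by (rule real_le_lsqrt) (auto simp: power2_sum)

lemma sqrt_sum_squares_le_sum:
  assumes "\<And>i. i \<in> I \<Longrightarrow> 0 \<le> y i"
  shows "sqrt (\<Sum>i\<in>I. (y i)\<^sup>2) \<le> (\<Sum>i\<in>I. y i :: real)"
  using L2_set_le_sum[of I y] assms by (simp add: L2_set_def)

text \<open>
  Multiply \<open>U\<close> by the cutoff \<open>\<psi>\<close>. The product is a test function, so the identity holds for it, and what remains
  is supported in the strip of width \<open>\<delta>\<close>: the terms with \<open>1 - \<psi>\<close>, and the term with the gradient of \<open>\<psi>\<close>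
  times \<open>U\<close>. The latter carries a factor \<open>1/\<delta>\<close>, which is compensated by the strip estimate for \<open>U\<close> up to the
  term \<open>sqrt (T / \<delta>)\<close>, where \<open>T\<close> is the boundary integral of \<open>U^2\<close>. The point of the estimate is that \<open>a\<close> and \<open>b\<close>
  enter only through their norms on the strip.
\<close>

lemma weak_identity_smooth_estimate:
  fixes \<Omega> :: "(real^'n) set"
  assumes n: "CARD('n) \<ge> 2" and \<Omega>: "open \<Omega>" "bounded \<Omega>" and k: "k \<ge> 1" "Ck_boundary k \<Omega>"
  shows "\<exists>C \<epsilon>0. C \<ge> 0 \<and> \<epsilon>0 > 0 \<and> (\<forall>a b U \<delta> T. 0 < \<delta> \<longrightarrow> \<delta> < \<epsilon>0 \<longrightarrow> sqint lborel a \<longrightarrow>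
     (\<forall>j. sqint lborel (b j)) \<longrightarrow>
     (\<forall>w\<in>test_funs \<Omega>. (\<integral>x. a x * w x + (\<Sum>j\<in>UNIV. b j x * dir_deriv (axis j 1) w x) \<partial>lborel) = 0) \<longrightarrow>
     smooth_fun U \<longrightarrow> T \<ge> 0 \<longrightarrow> (\<integral>\<^sup>+x\<in>frontier \<Omega>. ennreal ((U x)\<^sup>2) \<partial>surface_measure) = ennreal T \<longrightarrow>
     \<bar>\<integral>x. indicator \<Omega> x * (a x * U x + (\<Sum>j\<in>UNIV. b j x * dir_deriv (axis j 1) U x)) \<partial>lborel\<bar>
      \<le> C * (l2n lborel (\<lambda>x. indicator (boundary_strip \<Omega> \<delta>) x * a x)
             + (\<Sum>j\<in>UNIV. l2n lborel (\<lambda>x. indicator (boundary_strip \<Omega> \<delta>) x * b j x)))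
          * (l2n lborel (\<lambda>x. indicator \<Omega> x * U x)
             + (\<Sum>j\<in>UNIV. l2n lborel (\<lambda>x. indicator \<Omega> x * dir_deriv (axis j 1) U x)) + sqrt (T / \<delta>)))"
proof -
  obtain K \<epsilon>0 where K: "K \<ge> 0" "\<epsilon>0 > 0" and strip: "\<forall>\<epsilon> U. 0 < \<epsilon> \<longrightarrow> \<epsilon> < \<epsilon>0 \<longrightarrow> smooth_fun U \<longrightarrow>
     (\<integral>\<^sup>+x\<in>boundary_strip \<Omega> \<epsilon>. ennreal ((U x)\<^sup>2) \<partial>lborel)
      \<le> ennreal (K * \<epsilon>) * (\<integral>\<^sup>+x\<in>frontier \<Omega>. ennreal ((U x)\<^sup>2) \<partial>surface_measure)
        + ennreal (K * \<epsilon>\<^sup>2) * (\<integral>\<^sup>+x\<in>\<Omega>. ennreal (\<Sum>j\<in>UNIV. (dir_deriv (axis j 1) U x)\<^sup>2) \<partial>lborel)"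
    using boundary_strip_estimate[OF n \<Omega> k] by (elim exE conjE)
  obtain C0 :: real where C0: "C0 \<ge> 0" and cutoff: "\<And>(\<Omega> :: (real^'n) set) \<delta>. open \<Omega> \<Longrightarrow> bounded \<Omega> \<Longrightarrow> \<delta> > 0 \<Longrightarrow> \<exists>\<psi>\<in>test_funs \<Omega>.
       (\<forall>x. \<bar>\<psi> x\<bar> \<le> C0) \<and> (\<forall>x i. \<bar>dir_deriv (axis i 1) \<psi> x\<bar> \<le> C0 / \<delta>) \<and>
       (\<forall>x\<in>\<Omega> - boundary_strip \<Omega> \<delta>. \<psi> x = 1 \<and> (\<forall>i. dir_deriv (axis i 1) \<psi> x = 0))"
    using smooth_cutoff[where 'n='n] by metis
  \<comment> \<open>\<open>C0 + 1\<close> bounds \<open>1 - \<psi>\<close>; \<open>C0 * sqrt K\<close> comes from the gradient of \<open>\<psi>\<close> and the strip estimate.\<close>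
  define C where "C = (C0 + 1) + C0 * sqrt K"
  have C: "C \<ge> 0" using C0 K by (simp add: C_def)
  have main: "\<bar>\<integral>x. indicator \<Omega> x * (a x * U x + (\<Sum>j\<in>UNIV. b j x * dir_deriv (axis j 1) U x)) \<partial>lborel\<bar>
      \<le> C * (l2n lborel (\<lambda>x. indicator (boundary_strip \<Omega> \<delta>) x * a x)
             + (\<Sum>j\<in>UNIV. l2n lborel (\<lambda>x. indicator (boundary_strip \<Omega> \<delta>) x * b j x)))
          * (l2n lborel (\<lambda>x. indicator \<Omega> x * U x)
             + (\<Sum>j\<in>UNIV. l2n lborel (\<lambda>x. indicator \<Omega> x * dir_deriv (axis j 1) U x)) + sqrt (T / \<delta>))"
    if \<delta>: "0 < \<delta>" "\<delta> < \<epsilon>0" and a: "sqint lborel a" and b: "\<forall>j. sqint lborel (b j)"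
      and id: "\<forall>w\<in>test_funs \<Omega>. (\<integral>x. a x * w x + (\<Sum>j\<in>UNIV. b j x * dir_deriv (axis j 1) w x) \<partial>lborel) = 0"
      and U: "smooth_fun U" and T: "T \<ge> 0"
        "(\<integral>\<^sup>+x\<in>frontier \<Omega>. ennreal ((U x)\<^sup>2) \<partial>surface_measure) = ennreal T"
    for a b U \<delta> T
  proof -
    define S where "S = boundary_strip \<Omega> \<delta>"
    have S\<Omega>: "S \<subseteq> \<Omega>" by (auto simp: S_def boundary_strip_def)
    have [measurable]: "S \<in> sets borel" "\<Omega> \<in> sets borel"
      using open_boundary_strip[OF \<Omega>(1)] \<Omega> by (auto simp: S_def)
    have [measurable]: "U \<in> borel_measurable borel" "\<And>e. dir_deriv e U \<in> borel_measurable borel"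
      using U by (auto intro: smooth_measurable smooth_dir_deriv)
    have UL: "sqint lborel (\<lambda>x. indicator \<Omega> x * U x)"
      "\<And>e. sqint lborel (\<lambda>x. indicator \<Omega> x * dir_deriv e U x)"
      using U \<Omega> by (auto intro: sqint_smooth_on_bounded smooth_dir_deriv)
    define N0 where "N0 = l2n lborel (\<lambda>x. indicator \<Omega> x * U x)"
    define N1 where "N1 j = l2n lborel (\<lambda>x. indicator \<Omega> x * dir_deriv (axis j 1) U x)" for j
    define N where "N = N0 + (\<Sum>j\<in>UNIV. N1 j) + sqrt (T / \<delta>)"
    have nn: "N0 \<ge> 0" "\<And>j. N1 j \<ge> 0" "sqrt (T / \<delta>) \<ge> 0" using T \<delta> by (auto simp: N0_def N1_def)
    have N1s: "N1 j \<le> (\<Sum>j\<in>UNIV. N1 j)" for j by (rule member_le_sum) (use nn in auto)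
    have Ns0: "0 \<le> (\<Sum>j\<in>UNIV. N1 j)" by (rule sum_nonneg) (use nn in auto)
    have N_ge: "N0 \<le> N" "N1 j \<le> N" "0 \<le> N" for j
      using nn(1,3) Ns0 N1s[of j] unfolding N_def by linarith+
    have SU: "sqint lborel (\<lambda>x. indicator S x * U x)"
      by (rule sqint_dominated(1)[OF UL(1)]) (use S\<Omega> in \<open>auto simp: indicator_def\<close>)
    have SU_le: "l2n lborel (\<lambda>x. indicator S x * U x) \<le> \<delta> * sqrt K * N"
    proof -
      have sq: "(\<lambda>x. (indicator A x * f x)\<^sup>2) = (\<lambda>x. indicator A x * (f x)\<^sup>2)" for A and f :: "real^'n \<Rightarrow> real"
        by (auto simp: indicator_def)
      have i1: "integrable lborel (\<lambda>x. indicator S x * (U x)\<^sup>2)" using SU by (simp add: sqint_def sq)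
      have i2: "integrable lborel (\<lambda>x. indicator \<Omega> x * (dir_deriv (axis j 1) U x)\<^sup>2)" for j
        using UL(2)[of "axis j 1"] by (simp add: sqint_def sq)
      have D: "(\<integral>\<^sup>+x\<in>\<Omega>. ennreal (\<Sum>j\<in>UNIV. (dir_deriv (axis j 1) U x)\<^sup>2) \<partial>lborel) = ennreal (\<Sum>j\<in>UNIV. (N1 j)\<^sup>2)"
      proof -
        have "(\<integral>\<^sup>+x\<in>\<Omega>. ennreal (\<Sum>j\<in>UNIV. (dir_deriv (axis j 1) U x)\<^sup>2) \<partial>lborel)
            = (\<integral>\<^sup>+x. ennreal (\<Sum>j\<in>UNIV. indicator \<Omega> x * (dir_deriv (axis j 1) U x)\<^sup>2) \<partial>lborel)"
          by (rule nn_integral_cong) (simp add: indicator_def)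
        also have "\<dots> = ennreal (\<integral>x. (\<Sum>j\<in>UNIV. indicator \<Omega> x * (dir_deriv (axis j 1) U x)\<^sup>2) \<partial>lborel)"
        proof (rule nn_integral_eq_integral)
          show "integrable lborel (\<lambda>x. \<Sum>j\<in>UNIV. indicator \<Omega> x * (dir_deriv (axis j 1) U x)\<^sup>2)"
            by (intro Bochner_Integration.integrable_sum i2)
          show "AE x in lborel. 0 \<le> (\<Sum>j\<in>UNIV. indicator \<Omega> x * (dir_deriv (axis j 1) U x)\<^sup>2)"
            by (rule AE_I2, rule sum_nonneg) simp
        qed
        also have "(\<integral>x. (\<Sum>j\<in>UNIV. indicator \<Omega> x * (dir_deriv (axis j 1) U x)\<^sup>2) \<partial>lborel) = (\<Sum>j\<in>UNIV. (N1 j)\<^sup>2)"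
          unfolding N1_def l2n_sq sq by (rule Bochner_Integration.integral_sum) (rule i2)
        finally show ?thesis .
      qed
      have "ennreal ((l2n lborel (\<lambda>x. indicator S x * U x))\<^sup>2) = (\<integral>\<^sup>+x. ennreal (indicator S x * (U x)\<^sup>2) \<partial>lborel)"
        unfolding l2n_sq sq by (rule nn_integral_eq_integral[symmetric, OF i1]) auto
      also have "\<dots> = (\<integral>\<^sup>+x\<in>S. ennreal ((U x)\<^sup>2) \<partial>lborel)"
        by (rule nn_integral_cong) (simp add: indicator_def)
      also have "\<dots> \<le> ennreal (K * \<delta>) * ennreal T + ennreal (K * \<delta>\<^sup>2) * ennreal (\<Sum>j\<in>UNIV. (N1 j)\<^sup>2)"
        using strip[rule_format, OF \<delta> U] unfolding S_def T(2) D .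
      also have "\<dots> = ennreal (K * \<delta> * T + K * \<delta>\<^sup>2 * (\<Sum>j\<in>UNIV. (N1 j)\<^sup>2))"
        using K \<delta> T by (simp add: ennreal_mult[symmetric] ennreal_plus[symmetric] sum_nonneg del: ennreal_plus)
      finally have "(l2n lborel (\<lambda>x. indicator S x * U x))\<^sup>2 \<le> K * \<delta> * T + K * \<delta>\<^sup>2 * (\<Sum>j\<in>UNIV. (N1 j)\<^sup>2)"
        using K \<delta> T by (subst (asm) ennreal_le_iff) (auto intro!: add_nonneg_nonneg mult_nonneg_nonneg sum_nonneg)
      also have "\<dots> = \<delta>\<^sup>2 * K * (T / \<delta> + (\<Sum>j\<in>UNIV. (N1 j)\<^sup>2))"
        using \<delta> by (simp add: power2_eq_square field_simps)
      finally have "l2n lborel (\<lambda>x. indicator S x * U x) \<le> sqrt (\<delta>\<^sup>2 * K * (T / \<delta> + (\<Sum>j\<in>UNIV. (N1 j)\<^sup>2)))"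
        by (rule real_le_rsqrt)
      also have "\<dots> = \<delta> * sqrt K * sqrt (T / \<delta> + (\<Sum>j\<in>UNIV. (N1 j)\<^sup>2))"
        using \<delta> by (simp add: real_sqrt_mult)
      also have "\<dots> \<le> \<delta> * sqrt K * N"
      proof (rule mult_left_mono)
        have "sqrt (T / \<delta> + (\<Sum>j\<in>UNIV. (N1 j)\<^sup>2)) \<le> sqrt (T / \<delta>) + sqrt (\<Sum>j\<in>UNIV. (N1 j)\<^sup>2)"
          using T \<delta> by (intro sqrt_add_le sum_nonneg) auto
        also have "\<dots> \<le> sqrt (T / \<delta>) + (\<Sum>j\<in>UNIV. N1 j)"
          using nn by (intro add_left_mono sqrt_sum_squares_le_sum) auto
        finally show "sqrt (T / \<delta> + (\<Sum>j\<in>UNIV. (N1 j)\<^sup>2)) \<le> N" using nn by (simp add: N_def)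
      qed (use \<delta> K in auto)
      finally show ?thesis .
    qed
    have Sa: "sqint lborel (\<lambda>x. indicator S x * a x)"
      using sqint_bounded_mult(1)[OF a, of "indicator S" 1] by (auto simp: indicator_def)
    have Sb: "sqint lborel (\<lambda>x. indicator S x * b j x)" for j
      using sqint_bounded_mult(1)[OF b[rule_format], of "indicator S" 1] by (auto simp: indicator_def)
    define \<omega>a where "\<omega>a = l2n lborel (\<lambda>x. indicator S x * a x)"
    define \<omega>b where "\<omega>b j = l2n lborel (\<lambda>x. indicator S x * b j x)" for j
    obtain \<psi> where \<psi>: "\<psi> \<in> test_funs \<Omega>" "\<And>x. \<bar>\<psi> x\<bar> \<le> C0"
      "\<And>x i. \<bar>dir_deriv (axis i 1) \<psi> x\<bar> \<le> C0 / \<delta>"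
      "\<And>x. x \<in> \<Omega> - S \<Longrightarrow> \<psi> x = 1" "\<And>x i. x \<in> \<Omega> - S \<Longrightarrow> dir_deriv (axis i 1) \<psi> x = 0"
      using cutoff[OF \<Omega> \<delta>(1)] unfolding S_def by blast
    have s\<psi>: "smooth_fun \<psi>" by (rule test_funs_smooth[OF \<psi>(1)])
    have [measurable]: "\<psi> \<in> borel_measurable borel" "\<And>e. dir_deriv e \<psi> \<in> borel_measurable borel"
      using s\<psi> by (auto intro: smooth_measurable smooth_dir_deriv)
    have out: "\<psi> x = 0" "dir_deriv e \<psi> x = 0" if "x \<notin> \<Omega>" for x e
      using that \<psi>(1) by (auto intro: test_funs_outside test_funs_dir_deriv)
    \<comment> \<open>\<open>F\<close> is the integrand for \<open>\<psi> U\<close>, whose integral vanishes, and \<open>H\<close> the one for \<open>U\<close>.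
       The pieces \<open>I1\<close>, \<open>I2\<close>, \<open>I3\<close> below make up their difference on the strip.\<close>
    define F where "F x = a x * (\<psi> x * U x) + (\<Sum>j\<in>UNIV. b j x * (\<psi> x * dir_deriv (axis j 1) U x + dir_deriv (axis j 1) \<psi> x * U x))" for x
    define H where "H x = indicator \<Omega> x * (a x * U x + (\<Sum>j\<in>UNIV. b j x * dir_deriv (axis j 1) U x))" for x
    have F0: "integral\<^sup>L lborel F = 0"
    proof -
      have d: "dir_deriv (axis j 1) (\<lambda>x. \<psi> x * U x) = (\<lambda>x. \<psi> x * dir_deriv (axis j 1) U x + dir_deriv (axis j 1) \<psi> x * U x)" for j
        by (intro dir_deriv_mult smooth_differentiable s\<psi> U)
      show ?thesis
        using bspec[OF id test_funs_mult[OF \<psi>(1) U]] unfolding d F_def[abs_def] .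
    qed
    have p1: "sqint lborel (\<lambda>x. (1 - \<psi> x) * (indicator \<Omega> x * U x))"
       "l2n lborel (\<lambda>x. (1 - \<psi> x) * (indicator \<Omega> x * U x)) \<le> (C0 + 1) * N0"
    proof -
      have B: "\<bar>1 - \<psi> x\<bar> \<le> C0 + 1" for x using \<psi>(2)[of x] by linarith
      show "sqint lborel (\<lambda>x. (1 - \<psi> x) * (indicator \<Omega> x * U x))"
       "l2n lborel (\<lambda>x. (1 - \<psi> x) * (indicator \<Omega> x * U x)) \<le> (C0 + 1) * N0"
        unfolding N0_def by (rule sqint_bounded_mult[OF UL(1) _ B]; simp)+
    qed
    have p2: "sqint lborel (\<lambda>x. (1 - \<psi> x) * (indicator \<Omega> x * dir_deriv (axis j 1) U x))"
       "l2n lborel (\<lambda>x. (1 - \<psi> x) * (indicator \<Omega> x * dir_deriv (axis j 1) U x)) \<le> (C0 + 1) * N1 j" for j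
    proof -
      have B: "\<bar>1 - \<psi> x\<bar> \<le> C0 + 1" for x using \<psi>(2)[of x] by linarith
      show "sqint lborel (\<lambda>x. (1 - \<psi> x) * (indicator \<Omega> x * dir_deriv (axis j 1) U x))"
       "l2n lborel (\<lambda>x. (1 - \<psi> x) * (indicator \<Omega> x * dir_deriv (axis j 1) U x)) \<le> (C0 + 1) * N1 j"
        unfolding N1_def by (rule sqint_bounded_mult[OF UL(2) _ B]; simp)+
    qed
    have p3: "sqint lborel (\<lambda>x. dir_deriv (axis j 1) \<psi> x * (indicator S x * U x))"
       "l2n lborel (\<lambda>x. dir_deriv (axis j 1) \<psi> x * (indicator S x * U x)) \<le> C0 * sqrt K * N" for j
    proof -
      show "sqint lborel (\<lambda>x. dir_deriv (axis j 1) \<psi> x * (indicator S x * U x))"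
        by (rule sqint_bounded_mult(1)[OF SU _ \<psi>(3)]; simp)
      have "l2n lborel (\<lambda>x. dir_deriv (axis j 1) \<psi> x * (indicator S x * U x)) \<le> (C0 / \<delta>) * l2n lborel (\<lambda>x. indicator S x * U x)"
        by (rule sqint_bounded_mult(2)[OF SU _ \<psi>(3)]; simp)
      also have "\<dots> \<le> (C0 / \<delta>) * (\<delta> * sqrt K * N)" using C0 \<delta> by (intro mult_left_mono SU_le) auto
      also have "\<dots> = C0 * sqrt K * N" using \<delta> by simp
      finally show "l2n lborel (\<lambda>x. dir_deriv (axis j 1) \<psi> x * (indicator S x * U x)) \<le> C0 * sqrt K * N" .
    qed
    define I1 where "I1 x = (indicator S x * a x) * ((1 - \<psi> x) * (indicator \<Omega> x * U x))" for x
    define I2 where "I2 j x = (indicator S x * b j x) * ((1 - \<psi> x) * (indicator \<Omega> x * dir_deriv (axis j 1) U x))" for j x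
    define I3 where "I3 j x = (indicator S x * b j x) * (dir_deriv (axis j 1) \<psi> x * (indicator S x * U x))" for j x
    have int: "integrable lborel I1" "integrable lborel (I2 j)" "integrable lborel (I3 j)" for j
      unfolding I1_def I2_def I3_def by (intro sqint_mult_integrable Sa Sb p1 p2 p3)+
    have HF: "H x = F x + (I1 x + (\<Sum>j\<in>UNIV. I2 j x - I3 j x))" for x
    proof -
      consider "x \<notin> \<Omega>" | "x \<in> \<Omega> - S" | "x \<in> S" by blast
      then show ?thesis
      proof cases
        case 1
        then show ?thesis using S\<Omega> by (auto simp: H_def F_def I1_def I2_def I3_def out indicator_def)
      next
        case 2
        then show ?thesis by (auto simp: H_def F_def I1_def I2_def I3_def \<psi>(4,5) indicator_def)
      next
        case 3
        then have "x \<in> \<Omega>" using S\<Omega> by blast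
        have "(\<Sum>j\<in>UNIV. b j x * (\<psi> x * dir_deriv (axis j 1) U x + dir_deriv (axis j 1) \<psi> x * U x)) + (\<Sum>j\<in>UNIV. I2 j x - I3 j x)
            = (\<Sum>j\<in>UNIV. b j x * dir_deriv (axis j 1) U x)"
          unfolding sum.distrib[symmetric]
          by (rule sum.cong) (use 3 \<open>x \<in> \<Omega>\<close> in \<open>simp_all add: I2_def I3_def algebra_simps\<close>)
        moreover have "a x * (\<psi> x * U x) + I1 x = a x * U x"
          using 3 \<open>x \<in> \<Omega>\<close> by (simp add: I1_def algebra_simps)
        ultimately show ?thesis using \<open>x \<in> \<Omega>\<close> by (simp add: H_def F_def)
      qed
    qed
    have intF: "integrable lborel F"
    proof -
      have s1: "sqint lborel (\<lambda>x. \<psi> x * (indicator \<Omega> x * f x))" if "sqint lborel (\<lambda>x. indicator \<Omega> x * f x)" for f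
        by (rule sqint_bounded_mult(1)[OF that _ \<psi>(2)]) simp
      have s2: "sqint lborel (\<lambda>x. dir_deriv (axis j 1) \<psi> x * (indicator \<Omega> x * U x))" for j
        by (rule sqint_bounded_mult(1)[OF UL(1) _ \<psi>(3)]) simp
      have e1: "(\<lambda>x. \<psi> x * (indicator \<Omega> x * f x)) = (\<lambda>x. \<psi> x * f x)" for f :: "real^'n \<Rightarrow> real"
      proof
        show "\<psi> x * (indicator \<Omega> x * f x) = \<psi> x * f x" for x by (cases "x \<in> \<Omega>") (simp_all add: out)
      qed
      have e2: "(\<lambda>x. dir_deriv e \<psi> x * (indicator \<Omega> x * f x)) = (\<lambda>x. dir_deriv e \<psi> x * f x)" for f :: "real^'n \<Rightarrow> real" and e
      proof
        show "dir_deriv e \<psi> x * (indicator \<Omega> x * f x) = dir_deriv e \<psi> x * f x" for x by (cases "x \<in> \<Omega>") (simp_all add: out)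
      qed
      show ?thesis
        unfolding F_def[abs_def]
        by (intro Bochner_Integration.integrable_add Bochner_Integration.integrable_sum sqint_mult_integrable
            sqint_add a b[rule_format] s1[OF UL(1), unfolded e1] s1[OF UL(2), unfolded e1] s2[unfolded e2])
    qed
    have "integral\<^sup>L lborel H = integral\<^sup>L lborel F + (integral\<^sup>L lborel I1 + (\<Sum>j\<in>UNIV. integral\<^sup>L lborel (I2 j) - integral\<^sup>L lborel (I3 j)))"
      unfolding HF[abs_def] using intF int by simp
    then have "\<bar>integral\<^sup>L lborel H\<bar> \<le> \<bar>integral\<^sup>L lborel I1\<bar> + \<bar>\<Sum>j\<in>UNIV. integral\<^sup>L lborel (I2 j) - integral\<^sup>L lborel (I3 j)\<bar>"
      using F0 by simp
    also have "\<dots> \<le> \<bar>integral\<^sup>L lborel I1\<bar> + (\<Sum>j\<in>UNIV. \<bar>integral\<^sup>L lborel (I2 j)\<bar> + \<bar>integral\<^sup>L lborel (I3 j)\<bar>)"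
      by (intro add_left_mono order_trans[OF sum_abs] sum_mono abs_triangle_ineq4)
    also have "\<dots> \<le> C * \<omega>a * N + (\<Sum>j\<in>UNIV. C * \<omega>b j * N)"
    proof (intro add_mono sum_mono)
      have "\<bar>integral\<^sup>L lborel I1\<bar> \<le> \<omega>a * l2n lborel (\<lambda>x. (1 - \<psi> x) * (indicator \<Omega> x * U x))"
        unfolding I1_def \<omega>a_def by (rule Cauchy_Schwarz_integral[OF Sa p1(1)])
      also have "\<dots> \<le> \<omega>a * ((C0 + 1) * N0)" unfolding \<omega>a_def by (intro mult_left_mono p1) simp
      also have "\<dots> \<le> \<omega>a * (C * N)"
        unfolding \<omega>a_def using C0 K N_ge nn by (intro mult_left_mono mult_mono) (auto simp: C_def)
      finally show "\<bar>integral\<^sup>L lborel I1\<bar> \<le> C * \<omega>a * N" by (simp add: mult_ac)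
      fix j
      have "\<bar>integral\<^sup>L lborel (I2 j)\<bar> \<le> \<omega>b j * l2n lborel (\<lambda>x. (1 - \<psi> x) * (indicator \<Omega> x * dir_deriv (axis j 1) U x))"
        unfolding I2_def \<omega>b_def by (rule Cauchy_Schwarz_integral[OF Sb p2(1)])
      also have "\<dots> \<le> \<omega>b j * ((C0 + 1) * N1 j)" unfolding \<omega>b_def by (intro mult_left_mono p2) simp
      also have "\<dots> \<le> \<omega>b j * ((C0 + 1) * N)"
        unfolding \<omega>b_def using C0 N_ge by (intro mult_left_mono) auto
      finally have 2: "\<bar>integral\<^sup>L lborel (I2 j)\<bar> \<le> \<omega>b j * ((C0 + 1) * N)" .
      have "\<bar>integral\<^sup>L lborel (I3 j)\<bar> \<le> \<omega>b j * l2n lborel (\<lambda>x. dir_deriv (axis j 1) \<psi> x * (indicator S x * U x))"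
        unfolding I3_def \<omega>b_def by (rule Cauchy_Schwarz_integral[OF Sb p3(1)])
      also have "\<dots> \<le> \<omega>b j * (C0 * sqrt K * N)" unfolding \<omega>b_def by (intro mult_left_mono p3) simp
      finally have "\<bar>integral\<^sup>L lborel (I2 j)\<bar> + \<bar>integral\<^sup>L lborel (I3 j)\<bar>
          \<le> \<omega>b j * ((C0 + 1) * N) + \<omega>b j * (C0 * sqrt K * N)" using 2 by linarith
      also have "\<dots> = C * \<omega>b j * N" by (simp add: C_def algebra_simps)
      finally show "\<bar>integral\<^sup>L lborel (I2 j)\<bar> + \<bar>integral\<^sup>L lborel (I3 j)\<bar> \<le> C * \<omega>b j * N" .
    qed
    also have "\<dots> = C * (\<omega>a + (\<Sum>j\<in>UNIV. \<omega>b j)) * N"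
      by (simp add: distrib_left distrib_right sum_distrib_left sum_distrib_right)
    finally show ?thesis
      unfolding H_def[abs_def] N_def N0_def N1_def \<omega>a_def \<omega>b_def S_def .
  qed
  show ?thesis
    by (rule exI[of _ C], rule exI[of _ \<epsilon>0], intro conjI allI impI C K(2), rule main)
qed

text \<open>
  Approximate \<open>h\<close> by smooth \<open>U m\<close>. For fixed \<open>\<delta>\<close> the boundary integrals of \<open>U m\<close> tend to zero, which leaves the bound
  \<open>C \<omega>(\<delta>) M\<close> with \<open>\<omega>(\<delta>)\<close> the norms of \<open>a\<close> and \<open>b\<close> on the strip; as \<open>\<delta>\<close> tends to zero, so does \<open>\<omega>(\<delta>)\<close>.
  The order of the two limits is essential because of the term \<open>sqrt (T / \<delta>)\<close>.
\<close>

lemma weak_identity_extends_to_zero_trace: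
  fixes \<Omega> :: "(real^'n) set"
  assumes n: "CARD('n) \<ge> 2" and \<Omega>: "open \<Omega>" "bounded \<Omega>" and k: "k \<ge> 1" "Ck_boundary k \<Omega>"
    and a: "sqint lborel a" and b: "\<And>j. sqint lborel (b j)"
    and id: "\<And>w. w \<in> test_funs \<Omega> \<Longrightarrow>
      (\<integral>x. a x * w x + (\<Sum>j\<in>UNIV. b j x * dir_deriv (axis j 1) w x) \<partial>lborel) = 0"
    and h: "has_trace \<Omega> h (\<lambda>_. 0)" and G: "is_weak_gradient \<Omega> h G"
  shows "(\<integral>x. indicator \<Omega> x * (a x * h x + (\<Sum>j\<in>UNIV. b j x * G x $ j)) \<partial>lborel) = 0"
proof -
  obtain C \<epsilon>0 where C: "C \<ge> 0" "\<epsilon>0 > 0" and est: "\<forall>a b U \<delta> T. 0 < \<delta> \<longrightarrow> \<delta> < \<epsilon>0 \<longrightarrow> sqint lborel a \<longrightarrow>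
     (\<forall>j. sqint lborel (b j)) \<longrightarrow>
     (\<forall>w\<in>test_funs \<Omega>. (\<integral>x. a x * w x + (\<Sum>j\<in>UNIV. b j x * dir_deriv (axis j 1) w x) \<partial>lborel) = 0) \<longrightarrow>
     smooth_fun U \<longrightarrow> T \<ge> 0 \<longrightarrow> (\<integral>\<^sup>+x\<in>frontier \<Omega>. ennreal ((U x)\<^sup>2) \<partial>surface_measure) = ennreal T \<longrightarrow>
     \<bar>\<integral>x. indicator \<Omega> x * (a x * U x + (\<Sum>j\<in>UNIV. b j x * dir_deriv (axis j 1) U x)) \<partial>lborel\<bar>
      \<le> C * (l2n lborel (\<lambda>x. indicator (boundary_strip \<Omega> \<delta>) x * a x)
             + (\<Sum>j\<in>UNIV. l2n lborel (\<lambda>x. indicator (boundary_strip \<Omega> \<delta>) x * b j x)))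
          * (l2n lborel (\<lambda>x. indicator \<Omega> x * U x)
             + (\<Sum>j\<in>UNIV. l2n lborel (\<lambda>x. indicator \<Omega> x * dir_deriv (axis j 1) U x)) + sqrt (T / \<delta>))"
    using weak_identity_smooth_estimate[OF n \<Omega> k] by (elim exE conjE)
  obtain U :: "nat \<Rightarrow> real^'n \<Rightarrow> real" where U': "\<forall>m. smooth_fun (U m)"
    and U0: "(\<lambda>m. l2n lborel (\<lambda>x. indicator \<Omega> x * (U m x - h x))) \<longlonglongrightarrow> 0"
    and U1': "\<forall>j. (\<lambda>m. l2n lborel (\<lambda>x. indicator \<Omega> x * (dir_deriv (axis j 1) (U m) x - G x $ j))) \<longlonglongrightarrow> 0"
    and UT: "(\<lambda>m. \<integral>\<^sup>+x\<in>frontier \<Omega>. ennreal ((U m x)\<^sup>2) \<partial>surface_measure) \<longlonglongrightarrow> 0"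
    using zero_trace_approximation[OF \<Omega>(2,1) h G] by (elim exE conjE)
  note U = U'[rule_format] and U1 = U1'[rule_format]
  define e0 where "e0 m = l2n lborel (\<lambda>x. indicator \<Omega> x * (U m x - h x))" for m
  define e1 where "e1 j m = l2n lborel (\<lambda>x. indicator \<Omega> x * (dir_deriv (axis j 1) (U m) x - G x $ j))" for j m
  define T where "T m = (\<integral>\<^sup>+x\<in>frontier \<Omega>. ennreal ((U m x)\<^sup>2) \<partial>surface_measure)" for m
  define \<omega> where "\<omega> \<delta> = l2n lborel (\<lambda>x. indicator (boundary_strip \<Omega> \<delta>) x * a x)
             + (\<Sum>j\<in>UNIV. l2n lborel (\<lambda>x. indicator (boundary_strip \<Omega> \<delta>) x * b j x))" for \<delta>
  have \<omega>0: "0 \<le> \<omega> \<delta>" for \<delta> unfolding \<omega>_def by (auto intro!: add_nonneg_nonneg sum_nonneg)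
  define J where "J m = (\<integral>x. indicator \<Omega> x * (a x * U m x + (\<Sum>j\<in>UNIV. b j x * dir_deriv (axis j 1) (U m) x)) \<partial>lborel)" for m
  define J0 where "J0 = (\<integral>x. indicator \<Omega> x * (a x * h x + (\<Sum>j\<in>UNIV. b j x * G x $ j)) \<partial>lborel)"
  have hL: "sqint lborel (\<lambda>x. indicator \<Omega> x * h x)"
    using h by (simp add: has_trace_def W12_def L2_iff_sqint)
  have GL: "sqint lborel (\<lambda>x. indicator \<Omega> x * G x $ j)" for j
    using G by (auto simp: is_weak_gradient_def intro: L2_component)
  have UL: "sqint lborel (\<lambda>x. indicator \<Omega> x * U m x)"
    "sqint lborel (\<lambda>x. indicator \<Omega> x * dir_deriv e (U m) x)" for m e
    using U \<Omega> by (auto intro: sqint_smooth_on_bounded smooth_dir_deriv)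
  define M where "M = l2n lborel (\<lambda>x. indicator \<Omega> x * h x) + (\<Sum>j\<in>UNIV. l2n lborel (\<lambda>x. indicator \<Omega> x * G x $ j))"
  have expand: "(\<integral>x. indicator \<Omega> x * (a x * f x + (\<Sum>j\<in>UNIV. b j x * g j x)) \<partial>lborel)
      = (\<integral>x. a x * (indicator \<Omega> x * f x) \<partial>lborel) + (\<Sum>j\<in>UNIV. \<integral>x. b j x * (indicator \<Omega> x * g j x) \<partial>lborel)"
    if f: "sqint lborel (\<lambda>x. indicator \<Omega> x * f x)" and g: "\<And>j. sqint lborel (\<lambda>x. indicator \<Omega> x * g j x)" for f g
  proof -
    have "(\<integral>x. indicator \<Omega> x * (a x * f x + (\<Sum>j\<in>UNIV. b j x * g j x)) \<partial>lborel)
        = (\<integral>x. a x * (indicator \<Omega> x * f x) + (\<Sum>j\<in>UNIV. b j x * (indicator \<Omega> x * g j x)) \<partial>lborel)"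
      by (rule Bochner_Integration.integral_cong) (simp_all add: distrib_left sum_distrib_left mult.left_commute)
    also have "\<dots> = (\<integral>x. a x * (indicator \<Omega> x * f x) \<partial>lborel) + (\<integral>x. (\<Sum>j\<in>UNIV. b j x * (indicator \<Omega> x * g j x)) \<partial>lborel)"
      by (intro Bochner_Integration.integral_add Bochner_Integration.integrable_sum sqint_mult_integrable a b f g)
    also have "(\<integral>x. (\<Sum>j\<in>UNIV. b j x * (indicator \<Omega> x * g j x)) \<partial>lborel) = (\<Sum>j\<in>UNIV. \<integral>x. b j x * (indicator \<Omega> x * g j x) \<partial>lborel)"
      by (intro Bochner_Integration.integral_sum sqint_mult_integrable b g)
    finally show ?thesis .
  qed
  have conv: "(\<lambda>m. \<integral>x. c x * (indicator \<Omega> x * f m x) \<partial>lborel) \<longlonglongrightarrow> (\<integral>x. c x * (indicator \<Omega> x * g x) \<partial>lborel)"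
    if c: "sqint lborel c" and f: "\<And>m. sqint lborel (\<lambda>x. indicator \<Omega> x * f m x)" and g: "sqint lborel (\<lambda>x. indicator \<Omega> x * g x)"
      and l: "(\<lambda>m. l2n lborel (\<lambda>x. indicator \<Omega> x * (f m x - g x))) \<longlonglongrightarrow> 0" for c f g
  proof -
    have d: "sqint lborel (\<lambda>x. indicator \<Omega> x * (f m x - g x))" for m
      using sqint_diff[OF f g, of m] by (simp add: right_diff_distrib)
    have eq: "(\<integral>x. c x * (indicator \<Omega> x * f m x) \<partial>lborel) - (\<integral>x. c x * (indicator \<Omega> x * g x) \<partial>lborel)
        = (\<integral>x. c x * (indicator \<Omega> x * (f m x - g x)) \<partial>lborel)" for m
      by (subst Bochner_Integration.integral_diff[symmetric, OF sqint_mult_integrable[OF c f] sqint_mult_integrable[OF c g]])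
        (simp add: algebra_simps)
    have "(\<lambda>m. (\<integral>x. c x * (indicator \<Omega> x * f m x) \<partial>lborel) - (\<integral>x. c x * (indicator \<Omega> x * g x) \<partial>lborel)) \<longlonglongrightarrow> 0"
      unfolding eq
    proof (rule tendsto_rabs_zero_cancel, rule tendsto_sandwich[OF _ _ tendsto_const])
      show "(\<lambda>m. l2n lborel c * l2n lborel (\<lambda>x. indicator \<Omega> x * (f m x - g x))) \<longlonglongrightarrow> 0"
        by (rule tendsto_mult_right_zero[OF l])
      show "\<forall>\<^sub>F m in sequentially. \<bar>\<integral>x. c x * (indicator \<Omega> x * (f m x - g x)) \<partial>lborel\<bar>
          \<le> l2n lborel c * l2n lborel (\<lambda>x. indicator \<Omega> x * (f m x - g x))"
        by (intro always_eventually allI Cauchy_Schwarz_integral c d)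
    qed (auto intro: always_eventually)
    then show ?thesis by (simp add: LIM_zero_iff)
  qed
  have J: "J \<longlonglongrightarrow> J0"
    unfolding J_def[abs_def] J0_def expand[OF UL] expand[OF hL GL]
    by (intro tendsto_add tendsto_sum conv a b UL hL GL U0 U1)
  have bound: "\<bar>J0\<bar> \<le> C * \<omega> \<delta> * M" if \<delta>: "0 < \<delta>" "\<delta> < \<epsilon>0" for \<delta>
  proof -
    have Tfin: "\<forall>\<^sub>F m in sequentially. T m < 1"
      using UT unfolding T_def by (rule order_tendstoD) simp
    have "\<forall>\<^sub>F m in sequentially. \<bar>J m\<bar> \<le> C * \<omega> \<delta> * (M + (e0 m + (\<Sum>j\<in>UNIV. e1 j m)) + sqrt (enn2real (T m) / \<delta>))"
      using Tfin
    proof eventually_elim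
      case (elim m)
      then have "T m < top" using order_less_trans[OF _ ennreal_one_less_top] by blast
      then have Tm: "T m = ennreal (enn2real (T m))" by simp
      have "\<bar>J m\<bar> \<le> C * \<omega> \<delta> * (l2n lborel (\<lambda>x. indicator \<Omega> x * U m x)
             + (\<Sum>j\<in>UNIV. l2n lborel (\<lambda>x. indicator \<Omega> x * dir_deriv (axis j 1) (U m) x)) + sqrt (enn2real (T m) / \<delta>))"
        unfolding J_def \<omega>_def
        using est[rule_format, OF \<delta> a b id U enn2real_nonneg Tm[unfolded T_def]] unfolding T_def .
      also have "\<dots> \<le> C * \<omega> \<delta> * (M + (e0 m + (\<Sum>j\<in>UNIV. e1 j m)) + sqrt (enn2real (T m) / \<delta>))"
      proof (rule mult_left_mono)
        have tri: "l2n lborel (\<lambda>x. indicator \<Omega> x * f x) \<le> l2n lborel (\<lambda>x. indicator \<Omega> x * g x) + l2n lborel (\<lambda>x. indicator \<Omega> x * (f x - g x))"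
          if "sqint lborel (\<lambda>x. indicator \<Omega> x * f x)" "sqint lborel (\<lambda>x. indicator \<Omega> x * g x)" for f g
        proof -
          have "sqint lborel (\<lambda>x. indicator \<Omega> x * (f x - g x))"
            using sqint_diff[OF that] by (simp add: right_diff_distrib)
          from l2n_triangle[OF that(2) this] show ?thesis by (simp add: algebra_simps)
        qed
        have "l2n lborel (\<lambda>x. indicator \<Omega> x * U m x) \<le> l2n lborel (\<lambda>x. indicator \<Omega> x * h x) + e0 m"
          unfolding e0_def by (rule tri[OF UL(1) hL])
        moreover have "(\<Sum>j\<in>UNIV. l2n lborel (\<lambda>x. indicator \<Omega> x * dir_deriv (axis j 1) (U m) x))
            \<le> (\<Sum>j\<in>UNIV. l2n lborel (\<lambda>x. indicator \<Omega> x * G x $ j) + e1 j m)"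
          unfolding e1_def by (intro sum_mono tri UL GL)
        ultimately show "l2n lborel (\<lambda>x. indicator \<Omega> x * U m x)
             + (\<Sum>j\<in>UNIV. l2n lborel (\<lambda>x. indicator \<Omega> x * dir_deriv (axis j 1) (U m) x)) + sqrt (enn2real (T m) / \<delta>)
            \<le> M + (e0 m + (\<Sum>j\<in>UNIV. e1 j m)) + sqrt (enn2real (T m) / \<delta>)"
          by (simp add: M_def sum.distrib)
      qed (use C \<omega>0 in auto)
      finally show ?case .
    qed
    moreover have "(\<lambda>m. C * \<omega> \<delta> * (M + (e0 m + (\<Sum>j\<in>UNIV. e1 j m)) + sqrt (enn2real (T m) / \<delta>)))
        \<longlonglongrightarrow> C * \<omega> \<delta> * (M + (0 + (\<Sum>j\<in>(UNIV::'n set). 0)) + sqrt (0 / \<delta>))"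
    proof (intro tendsto_mult tendsto_add tendsto_sum tendsto_real_sqrt tendsto_divide tendsto_const)
      show "e0 \<longlonglongrightarrow> 0" using U0 by (simp add: e0_def[abs_def])
      show "(\<lambda>m. e1 j m) \<longlonglongrightarrow> 0" for j using U1 by (simp add: e1_def)
      show "(\<lambda>m. enn2real (T m)) \<longlonglongrightarrow> 0"
      proof (rule tendsto_enn2real)
        show "T \<longlonglongrightarrow> ennreal 0" using UT by (simp add: T_def[abs_def])
      qed simp
    qed (use \<delta> in auto)
    ultimately have "\<bar>J0\<bar> \<le> C * \<omega> \<delta> * (M + (0 + (\<Sum>j\<in>(UNIV::'n set). 0)) + sqrt (0 / \<delta>))"
      by (intro tendsto_le[OF sequentially_bot _ tendsto_rabs[OF J]]) auto
    then show ?thesis by simp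
  qed
  \<comment> \<open>A null sequence of widths in the range \<open>(0, \<epsilon>0)\<close> of the estimate.\<close>
  define \<delta> where "\<delta> l = \<epsilon>0 / (2 + real l)" for l
  have \<delta>: "0 < \<delta> l" "\<delta> l < \<epsilon>0" for l using C by (auto simp: \<delta>_def field_simps intro: add_pos_nonneg)
  have \<delta>0: "\<delta> \<longlonglongrightarrow> 0"
    unfolding \<delta>_def by (rule real_tendsto_divide_at_top[OF tendsto_const filterlim_tendsto_add_at_top[OF tendsto_const filterlim_real_sequentially]])
  have "(\<lambda>l. C * \<omega> (\<delta> l) * M) \<longlonglongrightarrow> C * (0 + (\<Sum>j\<in>(UNIV::'n set). 0)) * M"
    unfolding \<omega>_def
    by (intro tendsto_mult tendsto_const tendsto_add tendsto_sum boundary_strip_l2n_tendsto_0 \<Omega> a b \<delta>0)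
  then have "\<bar>J0\<bar> \<le> C * (0 + (\<Sum>j\<in>(UNIV::'n set). 0)) * M"
    by (rule LIMSEQ_le_const) (use bound \<delta> in blast)
  then show ?thesis by (simp add: J0_def)
qed

section \<open>Slices and products on space-time\<close>

lemma
  fixes f :: "'a::euclidean_space \<times> 'b::euclidean_space \<Rightarrow> real"
  assumes f: "integrable lborel f"
  shows lborel_AE_integrable_fst: "AE x in lborel. integrable lborel (\<lambda>y. f (x, y))"
    and lborel_AE_integrable_snd: "AE y in lborel. integrable lborel (\<lambda>x. f (x, y))"
    and lborel_integrable_fst: "integrable lborel (\<lambda>x. \<integral>y. f (x, y) \<partial>lborel)"
    and lborel_integrable_snd: "integrable lborel (\<lambda>y. \<integral>x. f (x, y) \<partial>lborel)"
    and lborel_integral_fst: "(\<integral>x. (\<integral>y. f (x, y) \<partial>lborel) \<partial>lborel) = integral\<^sup>L lborel f"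
    and lborel_integral_snd: "(\<integral>y. (\<integral>x. f (x, y) \<partial>lborel) \<partial>lborel) = integral\<^sup>L lborel f"
proof -
  have f': "integrable (lborel \<Otimes>\<^sub>M lborel) f" using f by (simp add: lborel_prod)
  have f'': "integrable (lborel \<Otimes>\<^sub>M lborel) (case_prod (\<lambda>x y. f (x, y)))" using f' by simp
  show "AE x in lborel. integrable lborel (\<lambda>y. f (x, y))"
    "integrable lborel (\<lambda>x. \<integral>y. f (x, y) \<partial>lborel)"
    by (rule lborel_pair.AE_integrable_fst'[OF f'] lborel_pair.integrable_fst'[OF f'])+
  show "AE y in lborel. integrable lborel (\<lambda>x. f (x, y))"
    "integrable lborel (\<lambda>y. \<integral>x. f (x, y) \<partial>lborel)"
    by (rule lborel_pair.AE_integrable_snd[OF f''] lborel_pair.integrable_snd[OF f''])+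
  show "(\<integral>x. (\<integral>y. f (x, y) \<partial>lborel) \<partial>lborel) = integral\<^sup>L lborel f"
    using lborel_pair.integral_fst'[OF f'] by (simp add: lborel_prod)
  show "(\<integral>y. (\<integral>x. f (x, y) \<partial>lborel) \<partial>lborel) = integral\<^sup>L lborel f"
    using lborel_pair.integral_snd[OF f''] by (simp add: lborel_prod)
qed

lemma integrable_tensor:
  fixes f :: "'a::euclidean_space \<Rightarrow> real" and g :: "'b::euclidean_space \<Rightarrow> real"
  assumes f: "integrable lborel f" and g: "integrable lborel g"
  shows "integrable lborel (\<lambda>z. f (fst z) * g (snd z))"
proof -
  have [measurable]: "f \<in> borel_measurable borel" "g \<in> borel_measurable borel"
    using f g by auto
  have "integrable (lborel \<Otimes>\<^sub>M lborel) (\<lambda>z. f (fst z) * g (snd z))"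
  proof (rule lborel_pair.Fubini_integrable)
    show "integrable lborel (\<lambda>x. \<integral>y. norm (f (fst (x, y)) * g (snd (x, y))) \<partial>lborel)"
      using f by (simp add: abs_mult)
    show "AE x in lborel. integrable lborel (\<lambda>y. f (fst (x, y)) * g (snd (x, y)))"
      using g by simp
  qed measurable
  then show ?thesis by (simp add: lborel_prod)
qed

lemma sqint_tensor:
  fixes f :: "'a::euclidean_space \<Rightarrow> real" and g :: "'b::euclidean_space \<Rightarrow> real"
  assumes f: "sqint lborel f" and g: "sqint lborel g"
  shows "sqint lborel (\<lambda>z. f (fst z) * g (snd z))"
proof (rule sqintI)
  have [measurable]: "f \<in> borel_measurable borel" "g \<in> borel_measurable borel"
    using f g by (auto simp: sqint_def)
  have "(\<lambda>z. f (fst z) * g (snd z)) \<in> borel_measurable (borel \<Otimes>\<^sub>M borel)" by measurable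
  then show "(\<lambda>z. f (fst z) * g (snd z)) \<in> borel_measurable lborel" by (simp add: borel_prod)
  show "integrable lborel (\<lambda>z. (f (fst z) * g (snd z))\<^sup>2)"
    using integrable_tensor[of "\<lambda>x. (f x)\<^sup>2" "\<lambda>x. (g x)\<^sup>2"] f g by (simp add: sqint_def power_mult_distrib)
qed

lemma slice_measurable:
  fixes F :: "'a::euclidean_space \<times> 'b::euclidean_space \<Rightarrow> real"
  assumes "F \<in> borel_measurable borel"
  shows "(\<lambda>y. F (x, y)) \<in> borel_measurable borel" "(\<lambda>x. F (x, y)) \<in> borel_measurable borel"
proof -
  have "F \<in> borel_measurable (borel \<Otimes>\<^sub>M borel)" using assms by (simp add: borel_prod)
  then show "(\<lambda>y. F (x, y)) \<in> borel_measurable borel" "(\<lambda>x. F (x, y)) \<in> borel_measurable borel"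
    by measurable
qed

lemma
  fixes F :: "'a::euclidean_space \<times> 'b::euclidean_space \<Rightarrow> real"
  assumes F: "sqint lborel F"
  shows sqint_AE_slice_fst: "AE x in lborel. sqint lborel (\<lambda>y. F (x, y))"
    and sqint_AE_slice_snd: "AE y in lborel. sqint lborel (\<lambda>x. F (x, y))"
proof -
  have m: "F \<in> borel_measurable borel" and i: "integrable lborel (\<lambda>z. (F z)\<^sup>2)"
    using F by (auto simp: sqint_def)
  show "AE x in lborel. sqint lborel (\<lambda>y. F (x, y))"
    using lborel_AE_integrable_fst[OF i] by eventually_elim (simp add: sqint_def slice_measurable[OF m])
  show "AE y in lborel. sqint lborel (\<lambda>x. F (x, y))"
    using lborel_AE_integrable_snd[OF i] by eventually_elim (simp add: sqint_def slice_measurable[OF m])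
qed

lemma sqint_swap:
  fixes F :: "'a::euclidean_space \<times> 'b::euclidean_space \<Rightarrow> real"
  assumes F: "sqint lborel F"
  shows "sqint lborel (\<lambda>z. F (snd z, fst z))"
proof (rule sqintI)
  have m: "F \<in> borel_measurable (borel \<Otimes>\<^sub>M borel)" and i: "integrable (lborel \<Otimes>\<^sub>M lborel) (\<lambda>z. (F z)\<^sup>2)"
    using F by (auto simp: sqint_def borel_prod lborel_prod)
  have "(\<lambda>z. F (snd z, fst z)) \<in> borel_measurable (borel \<Otimes>\<^sub>M borel)" using m by measurable
  then show "(\<lambda>z. F (snd z, fst z)) \<in> borel_measurable lborel" by (simp add: borel_prod)
  show "integrable lborel (\<lambda>z. (F (snd z, fst z))\<^sup>2)"
    using lborel_pair.integrable_product_swap[OF i] by (simp add: lborel_prod case_prod_unfold)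
qed

text \<open>
  By the Cauchy-Schwarz inequality in \<open>y\<close>, the square of the pairing is bounded by an integrable function of \<open>x\<close>.
\<close>

lemma sqint_pairing_snd:
  fixes F :: "'a::euclidean_space \<times> 'b::euclidean_space \<Rightarrow> real"
  assumes F: "sqint lborel F" and g: "sqint lborel g"
  shows "sqint lborel (\<lambda>x. \<integral>y. F (x, y) * g y \<partial>lborel)"
    and "AE x in lborel. (\<integral>y. F (x, y) * g y \<partial>lborel)\<^sup>2 \<le> (l2n lborel g)\<^sup>2 * (\<integral>y. (F (x, y))\<^sup>2 \<partial>lborel)"
proof -
  have i: "integrable lborel (\<lambda>z. (F z)\<^sup>2)" using F by (simp add: sqint_def)
  have [measurable]: "F \<in> borel_measurable (borel \<Otimes>\<^sub>M borel)" "g \<in> borel_measurable borel"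
    using F g by (auto simp: sqint_def borel_prod)
  show AE: "AE x in lborel. (\<integral>y. F (x, y) * g y \<partial>lborel)\<^sup>2 \<le> (l2n lborel g)\<^sup>2 * (\<integral>y. (F (x, y))\<^sup>2 \<partial>lborel)"
    using sqint_AE_slice_fst[OF F]
  proof eventually_elim
    case (elim x)
    have "\<bar>\<integral>y. F (x, y) * g y \<partial>lborel\<bar> \<le> l2n lborel (\<lambda>y. F (x, y)) * l2n lborel g"
      by (rule Cauchy_Schwarz_integral[OF elim g])
    then have "\<bar>\<integral>y. F (x, y) * g y \<partial>lborel\<bar>\<^sup>2 \<le> (l2n lborel (\<lambda>y. F (x, y)) * l2n lborel g)\<^sup>2"
      by (rule power_mono) simp
    then show ?case by (simp add: power_mult_distrib l2n_sq mult.commute)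
  qed
  show "sqint lborel (\<lambda>x. \<integral>y. F (x, y) * g y \<partial>lborel)"
  proof (rule sqintI)
    show m: "(\<lambda>x. \<integral>y. F (x, y) * g y \<partial>lborel) \<in> borel_measurable lborel" by measurable
    show "integrable lborel (\<lambda>x. (\<integral>y. F (x, y) * g y \<partial>lborel)\<^sup>2)"
    proof (rule Bochner_Integration.integrable_bound)
      show "integrable lborel (\<lambda>x. (l2n lborel g)\<^sup>2 * (\<integral>y. (F (x, y))\<^sup>2 \<partial>lborel))"
        by (intro integrable_mult_right lborel_integrable_fst[OF i])
      show "(\<lambda>x. (\<integral>y. F (x, y) * g y \<partial>lborel)\<^sup>2) \<in> borel_measurable lborel" using m by simp
      show "AE x in lborel. norm ((\<integral>y. F (x, y) * g y \<partial>lborel)\<^sup>2) \<le> norm ((l2n lborel g)\<^sup>2 * (\<integral>y. (F (x, y))\<^sup>2 \<partial>lborel))"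
        using AE by eventually_elim simp
    qed
  qed
qed

lemma sqint_pairing_fst:
  fixes F :: "'a::euclidean_space \<times> 'b::euclidean_space \<Rightarrow> real"
  assumes "sqint lborel F" "sqint lborel f"
  shows "sqint lborel (\<lambda>y. \<integral>x. F (x, y) * f x \<partial>lborel)"
  using sqint_pairing_snd(1)[OF sqint_swap[OF assms(1)] assms(2)] by simp

text \<open>
  Pairing a square integrable function on a product with a tensor product may be done in either order. This one
  statement serves to move between space-time integrals, time integrals of spatial pairings, and spatial
  pairings of time integrals.
\<close>

lemma Fubini_pairing:
  fixes F :: "'a::euclidean_space \<times> 'b::euclidean_space \<Rightarrow> real"
  assumes F: "sqint lborel F" and f: "sqint lborel f" and g: "sqint lborel g"
  shows "(\<integral>z. F z * (f (fst z) * g (snd z)) \<partial>lborel) = (\<integral>x. f x * (\<integral>y. F (x, y) * g y \<partial>lborel) \<partial>lborel)"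
    and "(\<integral>z. F z * (f (fst z) * g (snd z)) \<partial>lborel) = (\<integral>y. g y * (\<integral>x. F (x, y) * f x \<partial>lborel) \<partial>lborel)"
proof -
  have i: "integrable lborel (\<lambda>z. F z * (f (fst z) * g (snd z)))"
    by (rule sqint_mult_integrable[OF F sqint_tensor[OF f g]])
  have "(\<integral>y. F (x, y) * (f x * g y) \<partial>lborel) = f x * (\<integral>y. F (x, y) * g y \<partial>lborel)" for x
    by (subst integral_mult_right_zero[symmetric]) (simp add: mult_ac)
  then show "(\<integral>z. F z * (f (fst z) * g (snd z)) \<partial>lborel) = (\<integral>x. f x * (\<integral>y. F (x, y) * g y \<partial>lborel) \<partial>lborel)"
    using lborel_integral_fst[OF i] by simp
  have "(\<integral>x. F (x, y) * (f x * g y) \<partial>lborel) = g y * (\<integral>x. F (x, y) * f x \<partial>lborel)" for y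
    by (subst integral_mult_right_zero[symmetric]) (simp add: mult_ac)
  then show "(\<integral>z. F z * (f (fst z) * g (snd z)) \<partial>lborel) = (\<integral>y. g y * (\<integral>x. F (x, y) * f x \<partial>lborel) \<partial>lborel)"
    using lborel_integral_snd[OF i] by simp
qed

text \<open>
  The square of the integral is the integral of \<open>f(s) f(t)\<close> over the plane, and the halves \<open>s < t\<close> and \<open>t < s\<close>
  contribute equally by symmetry; the diagonal is negligible. This is \<open>\<integral> F' F = F^2 / 2\<close> for a primitive
  \<open>F\<close> of an integrable function.
\<close>

lemma triangle_integral:
  fixes f :: "real \<Rightarrow> real"
  assumes f: "integrable lborel f"
  shows "(\<integral>t. f t * (\<integral>s. indicator {..<t} s * f s \<partial>lborel) \<partial>lborel) = (\<integral>t. f t \<partial>lborel)\<^sup>2 / 2"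
proof -
  define F where "F z = f (fst z) * f (snd z)" for z
  have F: "integrable lborel F" unfolding F_def[abs_def] by (rule integrable_tensor[OF f f])
  define L where "L = {z :: real \<times> real. fst z < snd z}"
  define R where "R = {z :: real \<times> real. snd z < fst z}"
  have [measurable]: "L \<in> sets borel" "R \<in> sets borel"
    unfolding L_def R_def by (auto intro!: borel_open open_Collect_less continuous_intros)
  have iL: "integrable lborel (\<lambda>z. indicator L z * F z)" and iR: "integrable lborel (\<lambda>z. indicator R z * F z)"
    using integrable_mult_indicator[OF _ F, of L] integrable_mult_indicator[OF _ F, of R] by simp_all
  have swap: "integral\<^sup>L lborel (\<lambda>z. indicator R z * F z) = integral\<^sup>L lborel (\<lambda>z. indicator L z * F z)"
  proof -
    have "(\<lambda>z. indicator L z * F z) \<in> borel_measurable (lborel \<Otimes>\<^sub>M lborel)"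
      using iL by (simp add: lborel_prod)
    from lborel_pair.integral_product_swap[OF this]
    have "(\<integral>z. indicator L (snd z, fst z) * F (snd z, fst z) \<partial>lborel) = (\<integral>z. indicator L z * F z \<partial>lborel)"
      by (simp add: lborel_prod case_prod_unfold)
    moreover have "indicator L (snd z, fst z) * F (snd z, fst z) = indicator R z * F z" for z
      by (simp add: L_def R_def F_def indicator_def)
    ultimately show ?thesis by simp
  qed
  have "(\<integral>t. f t \<partial>lborel)\<^sup>2 = integral\<^sup>L lborel F"
    using lborel_integral_fst[OF F] by (simp add: F_def power2_eq_square)
  also have "\<dots> = (\<integral>z. indicator R z * F z + indicator L z * F z \<partial>lborel)"
    unfolding lborel_integral_fst[OF F, symmetric] lborel_integral_fst[OF Bochner_Integration.integrable_add[OF iR iL], symmetric]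
  proof (rule Bochner_Integration.integral_cong[OF refl])
    fix s
    show "(\<integral>t. F (s, t) \<partial>lborel) = (\<integral>t. indicator R (s, t) * F (s, t) + indicator L (s, t) * F (s, t) \<partial>lborel)"
    proof (rule integral_cong_AE)
      show "AE t in lborel. F (s, t) = indicator R (s, t) * F (s, t) + indicator L (s, t) * F (s, t)"
        using AE_lborel_singleton[of s] by eventually_elim (auto simp: L_def R_def indicator_def)
      show "(\<lambda>t. F (s, t)) \<in> borel_measurable lborel" using slice_measurable(1)[of F s] F by simp
      show "(\<lambda>t. indicator R (s, t) * F (s, t) + indicator L (s, t) * F (s, t)) \<in> borel_measurable lborel"
        using slice_measurable(1)[of "\<lambda>z. indicator R z * F z + indicator L z * F z" s] iL iR by simp
    qed
  qed
  also have "\<dots> = 2 * (\<integral>z. indicator L z * F z \<partial>lborel)"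
    using iL iR swap by simp
  also have "(\<integral>z. indicator L z * F z \<partial>lborel) = (\<integral>t. (\<integral>s. indicator L (s, t) * F (s, t) \<partial>lborel) \<partial>lborel)"
    by (rule lborel_integral_snd[OF iL, symmetric])
  also have "\<dots> = (\<integral>t. f t * (\<integral>s. indicator {..<t} s * f s \<partial>lborel) \<partial>lborel)"
  proof (rule Bochner_Integration.integral_cong[OF refl])
    fix t
    have "(\<integral>s. indicator L (s, t) * F (s, t) \<partial>lborel) = (\<integral>s. f t * (indicator {..<t} s * f s) \<partial>lborel)"
      by (rule Bochner_Integration.integral_cong[OF refl]) (simp add: L_def F_def indicator_def)
    then show "(\<integral>s. indicator L (s, t) * F (s, t) \<partial>lborel) = f t * (\<integral>s. indicator {..<t} s * f s \<partial>lborel)"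
      by simp
  qed
  finally show ?thesis by simp
qed

lemma smooth_fst_arg:
  fixes w :: "'a::euclidean_space \<Rightarrow> real"
  assumes "smooth_fun w"
  shows "smooth_fun (\<lambda>z :: 'a \<times> 'b::euclidean_space. w (fst z))"
proof -
  have D: "((\<lambda>z :: 'a \<times> 'b. w (fst z)) has_derivative (\<lambda>e. dir_deriv (fst e) w (fst z))) (at z)"
    if "w differentiable (at (fst z))" for w z
    by (rule has_derivative_compose[OF bounded_linear_imp_has_derivative[OF bounded_linear_fst] dir_deriv_has_derivative[OF that]])
  have "Ck k w \<Longrightarrow> Ck k (\<lambda>z :: 'a \<times> 'b. w (fst z))" for k
  proof (induction k arbitrary: w)
    case 0
    then show ?case by simp (rule continuous_on_compose2[of UNIV w]; auto intro!: continuous_intros)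
  next
    case (Suc k)
    have "dir_deriv e (\<lambda>z :: 'a \<times> 'b. w (fst z)) = (\<lambda>z. dir_deriv (fst e) w (fst z))" for e
      using Suc.prems by (intro ext dir_deriv_eqI D) auto
    moreover have "(\<lambda>z :: 'a \<times> 'b. w (fst z)) differentiable (at z)" for z
      using D[of w z] Suc.prems by (auto intro: differentiableI)
    ultimately show ?case using Suc by simp
  qed
  then show ?thesis using assms by (simp add: smooth_fun_def)
qed

lemma separated_test_fun:
  fixes w :: "real^'n \<Rightarrow> real" and \<theta> :: "real \<Rightarrow> real"
  assumes w: "w \<in> test_funs \<Omega>" and \<theta>: "\<theta> \<in> test_funs {0<..<T}"
  shows "(\<lambda>z. w (fst z) * \<theta> (snd z)) \<in> test_funs (cylinder \<Omega> T)"
    and "dir_deriv time_dir (\<lambda>z. w (fst z) * \<theta> (snd z)) = (\<lambda>z. w (fst z) * dir_deriv 1 \<theta> (snd z))"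
    and "dir_deriv (space_dir j) (\<lambda>z. w (fst z) * \<theta> (snd z)) = (\<lambda>z. dir_deriv (axis j 1) w (fst z) * \<theta> (snd z))"
proof -
  obtain K where K: "smooth_fun w" "compact K" "K \<subseteq> \<Omega>" "\<And>x. x \<notin> K \<Longrightarrow> w x = 0"
    using w by (elim test_funsE) blast
  obtain L where L: "smooth_fun \<theta>" "compact L" "L \<subseteq> {0<..<T}" "\<And>x. x \<notin> L \<Longrightarrow> \<theta> x = 0"
    using \<theta> by (elim test_funsE) blast
  have s\<theta>: "smooth_fun (\<lambda>z :: (real^'n) \<times> real. \<theta> (snd z))"
    using smooth_intros(4)[OF L(1), of 0 "(0 :: real^'n, 1 :: real)"] by (simp add: inner_prod_def)
  show "(\<lambda>z. w (fst z) * \<theta> (snd z)) \<in> test_funs (cylinder \<Omega> T)"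
  proof (rule test_funsI)
    show "smooth_fun (\<lambda>z :: (real^'n) \<times> real. w (fst z) * \<theta> (snd z))"
      by (intro smooth_intros(3) smooth_fst_arg K s\<theta>)
    show "compact (K \<times> L)" using K L by (intro compact_Times)
    show "K \<times> L \<subseteq> cylinder \<Omega> T" using K L by (auto simp: cylinder_def)
    show "w (fst z) * \<theta> (snd z) = 0" if "z \<notin> K \<times> L" for z
      using that K(4)[of "fst z"] L(4)[of "snd z"] by (cases z) auto
  qed
  have Dw: "((\<lambda>z :: (real^'n) \<times> real. w (fst z)) has_derivative (\<lambda>e. dir_deriv (fst e) w (fst z))) (at z)" for z
    by (rule has_derivative_compose[OF bounded_linear_imp_has_derivative[OF bounded_linear_fst]
          dir_deriv_has_derivative[OF smooth_differentiable[OF K(1)]]])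
  have D\<theta>: "((\<lambda>z :: (real^'n) \<times> real. \<theta> (snd z)) has_derivative (\<lambda>e. dir_deriv (snd e) \<theta> (snd z))) (at z)" for z
    by (rule has_derivative_compose[OF bounded_linear_imp_has_derivative[OF bounded_linear_snd]
          dir_deriv_has_derivative[OF smooth_differentiable[OF L(1)]]])
  have D0: "dir_deriv 0 f x = 0" if "smooth_fun f" for f :: "'c::euclidean_space \<Rightarrow> real" and x
    using linear_0[OF has_derivative_linear[OF dir_deriv_has_derivative[OF smooth_differentiable[OF that]]]] .
  have D: "dir_deriv e (\<lambda>z :: (real^'n) \<times> real. w (fst z) * \<theta> (snd z)) z
      = w (fst z) * dir_deriv (snd e) \<theta> (snd z) + dir_deriv (fst e) w (fst z) * \<theta> (snd z)" for e z
    by (rule dir_deriv_eqI) (rule has_derivative_mult[OF Dw D\<theta>])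
  show "dir_deriv time_dir (\<lambda>z. w (fst z) * \<theta> (snd z)) = (\<lambda>z. w (fst z) * dir_deriv 1 \<theta> (snd z))"
    by (rule ext) (simp add: D D0[OF K(1)])
  show "dir_deriv (space_dir j) (\<lambda>z. w (fst z) * \<theta> (snd z)) = (\<lambda>z. dir_deriv (axis j 1) w (fst z) * \<theta> (snd z))"
    by (rule ext) (simp add: D D0[OF L(1)])
qed

lemma test_funs_sqint:
  fixes \<phi> :: "'a::euclidean_space \<Rightarrow> real"
  shows "\<phi> \<in> test_funs U \<Longrightarrow> sqint lborel \<phi>"
proof (rule sqintI)
  assume \<phi>: "\<phi> \<in> test_funs U"
  show "\<phi> \<in> borel_measurable lborel" using smooth_measurable[OF test_funs_smooth[OF \<phi>]] by simp
  show "integrable lborel (\<lambda>x. (\<phi> x)\<^sup>2)"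
    using test_funs_integrable[OF test_funs_mult[OF \<phi> test_funs_smooth[OF \<phi>]]] by (simp add: power2_eq_square)
qed

section \<open>Weak derivatives in space-time and their slices\<close>

definition step_deriv :: "real \<Rightarrow> real" where
  "step_deriv = dir_deriv 1 smooth_step"

lemma smooth_step_has_derivative: "(smooth_step has_real_derivative step_deriv y) (at y)"
proof -
  have D: "(smooth_step has_derivative (\<lambda>e. dir_deriv e smooth_step y)) (at y)"
    by (intro dir_deriv_has_derivative smooth_differentiable smooth_step_smooth)
  have "dir_deriv e smooth_step y = step_deriv y * e" for e
    using linear_cmul[OF has_derivative_linear[OF D], of e 1] by (simp add: step_deriv_def)
  then show ?thesis using D by (simp only: has_field_derivative_def)
qed

lemma step_deriv_outside:
  assumes "y \<notin> {0..1}"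
  shows "step_deriv y = 0"
proof (cases "y < 0")
  case True
  have "((\<lambda>y. 0) has_real_derivative 0) (at y)" by simp
  then have "(smooth_step has_real_derivative 0) (at y)"
    by (rule has_field_derivative_transform_within_open[of _ _ _ "{..<0}"]) (use True smooth_step_0 in auto)
  then show ?thesis using smooth_step_has_derivative DERIV_unique by blast
next
  case False
  have "((\<lambda>y. 1) has_real_derivative 0) (at y)" by simp
  then have "(smooth_step has_real_derivative 0) (at y)"
    by (rule has_field_derivative_transform_within_open[of _ _ _ "{1<..}"]) (use False assms smooth_step_1 in auto)
  then show ?thesis using smooth_step_has_derivative DERIV_unique by blast
qed

lemma step_deriv_smooth: "smooth_fun step_deriv"
  unfolding step_deriv_def by (rule smooth_dir_deriv[OF smooth_step_smooth])

lemma step_deriv_test_fun: "step_deriv \<in> test_funs UNIV"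
  by (rule test_funsI[OF step_deriv_smooth, of "{0..1}"]) (auto simp: step_deriv_outside)

lemma integral_step_deriv: "(\<integral>y. step_deriv y \<partial>lborel) = 1"
proof -
  have "isCont step_deriv y" for y
    using smooth_continuous[OF step_deriv_smooth] by (simp add: continuous_on_eq_continuous_at)
  then have "(\<integral>y. step_deriv y * indicator {0..1} y \<partial>lborel) = smooth_step 1 - smooth_step 0"
    by (intro integral_FTC_Icc_real smooth_step_has_derivative) auto
  moreover have "step_deriv y * indicator {0..1} y = step_deriv y" for y
    using step_deriv_outside[of y] by (auto simp: indicator_def)
  ultimately show ?thesis by (simp add: smooth_step_0 smooth_step_1)
qed

text \<open>
  Substituting \<open>r = s + y / N m\<close> gives the integral of \<open>step_deriv y\<close> times a value of \<open>\<alpha>\<close> that tends to \<open>\<alpha> s\<close>.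
\<close>

lemma step_deriv_approximate_identity:
  fixes \<alpha> :: "real \<Rightarrow> real"
  assumes cont: "continuous_on UNIV \<alpha>" and B: "\<And>r. \<bar>\<alpha> r\<bar> \<le> B"
    and N: "\<And>m. N m > 0" "filterlim N at_top sequentially"
  shows "(\<lambda>m. \<integral>r. N m * step_deriv (N m * (r - s)) * \<alpha> r \<partial>lborel) \<longlonglongrightarrow> \<alpha> s"
proof -
  have [measurable]: "\<alpha> \<in> borel_measurable borel" by (rule borel_measurable_continuous_onI[OF cont])
  have [measurable]: "step_deriv \<in> borel_measurable borel" by (rule smooth_measurable[OF step_deriv_smooth])
  have eq: "(\<integral>r. N m * step_deriv (N m * (r - s)) * \<alpha> r \<partial>lborel) = (\<integral>y. step_deriv y * \<alpha> (s + (1 / N m) * y) \<partial>lborel)" for m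
  proof -
    have "(\<integral>r. N m * step_deriv (N m * (r - s)) * \<alpha> r \<partial>lborel)
        = \<bar>1 / N m\<bar> *\<^sub>R (\<integral>y. N m * step_deriv (N m * ((s + (1 / N m) * y) - s)) * \<alpha> (s + (1 / N m) * y) \<partial>lborel)"
      by (rule lborel_integral_real_affine) (use N(1)[of m] in simp)
    also have "\<dots> = (\<integral>y. \<bar>1 / N m\<bar> * (N m * step_deriv (N m * ((s + (1 / N m) * y) - s)) * \<alpha> (s + (1 / N m) * y)) \<partial>lborel)"
      by simp
    also have "\<dots> = (\<integral>y. step_deriv y * \<alpha> (s + (1 / N m) * y) \<partial>lborel)"
      by (rule Bochner_Integration.integral_cong[OF refl]) (use N(1)[of m] in simp)
    finally show ?thesis .
  qed
  have "(\<lambda>m. \<integral>y. step_deriv y * \<alpha> (s + (1 / N m) * y) \<partial>lborel) \<longlonglongrightarrow> (\<integral>y. step_deriv y * \<alpha> s \<partial>lborel)"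
  proof (rule integral_dominated_convergence[where w="\<lambda>y. \<bar>step_deriv y\<bar> * B"])
    show "integrable lborel (\<lambda>y. \<bar>step_deriv y\<bar> * B)"
      using test_funs_integrable[OF step_deriv_test_fun] by simp
    show "AE y in lborel. (\<lambda>m. step_deriv y * \<alpha> (s + (1 / N m) * y)) \<longlonglongrightarrow> step_deriv y * \<alpha> s"
    proof (rule AE_I2, rule tendsto_mult[OF tendsto_const])
      fix y
      have "(\<lambda>m. 1 / N m) \<longlonglongrightarrow> 0" by (rule real_tendsto_divide_at_top[OF tendsto_const N(2)])
      then have "(\<lambda>m. s + (1 / N m) * y) \<longlonglongrightarrow> s + 0 * y" by (intro tendsto_intros)
      then show "(\<lambda>m. \<alpha> (s + (1 / N m) * y)) \<longlonglongrightarrow> \<alpha> s"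
        by (intro continuous_on_tendsto_compose[OF cont]) auto
    qed
    show "AE y in lborel. norm (step_deriv y * \<alpha> (s + (1 / N m) * y)) \<le> \<bar>step_deriv y\<bar> * B" for m
      by (rule AE_I2) (simp add: abs_mult mult_left_mono B)
  qed auto
  then show ?thesis unfolding eq by (simp add: integral_step_deriv)
qed

lemma smooth_step_scaled_tendsto:
  assumes N: "\<And>m. N m > 0" "filterlim N at_top sequentially"
  shows "(\<lambda>m. smooth_step (N m * r)) \<longlonglongrightarrow> indicator {0<..} r"
proof (cases "r > 0")
  case True
  have "eventually (\<lambda>m. N m \<ge> 1 / r) sequentially" using N(2) by (auto simp: filterlim_at_top)
  then have "eventually (\<lambda>m. smooth_step (N m * r) = 1) sequentially"
    by eventually_elim (use True in \<open>auto intro!: smooth_step_1 simp: field_simps\<close>)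
  then show ?thesis using True by (simp add: tendsto_eventually)
next
  case False
  then have "smooth_step (N m * r) = 0" for m
    using N(1)[of m] by (intro smooth_step_0) (simp add: mult_le_0_iff)
  then show ?thesis using False by simp
qed

text \<open>
  Test with \<open>\<theta>\<close> rising from 0 to 1 just after \<open>\<epsilon>\<close> and falling back just after \<open>t\<close>. The weak identity tends to
  \<open>\<alpha>(\<epsilon>) - \<alpha>(t)\<close> on the left and to the integral of \<open>\<beta>\<close> over \<open>(\<epsilon>,t]\<close> on the right; then \<open>\<epsilon>\<close> tends to 0,
  where \<open>\<alpha>\<close> is continuous with value 0.
\<close>

lemma weak_time_derivative_integral:
  fixes \<alpha> \<beta> :: "real \<Rightarrow> real"
  assumes cont: "continuous_on {0..T} \<alpha>" and \<alpha>0: "\<alpha> 0 = 0"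
    and \<beta>: "integrable lborel \<beta>" "\<And>r. r \<notin> {0<..<T} \<Longrightarrow> \<beta> r = 0"
    and id: "\<And>\<theta>. \<theta> \<in> test_funs {0<..<T} \<Longrightarrow> (\<integral>r. dir_deriv 1 \<theta> r * \<alpha> r \<partial>lborel) = (\<integral>r. \<theta> r * \<beta> r \<partial>lborel)"
    and t: "0 < t" "t < T"
  shows "\<alpha> t = - (\<integral>r. \<beta> r * indicator {..<t} r \<partial>lborel)"
proof -
  \<comment> \<open>Constant continuation beyond \<open>[0,T]\<close> gives a bounded continuous function on the line.\<close>
  define \<alpha>' where "\<alpha>' r = \<alpha> (max 0 (min r T))" for r
  have T: "T > 0" using t by simp
  have cont': "continuous_on UNIV \<alpha>'"
    unfolding \<alpha>'_def by (rule continuous_on_compose2[OF cont]) (use T in \<open>auto intro!: continuous_intros\<close>)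
  have "bounded (\<alpha> ` {0..T})" by (intro compact_imp_bounded compact_continuous_image cont compact_Icc)
  then have "\<exists>B. \<forall>r\<in>{0..T}. \<bar>\<alpha> r\<bar> \<le> B" by (simp add: bounded_iff)
  then obtain B where "\<forall>r\<in>{0..T}. \<bar>\<alpha> r\<bar> \<le> B" by (elim exE)
  then have B: "\<bar>\<alpha> r\<bar> \<le> B" if "r \<in> {0..T}" for r using that by blast
  have B': "\<bar>\<alpha>' r\<bar> \<le> B" for r unfolding \<alpha>'_def by (rule B) (use T in auto)
  have \<alpha>'_eq: "\<alpha>' r = \<alpha> r" if "r \<in> {0..T}" for r using that by (simp add: \<alpha>'_def)
  have [measurable]: "\<alpha>' \<in> borel_measurable borel" by (rule borel_measurable_continuous_onI[OF cont'])
  have [measurable]: "smooth_step \<in> borel_measurable borel" "step_deriv \<in> borel_measurable borel"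
    by (intro smooth_measurable smooth_step_smooth step_deriv_smooth)+
  \<comment> \<open>Steps of width below \<open>T - t\<close> keep the support of the test functions inside \<open>(0,T)\<close>.\<close>
  obtain M where M: "inverse (real (Suc M)) < T - t" using reals_Archimedean[of "T - t"] t by auto
  define N where "N m = real (Suc (M + m))" for m
  have N: "N m > 0" "N m \<ge> real (Suc M)" for m by (auto simp: N_def)
  have N_lim: "filterlim N at_top sequentially"
    by (rule filterlim_at_top_mono[OF filterlim_real_sequentially]) (simp add: N_def)
  have N': "1 / N m < T - t" for m
  proof -
    have "1 / N m \<le> 1 / real (Suc M)" using N[of m] by (intro divide_left_mono) auto
    then show ?thesis using M by (simp add: inverse_eq_divide)
  qed
  have key: "\<alpha> \<epsilon> - \<alpha> t = (\<integral>r. indicator {\<epsilon><..t} r * \<beta> r \<partial>lborel)" if \<epsilon>: "0 < \<epsilon>" "\<epsilon> < t" for \<epsilon>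
  proof -
    define \<theta> where "\<theta> m r = smooth_step (N m * (r - \<epsilon>)) - smooth_step (N m * (r - t))" for m r
    have \<theta>_deriv: "dir_deriv 1 (\<theta> m) r = N m * step_deriv (N m * (r - \<epsilon>)) - N m * step_deriv (N m * (r - t))" for m r
    proof -
      have 1: "((\<lambda>r. smooth_step (N m * (r - c))) has_real_derivative step_deriv (N m * (r - c)) * N m) (at r)" for c
        by (rule DERIV_chain2[OF smooth_step_has_derivative]) (auto intro!: derivative_eq_intros)
      have "(\<theta> m has_real_derivative step_deriv (N m * (r - \<epsilon>)) * N m - step_deriv (N m * (r - t)) * N m) (at r)"
        unfolding \<theta>_def by (intro DERIV_diff 1)
      from dir_deriv_eqI[OF this[unfolded has_field_derivative_def], of 1] show ?thesis
        by (simp add: mult.commute)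
    qed
    have \<theta>_smooth: "smooth_fun (\<theta> m)" for m
    proof -
      have "smooth_fun (\<lambda>r. smooth_step (- N m * c + N m \<bullet> r))" for c
        by (intro smooth_intros(4) smooth_step_smooth)
      from smooth_diff[OF this[of \<epsilon>] this[of t]] show ?thesis
        by (simp add: \<theta>_def[abs_def] algebra_simps)
    qed
    have \<theta>_test: "\<theta> m \<in> test_funs {0<..<T}" for m
    proof (rule test_funsI[OF \<theta>_smooth])
      show "compact {\<epsilon>..t + 1 / N m}" by simp
      show "{\<epsilon>..t + 1 / N m} \<subseteq> {0<..<T}" using \<epsilon> N'[of m] by auto
      fix r assume r: "r \<notin> {\<epsilon>..t + 1 / N m}"
      then consider "r < \<epsilon>" | "r > t + 1 / N m" by fastforce
      then show "\<theta> m r = 0"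
      proof cases
        case 1
        then have "N m * (r - \<epsilon>) \<le> 0" "N m * (r - t) \<le> 0" using N[of m] \<epsilon> by (auto simp: mult_le_0_iff)
        then show ?thesis by (simp add: \<theta>_def smooth_step_0)
      next
        case 2
        then have "1 \<le> N m * (r - t)" using N(1)[of m] by (simp add: field_simps)
        moreover have "N m * (r - t) \<le> N m * (r - \<epsilon>)" using N(1)[of m] \<epsilon> by (intro mult_left_mono) auto
        ultimately show ?thesis by (simp add: \<theta>_def smooth_step_1)
      qed
    qed
    have "(\<lambda>m. (\<integral>r. N m * step_deriv (N m * (r - \<epsilon>)) * \<alpha>' r \<partial>lborel) - (\<integral>r. N m * step_deriv (N m * (r - t)) * \<alpha>' r \<partial>lborel))
        \<longlonglongrightarrow> \<alpha>' \<epsilon> - \<alpha>' t"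
      by (intro tendsto_diff step_deriv_approximate_identity[OF cont' B' N(1) N_lim])
    moreover have "(\<integral>r. N m * step_deriv (N m * (r - \<epsilon>)) * \<alpha>' r \<partial>lborel) - (\<integral>r. N m * step_deriv (N m * (r - t)) * \<alpha>' r \<partial>lborel)
        = (\<integral>r. \<theta> m r * \<beta> r \<partial>lborel)" for m
    proof -
      have int: "integrable lborel (\<lambda>r. N m * step_deriv (N m * (r - c)) * \<alpha>' r)" for c
      proof -
        have "integrable lborel (\<lambda>r. step_deriv (- N m * c + N m * r))"
          by (rule lborel_integrable_real_affine[OF test_funs_integrable[OF step_deriv_test_fun]]) (use N(1)[of m] in simp)
        then have i: "integrable lborel (\<lambda>r. B * (N m * step_deriv (N m * (r - c))))"
          by (intro integrable_mult_right) (simp add: algebra_simps)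
        show ?thesis
        proof (rule Bochner_Integration.integrable_bound[OF i])
          show "AE r in lborel. norm (N m * step_deriv (N m * (r - c)) * \<alpha>' r) \<le> norm (B * (N m * step_deriv (N m * (r - c))))"
          proof (rule AE_I2)
            fix r
            have "\<bar>\<alpha>' r\<bar> * \<bar>N m * step_deriv (N m * (r - c))\<bar> \<le> \<bar>B\<bar> * \<bar>N m * step_deriv (N m * (r - c))\<bar>"
              using B'[of r] by (intro mult_right_mono) auto
            then show "norm (N m * step_deriv (N m * (r - c)) * \<alpha>' r) \<le> norm (B * (N m * step_deriv (N m * (r - c))))"
              by (simp add: abs_mult mult_ac)
          qed
        qed measurable
      qed
      have "(\<integral>r. N m * step_deriv (N m * (r - \<epsilon>)) * \<alpha>' r \<partial>lborel) - (\<integral>r. N m * step_deriv (N m * (r - t)) * \<alpha>' r \<partial>lborel)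
          = (\<integral>r. dir_deriv 1 (\<theta> m) r * \<alpha>' r \<partial>lborel)"
        unfolding \<theta>_deriv left_diff_distrib by (rule Bochner_Integration.integral_diff[OF int int, symmetric])
      also have "\<dots> = (\<integral>r. dir_deriv 1 (\<theta> m) r * \<alpha> r \<partial>lborel)"
      proof (rule Bochner_Integration.integral_cong[OF refl])
        fix r
        show "dir_deriv 1 (\<theta> m) r * \<alpha>' r = dir_deriv 1 (\<theta> m) r * \<alpha> r"
          using test_funs_outside[OF test_funs_dir_deriv[OF \<theta>_test], of r] \<alpha>'_eq[of r] by (cases "r \<in> {0<..<T}") auto
      qed
      also have "\<dots> = (\<integral>r. \<theta> m r * \<beta> r \<partial>lborel)" by (rule id[OF \<theta>_test])
      finally show ?thesis .
    qed
    ultimately have L1: "(\<lambda>m. \<integral>r. \<theta> m r * \<beta> r \<partial>lborel) \<longlonglongrightarrow> \<alpha>' \<epsilon> - \<alpha>' t" by simp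
    have L2: "(\<lambda>m. \<integral>r. \<theta> m r * \<beta> r \<partial>lborel) \<longlonglongrightarrow> (\<integral>r. indicator {\<epsilon><..t} r * \<beta> r \<partial>lborel)"
    proof (rule integral_dominated_convergence[where w="\<lambda>r. \<bar>\<beta> r\<bar>"])
      have [measurable]: "\<beta> \<in> borel_measurable borel" using \<beta>(1) by auto
      show "(\<lambda>r. indicator {\<epsilon><..t} r * \<beta> r) \<in> borel_measurable lborel" by measurable
      show "(\<lambda>r. \<theta> m r * \<beta> r) \<in> borel_measurable lborel" for m unfolding \<theta>_def by measurable
      show "integrable lborel (\<lambda>r. \<bar>\<beta> r\<bar>)" using \<beta>(1) by simp
      show "AE r in lborel. (\<lambda>m. \<theta> m r * \<beta> r) \<longlonglongrightarrow> indicator {\<epsilon><..t} r * \<beta> r"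
      proof (rule AE_I2, rule tendsto_mult[OF _ tendsto_const])
        fix r
        have "(\<lambda>m. \<theta> m r) \<longlonglongrightarrow> indicator {0<..} (r - \<epsilon>) - indicator {0<..} (r - t)"
          unfolding \<theta>_def by (intro tendsto_diff smooth_step_scaled_tendsto N(1) N_lim)
        moreover have "indicator {0<..} (r - \<epsilon>) - indicator {0<..} (r - t) = (indicator {\<epsilon><..t} r :: real)"
          using \<epsilon> by (auto simp: indicator_def)
        ultimately show "(\<lambda>m. \<theta> m r) \<longlonglongrightarrow> indicator {\<epsilon><..t} r" by simp
      qed
      show "AE r in lborel. norm (\<theta> m r * \<beta> r) \<le> \<bar>\<beta> r\<bar>" for m
      proof (rule AE_I2)
        fix r
        have "\<bar>\<theta> m r\<bar> \<le> 1"
          using smooth_step_bounds[of "N m * (r - \<epsilon>)"] smooth_step_bounds[of "N m * (r - t)"]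
          unfolding \<theta>_def by linarith
        then show "norm (\<theta> m r * \<beta> r) \<le> \<bar>\<beta> r\<bar>" by (simp add: abs_mult mult_left_le_one_le)
      qed
    qed
    have "\<alpha>' \<epsilon> - \<alpha>' t = (\<integral>r. indicator {\<epsilon><..t} r * \<beta> r \<partial>lborel)" by (rule LIMSEQ_unique[OF L1 L2])
    then show ?thesis using \<alpha>'_eq[of \<epsilon>] \<alpha>'_eq[of t] \<epsilon> t by simp
  qed
  define \<epsilon> where "\<epsilon> m = t / (2 + real m)" for m
  have \<epsilon>: "0 < \<epsilon> m" "\<epsilon> m < t" for m
    using t by (auto simp: \<epsilon>_def field_simps intro: add_pos_nonneg)
  have \<epsilon>0: "\<epsilon> \<longlonglongrightarrow> 0"
    unfolding \<epsilon>_def by (rule real_tendsto_divide_at_top[OF tendsto_const filterlim_tendsto_add_at_top[OF tendsto_const filterlim_real_sequentially]])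
  have "(\<lambda>m. \<alpha>' (\<epsilon> m)) \<longlonglongrightarrow> \<alpha>' 0" by (rule continuous_on_tendsto_compose[OF cont' \<epsilon>0]) auto
  moreover have "\<alpha>' (\<epsilon> m) = \<alpha> (\<epsilon> m)" for m using \<epsilon>[of m] t by (intro \<alpha>'_eq) auto
  ultimately have L1: "(\<lambda>m. \<alpha> (\<epsilon> m) - \<alpha> t) \<longlonglongrightarrow> 0 - \<alpha> t"
    using \<alpha>'_eq[of 0] \<alpha>0 T by (intro tendsto_diff tendsto_const) auto
  have L2: "(\<lambda>m. \<integral>r. indicator {\<epsilon> m<..t} r * \<beta> r \<partial>lborel) \<longlonglongrightarrow> (\<integral>r. indicator {0<..t} r * \<beta> r \<partial>lborel)"
  proof (rule integral_dominated_convergence[where w="\<lambda>r. \<bar>\<beta> r\<bar>"])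
    have [measurable]: "\<beta> \<in> borel_measurable borel" using \<beta>(1) by auto
    show "(\<lambda>r. indicator {0<..t} r * \<beta> r) \<in> borel_measurable lborel"
      "(\<lambda>r. indicator {\<epsilon> m<..t} r * \<beta> r) \<in> borel_measurable lborel" for m by measurable
    show "integrable lborel (\<lambda>r. \<bar>\<beta> r\<bar>)" using \<beta>(1) by simp
    show "AE r in lborel. (\<lambda>m. indicator {\<epsilon> m<..t} r * \<beta> r) \<longlonglongrightarrow> indicator {0<..t} r * \<beta> r"
    proof (rule AE_I2, rule tendsto_mult[OF _ tendsto_const])
      fix r
      show "(\<lambda>m. indicator {\<epsilon> m<..t} r) \<longlonglongrightarrow> (indicator {0<..t} r :: real)"
      proof (cases "r > 0")
        case True
        have "eventually (\<lambda>m. \<epsilon> m < r) sequentially" by (rule order_tendstoD(2)[OF \<epsilon>0 True])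
        then have "eventually (\<lambda>m. (indicator {\<epsilon> m<..t} r :: real) = indicator {0<..t} r) sequentially"
          by eventually_elim (use True in \<open>auto simp: indicator_def\<close>)
        then show ?thesis by (rule tendsto_eventually)
      next
        case False
        then have "(indicator {\<epsilon> m<..t} r :: real) = indicator {0<..t} r" for m using \<epsilon>(1)[of m] by (auto simp: indicator_def)
        then show ?thesis by simp
      qed
    qed
    show "AE r in lborel. norm (indicator {\<epsilon> m<..t} r * \<beta> r) \<le> \<bar>\<beta> r\<bar>" for m
      by (rule AE_I2) (simp add: indicator_def)
  qed
  have "- \<alpha> t = (\<integral>r. indicator {0<..t} r * \<beta> r \<partial>lborel)"
    using LIMSEQ_unique[OF L1 L2[folded key[OF \<epsilon>]]] by simp
  also have "\<dots> = (\<integral>r. \<beta> r * indicator {..<t} r \<partial>lborel)"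
  proof (rule integral_cong_AE)
    have [measurable]: "\<beta> \<in> borel_measurable borel" using \<beta>(1) by auto
    show "(\<lambda>r. indicator {0<..t} r * \<beta> r) \<in> borel_measurable lborel"
      "(\<lambda>r. \<beta> r * indicator {..<t} r) \<in> borel_measurable lborel" by measurable
    show "AE r in lborel. indicator {0<..t} r * \<beta> r = \<beta> r * indicator {..<t} r"
      using AE_lborel_singleton[of t]
    proof eventually_elim
      case (elim r)
      then show ?case using \<beta>(2)[of r] by (auto simp: indicator_def)
    qed
  qed
  finally show ?thesis by simp
qed

lemma open_cylinder: "open \<Omega> \<Longrightarrow> open (cylinder \<Omega> T)"
  unfolding cylinder_def by (intro open_Times) auto

lemma bounded_cylinder: "bounded \<Omega> \<Longrightarrow> bounded (cylinder \<Omega> T)"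
  unfolding cylinder_def by (intro bounded_Times) auto

lemma indicator_cylinder:
  "indicator (cylinder \<Omega> T) (x, t) = indicator \<Omega> x * (indicator {0<..<T} t :: real)"
  by (auto simp: cylinder_def indicator_def)

text \<open>
  Testing in space-time with products \<open>\<phi>(x) \<theta>(t)\<close> shows, for each \<open>\<phi>\<close>, that the slice identity holds for almost
  every \<open>t\<close>. Taking \<open>\<phi>\<close> from a countable determining family makes the exceptional set independent of \<open>\<phi>\<close>. Then
  \<open>G(-,t)\<close> and the weak gradient \<open>H\<close> of the slice, which exists by assumption, have the same pairings
  with this family and agree almost everywhere.
\<close>

lemma weak_gradient_slices:
  fixes \<Omega> :: "(real^'n) set" and v :: "(real^'n) \<times> real \<Rightarrow> real" and G :: "(real^'n) \<times> real \<Rightarrow> real^'n"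
  assumes \<Omega>: "open \<Omega>" "bounded \<Omega>"
    and v: "sqint lborel (\<lambda>z. indicator (cylinder \<Omega> T) z * v z)"
    and G: "\<And>j. sqint lborel (\<lambda>z. indicator (cylinder \<Omega> T) z * G z $ j)"
    and w: "\<And>j. weak_deriv (cylinder \<Omega> T) (space_dir j) v (\<lambda>z. G z $ j)"
    and W: "AE t in lborel. t \<in> {0<..<T} \<longrightarrow> (\<lambda>x. v (x, t)) \<in> W12 \<Omega>"
  shows "AE t in lborel. t \<in> {0<..<T} \<longrightarrow> is_weak_gradient \<Omega> (\<lambda>x. v (x, t)) (\<lambda>x. G (x, t))"
proof -
  define Q where "Q = cylinder \<Omega> T"
  define v' where "v' z = indicator Q z * v z" for z
  define g where "g j z = indicator Q z * G z $ j" for j z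
  have v': "sqint lborel v'" and g: "\<And>j. sqint lborel (g j)"
    using v G by (simp_all add: v'_def[abs_def] g_def[abs_def] Q_def)
  obtain C where C: "countable C" "C \<subseteq> test_funs \<Omega>"
    and det: "\<forall>f. set_integrable lborel \<Omega> f \<longrightarrow> (\<forall>\<phi>\<in>C. (LINT x:\<Omega>|lborel. f x * \<phi> x) = 0) \<longrightarrow>
       (AE x in lborel. x \<in> \<Omega> \<longrightarrow> f x = 0)"
    using countable_determining_test_funs[OF \<Omega>(1)] by (elim exE conjE)
  have slice0: "AE t in lborel. t \<in> {0<..<T} \<longrightarrow>
      (\<integral>x. v' (x, t) * dir_deriv (axis j 1) \<phi> x \<partial>lborel) + (\<integral>x. g j (x, t) * \<phi> x \<partial>lborel) = 0"
    if \<phi>: "\<phi> \<in> C" for \<phi> j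
  proof (rule fundamental_lemma)
    have \<phi>t: "\<phi> \<in> test_funs \<Omega>" using \<phi> C by blast
    have s: "sqint lborel (\<lambda>t. \<integral>x. v' (x, t) * dir_deriv (axis j 1) \<phi> x \<partial>lborel)"
      "sqint lborel (\<lambda>t. \<integral>x. g j (x, t) * \<phi> x \<partial>lborel)"
      by (intro sqint_pairing_fst v' g test_funs_sqint[OF \<phi>t] test_funs_sqint[OF test_funs_dir_deriv[OF \<phi>t]])+
    let ?\<kappa> = "\<lambda>t. (\<integral>x. v' (x, t) * dir_deriv (axis j 1) \<phi> x \<partial>lborel) + (\<integral>x. g j (x, t) * \<phi> x \<partial>lborel)"
    have "sqint lborel (\<lambda>t. indicator {0<..<T} t * ?\<kappa> t)"
      by (rule sqint_dominated(1)[OF sqint_add[OF s]])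
        (use sqint_measurable[OF sqint_add[OF s]] in \<open>auto simp: indicator_def\<close>)
    then show "set_integrable lborel {0<..<T} ?\<kappa>"
      by (intro sqint_on_bounded_integrable) auto
    fix \<theta> assume \<theta>: "\<theta> \<in> test_funs {0<..<T}"
    note sep = separated_test_fun[OF \<phi>t \<theta>]
    have "0 = (LINT z:Q|lborel. v z * dir_deriv (space_dir j) (\<lambda>z. \<phi> (fst z) * \<theta> (snd z)) z)
        + (LINT z:Q|lborel. G z $ j * (\<phi> (fst z) * \<theta> (snd z)))"
      using w[of j] sep(1) by (auto simp: weak_deriv_def distr_deriv_def regular_distr_def Q_def)
    also have "\<dots> = (\<integral>z. v' z * (dir_deriv (axis j 1) \<phi> (fst z) * \<theta> (snd z)) \<partial>lborel) + (\<integral>z. g j z * (\<phi> (fst z) * \<theta> (snd z)) \<partial>lborel)"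
      by (simp add: set_lebesgue_integral_def v'_def g_def mult.assoc sep(3))
    also have "\<dots> = (\<integral>t. \<theta> t * (\<integral>x. v' (x, t) * dir_deriv (axis j 1) \<phi> x \<partial>lborel) \<partial>lborel)
        + (\<integral>t. \<theta> t * (\<integral>x. g j (x, t) * \<phi> x \<partial>lborel) \<partial>lborel)"
      using Fubini_pairing(2)[OF v' test_funs_sqint[OF test_funs_dir_deriv[OF \<phi>t]] test_funs_sqint[OF \<theta>]]
        Fubini_pairing(2)[OF g test_funs_sqint[OF \<phi>t] test_funs_sqint[OF \<theta>]] by simp
    also have "\<dots> = (\<integral>t. ?\<kappa> t * \<theta> t \<partial>lborel)"
      by (subst Bochner_Integration.integral_add[symmetric, OF sqint_mult_integrable[OF test_funs_sqint[OF \<theta>] s(1)]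
            sqint_mult_integrable[OF test_funs_sqint[OF \<theta>] s(2)]]) (simp add: algebra_simps)
    also have "\<dots> = (LINT t:{0<..<T}|lborel. ?\<kappa> t * \<theta> t)"
      by (rule set_lebesgue_integral_extend[symmetric]) (simp add: test_funs_outside[OF \<theta>])
    finally show "(LINT t:{0<..<T}|lborel. ?\<kappa> t * \<theta> t) = 0" by simp
  qed auto
  have "AE t in lborel. \<forall>\<phi>\<in>C. \<forall>j\<in>(UNIV::'n set). t \<in> {0<..<T} \<longrightarrow>
      (\<integral>x. v' (x, t) * dir_deriv (axis j 1) \<phi> x \<partial>lborel) + (\<integral>x. g j (x, t) * \<phi> x \<partial>lborel) = 0"
  proof (subst AE_ball_countable[OF C(1)], intro ballI)
    fix \<phi> assume "\<phi> \<in> C"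
    then show "AE t in lborel. \<forall>j\<in>(UNIV::'n set). t \<in> {0<..<T} \<longrightarrow>
      (\<integral>x. v' (x, t) * dir_deriv (axis j 1) \<phi> x \<partial>lborel) + (\<integral>x. g j (x, t) * \<phi> x \<partial>lborel) = 0"
      by (subst AE_finite_all[OF finite]) (intro ballI slice0)
  qed
  moreover have "AE t in lborel. sqint lborel (\<lambda>x. v' (x, t))" by (rule sqint_AE_slice_snd[OF v'])
  moreover have "AE t in lborel. \<forall>j\<in>(UNIV::'n set). sqint lborel (\<lambda>x. g j (x, t))"
    by (subst AE_ball_countable) (auto intro: sqint_AE_slice_snd[OF g])
  ultimately show ?thesis
    using W
  proof eventually_elim
    case (elim t)
    show ?case
    proof
      assume t: "t \<in> {0<..<T}"
      have ve: "v' (x, t) = indicator \<Omega> x * v (x, t)" and ge: "g j (x, t) = indicator \<Omega> x * G (x, t) $ j" for x j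
        using t by (simp_all add: v'_def g_def Q_def indicator_cylinder)
      obtain H where H: "is_weak_gradient \<Omega> (\<lambda>x. v (x, t)) H" using elim(4) t by (auto simp: W12_def)
      have HL: "sqint lborel (\<lambda>x. indicator \<Omega> x * H x $ j)" for j
        using H by (auto simp: is_weak_gradient_def intro: L2_component)
      have gL: "sqint lborel (\<lambda>x. indicator \<Omega> x * G (x, t) $ j)" for j
        using elim(3) by (simp add: ge)
      have eq: "AE x in lborel. x \<in> \<Omega> \<longrightarrow> G (x, t) $ j - H x $ j = 0" for j
      proof (rule det[rule_format])
        have dL: "sqint lborel (\<lambda>x. indicator \<Omega> x * (G (x, t) $ j - H x $ j))"
          using sqint_diff[OF gL[of j] HL[of j]] by (simp add: right_diff_distrib)
        show "set_integrable lborel \<Omega> (\<lambda>x. G (x, t) $ j - H x $ j)"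
          by (rule sqint_on_bounded_integrable[OF \<Omega>(2,1) dL])
        fix \<phi> assume \<phi>: "\<phi> \<in> C"
        then have \<phi>t: "\<phi> \<in> test_funs \<Omega>" using C by blast
        have "(\<integral>x. v' (x, t) * dir_deriv (axis j 1) \<phi> x \<partial>lborel) + (\<integral>x. g j (x, t) * \<phi> x \<partial>lborel) = 0"
          using elim(1) \<phi> t by blast
        moreover have "(\<integral>x. v' (x, t) * dir_deriv (axis j 1) \<phi> x \<partial>lborel) = - (\<integral>x. (indicator \<Omega> x * H x $ j) * \<phi> x \<partial>lborel)"
        proof -
          have "weak_deriv \<Omega> (axis j 1) (\<lambda>x. v (x, t)) (\<lambda>x. H x $ j)" using H by (simp add: is_weak_gradient_def)
          from bspec[OF this[unfolded weak_deriv_def distr_deriv_def regular_distr_def set_lebesgue_integral_def] \<phi>t]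
          have "- (\<integral>x. v' (x, t) * dir_deriv (axis j 1) \<phi> x \<partial>lborel) = (\<integral>x. (indicator \<Omega> x * H x $ j) * \<phi> x \<partial>lborel)"
            by (simp add: ve mult.assoc)
          then show ?thesis by linarith
        qed
        ultimately have "(\<integral>x. (indicator \<Omega> x * G (x, t) $ j) * \<phi> x \<partial>lborel) - (\<integral>x. (indicator \<Omega> x * H x $ j) * \<phi> x \<partial>lborel) = 0"
          by (simp add: ge)
        then have "(\<integral>x. (indicator \<Omega> x * G (x, t) $ j) * \<phi> x - (indicator \<Omega> x * H x $ j) * \<phi> x \<partial>lborel) = 0"
          using sqint_mult_integrable[OF gL test_funs_sqint[OF \<phi>t]] sqint_mult_integrable[OF HL test_funs_sqint[OF \<phi>t]]
          by (subst Bochner_Integration.integral_diff) auto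
        then show "(LINT x:\<Omega>|lborel. (G (x, t) $ j - H x $ j) * \<phi> x) = 0"
          by (simp add: set_lebesgue_integral_def algebra_simps)
      qed
      show "is_weak_gradient \<Omega> (\<lambda>x. v (x, t)) (\<lambda>x. G (x, t))"
        unfolding is_weak_gradient_def
      proof (intro conjI allI)
        show "(\<lambda>x. G (x, t)) \<in> L2 lborel \<Omega>" by (rule L2_vectorI[OF gL])
        fix j
        show "weak_deriv \<Omega> (axis j 1) (\<lambda>x. v (x, t)) (\<lambda>x. G (x, t) $ j)"
          unfolding weak_deriv_def
        proof
          fix \<phi> assume \<phi>: "\<phi> \<in> test_funs \<Omega>"
          have "distr_deriv (axis j 1) (regular_distr \<Omega> (\<lambda>x. v (x, t))) \<phi> = regular_distr \<Omega> (\<lambda>x. H x $ j) \<phi>"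
            using H \<phi> by (auto simp: is_weak_gradient_def weak_deriv_def)
          also have "\<dots> = (\<integral>x. (indicator \<Omega> x * H x $ j) * \<phi> x \<partial>lborel)"
            by (simp add: regular_distr_def set_lebesgue_integral_def mult.assoc)
          also have "\<dots> = (\<integral>x. (indicator \<Omega> x * G (x, t) $ j) * \<phi> x \<partial>lborel)"
          proof (rule integral_cong_AE)
            show "(\<lambda>x. (indicator \<Omega> x * H x $ j) * \<phi> x) \<in> borel_measurable lborel"
              "(\<lambda>x. (indicator \<Omega> x * G (x, t) $ j) * \<phi> x) \<in> borel_measurable lborel"
              by (intro borel_measurable_integrable sqint_mult_integrable HL gL test_funs_sqint[OF \<phi>])+
            show "AE x in lborel. (indicator \<Omega> x * H x $ j) * \<phi> x = (indicator \<Omega> x * G (x, t) $ j) * \<phi> x"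
              using eq[of j] by eventually_elim (auto simp: indicator_def)
          qed
          also have "\<dots> = regular_distr \<Omega> (\<lambda>x. G (x, t) $ j) \<phi>"
            by (simp add: regular_distr_def set_lebesgue_integral_def mult.assoc)
          finally show "distr_deriv (axis j 1) (regular_distr \<Omega> (\<lambda>x. v (x, t))) \<phi> = regular_distr \<Omega> (\<lambda>x. G (x, t) $ j) \<phi>" .
        qed
      qed
    qed
  qed
qed

section \<open>Uniqueness\<close>

lemma AE_lborel_fst:
  assumes "AE x in (lborel :: 'a::euclidean_space measure). P x"
  shows "AE z in (lborel :: ('a \<times> 'b::euclidean_space) measure). P (fst z)"
proof -
  obtain N where N: "N \<in> sets (lborel :: 'a measure)" "emeasure lborel N = 0" "{x \<in> space lborel. \<not> P x} \<subseteq> N"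
    using AE_E[OF assms] by metis
  have "emeasure (lborel \<Otimes>\<^sub>M lborel :: ('a \<times> 'b) measure) (N \<times> UNIV) = emeasure lborel N * emeasure (lborel :: 'b measure) UNIV"
    by (rule lborel.emeasure_pair_measure_Times) (use N in auto)
  then have "emeasure (lborel :: ('a \<times> 'b) measure) (N \<times> UNIV) = 0" using N by (simp add: lborel_prod)
  moreover have "N \<times> UNIV \<in> sets (lborel \<Otimes>\<^sub>M lborel :: ('a \<times> 'b) measure)" using N by auto
  then have "N \<times> UNIV \<in> sets (lborel :: ('a \<times> 'b) measure)" by (simp only: lborel_prod)
  ultimately have "N \<times> UNIV \<in> null_sets (lborel :: ('a \<times> 'b) measure)"
    by (rule null_setsI)
  then show ?thesis by (rule AE_I') (use N(3) in auto)
qed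

lemma sqint_indicator_interval: "sqint lborel (indicator {0<..<t} :: real \<Rightarrow> real)"
  using sqint_indicator_bounded[of "{0<..<t}" "\<lambda>_. 1" 1] by simp

text \<open>
  For fixed \<open>x\<close> the function \<open>Y t x\<close> is a primitive of \<open>u (x, t)\<close> in \<open>t\<close>, so the inner time integral of \<open>u Y\<close> is
  \<open>Y^2 / 2\<close>. The exchange of the integrals is justified by the bound \<open>|Y t x| \<le> W x\<close>, uniform in \<open>t\<close>.
\<close>

lemma running_integral_pairing:
  fixes u :: "'a::euclidean_space \<times> real \<Rightarrow> real"
  assumes u: "sqint lborel u" and u0: "\<And>x t. t \<notin> {0<..<T} \<Longrightarrow> u (x, t) = 0"
  defines "Y \<equiv> \<lambda>t x. \<integral>s. u (x, s) * indicator {0<..<t} s \<partial>lborel"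
  shows "integrable lborel (\<lambda>t. indicator {0<..<\<tau>} t * (\<integral>x. u (x, t) * Y t x \<partial>lborel))"
    and "(\<integral>t. indicator {0<..<\<tau>} t * (\<integral>x. u (x, t) * Y t x \<partial>lborel) \<partial>lborel) = (\<integral>x. (Y \<tau> x)\<^sup>2 / 2 \<partial>lborel)"
proof -
  have [measurable]: "u \<in> borel_measurable (borel \<Otimes>\<^sub>M borel)" using u by (simp add: sqint_def borel_prod)
  define W where "W x = (\<integral>s. \<bar>u (x, s)\<bar> * indicator {0<..<T} s \<partial>lborel)" for x
  have au: "sqint lborel (\<lambda>z. \<bar>u z\<bar>)" using u by (auto simp: sqint_def)
  have W: "sqint lborel W"
    unfolding W_def[abs_def] by (rule sqint_pairing_snd(1)[OF au sqint_indicator_interval])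
  define \<Phi> where "\<Phi> z = indicator {0<..<\<tau>} (snd z) * (u z * Y (snd z) (fst z))" for z
  have \<Phi>_meas: "\<Phi> \<in> borel_measurable lborel"
  proof -
    have "Y (snd z) (fst z) = (\<integral>s. (if 0 < s \<and> s < snd z then u (fst z, s) else 0) \<partial>lborel)" for z
      unfolding Y_def by (rule Bochner_Integration.integral_cong[OF refl]) (simp add: indicator_def)
    then have "\<Phi> = (\<lambda>z. indicator {0<..<\<tau>} (snd z) * (u z * (\<integral>s. (if 0 < s \<and> s < snd z then u (fst z, s) else 0) \<partial>lborel)))"
      by (auto simp: \<Phi>_def)
    also have "\<dots> \<in> borel_measurable (borel \<Otimes>\<^sub>M borel)" by measurable
    finally show ?thesis by (simp add: borel_prod)
  qed
  have bound: "AE z in lborel. norm (\<Phi> z) \<le> norm (\<bar>u z\<bar> * (W (fst z) * indicator {0<..<T} (snd z)))"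
    using AE_lborel_fst[OF sqint_AE_slice_fst[OF u]]
  proof eventually_elim
    case (elim z)
    obtain x t where z: "z = (x, t)" by (cases z)
    have "\<bar>Y t x\<bar> \<le> W x"
    proof -
      have "\<bar>Y t x\<bar> \<le> (\<integral>s. \<bar>u (x, s) * indicator {0<..<t} s\<bar> \<partial>lborel)"
        unfolding Y_def by (rule integral_abs_bound)
      also have "\<dots> \<le> W x"
        unfolding W_def
      proof (rule integral_mono)
        have s: "sqint lborel (\<lambda>s. u (x, s))" using elim by (simp add: z)
        show "integrable lborel (\<lambda>s. \<bar>u (x, s) * indicator {0<..<t} s\<bar>)"
          by (intro integrable_abs sqint_mult_integrable s sqint_indicator_interval)
        have "sqint lborel (\<lambda>s. \<bar>u (x, s)\<bar>)" using s by (auto simp: sqint_def)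
        then show "integrable lborel (\<lambda>s. \<bar>u (x, s)\<bar> * indicator {0<..<T} s)"
          by (intro sqint_mult_integrable sqint_indicator_interval)
        show "\<bar>u (x, s) * indicator {0<..<t} s\<bar> \<le> \<bar>u (x, s)\<bar> * indicator {0<..<T} s" for s
          using u0[of s x] by (auto simp: indicator_def)
      qed
      finally show ?thesis .
    qed
    then show ?case
      using u0[of t x] by (auto simp: \<Phi>_def z indicator_def abs_mult intro!: mult_left_mono)
  qed
  have \<Phi>: "integrable lborel \<Phi>"
    by (rule Bochner_Integration.integrable_bound[OF sqint_mult_integrable[OF au sqint_tensor[OF W sqint_indicator_interval]] \<Phi>_meas bound])
  have inner: "(\<integral>x. \<Phi> (x, t) \<partial>lborel) = indicator {0<..<\<tau>} t * (\<integral>x. u (x, t) * Y t x \<partial>lborel)" for t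
    by (simp add: \<Phi>_def)
  show "integrable lborel (\<lambda>t. indicator {0<..<\<tau>} t * (\<integral>x. u (x, t) * Y t x \<partial>lborel))"
    using lborel_integrable_snd[OF \<Phi>] unfolding inner .
  have "(\<integral>t. indicator {0<..<\<tau>} t * (\<integral>x. u (x, t) * Y t x \<partial>lborel) \<partial>lborel) = (\<integral>x. (\<integral>t. \<Phi> (x, t) \<partial>lborel) \<partial>lborel)"
    unfolding lborel_integral_fst[OF \<Phi>] inner[symmetric] by (rule lborel_integral_snd[OF \<Phi>])
  also have "\<dots> = (\<integral>x. (Y \<tau> x)\<^sup>2 / 2 \<partial>lborel)"
  proof (rule integral_cong_AE)
    show "(\<lambda>x. \<integral>t. \<Phi> (x, t) \<partial>lborel) \<in> borel_measurable lborel"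
      using lborel_integrable_fst[OF \<Phi>] by auto
    have "Y \<tau> \<in> borel_measurable lborel"
      unfolding Y_def using sqint_pairing_snd(1)[OF u sqint_indicator_interval] by (simp add: sqint_def)
    then show "(\<lambda>x. (Y \<tau> x)\<^sup>2 / 2) \<in> borel_measurable lborel" by simp
    show "AE x in lborel. (\<integral>t. \<Phi> (x, t) \<partial>lborel) = (Y \<tau> x)\<^sup>2 / 2"
      using sqint_AE_slice_fst[OF u]
    proof eventually_elim
      case (elim x)
      define f where "f t = u (x, t) * indicator {0<..<\<tau>} t" for t
      have f: "integrable lborel f"
        unfolding f_def[abs_def] by (intro sqint_mult_integrable elim sqint_indicator_interval)
      have "\<Phi> (x, t) = f t * (\<integral>s. indicator {..<t} s * f s \<partial>lborel)" for t
      proof (cases "t \<in> {0<..<\<tau>}")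
        case True
        have "Y t x = (\<integral>s. indicator {..<t} s * f s \<partial>lborel)"
          unfolding Y_def by (rule Bochner_Integration.integral_cong[OF refl]) (use True in \<open>auto simp: f_def indicator_def\<close>)
        then show ?thesis using True by (simp add: \<Phi>_def f_def)
      qed (simp add: \<Phi>_def f_def)
      then have "(\<integral>t. \<Phi> (x, t) \<partial>lborel) = (\<integral>t. f t * (\<integral>s. indicator {..<t} s * f s \<partial>lborel) \<partial>lborel)" by simp
      also have "\<dots> = (\<integral>t. f t \<partial>lborel)\<^sup>2 / 2" by (rule triangle_integral[OF f])
      also have "(\<integral>t. f t \<partial>lborel) = Y \<tau> x" by (simp add: Y_def f_def)
      finally show ?case .
    qed
  qed
  finally show "(\<integral>t. indicator {0<..<\<tau>} t * (\<integral>x. u (x, t) * Y t x \<partial>lborel) \<partial>lborel) = (\<integral>x. (Y \<tau> x)\<^sup>2 / 2 \<partial>lborel)" .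
qed

text \<open>
  Rational \<open>\<tau>\<close> suffice, so for almost every \<open>x\<close> all integrals of \<open>u (x, s)\<close> over rational intervals vanish.
\<close>

lemma vanishing_running_integrals_imp_0:
  fixes u :: "'a::euclidean_space \<times> real \<Rightarrow> real"
  assumes u: "sqint lborel u" and u0: "\<And>x t. t \<notin> {0<..<T} \<Longrightarrow> u (x, t) = 0"
    and Y: "\<And>\<tau>. \<tau> > 0 \<Longrightarrow> AE x in lborel. (\<integral>s. u (x, s) * indicator {0<..<\<tau>} s \<partial>lborel) = 0"
  shows "AE z in lborel. u z = 0"
proof -
  have [measurable]: "u \<in> borel_measurable (borel \<Otimes>\<^sub>M borel)" using u by (simp add: sqint_def borel_prod)
  have "AE x in lborel. \<forall>\<tau>\<in>{\<tau> \<in> \<rat>. \<tau> > 0}. (\<integral>s. u (x, s) * indicator {0<..<\<tau>} s \<partial>lborel) = 0"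
    by (subst AE_ball_countable) (auto intro!: Y countable_subset[OF _ countable_rat])
  then have "AE x in lborel. AE t in lborel. u (x, t) = 0"
    using sqint_AE_slice_fst[OF u]
  proof eventually_elim
    case (elim x)
    have i: "integrable lborel (\<lambda>s. u (x, s) * indicator {0<..<\<tau>} s)" for \<tau>
      by (intro sqint_mult_integrable elim sqint_indicator_interval)
    have eqT: "u (x, s) * indicator {0<..<T} s = u (x, s)" for s using u0[of s x] by (auto simp: indicator_def)
    show ?case
    proof (rule integral_rational_boxes_0_imp_AE_0)
      show "integrable lborel (\<lambda>t. u (x, t))" using i[of T] by (simp add: eqT)
      fix a b :: real assume ab: "a \<in> rational_points" "b \<in> rational_points"
      then have r: "a \<in> \<rat>" "b \<in> \<rat>" by (auto simp: rational_points_def)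
      have Y0: "(\<integral>s. u (x, s) * indicator {0<..<\<tau>} s \<partial>lborel) = 0" if "\<tau> \<in> \<rat>" for \<tau>
        using elim(1) that by (cases "\<tau> > 0") auto
      \<comment> \<open>The minimum makes the difference of the two running integrals vanish when the box is empty.\<close>
      have "(\<integral>t. indicator (box a b) t * u (x, t) \<partial>lborel)
          = (\<integral>s. u (x, s) * indicator {0<..<b} s - u (x, s) * indicator {0<..<min a b} s \<partial>lborel)"
      proof (rule integral_cong_AE)
        have [measurable]: "(\<lambda>t. u (x, t)) \<in> borel_measurable borel" using elim(2) by (simp add: sqint_def)
        show "(\<lambda>t. indicator (box a b) t * u (x, t)) \<in> borel_measurable lborel"
          "(\<lambda>s. u (x, s) * indicator {0<..<b} s - u (x, s) * indicator {0<..<min a b} s) \<in> borel_measurable lborel"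
          by measurable
        show "AE t in lborel. indicator (box a b) t * u (x, t) = u (x, t) * indicator {0<..<b} t - u (x, t) * indicator {0<..<min a b} t"
          using AE_lborel_singleton[of a]
        proof eventually_elim
          case (elim t)
          then show ?case using u0[of t x] by (auto simp: indicator_def)
        qed
      qed
      also have "\<dots> = 0" using i Y0[of b] Y0[of "min a b"] r by (simp add: min_def)
      finally show "(\<integral>t. indicator (box a b) t * u (x, t) \<partial>lborel) = 0" .
    qed
  qed
  then have "AE z in lborel \<Otimes>\<^sub>M lborel. u z = 0"
    by (intro lborel_pair.AE_pair_measure) measurable
  then show ?thesis by (simp only: lborel_prod)
qed

text \<open>
  The energy argument. All functions are extended by zero to the whole space and to all times. \<open>V\<close> is the
  representative of \<open>u\<close> that is continuous in time; it is needed because the identity in \<open>x\<close> at time \<open>t\<close>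
  comes from a limit of time averages. The hypothesis \<open>zero_trace\<close> says that for almost every \<open>s\<close> the slice \<open>u i (x, s)\<close>, with
  gradient \<open>G i j (x, s)\<close>, may be inserted into every weak identity that holds for test functions; this is
  the only way in which the boundary condition enters.
\<close>

lemma stokes_abstract_uniqueness:
  fixes u :: "'n::finite \<Rightarrow> (real^'n) \<times> real \<Rightarrow> real"
  assumes u: "\<And>i. sqint lborel (u i)" and q: "sqint lborel q" and G: "\<And>i j. sqint lborel (G i j)"
    and u0: "\<And>i x t. t \<notin> {0<..<T} \<Longrightarrow> u i (x, t) = 0"
    and q0: "\<And>x t. t \<notin> {0<..<T} \<Longrightarrow> q (x, t) = 0"
    and G0: "\<And>i j x t. t \<notin> {0<..<T} \<Longrightarrow> G i j (x, t) = 0"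
    and eq: "\<And>i \<phi>. \<phi> \<in> test_funs (cylinder \<Omega> T) \<Longrightarrow>
      (\<integral>z. u i z * dir_deriv time_dir \<phi> z \<partial>lborel) + (\<integral>z. q z * dir_deriv (space_dir i) \<phi> z \<partial>lborel)
        - (\<Sum>j\<in>UNIV. \<integral>z. G i j z * dir_deriv (space_dir j) \<phi> z \<partial>lborel) = 0"
    and divergence: "AE z in lborel. (\<Sum>i\<in>UNIV. G i i z) = 0"
    and V: "\<And>t i. t \<in> {0..T} \<Longrightarrow> sqint lborel (V t i)"
    and V_cont: "\<And>t i. t \<in> {0..T} \<Longrightarrow> ((\<lambda>s. l2n lborel (\<lambda>x. V s i x - V t i x)) \<longlongrightarrow> 0) (at t within {0..T})"
    and V_0: "\<And>i. AE x in lborel. V 0 i x = 0"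
    and V_eq: "AE t in lborel. t \<in> {0<..<T} \<longrightarrow> (\<forall>i. AE x in lborel. u i (x, t) = V t i x)"
    and zero_trace: "AE s in lborel. s \<in> {0<..<T} \<longrightarrow> (\<forall>i a b. sqint lborel a \<longrightarrow> (\<forall>j. sqint lborel (b j)) \<longrightarrow>
      (\<forall>w\<in>test_funs \<Omega>. (\<integral>x. a x * w x + (\<Sum>j\<in>UNIV. b j x * dir_deriv (axis j 1) w x) \<partial>lborel) = 0) \<longrightarrow>
      (\<integral>x. a x * u i (x, s) + (\<Sum>j\<in>UNIV. b j x * G i j (x, s)) \<partial>lborel) = 0)"
  shows "AE z in lborel. u i z = 0"
proof -
  define Ind :: "real \<Rightarrow> real \<Rightarrow> real" where "Ind t = indicator {0<..<t}" for t
  have Ind: "sqint lborel (Ind t)" for t unfolding Ind_def by (rule sqint_indicator_interval)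
  define B where "B i j t x = (\<integral>s. G i j (x, s) * Ind t s \<partial>lborel)" for i j t x
  define P where "P t x = (\<integral>s. q (x, s) * Ind t s \<partial>lborel)" for t x
  define Y where "Y i t x = (\<integral>s. u i (x, s) * Ind t s \<partial>lborel)" for i t x
  have B: "sqint lborel (B i j t)" for i j t
    unfolding B_def[abs_def] by (rule sqint_pairing_snd(1)[OF G Ind])
  have P: "sqint lborel (P t)" for t
    unfolding P_def[abs_def] by (rule sqint_pairing_snd(1)[OF q Ind])
  have Y: "sqint lborel (Y i t)" for i t
    unfolding Y_def[abs_def] by (rule sqint_pairing_snd(1)[OF u Ind])
  \<comment> \<open>The momentum equation integrated over \<open>(0,t)\<close>.\<close>
  have time: "(\<integral>x. V t i x * w x \<partial>lborel)
      = (\<integral>x. P t x * dir_deriv (axis i 1) w x \<partial>lborel) - (\<Sum>j\<in>UNIV. \<integral>x. B i j t x * dir_deriv (axis j 1) w x \<partial>lborel)"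
    if t: "t \<in> {0<..<T}" and w: "w \<in> test_funs \<Omega>" for t i w
  proof -
    have T: "T > 0" using t by auto
    have ws: "sqint lborel w" "\<And>e. sqint lborel (dir_deriv e w)"
      by (intro test_funs_sqint[OF w] test_funs_sqint[OF test_funs_dir_deriv[OF w]])+
    define \<alpha> where "\<alpha> r = (\<integral>x. V r i x * w x \<partial>lborel)" for r
    define q' where "q' r = (\<integral>x. q (x, r) * dir_deriv (axis i 1) w x \<partial>lborel)" for r
    define g' where "g' j r = (\<integral>x. G i j (x, r) * dir_deriv (axis j 1) w x \<partial>lborel)" for j r
    have q's: "sqint lborel q'" and g's: "\<And>j. sqint lborel (g' j)"
      unfolding q'_def[abs_def] g'_def[abs_def] by (intro sqint_pairing_fst q G ws)+
    define \<beta> where "\<beta> r = (\<Sum>j\<in>UNIV. g' j r) - q' r" for r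
    have \<beta>s: "sqint lborel \<beta>" unfolding \<beta>_def[abs_def] by (intro sqint_diff sqint_sum g's q's)
    have \<beta>0: "\<beta> r = 0" if "r \<notin> {0<..<T}" for r
      using that by (simp add: \<beta>_def g'_def q'_def q0 G0)
    have \<alpha>_cont: "continuous_on {0..T} \<alpha>"
      unfolding continuous_on_def
    proof
      fix r assume r: "r \<in> {0..T}"
      have "((\<lambda>s. \<alpha> s - \<alpha> r) \<longlongrightarrow> 0) (at r within {0..T})"
      proof (rule tendsto_rabs_zero_cancel, rule tendsto_sandwich[OF _ _ tendsto_const])
        show "((\<lambda>s. l2n lborel (\<lambda>x. V s i x - V r i x) * l2n lborel w) \<longlongrightarrow> 0) (at r within {0..T})"
          by (rule tendsto_mult_left_zero[OF V_cont[OF r]])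
        show "\<forall>\<^sub>F s in at r within {0..T}. \<bar>\<alpha> s - \<alpha> r\<bar> \<le> l2n lborel (\<lambda>x. V s i x - V r i x) * l2n lborel w"
          unfolding eventually_at_filter
        proof (rule always_eventually, intro allI impI)
          fix s assume s: "s \<in> {0..T}"
          have "\<alpha> s - \<alpha> r = (\<integral>x. (V s i x - V r i x) * w x \<partial>lborel)"
            unfolding \<alpha>_def left_diff_distrib
            by (rule Bochner_Integration.integral_diff[symmetric]) (intro sqint_mult_integrable V s r ws)+
          also have "\<bar>\<dots>\<bar> \<le> l2n lborel (\<lambda>x. V s i x - V r i x) * l2n lborel w"
            by (intro Cauchy_Schwarz_integral sqint_diff V s r ws)
          finally show "\<bar>\<alpha> s - \<alpha> r\<bar> \<le> l2n lborel (\<lambda>x. V s i x - V r i x) * l2n lborel w" .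
        qed
      qed simp
      then show "(\<alpha> \<longlongrightarrow> \<alpha> r) (at r within {0..T})" by (simp add: LIM_zero_iff)
    qed
    have gB: "(\<integral>r. Ind t r * g' j r \<partial>lborel) = (\<integral>x. B i j t x * dir_deriv (axis j 1) w x \<partial>lborel)" for j
    proof -
      have "(\<integral>r. Ind t r * g' j r \<partial>lborel) = (\<integral>x. dir_deriv (axis j 1) w x * B i j t x \<partial>lborel)"
        unfolding g'_def B_def
        by (rule trans[OF Fubini_pairing(2)[OF G ws(2) Ind, symmetric] Fubini_pairing(1)[OF G ws(2) Ind]])
      then show ?thesis by (simp add: mult.commute)
    qed
    have qP: "(\<integral>r. Ind t r * q' r \<partial>lborel) = (\<integral>x. P t x * dir_deriv (axis i 1) w x \<partial>lborel)"
    proof -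
      have "(\<integral>r. Ind t r * q' r \<partial>lborel) = (\<integral>x. dir_deriv (axis i 1) w x * P t x \<partial>lborel)"
        unfolding q'_def P_def
        by (rule trans[OF Fubini_pairing(2)[OF q ws(2) Ind, symmetric] Fubini_pairing(1)[OF q ws(2) Ind]])
      then show ?thesis by (simp add: mult.commute)
    qed
    have "\<alpha> t = - (\<integral>r. \<beta> r * indicator {..<t} r \<partial>lborel)"
    proof (rule weak_time_derivative_integral[where T=T])
      show "continuous_on {0..T} \<alpha>" by (rule \<alpha>_cont)
      show "\<alpha> 0 = 0"
      proof -
        have "(\<integral>x. V 0 i x * w x \<partial>lborel) = (\<integral>x. 0 \<partial>(lborel :: (real^'n) measure))"
        proof (rule integral_cong_AE)
          show "(\<lambda>x. V 0 i x * w x) \<in> borel_measurable lborel"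
            by (intro borel_measurable_integrable sqint_mult_integrable V ws) (use T in auto)
          show "AE x in lborel. V 0 i x * w x = 0"
            using V_0[of i] by eventually_elim simp
        qed simp
        then show ?thesis by (simp add: \<alpha>_def)
      qed
      show "integrable lborel \<beta>"
      proof -
        have "integrable lborel (\<lambda>r. \<beta> r * Ind T r)" by (rule sqint_mult_integrable[OF \<beta>s Ind])
        moreover have "\<beta> r * Ind T r = \<beta> r" for r using \<beta>0[of r] by (auto simp: Ind_def indicator_def)
        ultimately show ?thesis by simp
      qed
      show "\<beta> r = 0" if "r \<notin> {0<..<T}" for r by (rule \<beta>0[OF that])
      show "0 < t" "t < T" using t by auto
      fix \<theta> assume \<theta>: "\<theta> \<in> test_funs {0<..<T}"
      note sep = separated_test_fun[OF w \<theta>]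
      have \<theta>s: "sqint lborel \<theta>" "sqint lborel (dir_deriv 1 \<theta>)"
        by (intro test_funs_sqint[OF \<theta>] test_funs_sqint[OF test_funs_dir_deriv[OF \<theta>]])+
      have "(\<integral>r. dir_deriv 1 \<theta> r * \<alpha> r \<partial>lborel) = (\<integral>r. dir_deriv 1 \<theta> r * (\<integral>x. u i (x, r) * w x \<partial>lborel) \<partial>lborel)"
      proof (rule integral_cong_AE)
        have [measurable]: "(\<lambda>r. indicator {0..T} r *\<^sub>R \<alpha> r) \<in> borel_measurable borel"
          by (rule borel_measurable_continuous_on_indicator[OF _ \<alpha>_cont]) simp
        have [measurable]: "dir_deriv 1 \<theta> \<in> borel_measurable borel" using \<theta>s(2) by (simp add: sqint_def)
        have out: "dir_deriv 1 \<theta> r = 0" if "r \<notin> {0<..<T}" for r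
          by (rule test_funs_outside[OF test_funs_dir_deriv[OF \<theta>] that])
        have \<alpha>_ind: "(\<lambda>r. dir_deriv 1 \<theta> r * \<alpha> r) = (\<lambda>r. dir_deriv 1 \<theta> r * (indicator {0..T} r *\<^sub>R \<alpha> r))"
        proof
          show "dir_deriv 1 \<theta> r * \<alpha> r = dir_deriv 1 \<theta> r * (indicator {0..T} r *\<^sub>R \<alpha> r)" for r
            using out[of r] by (cases "r \<in> {0<..<T}") auto
        qed
        show "(\<lambda>r. dir_deriv 1 \<theta> r * \<alpha> r) \<in> borel_measurable lborel"
          unfolding \<alpha>_ind by measurable
        show "(\<lambda>r. dir_deriv 1 \<theta> r * (\<integral>x. u i (x, r) * w x \<partial>lborel)) \<in> borel_measurable lborel"
          by (intro borel_measurable_integrable sqint_mult_integrable \<theta>s sqint_pairing_fst u ws)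
        show "AE r in lborel. dir_deriv 1 \<theta> r * \<alpha> r = dir_deriv 1 \<theta> r * (\<integral>x. u i (x, r) * w x \<partial>lborel)"
          using V_eq sqint_AE_slice_snd[OF u[of i]]
        proof eventually_elim
          case (elim r)
          show ?case
          proof (cases "r \<in> {0<..<T}")
            case True
            have "\<alpha> r = (\<integral>x. u i (x, r) * w x \<partial>lborel)"
              unfolding \<alpha>_def
            proof (rule integral_cong_AE)
              show "(\<lambda>x. V r i x * w x) \<in> borel_measurable lborel"
                by (intro borel_measurable_integrable sqint_mult_integrable V ws) (use True in auto)
              show "(\<lambda>x. u i (x, r) * w x) \<in> borel_measurable lborel"
                by (intro borel_measurable_integrable sqint_mult_integrable elim ws)
              have "AE x in lborel. u i (x, r) = V r i x" using elim(1) True by blast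
              then show "AE x in lborel. V r i x * w x = u i (x, r) * w x" by eventually_elim simp
            qed
            then show ?thesis by simp
          qed (simp add: out)
        qed
      qed
      also have "\<dots> = (\<integral>z. u i z * (w (fst z) * dir_deriv 1 \<theta> (snd z)) \<partial>lborel)"
        by (rule Fubini_pairing(2)[OF u ws(1) \<theta>s(2), symmetric])
      also have "\<dots> = (\<Sum>j\<in>UNIV. \<integral>z. G i j z * (dir_deriv (axis j 1) w (fst z) * \<theta> (snd z)) \<partial>lborel)
          - (\<integral>z. q z * (dir_deriv (axis i 1) w (fst z) * \<theta> (snd z)) \<partial>lborel)"
        using eq[OF sep(1), of i] unfolding sep(2,3) by linarith
      also have "\<dots> = (\<Sum>j\<in>UNIV. \<integral>r. \<theta> r * g' j r \<partial>lborel) - (\<integral>r. \<theta> r * q' r \<partial>lborel)"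
        unfolding g'_def q'_def by (simp only: Fubini_pairing(2)[OF G ws(2) \<theta>s(1)] Fubini_pairing(2)[OF q ws(2) \<theta>s(1)])
      also have "\<dots> = (\<integral>r. \<theta> r * \<beta> r \<partial>lborel)"
        unfolding \<beta>_def right_diff_distrib sum_distrib_left
        by (simp add: sqint_mult_integrable[OF \<theta>s(1) g's] sqint_mult_integrable[OF \<theta>s(1) q's])
      finally show "(\<integral>r. dir_deriv 1 \<theta> r * \<alpha> r \<partial>lborel) = (\<integral>r. \<theta> r * \<beta> r \<partial>lborel)" .
    qed
    also have "(\<integral>r. \<beta> r * indicator {..<t} r \<partial>lborel) = (\<integral>r. Ind t r * \<beta> r \<partial>lborel)"
      by (rule Bochner_Integration.integral_cong[OF refl]) (use \<beta>0 in \<open>auto simp: Ind_def indicator_def\<close>)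
    also have "\<dots> = (\<Sum>j\<in>UNIV. \<integral>r. Ind t r * g' j r \<partial>lborel) - (\<integral>r. Ind t r * q' r \<partial>lborel)"
      unfolding \<beta>_def right_diff_distrib sum_distrib_left
      by (simp add: sqint_mult_integrable[OF Ind g's] sqint_mult_integrable[OF Ind q's])
    also have "\<dots> = (\<Sum>j\<in>UNIV. \<integral>x. B i j t x * dir_deriv (axis j 1) w x \<partial>lborel) - (\<integral>x. P t x * dir_deriv (axis i 1) w x \<partial>lborel)"
      by (simp only: gB qP)
    finally show ?thesis by (simp add: \<alpha>_def)
  qed
  \<comment> \<open>Row \<open>i\<close> of the time-integrated stress: the pressure becomes part of the flux paired with the gradient.\<close>
  define b where "b i t j x = B i j t x - (if j = i then P t x else 0)" for i t j x
  have bs: "sqint lborel (b i t j)" for i t j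
    unfolding b_def[abs_def] by (cases "j = i") (simp_all add: sqint_diff B P)
  have b_sum: "(\<Sum>j\<in>UNIV. b i t j x * y j) = (\<Sum>j\<in>UNIV. B i j t x * y j) - P t x * y i" for i t x y
    by (simp add: b_def left_diff_distrib sum_subtractf if_distrib[of "\<lambda>y. y * _"] cong: if_cong)
  have weak: "(\<integral>x. V t i x * w x + (\<Sum>j\<in>UNIV. b i t j x * dir_deriv (axis j 1) w x) \<partial>lborel) = 0"
    if t: "t \<in> {0<..<T}" and w: "w \<in> test_funs \<Omega>" for t i w
  proof -
    have ws: "sqint lborel w" "\<And>e. sqint lborel (dir_deriv e w)"
      by (intro test_funs_sqint[OF w] test_funs_sqint[OF test_funs_dir_deriv[OF w]])+
    have tT: "t \<in> {0..T}" using t by auto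
    have "(\<integral>x. V t i x * w x + (\<Sum>j\<in>UNIV. b i t j x * dir_deriv (axis j 1) w x) \<partial>lborel)
        = (\<integral>x. V t i x * w x + ((\<Sum>j\<in>UNIV. B i j t x * dir_deriv (axis j 1) w x) - P t x * dir_deriv (axis i 1) w x) \<partial>lborel)"
      by (simp only: b_sum)
    also have "\<dots> = (\<integral>x. V t i x * w x \<partial>lborel) + ((\<Sum>j\<in>UNIV. \<integral>x. B i j t x * dir_deriv (axis j 1) w x \<partial>lborel)
        - (\<integral>x. P t x * dir_deriv (axis i 1) w x \<partial>lborel))"
      by (simp add: sqint_mult_integrable V[OF tT] B P ws)
    also have "\<dots> = 0" using time[OF t w, of i] by simp
    finally show ?thesis .
  qed
  have div_slice: "AE s in lborel. AE x in lborel. (\<Sum>i\<in>UNIV. G i i (x, s)) = 0"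
  proof -
    have "AE z in (lborel \<Otimes>\<^sub>M lborel). (\<Sum>i\<in>UNIV. G i i z) = 0" using divergence by (simp only: lborel_prod)
    then have *: "AE x in lborel. AE s in lborel. (\<Sum>i\<in>UNIV. G i i (x, s)) = 0" by (rule lborel_pair.AE_pair)
    have [measurable]: "G i j \<in> borel_measurable (borel \<Otimes>\<^sub>M borel)" for i j using G[of i j] by (simp add: sqint_def borel_prod)
    have "{z \<in> space (lborel \<Otimes>\<^sub>M lborel). (\<Sum>i\<in>UNIV. G i i (fst z, snd z)) = 0} \<in> sets (lborel \<Otimes>\<^sub>M lborel)"
      by measurable
    from iffD1[OF lborel_pair.AE_commute[OF this] *] show ?thesis .
  qed
  have G_slices: "AE s in lborel. \<forall>i\<in>UNIV. \<forall>j\<in>UNIV. sqint lborel (\<lambda>x. G i j (x, s))"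
    by (subst AE_finite_all[OF finite], intro ballI, subst AE_finite_all[OF finite], intro ballI) (rule sqint_AE_slice_snd[OF G])
  have u_slices: "AE s in lborel. \<forall>i\<in>UNIV. sqint lborel (\<lambda>x. u i (x, s))"
    by (subst AE_finite_all[OF finite], intro ballI) (rule sqint_AE_slice_snd[OF u])
  \<comment> \<open>Insert \<open>u i\<close> at time \<open>s\<close> into the identity at time \<open>t\<close>; the pressure meets the divergence and drops out.\<close>
  have slice_id: "AE s in lborel. s \<in> {0<..<T} \<longrightarrow>
      (\<Sum>i\<in>UNIV. \<integral>x. u i (x, s) * V t i x \<partial>lborel) = - (\<Sum>i\<in>UNIV. \<Sum>j\<in>UNIV. \<integral>x. G i j (x, s) * B i j t x \<partial>lborel)"
    if t: "t \<in> {0<..<T}" for t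
    using zero_trace div_slice G_slices u_slices
  proof eventually_elim
    case (elim s)
    show ?case
    proof
      assume s: "s \<in> {0<..<T}"
      have tT: "t \<in> {0..T}" using t by auto
      have Gs: "sqint lborel (\<lambda>x. G i j (x, s))" and us: "sqint lborel (\<lambda>x. u i (x, s))" for i j using elim by auto
      have id: "(\<integral>x. V t i x * u i (x, s) + (\<Sum>j\<in>UNIV. b i t j x * G i j (x, s)) \<partial>lborel) = 0" for i
        using elim(1) s V[OF tT] bs weak[OF t] by blast
      have "(\<integral>x. u i (x, s) * V t i x \<partial>lborel) + (\<Sum>j\<in>UNIV. \<integral>x. G i j (x, s) * B i j t x \<partial>lborel)
          = (\<integral>x. G i i (x, s) * P t x \<partial>lborel)" for i
      proof -
        have "(\<Sum>j\<in>UNIV. b i t j x * G i j (x, s)) = (\<Sum>j\<in>UNIV. G i j (x, s) * B i j t x) - G i i (x, s) * P t x" for x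
          unfolding b_sum by (simp add: mult.commute)
        then have "0 = (\<integral>x. u i (x, s) * V t i x + ((\<Sum>j\<in>UNIV. G i j (x, s) * B i j t x) - G i i (x, s) * P t x) \<partial>lborel)"
          using id[of i] by (simp add: mult.commute)
        also have "\<dots> = (\<integral>x. u i (x, s) * V t i x \<partial>lborel) + ((\<Sum>j\<in>UNIV. \<integral>x. G i j (x, s) * B i j t x \<partial>lborel)
            - (\<integral>x. G i i (x, s) * P t x \<partial>lborel))"
          by (simp add: sqint_mult_integrable V[OF tT] B P Gs us)
        finally show ?thesis by simp
      qed
      then have "(\<Sum>i\<in>UNIV. (\<integral>x. u i (x, s) * V t i x \<partial>lborel) + (\<Sum>j\<in>UNIV. \<integral>x. G i j (x, s) * B i j t x \<partial>lborel))
          = (\<Sum>i\<in>UNIV. \<integral>x. G i i (x, s) * P t x \<partial>lborel)" by simp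
      also have "\<dots> = (\<integral>x. (\<Sum>i\<in>UNIV. G i i (x, s) * P t x) \<partial>lborel)"
        by (rule Bochner_Integration.integral_sum[symmetric]) (rule sqint_mult_integrable[OF Gs P])
      also have "\<dots> = (\<integral>x. 0 \<partial>(lborel :: (real^'n) measure))"
      proof (rule integral_cong_AE)
        show "(\<lambda>x. \<Sum>i\<in>UNIV. G i i (x, s) * P t x) \<in> borel_measurable lborel"
          by (intro borel_measurable_sum borel_measurable_integrable sqint_mult_integrable Gs P)
        show "AE x in lborel. (\<Sum>i\<in>UNIV. G i i (x, s) * P t x) = 0"
          using elim(2) by eventually_elim (simp add: sum_distrib_right[symmetric])
      qed simp
      finally show "(\<Sum>i\<in>UNIV. \<integral>x. u i (x, s) * V t i x \<partial>lborel) = - (\<Sum>i\<in>UNIV. \<Sum>j\<in>UNIV. \<integral>x. G i j (x, s) * B i j t x \<partial>lborel)"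
        by (simp add: sum.distrib)
    qed
  qed
  \<comment> \<open>Integration over \<open>s\<close> in \<open>(0,t)\<close> turns the right hand side into minus the square of \<open>B\<close>.\<close>
  have energy: "(\<Sum>i\<in>UNIV. \<integral>x. V t i x * Y i t x \<partial>lborel) \<le> 0" if t: "t \<in> {0<..<T}" for t
  proof -
    have tT: "t \<in> {0..T}" using t by auto
    have i1: "integrable lborel (\<lambda>s. Ind t s * (\<integral>x. u i (x, s) * V t i x \<partial>lborel))" for i
      by (intro sqint_mult_integrable Ind sqint_pairing_fst u V tT)
    have i2: "integrable lborel (\<lambda>s. Ind t s * (\<integral>x. G i j (x, s) * B i j t x \<partial>lborel))" for i j
      by (intro sqint_mult_integrable Ind sqint_pairing_fst G B)
    have "(\<Sum>i\<in>UNIV. \<integral>x. V t i x * Y i t x \<partial>lborel) = (\<Sum>i\<in>UNIV. \<integral>s. Ind t s * (\<integral>x. u i (x, s) * V t i x \<partial>lborel) \<partial>lborel)"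
      unfolding Y_def using Fubini_pairing[OF u V[OF tT] Ind] by simp
    also have "\<dots> = (\<integral>s. (\<Sum>i\<in>UNIV. Ind t s * (\<integral>x. u i (x, s) * V t i x \<partial>lborel)) \<partial>lborel)"
      by (rule Bochner_Integration.integral_sum[symmetric]) (rule i1)
    also have "\<dots> = (\<integral>s. - (\<Sum>i\<in>UNIV. \<Sum>j\<in>UNIV. Ind t s * (\<integral>x. G i j (x, s) * B i j t x \<partial>lborel)) \<partial>lborel)"
    proof (rule integral_cong_AE)
      show "(\<lambda>s. \<Sum>i\<in>UNIV. Ind t s * (\<integral>x. u i (x, s) * V t i x \<partial>lborel)) \<in> borel_measurable lborel"
        by (intro borel_measurable_sum borel_measurable_integrable i1)
      show "(\<lambda>s. - (\<Sum>i\<in>UNIV. \<Sum>j\<in>UNIV. Ind t s * (\<integral>x. G i j (x, s) * B i j t x \<partial>lborel))) \<in> borel_measurable lborel"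
        by (intro borel_measurable_uminus borel_measurable_sum borel_measurable_integrable i2)
      show "AE s in lborel. (\<Sum>i\<in>UNIV. Ind t s * (\<integral>x. u i (x, s) * V t i x \<partial>lborel))
          = - (\<Sum>i\<in>UNIV. \<Sum>j\<in>UNIV. Ind t s * (\<integral>x. G i j (x, s) * B i j t x \<partial>lborel))"
        using slice_id[OF t]
      proof eventually_elim
        case (elim s)
        show ?case
        proof (cases "s \<in> {0<..<t}")
          case True
          then show ?thesis using elim t by (simp add: Ind_def)
        qed (simp add: Ind_def)
      qed
    qed
    also have "\<dots> = - (\<Sum>i\<in>UNIV. \<Sum>j\<in>UNIV. \<integral>s. Ind t s * (\<integral>x. G i j (x, s) * B i j t x \<partial>lborel) \<partial>lborel)"
      by (simp add: i2)
    also have "\<dots> = - (\<Sum>i\<in>UNIV. \<Sum>j\<in>UNIV. \<integral>x. (B i j t x)\<^sup>2 \<partial>lborel)"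
    proof -
      have "(\<integral>s. Ind t s * (\<integral>x. G i j (x, s) * B i j t x \<partial>lborel) \<partial>lborel) = (\<integral>x. (B i j t x)\<^sup>2 \<partial>lborel)" for i j
        using Fubini_pairing[OF G B Ind, of i j i j t t] by (simp add: B_def[symmetric] power2_eq_square)
      then show ?thesis by simp
    qed
    also have "\<dots> \<le> 0" by (simp add: sum_nonneg)
    finally show ?thesis .
  qed
  have energy': "AE t in lborel. (\<Sum>i\<in>UNIV. \<integral>x. u i (x, t) * Y i t x \<partial>lborel) \<le> 0"
    using V_eq u_slices
  proof eventually_elim
    case (elim t)
    show ?case
    proof (cases "t \<in> {0<..<T}")
      case True
      then have tT: "t \<in> {0..T}" by auto
      have "(\<integral>x. u i (x, t) * Y i t x \<partial>lborel) = (\<integral>x. V t i x * Y i t x \<partial>lborel)" for i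
      proof (rule integral_cong_AE)
        show "(\<lambda>x. u i (x, t) * Y i t x) \<in> borel_measurable lborel" "(\<lambda>x. V t i x * Y i t x) \<in> borel_measurable lborel"
          by (intro borel_measurable_integrable sqint_mult_integrable Y V tT elim(2)[rule_format] UNIV_I)+
        have "AE x in lborel. u i (x, t) = V t i x" using elim(1) True by blast
        then show "AE x in lborel. u i (x, t) * Y i t x = V t i x * Y i t x" by eventually_elim simp
      qed
      then show ?thesis using energy[OF True] by simp
    qed (simp add: u0)
  qed
  \<comment> \<open>Integration over \<open>t\<close> in \<open>(0,\<tau>)\<close>: a sum of squares is at most 0.\<close>
  have Y0: "AE x in lborel. Y i \<tau> x = 0" for i \<tau>
  proof -
    have R: "integrable lborel (\<lambda>t. Ind \<tau> t * (\<integral>x. u i (x, t) * Y i t x \<partial>lborel))"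
      "(\<integral>t. Ind \<tau> t * (\<integral>x. u i (x, t) * Y i t x \<partial>lborel) \<partial>lborel) = (\<integral>x. (Y i \<tau> x)\<^sup>2 / 2 \<partial>lborel)" for i
      unfolding Ind_def Y_def using running_integral_pairing[OF u u0] by blast+
    have "(\<Sum>i\<in>UNIV. \<integral>x. (Y i \<tau> x)\<^sup>2 / 2 \<partial>lborel) = (\<Sum>i\<in>UNIV. \<integral>t. Ind \<tau> t * (\<integral>x. u i (x, t) * Y i t x \<partial>lborel) \<partial>lborel)"
      by (simp only: R(2))
    also have "\<dots> = (\<integral>t. (\<Sum>i\<in>UNIV. Ind \<tau> t * (\<integral>x. u i (x, t) * Y i t x \<partial>lborel)) \<partial>lborel)"
      by (rule Bochner_Integration.integral_sum[symmetric]) (rule R(1))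
    also have "\<dots> \<le> 0"
    proof -
      have "0 \<le> (\<integral>t. - (\<Sum>i\<in>UNIV. Ind \<tau> t * (\<integral>x. u i (x, t) * Y i t x \<partial>lborel)) \<partial>lborel)"
      proof (rule integral_nonneg_AE)
        show "AE t in lborel. 0 \<le> - (\<Sum>i\<in>UNIV. Ind \<tau> t * (\<integral>x. u i (x, t) * Y i t x \<partial>lborel))"
          using energy' by eventually_elim (simp add: sum_distrib_left[symmetric] Ind_def indicator_def)
      qed
      then show ?thesis by simp
    qed
    finally have le: "(\<Sum>i\<in>UNIV. \<integral>x. (Y i \<tau> x)\<^sup>2 / 2 \<partial>lborel) \<le> 0" .
    have nn: "0 \<le> (\<integral>x. (Y i \<tau> x)\<^sup>2 / 2 \<partial>lborel)" for i by (rule integral_nonneg_AE) simp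
    have "(\<integral>x. (Y i \<tau> x)\<^sup>2 / 2 \<partial>lborel) \<le> (\<Sum>i\<in>UNIV. \<integral>x. (Y i \<tau> x)\<^sup>2 / 2 \<partial>lborel)"
      by (rule member_le_sum) (use nn in auto)
    then have "(\<integral>x. (Y i \<tau> x)\<^sup>2 / 2 \<partial>lborel) = 0" using le nn[of i] by linarith
    moreover have "integrable lborel (\<lambda>x. (Y i \<tau> x)\<^sup>2 / 2)" using Y[of i \<tau>] by (simp add: sqint_def)
    ultimately have "AE x in lborel. (Y i \<tau> x)\<^sup>2 / 2 = 0"
      by (subst (asm) integral_nonneg_eq_0_iff_AE) auto
    then show ?thesis by eventually_elim simp
  qed
  show ?thesis
    by (rule vanishing_running_integrals_imp_0[OF u u0]) (use Y0 in \<open>auto simp: Y_def Ind_def\<close>)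
qed

lemma weak_solutionD:
  assumes "weak_solution \<Omega> T f g v p"
  shows "\<exists>V. L2_continuous_rep \<Omega> T v V \<and> (AE x in lborel. x \<in> \<Omega> \<longrightarrow> V 0 x = 0)"
    and "\<forall>i. (\<lambda>z. v z $ i) \<in> W102 \<Omega> T"
    and "p \<in> L2 lborel (cylinder \<Omega> T)"
    and "\<forall>i. \<forall>\<phi>\<in>test_funs (cylinder \<Omega> T).
        distr_deriv time_dir (regular_distr (cylinder \<Omega> T) (\<lambda>z. v z $ i)) \<phi>
        - (\<Sum>j\<in>UNIV. distr_deriv (space_dir j)
             (distr_deriv (space_dir j) (regular_distr (cylinder \<Omega> T) (\<lambda>z. v z $ i))) \<phi>)
        + distr_deriv (space_dir i) (regular_distr (cylinder \<Omega> T) p) \<phi>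
        = regular_distr (cylinder \<Omega> T) (\<lambda>z. f z $ i) \<phi>"
    and "\<forall>\<phi>\<in>test_funs (cylinder \<Omega> T).
        (\<Sum>j\<in>UNIV. distr_deriv (space_dir j) (regular_distr (cylinder \<Omega> T) (\<lambda>z. v z $ j)) \<phi>)
        = regular_distr (cylinder \<Omega> T) g \<phi>"
    and "AE t in lborel. t \<in> {0<..<T} \<longrightarrow> (\<forall>i. has_trace \<Omega> (\<lambda>x. v (x, t) $ i) (\<lambda>_. 0))"
proof -
  note s = assms[unfolded weak_solution_def Let_def]
  note s2 = s[THEN conjunct2] and s3 = s[THEN conjunct2, THEN conjunct2]
  note s4 = s3[THEN conjunct2, THEN conjunct2]
  show "\<exists>V. L2_continuous_rep \<Omega> T v V \<and> (AE x in lborel. x \<in> \<Omega> \<longrightarrow> V 0 x = 0)"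
    by (rule s[THEN conjunct1])
  show "\<forall>i. (\<lambda>z. v z $ i) \<in> W102 \<Omega> T" by (rule s2[THEN conjunct1])
  show "p \<in> L2 lborel (cylinder \<Omega> T)" by (rule s3[THEN conjunct1])
  show "\<forall>i. \<forall>\<phi>\<in>test_funs (cylinder \<Omega> T).
        distr_deriv time_dir (regular_distr (cylinder \<Omega> T) (\<lambda>z. v z $ i)) \<phi>
        - (\<Sum>j\<in>UNIV. distr_deriv (space_dir j)
             (distr_deriv (space_dir j) (regular_distr (cylinder \<Omega> T) (\<lambda>z. v z $ i))) \<phi>)
        + distr_deriv (space_dir i) (regular_distr (cylinder \<Omega> T) p) \<phi>
        = regular_distr (cylinder \<Omega> T) (\<lambda>z. f z $ i) \<phi>" by (rule s4[THEN conjunct1])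
  show "\<forall>\<phi>\<in>test_funs (cylinder \<Omega> T).
        (\<Sum>j\<in>UNIV. distr_deriv (space_dir j) (regular_distr (cylinder \<Omega> T) (\<lambda>z. v z $ j)) \<phi>)
        = regular_distr (cylinder \<Omega> T) g \<phi>" by (rule s4[THEN conjunct2, THEN conjunct1])
  show "AE t in lborel. t \<in> {0<..<T} \<longrightarrow> (\<forall>i. has_trace \<Omega> (\<lambda>x. v (x, t) $ i) (\<lambda>_. 0))"
    by (rule s4[THEN conjunct2, THEN conjunct2])
qed

text \<open>
  The distributional formulation is rewritten with one chosen space-time gradient \<open>G i\<close> of each component, which
  at almost every time is also the weak gradient of the slice. The second derivatives thereby lose one order, and
  each term is a pairing of square integrable functions with a derivative of the test function.
\<close>

lemma weak_solution_structure:
  fixes \<Omega> :: "(real^'n) set"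
  assumes \<Omega>: "open \<Omega>" "bounded \<Omega>" and sol: "weak_solution \<Omega> T f g v p"
  shows "\<exists>V G. (\<forall>i. sqint lborel (\<lambda>z. indicator (cylinder \<Omega> T) z * v z $ i)) \<and>
    sqint lborel (\<lambda>z. indicator (cylinder \<Omega> T) z * p z) \<and>
    (\<forall>i j. sqint lborel (\<lambda>z. indicator (cylinder \<Omega> T) z * G i z $ j)) \<and>
    (\<forall>i. \<forall>\<phi>\<in>test_funs (cylinder \<Omega> T).
      (LINT z:cylinder \<Omega> T|lborel. v z $ i * dir_deriv time_dir \<phi> z) + (LINT z:cylinder \<Omega> T|lborel. p z * dir_deriv (space_dir i) \<phi> z)
        - (\<Sum>j\<in>UNIV. LINT z:cylinder \<Omega> T|lborel. G i z $ j * dir_deriv (space_dir j) \<phi> z)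
        = - (LINT z:cylinder \<Omega> T|lborel. f z $ i * \<phi> z)) \<and>
    (\<forall>\<phi>\<in>test_funs (cylinder \<Omega> T). (\<Sum>j\<in>UNIV. LINT z:cylinder \<Omega> T|lborel. G j z $ j * \<phi> z) = (LINT z:cylinder \<Omega> T|lborel. g z * \<phi> z)) \<and>
    (\<forall>t\<in>{0..T}. \<forall>i. sqint lborel (\<lambda>x. indicator \<Omega> x * V t x $ i)) \<and>
    (\<forall>t\<in>{0..T}. \<forall>i. ((\<lambda>s. l2n lborel (\<lambda>x. indicator \<Omega> x * (V s x $ i - V t x $ i))) \<longlongrightarrow> 0) (at t within {0..T})) \<and>
    (AE x in lborel. x \<in> \<Omega> \<longrightarrow> V 0 x = 0) \<and>
    (AE t in lborel. t \<in> {0<..<T} \<longrightarrow> (AE x in lborel. x \<in> \<Omega> \<longrightarrow> v (x, t) = V t x)) \<and>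
    (AE t in lborel. t \<in> {0<..<T} \<longrightarrow> (\<forall>i. has_trace \<Omega> (\<lambda>x. v (x, t) $ i) (\<lambda>_. 0) \<and>
      is_weak_gradient \<Omega> (\<lambda>x. v (x, t) $ i) (\<lambda>x. G i (x, t))))"
proof -
  define Q where "Q = cylinder \<Omega> T"
  note sol' = weak_solutionD[OF sol, folded Q_def]
  obtain V where V: "L2_continuous_rep \<Omega> T v V" and V0: "AE x in lborel. x \<in> \<Omega> \<longrightarrow> V 0 x = 0"
    using sol'(1) by (elim conjE exE)
  note W = sol'(2) and p = sol'(3) and mom = sol'(4) and dv = sol'(5) and tr = sol'(6)
  have "\<forall>i. \<exists>G :: (real^'n) \<times> real \<Rightarrow> real^'n. G \<in> L2 lborel Q \<and> (\<forall>j. weak_deriv Q (space_dir j) (\<lambda>z. v z $ i) (\<lambda>z. G z $ j))"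
    using W by (simp add: W102_def Q_def)
  then obtain G :: "'n \<Rightarrow> (real^'n) \<times> real \<Rightarrow> real^'n" where
    G: "\<forall>i. G i \<in> L2 lborel Q \<and> (\<forall>j. weak_deriv Q (space_dir j) (\<lambda>z. v z $ i) (\<lambda>z. G i z $ j))"
    by (auto dest: choice)
  have Gw: "distr_deriv (space_dir j) (regular_distr Q (\<lambda>z. v z $ i)) \<phi> = regular_distr Q (\<lambda>z. G i z $ j) \<phi>"
    if "\<phi> \<in> test_funs Q" for i j \<phi>
    using G that by (simp add: weak_deriv_def)
  have 1: "sqint lborel (\<lambda>z. indicator Q z * v z $ i)" for i
    using W by (simp add: W102_def L2_iff_sqint Q_def)
  have 2: "sqint lborel (\<lambda>z. indicator Q z * p z)" using p by (simp add: L2_iff_sqint)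
  have 3: "sqint lborel (\<lambda>z. indicator Q z * G i z $ j)" for i j using G by (simp add: L2_component)
  have 4: "(LINT z:Q|lborel. v z $ i * dir_deriv time_dir \<phi> z) + (LINT z:Q|lborel. p z * dir_deriv (space_dir i) \<phi> z)
        - (\<Sum>j\<in>UNIV. LINT z:Q|lborel. G i z $ j * dir_deriv (space_dir j) \<phi> z)
        = - (LINT z:Q|lborel. f z $ i * \<phi> z)" if \<phi>: "\<phi> \<in> test_funs Q" for i \<phi>
  proof -
    have dd: "distr_deriv (space_dir j) (distr_deriv (space_dir j) (regular_distr Q (\<lambda>z. v z $ i))) \<phi>
        = - (LINT z:Q|lborel. G i z $ j * dir_deriv (space_dir j) \<phi> z)" for j
      using Gw[OF test_funs_dir_deriv[OF \<phi>], of j i "space_dir j"]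
      by (simp add: distr_deriv_def[of _ "distr_deriv _ _"] regular_distr_def[of _ "\<lambda>z. G i z $ j"])
    have d1: "distr_deriv e (regular_distr Q h) \<phi> = - (LINT z:Q|lborel. h z * dir_deriv e \<phi> z)" for e h
      by (simp add: distr_deriv_def regular_distr_def)
    have "regular_distr Q (\<lambda>z. f z $ i) \<phi> = (LINT z:Q|lborel. f z $ i * \<phi> z)"
      by (simp add: regular_distr_def)
    then show ?thesis
      using mom[rule_format, OF \<phi>, of i] unfolding dd d1 sum_negf by linarith
  qed
  have 5: "(\<Sum>j\<in>UNIV. LINT z:Q|lborel. G j z $ j * \<phi> z) = (LINT z:Q|lborel. g z * \<phi> z)"
    if \<phi>: "\<phi> \<in> test_funs Q" for \<phi>
    using bspec[OF dv \<phi>] by (simp add: Gw[OF \<phi>]) (simp add: regular_distr_def)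
  have V1: "\<And>t. t \<in> {0..T} \<Longrightarrow> V t \<in> L2 lborel \<Omega>"
    and V2: "\<And>t. t \<in> {0..T} \<Longrightarrow> ((\<lambda>s. L2_norm \<Omega> (\<lambda>x. V s x - V t x)) \<longlongrightarrow> 0) (at t within {0..T})"
    and V3: "AE t in lborel. t \<in> {0<..<T} \<longrightarrow> (AE x in lborel. x \<in> \<Omega> \<longrightarrow> v (x, t) = V t x)"
    using V by (simp_all add: L2_continuous_rep_def)
  have 6: "sqint lborel (\<lambda>x. indicator \<Omega> x * V t x $ i)" if "t \<in> {0..T}" for t i
    by (rule L2_component[OF V1[OF that]])
  have 7: "((\<lambda>s. l2n lborel (\<lambda>x. indicator \<Omega> x * (V s x $ i - V t x $ i))) \<longlongrightarrow> 0) (at t within {0..T})"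
    if t: "t \<in> {0..T}" for t i
  proof (rule tendsto_sandwich[OF _ _ tendsto_const V2[OF t]])
    show "\<forall>\<^sub>F s in at t within {0..T}. l2n lborel (\<lambda>x. indicator \<Omega> x * (V s x $ i - V t x $ i)) \<le> L2_norm \<Omega> (\<lambda>x. V s x - V t x)"
      unfolding eventually_at_filter
    proof (rule always_eventually, intro allI impI)
      fix s assume s: "s \<in> {0..T}"
      have "(\<lambda>x. V s x - V t x) \<in> L2 lborel \<Omega>"
      proof (rule L2_vectorI)
        show "sqint lborel (\<lambda>x. indicator \<Omega> x * (V s x - V t x) $ i)" for i
          using sqint_diff[OF 6[OF s, of i] 6[OF t, of i]] by (simp add: right_diff_distrib)
      qed
      from L2_component_norm_le[OF this, of i]
      show "l2n lborel (\<lambda>x. indicator \<Omega> x * (V s x $ i - V t x $ i)) \<le> L2_norm \<Omega> (\<lambda>x. V s x - V t x)" by simp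
    qed
  qed simp
  have "AE t in lborel. t \<in> {0<..<T} \<longrightarrow> is_weak_gradient \<Omega> (\<lambda>x. v (x, t) $ i) (\<lambda>x. G i (x, t))" for i
  proof (rule weak_gradient_slices[OF \<Omega>])
    show "sqint lborel (\<lambda>z. indicator (cylinder \<Omega> T) z * v z $ i)" using 1 by (simp add: Q_def)
    show "sqint lborel (\<lambda>z. indicator (cylinder \<Omega> T) z * G i z $ j)" for j using 3 by (simp add: Q_def)
    show "weak_deriv (cylinder \<Omega> T) (space_dir j) (\<lambda>z. v z $ i) (\<lambda>z. G i z $ j)" for j
      using G by (simp add: Q_def)
    show "AE t in lborel. t \<in> {0<..<T} \<longrightarrow> (\<lambda>x. v (x, t) $ i) \<in> W12 \<Omega>"
      using tr by eventually_elim (auto simp: has_trace_def)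
  qed
  then have "AE t in lborel. \<forall>i\<in>UNIV. t \<in> {0<..<T} \<longrightarrow> is_weak_gradient \<Omega> (\<lambda>x. v (x, t) $ i) (\<lambda>x. G i (x, t))"
    by (subst AE_finite_all[OF finite]) blast
  then have 8: "AE t in lborel. t \<in> {0<..<T} \<longrightarrow> (\<forall>i. has_trace \<Omega> (\<lambda>x. v (x, t) $ i) (\<lambda>_. 0) \<and>
      is_weak_gradient \<Omega> (\<lambda>x. v (x, t) $ i) (\<lambda>x. G i (x, t)))"
    using tr by eventually_elim blast
  show ?thesis
    unfolding Q_def[symmetric]
    by (rule exI[of _ V], rule exI[of _ G], intro conjI allI ballI 1 2 3 4 5 6 7 8 V0 V3)
qed

lemma regular_distr_cong_AE:
  fixes U :: "'a::euclidean_space set"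
  assumes "sqint lborel (\<lambda>z. indicator U z * u z)" "sqint lborel (\<lambda>z. indicator U z * v z)"
    and "AE z in lborel. z \<in> U \<longrightarrow> u z = v z" and \<phi>: "\<phi> \<in> test_funs U"
  shows "regular_distr U u \<phi> = regular_distr U v \<phi>"
proof -
  have "(\<integral>z. (indicator U z * u z) * \<phi> z \<partial>lborel) = (\<integral>z. (indicator U z * v z) * \<phi> z \<partial>lborel)"
  proof (rule integral_cong_AE)
    show "(\<lambda>z. (indicator U z * u z) * \<phi> z) \<in> borel_measurable lborel"
      "(\<lambda>z. (indicator U z * v z) * \<phi> z) \<in> borel_measurable lborel"
      by (intro borel_measurable_integrable sqint_mult_integrable assms test_funs_sqint[OF \<phi>])+
    show "AE z in lborel. (indicator U z * u z) * \<phi> z = (indicator U z * v z) * \<phi> z"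
      using assms(3) by eventually_elim (auto simp: indicator_def)
  qed
  then show ?thesis by (simp add: regular_distr_def set_lebesgue_integral_def mult.assoc)
qed

text \<open>
  The differences of the two solutions satisfy the hypotheses of the energy argument: \<open>f\<close> and \<open>g\<close> cancel, and zero
  traces allow the slices of both velocities to be inserted into weak identities.
\<close>

lemma weak_solution_velocity_unique:
  fixes \<Omega> :: "(real^'n) set"
  assumes n: "CARD('n) \<ge> 2" and \<Omega>: "open \<Omega>" "bounded \<Omega>" and k: "k \<ge> 1" "Ck_boundary k \<Omega>"
    and sol1: "weak_solution \<Omega> T f g v1 p1" and sol2: "weak_solution \<Omega> T f g v2 p2"
  shows "AE z in lborel. z \<in> cylinder \<Omega> T \<longrightarrow> v1 z = v2 z"
proof -
  define Q where "Q = cylinder \<Omega> T"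
  note S1 = weak_solution_structure[OF \<Omega> sol1, folded Q_def]
  note S2 = weak_solution_structure[OF \<Omega> sol2, folded Q_def]
  obtain V1 G1 where
    v1: "\<forall>i. sqint lborel (\<lambda>z. indicator Q z * v1 z $ i)" and p1: "sqint lborel (\<lambda>z. indicator Q z * p1 z)"
    and G1: "\<forall>i j. sqint lborel (\<lambda>z. indicator Q z * G1 i z $ j)"
    and mom1: "\<forall>i. \<forall>\<phi>\<in>test_funs Q. (LINT z:Q|lborel. v1 z $ i * dir_deriv time_dir \<phi> z) + (LINT z:Q|lborel. p1 z * dir_deriv (space_dir i) \<phi> z)
        - (\<Sum>j\<in>UNIV. LINT z:Q|lborel. G1 i z $ j * dir_deriv (space_dir j) \<phi> z) = - (LINT z:Q|lborel. f z $ i * \<phi> z)"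
    and div1: "\<forall>\<phi>\<in>test_funs Q. (\<Sum>j\<in>UNIV. LINT z:Q|lborel. G1 j z $ j * \<phi> z) = (LINT z:Q|lborel. g z * \<phi> z)"
    and V1: "\<forall>t\<in>{0..T}. \<forall>i. sqint lborel (\<lambda>x. indicator \<Omega> x * V1 t x $ i)"
    and V1c: "\<forall>t\<in>{0..T}. \<forall>i. ((\<lambda>s. l2n lborel (\<lambda>x. indicator \<Omega> x * (V1 s x $ i - V1 t x $ i))) \<longlongrightarrow> 0) (at t within {0..T})"
    and V10: "AE x in lborel. x \<in> \<Omega> \<longrightarrow> V1 0 x = 0"
    and V1e: "AE t in lborel. t \<in> {0<..<T} \<longrightarrow> (AE x in lborel. x \<in> \<Omega> \<longrightarrow> v1 (x, t) = V1 t x)"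
    and tr1: "AE t in lborel. t \<in> {0<..<T} \<longrightarrow> (\<forall>i. has_trace \<Omega> (\<lambda>x. v1 (x, t) $ i) (\<lambda>_. 0) \<and>
      is_weak_gradient \<Omega> (\<lambda>x. v1 (x, t) $ i) (\<lambda>x. G1 i (x, t)))"
    using S1 by (elim exE conjE)
  obtain V2 G2 where
    v2: "\<forall>i. sqint lborel (\<lambda>z. indicator Q z * v2 z $ i)" and p2: "sqint lborel (\<lambda>z. indicator Q z * p2 z)"
    and G2: "\<forall>i j. sqint lborel (\<lambda>z. indicator Q z * G2 i z $ j)"
    and mom2: "\<forall>i. \<forall>\<phi>\<in>test_funs Q. (LINT z:Q|lborel. v2 z $ i * dir_deriv time_dir \<phi> z) + (LINT z:Q|lborel. p2 z * dir_deriv (space_dir i) \<phi> z)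
        - (\<Sum>j\<in>UNIV. LINT z:Q|lborel. G2 i z $ j * dir_deriv (space_dir j) \<phi> z) = - (LINT z:Q|lborel. f z $ i * \<phi> z)"
    and div2: "\<forall>\<phi>\<in>test_funs Q. (\<Sum>j\<in>UNIV. LINT z:Q|lborel. G2 j z $ j * \<phi> z) = (LINT z:Q|lborel. g z * \<phi> z)"
    and V2: "\<forall>t\<in>{0..T}. \<forall>i. sqint lborel (\<lambda>x. indicator \<Omega> x * V2 t x $ i)"
    and V2c: "\<forall>t\<in>{0..T}. \<forall>i. ((\<lambda>s. l2n lborel (\<lambda>x. indicator \<Omega> x * (V2 s x $ i - V2 t x $ i))) \<longlongrightarrow> 0) (at t within {0..T})"
    and V20: "AE x in lborel. x \<in> \<Omega> \<longrightarrow> V2 0 x = 0"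
    and V2e: "AE t in lborel. t \<in> {0<..<T} \<longrightarrow> (AE x in lborel. x \<in> \<Omega> \<longrightarrow> v2 (x, t) = V2 t x)"
    and tr2: "AE t in lborel. t \<in> {0<..<T} \<longrightarrow> (\<forall>i. has_trace \<Omega> (\<lambda>x. v2 (x, t) $ i) (\<lambda>_. 0) \<and>
      is_weak_gradient \<Omega> (\<lambda>x. v2 (x, t) $ i) (\<lambda>x. G2 i (x, t)))"
    using S2 by (elim exE conjE)
  define u where "u i z = indicator Q z * v1 z $ i - indicator Q z * v2 z $ i" for i z
  define q where "q z = indicator Q z * p1 z - indicator Q z * p2 z" for z
  define G where "G i j z = indicator Q z * G1 i z $ j - indicator Q z * G2 i z $ j" for i j z
  define V where "V t i x = indicator \<Omega> x * V1 t x $ i - indicator \<Omega> x * V2 t x $ i" for t i x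
  have uL: "sqint lborel (u i)" for i unfolding u_def[abs_def] using v1 v2 by (intro sqint_diff) auto
  have qL: "sqint lborel q" unfolding q_def[abs_def] by (intro sqint_diff p1 p2)
  have GL: "sqint lborel (G i j)" for i j unfolding G_def[abs_def] using G1 G2 by (intro sqint_diff) auto
  have VL: "sqint lborel (V t i)" if "t \<in> {0..T}" for t i
    unfolding V_def[abs_def] using V1 V2 that by (intro sqint_diff) auto
  have out: "u i (x, t) = 0" "q (x, t) = 0" "G i j (x, t) = 0" if "t \<notin> {0<..<T}" for i j x t
    using that by (auto simp: u_def q_def G_def Q_def cylinder_def)
  have test: "(\<integral>z. (indicator Q z * a z - indicator Q z * b z) * \<psi> z \<partial>lborel) = (LINT z:Q|lborel. a z * \<psi> z) - (LINT z:Q|lborel. b z * \<psi> z)"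
    if "sqint lborel (\<lambda>z. indicator Q z * a z)" "sqint lborel (\<lambda>z. indicator Q z * b z)" "\<psi> \<in> test_funs Q" for a b \<psi>
  proof -
    note i = sqint_mult_integrable[OF that(1) test_funs_sqint[OF that(3)]] sqint_mult_integrable[OF that(2) test_funs_sqint[OF that(3)]]
    show ?thesis
      unfolding left_diff_distrib Bochner_Integration.integral_diff[OF i]
      by (simp add: set_lebesgue_integral_def mult.assoc)
  qed
  have "AE z in lborel. u i z = 0" for i
  proof (rule stokes_abstract_uniqueness[where u=u and q=q and G=G and V=V and T=T and \<Omega>=\<Omega>, OF uL qL GL out(1) out(2) out(3)])
    fix i \<phi> assume "\<phi> \<in> test_funs (cylinder \<Omega> T)"
    then have \<phi>: "\<phi> \<in> test_funs Q" by (simp add: Q_def)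
    note d = test_funs_dir_deriv[OF \<phi>]
    show "(\<integral>z. u i z * dir_deriv time_dir \<phi> z \<partial>lborel) + (\<integral>z. q z * dir_deriv (space_dir i) \<phi> z \<partial>lborel)
        - (\<Sum>j\<in>UNIV. \<integral>z. G i j z * dir_deriv (space_dir j) \<phi> z \<partial>lborel) = 0"
      unfolding u_def q_def G_def test[OF v1[rule_format] v2[rule_format] d] test[OF p1 p2 d]
        test[OF G1[rule_format] G2[rule_format] d] sum_subtractf
      using mom1[rule_format, OF \<phi>, of i] mom2[rule_format, OF \<phi>, of i] by linarith
  next
    have "AE z in lborel. z \<in> Q \<longrightarrow> (\<Sum>i\<in>UNIV. G i i z) = 0"
    proof (rule fundamental_lemma)
      show Qo: "open Q" unfolding Q_def by (rule open_cylinder[OF \<Omega>(1)])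
      have Qb: "bounded Q" unfolding Q_def by (rule bounded_cylinder[OF \<Omega>(2)])
      have s: "sqint lborel (\<lambda>z. \<Sum>i\<in>UNIV. G i i z)" by (intro sqint_sum GL)
      have "sqint lborel (\<lambda>z. indicator Q z * (\<Sum>i\<in>UNIV. G i i z))"
      proof (rule sqint_bounded_mult(1)[OF s, where C=1])
        show "indicator Q \<in> borel_measurable lborel" using Qo by simp
      qed (simp add: indicator_def)
      then show "set_integrable lborel Q (\<lambda>z. \<Sum>i\<in>UNIV. G i i z)" by (rule sqint_on_bounded_integrable[OF Qb Qo])
      fix \<phi> assume \<phi>: "\<phi> \<in> test_funs Q"
      have "(LINT z:Q|lborel. (\<Sum>i\<in>UNIV. G i i z) * \<phi> z) = (\<integral>z. (\<Sum>i\<in>UNIV. G i i z * \<phi> z) \<partial>lborel)"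
        by (subst set_lebesgue_integral_extend) (simp_all add: test_funs_outside[OF \<phi>] sum_distrib_right)
      also have "\<dots> = (\<Sum>i\<in>UNIV. \<integral>z. G i i z * \<phi> z \<partial>lborel)"
        by (rule Bochner_Integration.integral_sum) (rule sqint_mult_integrable[OF GL test_funs_sqint[OF \<phi>]])
      also have "\<dots> = (\<Sum>i\<in>UNIV. (LINT z:Q|lborel. G1 i z $ i * \<phi> z)) - (\<Sum>i\<in>UNIV. (LINT z:Q|lborel. G2 i z $ i * \<phi> z))"
        unfolding G_def test[OF G1[rule_format] G2[rule_format] \<phi>] sum_subtractf ..
      also have "\<dots> = 0" using bspec[OF div1 \<phi>] bspec[OF div2 \<phi>] by simp
      finally show "(LINT z:Q|lborel. (\<Sum>i\<in>UNIV. G i i z) * \<phi> z) = 0" .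
    qed
    then show "AE z in lborel. (\<Sum>i\<in>UNIV. G i i z) = 0"
      by eventually_elim (auto simp: G_def indicator_def)
  next
    show "sqint lborel (V t i)" if "t \<in> {0..T}" for t i by (rule VL[OF that])
  next
    fix t i assume t: "t \<in> {0..T}"
    have c1: "((\<lambda>s. l2n lborel (\<lambda>x. indicator \<Omega> x * (V1 s x $ i - V1 t x $ i))) \<longlongrightarrow> 0) (at t within {0..T})"
      and c2: "((\<lambda>s. l2n lborel (\<lambda>x. indicator \<Omega> x * (V2 s x $ i - V2 t x $ i))) \<longlongrightarrow> 0) (at t within {0..T})"
      using V1c V2c t by auto
    show "((\<lambda>s. l2n lborel (\<lambda>x. V s i x - V t i x)) \<longlongrightarrow> 0) (at t within {0..T})"
    proof (rule tendsto_sandwich[OF _ _ tendsto_const])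
      show "((\<lambda>s. l2n lborel (\<lambda>x. indicator \<Omega> x * (V1 s x $ i - V1 t x $ i)) + l2n lborel (\<lambda>x. indicator \<Omega> x * (V2 s x $ i - V2 t x $ i))) \<longlongrightarrow> 0) (at t within {0..T})"
        using tendsto_add[OF c1 c2] by simp
      show "\<forall>\<^sub>F s in at t within {0..T}. l2n lborel (\<lambda>x. V s i x - V t i x)
          \<le> l2n lborel (\<lambda>x. indicator \<Omega> x * (V1 s x $ i - V1 t x $ i)) + l2n lborel (\<lambda>x. indicator \<Omega> x * (V2 s x $ i - V2 t x $ i))"
        unfolding eventually_at_filter
      proof (rule always_eventually, intro allI impI)
        fix s assume s: "s \<in> {0..T}"
        have d1: "sqint lborel (\<lambda>x. indicator \<Omega> x * (V1 s x $ i - V1 t x $ i))"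
          using sqint_diff[of lborel "\<lambda>x. indicator \<Omega> x * V1 s x $ i" "\<lambda>x. indicator \<Omega> x * V1 t x $ i"] V1 s t
          by (simp add: right_diff_distrib)
        have d2: "sqint lborel (\<lambda>x. - 1 * (indicator \<Omega> x * (V2 s x $ i - V2 t x $ i)))"
          using sqint_cmult[OF sqint_diff[of lborel "\<lambda>x. indicator \<Omega> x * V2 s x $ i" "\<lambda>x. indicator \<Omega> x * V2 t x $ i"], of "- 1"] V2 s t
          by (simp add: right_diff_distrib)
        have "l2n lborel (\<lambda>x. V s i x - V t i x)
            = l2n lborel (\<lambda>x. indicator \<Omega> x * (V1 s x $ i - V1 t x $ i) + - 1 * (indicator \<Omega> x * (V2 s x $ i - V2 t x $ i)))"
          by (simp add: V_def algebra_simps)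
        also have "\<dots> \<le> l2n lborel (\<lambda>x. indicator \<Omega> x * (V1 s x $ i - V1 t x $ i)) + l2n lborel (\<lambda>x. - 1 * (indicator \<Omega> x * (V2 s x $ i - V2 t x $ i)))"
          by (rule l2n_triangle[OF d1 d2])
        also have "l2n lborel (\<lambda>x. - 1 * (indicator \<Omega> x * (V2 s x $ i - V2 t x $ i))) = l2n lborel (\<lambda>x. indicator \<Omega> x * (V2 s x $ i - V2 t x $ i))"
          by (subst l2n_cmult) simp
        finally show "l2n lborel (\<lambda>x. V s i x - V t i x)
          \<le> l2n lborel (\<lambda>x. indicator \<Omega> x * (V1 s x $ i - V1 t x $ i)) + l2n lborel (\<lambda>x. indicator \<Omega> x * (V2 s x $ i - V2 t x $ i))" .
      qed
    qed simp
  next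
    show "AE x in lborel. V 0 i x = 0" for i
      using V10 V20 by eventually_elim (auto simp: V_def indicator_def)
  next
    show "AE t in lborel. t \<in> {0<..<T} \<longrightarrow> (\<forall>i. AE x in lborel. u i (x, t) = V t i x)"
      using V1e V2e
    proof eventually_elim
      case (elim t)
      show ?case
      proof (intro impI allI)
        fix i assume t: "t \<in> {0<..<T}"
        have "AE x in lborel. x \<in> \<Omega> \<longrightarrow> v1 (x, t) = V1 t x" "AE x in lborel. x \<in> \<Omega> \<longrightarrow> v2 (x, t) = V2 t x"
          using elim t by auto
        then show "AE x in lborel. u i (x, t) = V t i x"
        proof eventually_elim
          case (elim x)
          then show ?case using t by (cases "x \<in> \<Omega>") (simp_all add: u_def V_def Q_def indicator_cylinder)
        qed
      qed
    qed
  next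
    show "AE s in lborel. s \<in> {0<..<T} \<longrightarrow> (\<forall>i a b. sqint lborel a \<longrightarrow> (\<forall>j. sqint lborel (b j)) \<longrightarrow>
      (\<forall>w\<in>test_funs \<Omega>. (\<integral>x. a x * w x + (\<Sum>j\<in>UNIV. b j x * dir_deriv (axis j 1) w x) \<partial>lborel) = 0) \<longrightarrow>
      (\<integral>x. a x * u i (x, s) + (\<Sum>j\<in>UNIV. b j x * G i j (x, s)) \<partial>lborel) = 0)"
      using tr1 tr2
    proof eventually_elim
      case (elim s)
      show ?case
      proof (intro impI allI)
        fix i a b assume s: "s \<in> {0<..<T}" and a: "sqint lborel a" and b: "\<forall>j. sqint lborel (b j)"
          and id: "\<forall>w\<in>test_funs \<Omega>. (\<integral>x. a x * w x + (\<Sum>j\<in>UNIV. b j x * dir_deriv (axis j 1) w x) \<partial>lborel) = 0"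
        have zt: "(\<integral>x. indicator \<Omega> x * (a x * h x + (\<Sum>j\<in>UNIV. b j x * H x $ j)) \<partial>lborel) = 0"
          "integrable lborel (\<lambda>x. indicator \<Omega> x * (a x * h x + (\<Sum>j\<in>UNIV. b j x * H x $ j)))"
          if h: "has_trace \<Omega> h (\<lambda>_. 0)" and H: "is_weak_gradient \<Omega> h H" for h H
        proof -
          show "(\<integral>x. indicator \<Omega> x * (a x * h x + (\<Sum>j\<in>UNIV. b j x * H x $ j)) \<partial>lborel) = 0"
            by (rule weak_identity_extends_to_zero_trace[OF n \<Omega> k a b[rule_format] id[rule_format] h H])
          have hL: "sqint lborel (\<lambda>x. indicator \<Omega> x * h x)" using h by (simp add: has_trace_def W12_def L2_iff_sqint)
          have HL: "sqint lborel (\<lambda>x. indicator \<Omega> x * H x $ j)" for j using H by (simp add: is_weak_gradient_def L2_component)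
          have "integrable lborel (\<lambda>x. a x * (indicator \<Omega> x * h x) + (\<Sum>j\<in>UNIV. b j x * (indicator \<Omega> x * H x $ j)))"
            by (intro Bochner_Integration.integrable_add Bochner_Integration.integrable_sum sqint_mult_integrable a b[rule_format] hL HL)
          moreover have "(\<lambda>x. a x * (indicator \<Omega> x * h x) + (\<Sum>j\<in>UNIV. b j x * (indicator \<Omega> x * H x $ j)))
              = (\<lambda>x. indicator \<Omega> x * (a x * h x + (\<Sum>j\<in>UNIV. b j x * H x $ j)))"
            by (rule ext) (simp add: distrib_left sum_distrib_left mult.left_commute)
          ultimately show "integrable lborel (\<lambda>x. indicator \<Omega> x * (a x * h x + (\<Sum>j\<in>UNIV. b j x * H x $ j)))" by simp
        qed
        have t1: "has_trace \<Omega> (\<lambda>x. v1 (x, s) $ i) (\<lambda>_. 0)" "is_weak_gradient \<Omega> (\<lambda>x. v1 (x, s) $ i) (\<lambda>x. G1 i (x, s))"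
          and t2: "has_trace \<Omega> (\<lambda>x. v2 (x, s) $ i) (\<lambda>_. 0)" "is_weak_gradient \<Omega> (\<lambda>x. v2 (x, s) $ i) (\<lambda>x. G2 i (x, s))"
          using elim s by auto
        have "(\<integral>x. a x * u i (x, s) + (\<Sum>j\<in>UNIV. b j x * G i j (x, s)) \<partial>lborel)
            = (\<integral>x. indicator \<Omega> x * (a x * v1 (x, s) $ i + (\<Sum>j\<in>UNIV. b j x * G1 i (x, s) $ j))
                - indicator \<Omega> x * (a x * v2 (x, s) $ i + (\<Sum>j\<in>UNIV. b j x * G2 i (x, s) $ j)) \<partial>lborel)"
        proof (rule Bochner_Integration.integral_cong[OF refl])
          fix x
          show "a x * u i (x, s) + (\<Sum>j\<in>UNIV. b j x * G i j (x, s))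
              = indicator \<Omega> x * (a x * v1 (x, s) $ i + (\<Sum>j\<in>UNIV. b j x * G1 i (x, s) $ j))
                - indicator \<Omega> x * (a x * v2 (x, s) $ i + (\<Sum>j\<in>UNIV. b j x * G2 i (x, s) $ j))"
            using s by (cases "x \<in> \<Omega>")
              (simp_all add: u_def G_def Q_def indicator_cylinder right_diff_distrib sum_subtractf)
        qed
        also have "\<dots> = 0"
          unfolding Bochner_Integration.integral_diff[OF zt(2)[OF t1] zt(2)[OF t2]] zt(1)[OF t1] zt(1)[OF t2] by simp
        finally show "(\<integral>x. a x * u i (x, s) + (\<Sum>j\<in>UNIV. b j x * G i j (x, s)) \<partial>lborel) = 0" .
      qed
    qed
  qed auto
  then have "AE z in lborel. \<forall>i\<in>UNIV. u i z = 0" by (subst AE_finite_all[OF finite]) blast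
  then show ?thesis
    unfolding Q_def[symmetric] by eventually_elim (auto simp: u_def vec_eq_iff)
qed

text \<open>
  The momentum equation expresses the distribution \<open>\<partial>\<^sub>i p\<close> by \<open>f\<close> and distributional derivatives of the velocity,
  and these depend only on the almost everywhere class of the velocity.
\<close>

lemma weak_solution_pressure_gradient_unique:
  fixes \<Omega> :: "(real^'n) set"
  assumes sol1: "weak_solution \<Omega> T f g v1 p1" and sol2: "weak_solution \<Omega> T f g v2 p2"
    and v: "AE z in lborel. z \<in> cylinder \<Omega> T \<longrightarrow> v1 z = v2 z" and \<phi>: "\<phi> \<in> test_funs (cylinder \<Omega> T)"
  shows "distr_deriv (space_dir i) (regular_distr (cylinder \<Omega> T) p1) \<phi>
    = distr_deriv (space_dir i) (regular_distr (cylinder \<Omega> T) p2) \<phi>"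
proof -
  define Q where "Q = cylinder \<Omega> T"
  have mom: "distr_deriv time_dir (regular_distr Q (\<lambda>z. v z $ i)) \<phi>
        - (\<Sum>j\<in>UNIV. distr_deriv (space_dir j)
             (distr_deriv (space_dir j) (regular_distr Q (\<lambda>z. v z $ i))) \<phi>)
        + distr_deriv (space_dir i) (regular_distr Q p) \<phi>
        = regular_distr Q (\<lambda>z. f z $ i) \<phi>" and vL: "sqint lborel (\<lambda>z. indicator Q z * v z $ i)"
    if sol: "weak_solution \<Omega> T f g v p" for v p
  proof -
    note W = weak_solutionD(2)[OF sol] and m = weak_solutionD(4)[OF sol, folded Q_def]
    show "distr_deriv time_dir (regular_distr Q (\<lambda>z. v z $ i)) \<phi>
        - (\<Sum>j\<in>UNIV. distr_deriv (space_dir j)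
             (distr_deriv (space_dir j) (regular_distr Q (\<lambda>z. v z $ i))) \<phi>)
        + distr_deriv (space_dir i) (regular_distr Q p) \<phi>
        = regular_distr Q (\<lambda>z. f z $ i) \<phi>"
      using m[rule_format] \<phi> by (simp add: Q_def)
    show "sqint lborel (\<lambda>z. indicator Q z * v z $ i)" using W by (simp add: W102_def L2_iff_sqint Q_def)
  qed
  have ae: "AE z in lborel. z \<in> Q \<longrightarrow> v1 z $ i = v2 z $ i" using v unfolding Q_def by eventually_elim simp
  have reg: "regular_distr Q (\<lambda>z. v1 z $ i) \<psi> = regular_distr Q (\<lambda>z. v2 z $ i) \<psi>" if "\<psi> \<in> test_funs Q" for \<psi>
    by (rule regular_distr_cong_AE[OF vL[OF sol1] vL[OF sol2] ae that])
  have \<phi>': "\<phi> \<in> test_funs Q" using \<phi> by (simp add: Q_def)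
  have "distr_deriv time_dir (regular_distr Q (\<lambda>z. v1 z $ i)) \<phi> = distr_deriv time_dir (regular_distr Q (\<lambda>z. v2 z $ i)) \<phi>"
    "distr_deriv e (distr_deriv e (regular_distr Q (\<lambda>z. v1 z $ i))) \<phi> = distr_deriv e (distr_deriv e (regular_distr Q (\<lambda>z. v2 z $ i))) \<phi>" for e
    by (simp_all add: distr_deriv_def reg test_funs_dir_deriv \<phi>')
  then have "distr_deriv (space_dir i) (regular_distr Q p1) \<phi> = distr_deriv (space_dir i) (regular_distr Q p2) \<phi>"
    using mom[OF sol1] mom[OF sol2] by simp
  then show ?thesis by (simp add: Q_def)
qed

theorem theorem1p3:
  assumes "CARD('n::finite) \<ge> 2"
  shows "\<exists>k0. \<forall>k\<ge>k0. \<forall>(\<Omega> :: (real^'n) set) T f g v1 p1 v2 p2.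
           open \<Omega> \<longrightarrow> connected \<Omega> \<longrightarrow> bounded \<Omega> \<longrightarrow> Ck_boundary k \<Omega> \<longrightarrow>
           \<Omega> homeomorphic ball (0 :: real^'n) 1 \<longrightarrow> T > 0 \<longrightarrow>
           admissible_data \<Omega> T f g \<longrightarrow>
           weak_solution \<Omega> T f g v1 p1 \<longrightarrow> weak_solution \<Omega> T f g v2 p2 \<longrightarrow>
           (AE z in lborel. z \<in> cylinder \<Omega> T \<longrightarrow> v1 z = v2 z) \<and>
           (\<forall>i. \<forall>\<phi>\<in>test_funs (cylinder \<Omega> T).
              distr_deriv (space_dir i) (regular_distr (cylinder \<Omega> T) p1) \<phi>
              = distr_deriv (space_dir i) (regular_distr (cylinder \<Omega> T) p2) \<phi>)"
proof (rule exI[of _ 1], intro allI impI)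
  \<comment> \<open>Class \<open>C^1\<close> suffices: the boundary charts only have to be locally Lipschitz.\<close>
  fix k and \<Omega> :: "(real^'n) set" and T f g v1 p1 v2 p2
  assume k: "1 \<le> k" and \<Omega>: "open \<Omega>" "bounded \<Omega>" "Ck_boundary k \<Omega>"
    and sol: "weak_solution \<Omega> T f g v1 p1" "weak_solution \<Omega> T f g v2 p2"
  have v: "AE z in lborel. z \<in> cylinder \<Omega> T \<longrightarrow> v1 z = v2 z"
    by (rule weak_solution_velocity_unique[OF assms \<Omega>(1,2) k \<Omega>(3) sol])
  then show "(AE z in lborel. z \<in> cylinder \<Omega> T \<longrightarrow> v1 z = v2 z) \<and>
           (\<forall>i. \<forall>\<phi>\<in>test_funs (cylinder \<Omega> T).
              distr_deriv (space_dir i) (regular_distr (cylinder \<Omega> T) p1) \<phi>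
              = distr_deriv (space_dir i) (regular_distr (cylinder \<Omega> T) p2) \<phi>)"
    using weak_solution_pressure_gradient_unique[OF sol v] by blast
qed

end
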